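(* Let $\{F_k\}_{k\in\mathbb{N}}$ be a sequence of centered square integrable random variables in $L^2(\Omega,\mathcal{F},P)$ with Wiener chaos expansions $F_k=\sum_{n=1}^\infty J_n(F_k)$. Suppose that (i) $\lim_{N\to+\infty}\limsup_{k\to+\infty}\sum_{n=N+1}^\infty\mathbb{E}[(J_nF_k)^2]=0$; (ii) for every $n\ge1$, $\lim_{k\to+\infty}\mathbb{E}[(J_nF_k)^2]=\sigma_n^2$; (iii) $\sum_{n=1}^\infty\sigma_n^2=\sigma^2<+\infty$; (iv) for all $n\ge1$, $\|D(J_nF_k)\|_H^2\to n\sigma_n^2$ in $L^2(\Omega)$ as $k\to+\infty$. Then $F_k$ converges in distribution to the normal law $N(0,\sigma^2)$ as $k$ tends to infinity.
   Context: $H$ is a real separable Hilbert space and $X=\{X(h):h\in H\}$ is an isonormal Gaussian process on $H$: a centered Gaussian family on a probability space $(\Omega,\mathcal{F},P)$ with $\mathbb{E}[X(h)X(g)]=\langle h,g\rangle_H$ for all $h,g\in H$; it is assumed that $\mathcal{F}$ is generated by $X$. Wiener chaos: for $n\ge 1$, the $n$th Wiener chaos $\mathcal{H}_n$ is the closed linear subspace of $L^2(\Omega,\mathcal{F},P)$ generated by $\{H_n(X(h)):h\in H,\|h\|_H=1\}$, where $H_n$ is the $n$th Hermite polynomial; $\mathcal{H}_0$ is the space of constants. $L^2(\Omega,\mathcal{F},P)$ is the orthogonal sum of the spaces $\mathcal{H}_n$, $n\ge0$, and $J_n$ denotes the orthogonal projection onto $\mathcal{H}_n$. Malliavin derivative: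 for $F=f(X(h_1),\dots,X(h_p))$ with $f\in\mathcal{C}_b^\infty(\mathbb{R}^p)$ (bounded with bounded derivatives of all orders), $DF=\sum_{i=1}^p\frac{\partial f}{\partial x_i}(X(h_1),\dots,X(h_p))h_i\in L^2(\Omega;H)$. $D$ is extended by closure to $\mathbb{D}^{1,2}$, the completion of the set of such $F$ under $\|F\|_{1,2}^2=\mathbb{E}[F^2]+\mathbb{E}[\|DF\|_H^2]$; every element of a fixed Wiener chaos belongs to $\mathbb{D}^{1,2}$. The $F_k$ themselves are not assumed to belong to $\mathbb{D}^{1,2}$. *)

theory Defs
  imports "HOL-Probability.Probability" "HOL-Computational_Algebra.Polynomial"
begin

(* Degenerate normal laws are Dirac measures; normal_density with standard deviation 0 is
   identically 0 and so does not cover them. *)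
definition normal_law :: "real \<Rightarrow> real \<Rightarrow> real measure" where
  "normal_law \<mu> v =
     (if v = 0 then return borel \<mu> else density lborel (\<lambda>x. ennreal (normal_density \<mu> (sqrt v) x)))"

definition centered_gaussian_family :: "'a measure \<Rightarrow> ('i \<Rightarrow> 'a \<Rightarrow> real) \<Rightarrow> bool" where
  "centered_gaussian_family M X \<longleftrightarrow>
     (\<forall>i. X i \<in> borel_measurable M) \<and>
     (\<forall>S c. finite S \<longrightarrow> (\<exists>v\<ge>0. distr M borel (\<lambda>\<omega>. \<Sum>i\<in>S. c i * X i \<omega>) = normal_law 0 v))"

definition isonormal_gaussian_process ::
    "'a measure \<Rightarrow> ('h::{real_inner,banach,second_countable_topology} \<Rightarrow> 'a \<Rightarrow> real) \<Rightarrow> bool" where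
  "isonormal_gaussian_process M X \<longleftrightarrow>
     prob_space M \<and> centered_gaussian_family M X \<and>
     (\<forall>h g. (\<integral>\<omega>. X h \<omega> * X g \<omega> \<partial>M) = h \<bullet> g)"

definition generated_by :: "'a measure \<Rightarrow> ('i \<Rightarrow> 'a \<Rightarrow> real) \<Rightarrow> bool" where
  "generated_by M X \<longleftrightarrow>
     sets M = sigma_sets (space M) {X i -` B \<inter> space M | i B. B \<in> sets borel}"

(* Elements of L^2 are functions here, not classes modulo null sets; the sets and operators
   below are closed under, respectively determined up to, almost everywhere equality. *)
definition L2 :: "'a measure \<Rightarrow> ('a \<Rightarrow> 'b::{banach,second_countable_topology}) set" where
  "L2 M = {F \<in> borel_measurable M. integrable M (\<lambda>\<omega>. (norm (F \<omega>))\<^sup>2)}"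

(* Probabilists' normalisation: monic, orthogonal for N(0,1); see hermite_rodrigues. *)
fun hermite :: "nat \<Rightarrow> real poly" where
  "hermite 0 = 1"
| "hermite (Suc n) = [:0, 1:] * hermite n - pderiv (hermite n)"

lemma hermite_rodrigues:
  "poly (hermite n) x = (- 1) ^ n * exp (x\<^sup>2 / 2) * (deriv ^^ n) (\<lambda>t. exp (- (t\<^sup>2 / 2))) x"
proof -
  have "(deriv ^^ n) (\<lambda>t. exp (- (t\<^sup>2 / 2))) =
        (\<lambda>t. (- 1) ^ n * poly (hermite n) t * exp (- (t\<^sup>2 / 2)))"
  proof (induction n)
    case 0
    then show ?case by simp
  next
    case (Suc n)
    have "((\<lambda>t. (- 1) ^ n * poly (hermite n) t * exp (- (t\<^sup>2 / 2))) has_real_derivative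
            (- 1) ^ Suc n * poly (hermite (Suc n)) x * exp (- (x\<^sup>2 / 2))) (at x)" for x :: real
      by (auto intro!: derivative_eq_intros poly_DERIV simp: algebra_simps)
    then show ?case
      unfolding funpow.simps o_apply Suc.IH by (intro ext DERIV_imp_deriv)
  qed
  then have "(- 1) ^ n * exp (x\<^sup>2 / 2) * (deriv ^^ n) (\<lambda>t. exp (- (t\<^sup>2 / 2))) x =
        ((- 1) ^ n * (- 1) ^ n) * (exp (x\<^sup>2 / 2) * exp (- (x\<^sup>2 / 2))) * poly (hermite n) x"
    by (simp only: ac_simps)
  also have "(- 1 :: real) ^ n * (- 1) ^ n = 1"
    by (simp flip: power_mult_distrib)
  also have "exp (x\<^sup>2 / 2) * exp (- (x\<^sup>2 / 2)) = 1"
    by (simp flip: exp_add)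
  finally show ?thesis by simp
qed

definition hermite_span :: "('h::real_normed_vector \<Rightarrow> 'a \<Rightarrow> real) \<Rightarrow> nat \<Rightarrow> ('a \<Rightarrow> real) set" where
  "hermite_span X n =
     {\<lambda>\<omega>. \<Sum>h\<in>S. c h * poly (hermite n) (X h \<omega>) | S c. finite S \<and> S \<subseteq> {h. norm h = 1}}"

definition wiener_chaos :: "'a measure \<Rightarrow> ('h::real_normed_vector \<Rightarrow> 'a \<Rightarrow> real) \<Rightarrow> nat \<Rightarrow> ('a \<Rightarrow> real) set" where
  "wiener_chaos M X n =
     (if n = 0 then {F \<in> L2 M. \<exists>c. AE \<omega> in M. F \<omega> = c}
      else {F \<in> L2 M. \<forall>\<epsilon>>0. \<exists>G \<in> hermite_span X n. (\<integral>\<omega>. (F \<omega> - G \<omega>)\<^sup>2 \<partial>M) < \<epsilon>})"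

definition is_chaos_projection ::
    "'a measure \<Rightarrow> ('h::real_normed_vector \<Rightarrow> 'a \<Rightarrow> real) \<Rightarrow> nat \<Rightarrow> ('a \<Rightarrow> real) \<Rightarrow> ('a \<Rightarrow> real) \<Rightarrow> bool" where
  "is_chaos_projection M X n F G \<longleftrightarrow>
     G \<in> wiener_chaos M X n \<and> (\<forall>Z \<in> wiener_chaos M X n. (\<integral>\<omega>. (F \<omega> - G \<omega>) * Z \<omega> \<partial>M) = 0)"

definition chaos_projection ::
    "'a measure \<Rightarrow> ('h::real_normed_vector \<Rightarrow> 'a \<Rightarrow> real) \<Rightarrow> nat \<Rightarrow> ('a \<Rightarrow> real) \<Rightarrow> 'a \<Rightarrow> real" where
  "chaos_projection M X n F = (SOME G. is_chaos_projection M X n F G)"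

(* A function on R^p is encoded as a function of x :: nat => real that depends only on the
   coordinates x 0, ..., x (p - 1). *)
definition partial_deriv :: "nat \<Rightarrow> ((nat \<Rightarrow> real) \<Rightarrow> real) \<Rightarrow> (nat \<Rightarrow> real) \<Rightarrow> real" where
  "partial_deriv i f x = deriv (\<lambda>t. f (x(i := t))) (x i)"

definition Cb_infinity :: "nat \<Rightarrow> ((nat \<Rightarrow> real) \<Rightarrow> real) set" where
  "Cb_infinity p =
     {f. (\<forall>x y. (\<forall>i<p. x i = y i) \<longrightarrow> f x = f y) \<and>
         (\<forall>js. set js \<subseteq> {..<p} \<longrightarrow>
            (let g = foldr partial_deriv js f in
               continuous_on UNIV g \<and> bounded (range g) \<and>
               (\<forall>i<p. \<forall>x. (\<lambda>t. g (x(i := t))) differentiable at (x i))))}"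

(* The graph of the derivative on smooth functionals; that DF does not depend on the
   representation of F, up to null sets, is not needed to state this. *)
definition smooth_malliavin_graph ::
    "('h::real_normed_vector \<Rightarrow> 'a \<Rightarrow> real) \<Rightarrow> (('a \<Rightarrow> real) \<times> ('a \<Rightarrow> 'h)) set" where
  "smooth_malliavin_graph X =
     {(\<lambda>\<omega>. f (\<lambda>j. X (h j) \<omega>), \<lambda>\<omega>. \<Sum>i<p. partial_deriv i f (\<lambda>j. X (h j) \<omega>) *\<^sub>R h i)
      | p f h. f \<in> Cb_infinity p}"

(* The closure of that graph in L^2(Omega) x L^2(Omega; H), that is, for the norm of D^{1,2}:
   F lies in D^{1,2} and U is a version of DF. *)
definition has_malliavin_derivative ::
    "'a measure \<Rightarrow> ('h::{real_inner,banach,second_countable_topology} \<Rightarrow> 'a \<Rightarrow> real) \<Rightarrow>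
     ('a \<Rightarrow> real) \<Rightarrow> ('a \<Rightarrow> 'h) \<Rightarrow> bool" where
  "has_malliavin_derivative M X F U \<longleftrightarrow>
     F \<in> L2 M \<and> U \<in> L2 M \<and>
     (\<forall>\<epsilon>>0. \<exists>(G, V) \<in> smooth_malliavin_graph X.
        (\<integral>\<omega>. (F \<omega> - G \<omega>)\<^sup>2 \<partial>M) + (\<integral>\<omega>. (norm (U \<omega> - V \<omega>))\<^sup>2 \<partial>M) < \<epsilon>)"

definition malliavin_derivative ::
    "'a measure \<Rightarrow> ('h::{real_inner,banach,second_countable_topology} \<Rightarrow> 'a \<Rightarrow> real) \<Rightarrow>
     ('a \<Rightarrow> real) \<Rightarrow> 'a \<Rightarrow> 'h" where
  "malliavin_derivative M X F = (SOME U. has_malliavin_derivative M X F U)"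

end

theory Submission
  imports Defs
begin

text \<open>
  Let \<open>F\<^sub>1, \<dots>, F\<^sub>N\<close> lie in the first \<open>N\<close> chaoses, \<open>T = F\<^sub>1 + \<dots> + F\<^sub>N\<close>. Integration by parts on a
  chaos reads \<open>n E[F \<Phi>] = E\<langle>DF, D\<Phi>\<rangle>\<close> for \<open>F\<close> in the \<open>n\<close>th chaos; applied to \<open>\<Phi> = exp (i t T)\<close> it gives
  \<open>d/dt E[exp (i t T)] = - t E[Y exp (i t T)]\<close> with \<open>Y = \<Sum>\<^sub>n \<langle>DF\<^sub>n, DT\<rangle> / n\<close>. Hence the characteristic
  function of \<open>T\<close> is within \<open>t\<^sup>2 E|Y - V|\<close> of \<open>exp (- V t\<^sup>2 / 2)\<close> (\<open>chaos_sum_characteristic_bound\<close>), and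
  the limit theorem for \<open>T\<close> follows once \<open>Y\<close> concentrates at \<open>V = \<Sum>\<^sub>n \<sigma>\<^sub>n\<^sup>2\<close>. The diagonal terms
  \<open>\<parallel>DF\<^sub>n\<parallel>\<^sup>2 / n\<close> concentrate by assumption; the point is that the mixed terms vanish in the limit on their own.

  This is \<open>gradients_asymptotically_orthogonal\<close>. For \<open>F, G\<close> in chaoses of orders \<open>p \<noteq> q\<close> put
  \<open>R = \<langle>DF, DG\<rangle>\<close> and \<open>B = E[F G R]\<close>. Integrating by parts in \<open>E[F\<^sup>2 G\<^sup>2]\<close> from either factor,
  \<open>p E[F\<^sup>2 G\<^sup>2] = E[G\<^sup>2 \<parallel>DF\<parallel>\<^sup>2] + 2 B\<close> and \<open>q E[F\<^sup>2 G\<^sup>2] = E[F\<^sup>2 \<parallel>DG\<parallel>\<^sup>2] + 2 B\<close>.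
  If \<open>\<parallel>DF\<parallel>\<^sup>2\<close> and \<open>\<parallel>DG\<parallel>\<^sup>2\<close> concentrate at \<open>p \<alpha>\<close> and \<open>q \<beta>\<close>, where \<open>\<alpha>, \<beta>\<close> are the limits of the second
  moments, the two expectations on the right tend to \<open>p \<alpha> \<beta>\<close> and \<open>q \<alpha> \<beta>\<close>. Subtracting, and using
  \<open>p \<noteq> q\<close>, gives \<open>E[F\<^sup>2 G\<^sup>2] \<rightarrow> \<alpha> \<beta>\<close> and so \<open>B \<rightarrow> 0\<close>. Finally \<open>R = (L + p + q) (F G) / 2\<close> for the
  Ornstein-Uhlenbeck operator \<open>L\<close>, which is \<open>- k\<close> on the \<open>k\<close>th chaos, while \<open>F G\<close> has components of
  order at most \<open>p + q\<close> only; on these \<open>0 \<le> L + p + q \<le> p + q\<close>, so that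
  \<open>E[R\<^sup>2] \<le> (p + q) / 2 * B\<close> (\<open>gradient_inner_product_bound\<close>).

  These identities are proved for finite sums of Hermite polynomials (\<open>chaos_poly\<close>). They carry over
  to arbitrary elements of a chaos because \<open>E[F\<^sup>4] \<le> (3\<^sup>n E[F\<^sup>2])\<^sup>2\<close> on the \<open>n\<close>th chaos: approximating
  \<open>F\<close> in \<open>L\<^sup>2\<close> then also approximates \<open>\<parallel>DF\<parallel>\<^sup>2\<close> in \<open>L\<^sup>2\<close> (\<open>wiener_chaos_poly_approx\<close>). The bound itself follows by
  induction on \<open>n\<close> from \<open>n E[F\<^sup>4] = 3 E[F\<^sup>2 \<parallel>DF\<parallel>\<^sup>2]\<close>, since the components of \<open>DF\<close> lie in the chaos of
  order \<open>n - 1\<close> (\<open>chaos_poly_hypercontractive\<close>).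

  Two tools carry the rest. Integration by parts is Stein's identity in the variable \<open>X h\<close>, after
  splitting off from every other coordinate its component along \<open>h\<close>; the remainder is independent of
  \<open>X h\<close>. Fourier uniqueness in several variables yields that independence, the totality of the
  chaoses, and the uniqueness of the closed Malliavin derivative.
\<close>

section \<open>Square integrable functions\<close>

lemma L2_I:
  assumes "f \<in> borel_measurable M" "integrable M (\<lambda>x. (norm (f x))\<^sup>2)"
  shows "f \<in> L2 M"
  using assms by (simp add: L2_def)

lemma L2_measurable: "f \<in> L2 M \<Longrightarrow> f \<in> borel_measurable M"
  by (simp add: L2_def)

lemma L2_integrable: "f \<in> L2 M \<Longrightarrow> integrable M (\<lambda>x. (norm (f x))\<^sup>2)"
  by (simp add: L2_def)

lemma L2_integrable_real: "f \<in> L2 M \<Longrightarrow> integrable M (\<lambda>x. (f x :: real)\<^sup>2)"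
  using L2_integrable[of f M] by simp

lemma L2_add:
  assumes "f \<in> L2 M" "g \<in> L2 M"
  shows "(\<lambda>x. f x + g x) \<in> L2 M"
proof (rule L2_I)
  note [measurable] = assms[THEN L2_measurable]
  show "(\<lambda>x. f x + g x) \<in> borel_measurable M" by measurable
  show "integrable M (\<lambda>x. (norm (f x + g x))\<^sup>2)"
  proof (rule Bochner_Integration.integrable_bound)
    show "integrable M (\<lambda>x. 2 * (norm (f x))\<^sup>2 + 2 * (norm (g x))\<^sup>2)"
      using assms by (auto intro!: Bochner_Integration.integrable_add dest: L2_integrable)
    have "(norm (f x + g x))\<^sup>2 \<le> 2 * (norm (f x))\<^sup>2 + 2 * (norm (g x))\<^sup>2" for x
    proof -
      have "(norm (f x + g x))\<^sup>2 \<le> (norm (f x) + norm (g x))\<^sup>2"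
        by (intro power_mono norm_triangle_ineq) auto
      also have "\<dots> \<le> 2 * (norm (f x))\<^sup>2 + 2 * (norm (g x))\<^sup>2"
        using sum_squares_bound[of "norm (f x)" "norm (g x)"] by (simp add: power2_sum)
      finally show ?thesis .
    qed
    then show "AE x in M. norm ((norm (f x + g x))\<^sup>2) \<le> norm (2 * (norm (f x))\<^sup>2 + 2 * (norm (g x))\<^sup>2)"
      by auto
  qed measurable
qed

lemma L2_scaleR: "f \<in> L2 M \<Longrightarrow> (\<lambda>x. c *\<^sub>R f x) \<in> L2 M"
  by (auto simp: L2_def power_mult_distrib)

lemma L2_mult: "f \<in> L2 M \<Longrightarrow> (\<lambda>x. c * f x) \<in> L2 M" for f :: "_ \<Rightarrow> real"
  using L2_scaleR[of f M c] by simp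

lemma L2_diff:
  assumes "f \<in> L2 M" "g \<in> L2 M"
  shows "(\<lambda>x. f x - g x) \<in> L2 M"
  using L2_add[OF assms(1) L2_scaleR[OF assms(2), of "- 1"]] by simp

lemma L2_zero: "(\<lambda>x. 0) \<in> L2 M"
  by (simp add: L2_def)

lemma L2_sum: "(\<And>i. i \<in> I \<Longrightarrow> f i \<in> L2 M) \<Longrightarrow> (\<lambda>x. \<Sum>i\<in>I. f i x) \<in> L2 M"
  by (induction I rule: infinite_finite_induct) (auto intro: L2_add L2_zero)

lemma integrable_mult_L2:
  assumes "f \<in> L2 M" "g \<in> L2 M"
  shows "integrable M (\<lambda>x. f x * (g x :: real))"
proof (rule Bochner_Integration.integrable_bound)
  note [measurable] = assms[THEN L2_measurable]
  show "integrable M (\<lambda>x. (f x)\<^sup>2 + (g x)\<^sup>2)"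
    using assms by (auto intro!: Bochner_Integration.integrable_add dest: L2_integrable)
  have "\<bar>f x * g x\<bar> \<le> \<bar>(f x)\<^sup>2 + (g x)\<^sup>2\<bar>" for x
  proof -
    have "2 * (\<bar>f x\<bar> * \<bar>g x\<bar>) \<le> (f x)\<^sup>2 + (g x)\<^sup>2"
      using sum_squares_bound[of "\<bar>f x\<bar>" "\<bar>g x\<bar>"] by (simp add: mult.assoc)
    moreover have "0 \<le> \<bar>f x\<bar> * \<bar>g x\<bar>" by simp
    ultimately show ?thesis unfolding abs_mult by linarith
  qed
  then show "AE x in M. norm (f x * g x) \<le> norm ((f x)\<^sup>2 + (g x)\<^sup>2)"
    by simp
  show "(\<lambda>x. f x * g x) \<in> borel_measurable M" by measurable
qed

lemma L2_norm: "f \<in> L2 M \<Longrightarrow> (\<lambda>x. norm (f x)) \<in> L2 M"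
  by (auto simp: L2_def)

lemma L2_cauchy_schwarz_abs:
  assumes "f \<in> L2 M" "g \<in> L2 M"
  shows "(\<integral>x. \<bar>f x * (g x :: real)\<bar> \<partial>M)\<^sup>2 \<le> (\<integral>x. (f x)\<^sup>2 \<partial>M) * (\<integral>x. (g x)\<^sup>2 \<partial>M)"
proof -
  note [measurable] = assms[THEN L2_measurable]
  have "ennreal ((\<integral>x. \<bar>f x * g x\<bar> \<partial>M)\<^sup>2) = (\<integral>\<^sup>+x. ennreal \<bar>f x * g x\<bar> \<partial>M)\<^sup>2"
    using integrable_mult_L2[OF assms] by (subst nn_integral_eq_integral) (auto simp: ennreal_power)
  also have "\<dots> = (\<integral>\<^sup>+x. ennreal \<bar>f x\<bar> * ennreal \<bar>g x\<bar> \<partial>M)\<^sup>2"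
    by (simp add: abs_mult ennreal_mult)
  also have "\<dots> \<le> (\<integral>\<^sup>+x. ennreal \<bar>f x\<bar> ^ 2 \<partial>M) * (\<integral>\<^sup>+x. ennreal \<bar>g x\<bar> ^ 2 \<partial>M)"
    by (intro Cauchy_Schwarz_nn_integral) auto
  also have "\<dots> = (\<integral>\<^sup>+x. ennreal ((f x)\<^sup>2) \<partial>M) * (\<integral>\<^sup>+x. ennreal ((g x)\<^sup>2) \<partial>M)"
    by (simp add: ennreal_power)
  also have "\<dots> = ennreal (\<integral>x. (f x)\<^sup>2 \<partial>M) * ennreal (\<integral>x. (g x)\<^sup>2 \<partial>M)"
    using assms[THEN L2_integrable_real] by (simp add: nn_integral_eq_integral)
  also have "\<dots> = ennreal ((\<integral>x. (f x)\<^sup>2 \<partial>M) * (\<integral>x. (g x)\<^sup>2 \<partial>M))"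
    by (simp add: ennreal_mult)
  finally show ?thesis by (simp add: mult_nonneg_nonneg)
qed

lemma L2_cauchy_schwarz_abs_sqrt:
  assumes "f \<in> L2 M" "g \<in> L2 M"
  shows "(\<integral>x. \<bar>f x * (g x :: real)\<bar> \<partial>M) \<le> sqrt (\<integral>x. (f x)\<^sup>2 \<partial>M) * sqrt (\<integral>x. (g x)\<^sup>2 \<partial>M)"
  using L2_cauchy_schwarz_abs[OF assms] by (metis real_le_rsqrt real_sqrt_mult)

lemma L2_cauchy_schwarz:
  assumes "f \<in> L2 M" "g \<in> L2 M"
  shows "\<bar>\<integral>x. f x * (g x :: real) \<partial>M\<bar> \<le> sqrt (\<integral>x. (f x)\<^sup>2 \<partial>M) * sqrt (\<integral>x. (g x)\<^sup>2 \<partial>M)"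
proof -
  have "\<bar>\<integral>x. f x * g x \<partial>M\<bar> \<le> (\<integral>x. \<bar>f x * g x\<bar> \<partial>M)"
    by (rule integral_abs_bound)
  also note L2_cauchy_schwarz_abs_sqrt[OF assms]
  finally show ?thesis .
qed

lemma L2_triangle:
  assumes "f \<in> L2 M" "g \<in> L2 M"
  shows "sqrt (\<integral>x. (f x + g x :: real)\<^sup>2 \<partial>M) \<le> sqrt (\<integral>x. (f x)\<^sup>2 \<partial>M) + sqrt (\<integral>x. (g x)\<^sup>2 \<partial>M)"
proof (rule real_le_lsqrt)
  show "0 \<le> sqrt (\<integral>x. (f x)\<^sup>2 \<partial>M) + sqrt (\<integral>x. (g x)\<^sup>2 \<partial>M)" by simp
  have "(\<integral>x. (f x + g x)\<^sup>2 \<partial>M) = (\<integral>x. (f x)\<^sup>2 \<partial>M) + (\<integral>x. (g x)\<^sup>2 \<partial>M) + 2 * (\<integral>x. f x * g x \<partial>M)"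
    using assms[THEN L2_integrable_real] integrable_mult_L2[OF assms]
    by (simp add: power2_sum mult.assoc)
  also have "\<dots> \<le> (\<integral>x. (f x)\<^sup>2 \<partial>M) + (\<integral>x. (g x)\<^sup>2 \<partial>M)
      + 2 * (sqrt (\<integral>x. (f x)\<^sup>2 \<partial>M) * sqrt (\<integral>x. (g x)\<^sup>2 \<partial>M))"
    using L2_cauchy_schwarz[OF assms] by simp
  also have "\<dots> = (sqrt (\<integral>x. (f x)\<^sup>2 \<partial>M) + sqrt (\<integral>x. (g x)\<^sup>2 \<partial>M))\<^sup>2"
    by (simp add: power2_sum)
  finally show "(\<integral>x. (f x + g x)\<^sup>2 \<partial>M) \<le> (sqrt (\<integral>x. (f x)\<^sup>2 \<partial>M) + sqrt (\<integral>x. (g x)\<^sup>2 \<partial>M))\<^sup>2" .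
qed

text \<open>
  Bounds that are uniform along an almost surely convergent sequence pass to the limit. It is
  used with second moments (completeness) and with fourth moments (limits of gradients).
\<close>

lemma nn_integral_norm_power_Fatou:
  fixes f :: "nat \<Rightarrow> 'a \<Rightarrow> 'b::{banach,second_countable_topology}"
  assumes [measurable]: "\<And>n. f n \<in> borel_measurable M" "g \<in> borel_measurable M"
    and lim: "AE x in M. (\<lambda>n. f n x) \<longlonglongrightarrow> g x"
    and bound: "\<And>n. n \<ge> m \<Longrightarrow> (\<integral>\<^sup>+x. ennreal (norm (f n x) ^ k) \<partial>M) \<le> c"
  shows "(\<integral>\<^sup>+x. ennreal (norm (g x) ^ k) \<partial>M) \<le> c"
proof -
  have "AE x in M. ennreal (norm (g x) ^ k) = liminf (\<lambda>n. ennreal (norm (f n x) ^ k))"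
    using lim
  proof eventually_elim
    case (elim x)
    then have "(\<lambda>n. ennreal (norm (f n x) ^ k)) \<longlonglongrightarrow> ennreal (norm (g x) ^ k)"
      by (intro tendsto_ennrealI tendsto_intros)
    then show ?case by (intro lim_imp_Liminf[symmetric]) auto
  qed
  then have "(\<integral>\<^sup>+x. ennreal (norm (g x) ^ k) \<partial>M)
      = (\<integral>\<^sup>+x. liminf (\<lambda>n. ennreal (norm (f n x) ^ k)) \<partial>M)"
    by (rule nn_integral_cong_AE)
  also have "\<dots> \<le> liminf (\<lambda>n. \<integral>\<^sup>+x. ennreal (norm (f n x) ^ k) \<partial>M)"
    by (rule nn_integral_liminf) measurable
  also have "\<dots> \<le> limsup (\<lambda>n. \<integral>\<^sup>+x. ennreal (norm (f n x) ^ k) \<partial>M)"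
    by (intro Liminf_le_Limsup) auto
  also have "\<dots> \<le> c"
    using bound by (intro Limsup_bounded) (auto simp: eventually_sequentially)
  finally show ?thesis .
qed

lemma L2_nn_I:
  assumes [measurable]: "f \<in> borel_measurable M"
    and "(\<integral>\<^sup>+x. ennreal ((norm (f x))\<^sup>2) \<partial>M) \<le> ennreal c"
  shows "f \<in> L2 M"
proof (rule L2_I)
  show "integrable M (\<lambda>x. (norm (f x))\<^sup>2)"
    using assms(2) by (intro integrableI_bounded) (auto simp: order_le_less_trans)
qed fact

lemma integral_norm2_le_of_nn:
  assumes "f \<in> L2 M" "(\<integral>\<^sup>+x. ennreal ((norm (f x))\<^sup>2) \<partial>M) \<le> ennreal c" "0 \<le> c"
  shows "(\<integral>x. (norm (f x))\<^sup>2 \<partial>M) \<le> c"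
  using assms L2_integrable[OF assms(1)] by (simp add: nn_integral_eq_integral)

lemma nn_integral_norm2:
  "f \<in> L2 M \<Longrightarrow> (\<integral>\<^sup>+x. ennreal ((norm (f x))\<^sup>2) \<partial>M) = ennreal (\<integral>x. (norm (f x))\<^sup>2 \<partial>M)"
  using L2_integrable[of f M] by (simp add: nn_integral_eq_integral)

text \<open>
  Riesz-Fischer. The weights \<open>2\<^sup>n\<close> keep \<open>\<Sum>\<^sub>n 2\<^sup>n \<parallel>f\<^sub>n\<^sub>+\<^sub>1 - f\<^sub>n\<parallel>\<^sup>2\<close> integrable, so this sum is
  finite almost everywhere; by Cauchy-Schwarz it controls \<open>(\<Sum>\<^sub>n \<parallel>f\<^sub>n\<^sub>+\<^sub>1 - f\<^sub>n\<parallel>)\<^sup>2\<close>.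
\<close>

lemma L2_fast_Cauchy_limit:
  fixes f :: "nat \<Rightarrow> 'a \<Rightarrow> 'b::{banach,second_countable_topology}"
  assumes f: "\<And>n. f n \<in> L2 M"
    and fast: "\<And>n. (\<integral>x. (norm (f (Suc n) x - f n x))\<^sup>2 \<partial>M) \<le> (1/4) ^ n"
  shows "\<exists>g\<in>L2 M. AE x in M. (\<lambda>n. f n x) \<longlonglongrightarrow> g x"
proof -
  note [measurable] = f[THEN L2_measurable]
  define a where "a n x = norm (f (Suc n) x - f n x)" for n x
  have [measurable]: "a n \<in> borel_measurable M" for n unfolding a_def by measurable
  have aL2: "(\<integral>\<^sup>+x. ennreal ((a n x)\<^sup>2) \<partial>M) \<le> ennreal ((1/4) ^ n)" for n
    using nn_integral_norm2[OF L2_diff[OF f f], of "Suc n" n] fast[of n] unfolding a_def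
    by (simp add: ennreal_leI)
  define S where "S x = (\<Sum>n. ennreal (2 ^ n * (a n x)\<^sup>2))" for x
  have [measurable]: "S \<in> borel_measurable M" unfolding S_def by measurable
  have S: "(\<integral>\<^sup>+x. S x \<partial>M) \<le> ennreal 2"
  proof -
    have "(\<integral>\<^sup>+x. S x \<partial>M) = (\<Sum>n. \<integral>\<^sup>+x. ennreal (2 ^ n * (a n x)\<^sup>2) \<partial>M)"
      unfolding S_def by (rule nn_integral_suminf) measurable
    also have "\<dots> \<le> (\<Sum>n. ennreal ((1/2) ^ n))"
    proof (intro suminf_le allI)
      fix n
      have "(\<integral>\<^sup>+x. ennreal (2 ^ n * (a n x)\<^sup>2) \<partial>M) = ennreal (2 ^ n) * (\<integral>\<^sup>+x. ennreal ((a n x)\<^sup>2) \<partial>M)"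
        by (simp add: ennreal_mult nn_integral_cmult)
      also have "\<dots> \<le> ennreal (2 ^ n) * ennreal ((1/4) ^ n)"
        by (intro mult_left_mono aL2) auto
      also have "\<dots> = ennreal ((1/2) ^ n)"
        by (simp flip: ennreal_mult power_mult_distrib)
      finally show "(\<integral>\<^sup>+x. ennreal (2 ^ n * (a n x)\<^sup>2) \<partial>M) \<le> ennreal ((1/2) ^ n)" .
    qed auto
    also have "\<dots> = ennreal 2"
      by (subst suminf_ennreal_eq[where x = 2]) (auto intro!: geometric_sums[of "1/2::real", simplified])
    finally show ?thesis .
  qed
  have "AE x in M. S x \<noteq> \<infinity>"
    using S by (intro nn_integral_noteq_infinite) (auto simp: top_unique)
  moreover have key: "convergent (\<lambda>n. f n x) \<and> (\<forall>n. (norm (f n x - f 0 x))\<^sup>2 \<le> 2 * enn2real (S x))"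
    if "S x \<noteq> \<infinity>" for x
  proof -
    let ?b = "\<lambda>n. 2 ^ n * (a n x)\<^sup>2"
    have tel: "(\<Sum>k<n. f (Suc k) x - f k x) = f n x - f 0 x" for n
      by (rule sum_lessThan_telescope)
    have sb: "summable ?b"
      using that unfolding S_def by (intro summable_suminf_not_top) auto
    have Sx: "S x = ennreal (suminf ?b)"
      unfolding S_def by (rule suminf_ennreal2) (use sb in auto)
    have sum_le: "(\<Sum>k<n. a k x)\<^sup>2 \<le> 2 * suminf ?b" for n
    proof -
      have "(\<Sum>k<n. a k x) = (\<Sum>k<n. sqrt ((1/2) ^ k) * (sqrt (2 ^ k) * a k x))"
        by (intro sum.cong) (auto simp flip: real_sqrt_mult power_mult_distrib mult.assoc)
      then have "(\<Sum>k<n. a k x)\<^sup>2 \<le> (\<Sum>k<n. (sqrt ((1/2) ^ k))\<^sup>2) * (\<Sum>k<n. (sqrt (2 ^ k) * a k x)\<^sup>2)"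
        using Cauchy_Schwarz_ineq_sum[of "\<lambda>k. sqrt ((1/2) ^ k)" "\<lambda>k. sqrt (2 ^ k) * a k x" "{..<n}"]
        by simp
      also have "\<dots> = (\<Sum>k<n. (1/2) ^ k) * (\<Sum>k<n. ?b k)"
        by (simp add: power_mult_distrib)
      also have "\<dots> \<le> 2 * suminf ?b"
      proof (intro mult_mono)
        have "(\<Sum>k<n. (1/2::real) ^ k) \<le> (\<Sum>k. (1/2) ^ k)"
          by (intro sum_le_suminf summable_geometric) auto
        then show "(\<Sum>k<n. (1/2::real) ^ k) \<le> 2" by (simp add: suminf_geometric)
        show "(\<Sum>k<n. ?b k) \<le> suminf ?b" using sb by (intro sum_le_suminf) auto
      qed (auto intro: sum_nonneg)
      finally show ?thesis .
    qed
    have "summable (\<lambda>k. a k x)"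
    proof (rule bounded_imp_summable)
      show "a n x \<ge> 0" for n by (simp add: a_def)
      fix n
      have "\<bar>\<Sum>k<Suc n. a k x\<bar> \<le> sqrt (2 * suminf ?b)"
        using sum_le[of "Suc n"] by (metis real_sqrt_abs real_sqrt_le_iff)
      then show "(\<Sum>k\<le>n. a k x) \<le> sqrt (2 * suminf ?b)" by (simp add: lessThan_Suc_atMost)
    qed
    then have "summable (\<lambda>k. f (Suc k) x - f k x)"
      unfolding a_def by (rule summable_norm_cancel)
    then have "convergent (\<lambda>n. \<Sum>k<n. f (Suc k) x - f k x)"
      by (simp only: summable_iff_convergent)
    then have "convergent (\<lambda>n. (f n x - f 0 x) + f 0 x)"
      unfolding tel by (intro convergent_add convergent_const)
    then have c: "convergent (\<lambda>n. f n x)" by simp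
    have "(norm (f n x - f 0 x))\<^sup>2 \<le> 2 * enn2real (S x)" for n
    proof -
      have "norm (f n x - f 0 x) \<le> (\<Sum>k<n. a k x)"
        unfolding a_def tel[symmetric] by (rule norm_sum)
      then have "(norm (f n x - f 0 x))\<^sup>2 \<le> (\<Sum>k<n. a k x)\<^sup>2" by (intro power_mono) auto
      also note sum_le
      also have "suminf ?b = enn2real (S x)"
        unfolding Sx using sb by (simp add: suminf_nonneg)
      finally show ?thesis .
    qed
    with c show ?thesis by blast
  qed
  define g where "g x = lim (\<lambda>n. f n x)" for x
  have [measurable]: "g \<in> borel_measurable M"
    unfolding g_def by (rule borel_measurable_lim_metric) measurable
  have lim: "AE x in M. (\<lambda>n. f n x) \<longlonglongrightarrow> g x"
    using calculation(1) by eventually_elim (use key in \<open>auto simp: g_def convergent_LIMSEQ_iff\<close>)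
  have diff: "(\<lambda>x. g x - f 0 x) \<in> L2 M"
  proof (rule L2_nn_I)
    have "(\<integral>\<^sup>+x. ennreal ((norm (g x - f 0 x))\<^sup>2) \<partial>M) \<le> (\<integral>\<^sup>+x. 2 * S x \<partial>M)"
    proof (rule nn_integral_mono_AE)
      show "AE x in M. ennreal ((norm (g x - f 0 x))\<^sup>2) \<le> 2 * S x"
        using calculation(1) lim
      proof eventually_elim
        case (elim x)
        have "(\<lambda>n. (norm (f n x - f 0 x))\<^sup>2) \<longlonglongrightarrow> (norm (g x - f 0 x))\<^sup>2"
          using elim(2) by (intro tendsto_intros)
        then have "(norm (g x - f 0 x))\<^sup>2 \<le> 2 * enn2real (S x)"
          by (rule lim_mono[OF _ _ tendsto_const, rotated]) (use key elim in auto)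
        then have "ennreal ((norm (g x - f 0 x))\<^sup>2) \<le> ennreal (2 * enn2real (S x))"
          by (rule ennreal_leI)
        also have "\<dots> = 2 * S x" using elim(1) by (simp add: ennreal_mult top.not_eq_extremum)
        finally show ?case .
      qed
    qed
    also have "\<dots> = 2 * (\<integral>\<^sup>+x. S x \<partial>M)" by (simp add: nn_integral_cmult)
    also have "\<dots> \<le> 2 * ennreal 2" by (intro mult_left_mono S) auto
    also have "\<dots> = ennreal 4" by (simp flip: ennreal_numeral ennreal_mult)
    finally show "(\<integral>\<^sup>+x. ennreal ((norm (g x - f 0 x))\<^sup>2) \<partial>M) \<le> ennreal 4" .
  qed measurable
  then have "(\<lambda>x. (g x - f 0 x) + f 0 x) \<in> L2 M" by (intro L2_add f)
  then have "g \<in> L2 M" by simp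
  with lim show ?thesis by blast
qed


lemma L2_fast_Cauchy_limit_rate:
  fixes f :: "nat \<Rightarrow> 'a \<Rightarrow> 'b::{banach,second_countable_topology}"
  assumes f: "\<And>n. f n \<in> L2 M"
    and fast: "\<And>n m. n \<le> m \<Longrightarrow> (\<integral>x. (norm (f m x - f n x))\<^sup>2 \<partial>M) \<le> (1/4) ^ n"
  shows "\<exists>g\<in>L2 M. (AE x in M. (\<lambda>n. f n x) \<longlonglongrightarrow> g x)
           \<and> (\<forall>n. (\<integral>x. (norm (g x - f n x))\<^sup>2 \<partial>M) \<le> (1/4) ^ n)"
proof -
  obtain g where g: "g \<in> L2 M" and lim: "AE x in M. (\<lambda>n. f n x) \<longlonglongrightarrow> g x"
    using L2_fast_Cauchy_limit[of f M] f fast by force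
  have "(\<integral>x. (norm (g x - f n x))\<^sup>2 \<partial>M) \<le> (1/4) ^ n" for n
  proof (rule integral_norm2_le_of_nn)
    show "(\<lambda>x. g x - f n x) \<in> L2 M" by (intro L2_diff f g)
    show "(\<integral>\<^sup>+x. ennreal ((norm (g x - f n x))\<^sup>2) \<partial>M) \<le> ennreal ((1/4) ^ n)"
    proof (rule nn_integral_norm_power_Fatou[where f = "\<lambda>m x. f m x - f n x" and m = n])
      show "AE x in M. (\<lambda>m. f m x - f n x) \<longlonglongrightarrow> g x - f n x"
        using lim by eventually_elim (intro tendsto_intros)
      show "(\<integral>\<^sup>+x. ennreal ((norm (f m x - f n x))\<^sup>2) \<partial>M) \<le> ennreal ((1/4) ^ n)" if "n \<le> m" for m
        using nn_integral_norm2[OF L2_diff[OF f f], of m n] fast[OF that] by (simp add: ennreal_leI)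
    qed (use L2_measurable[OF L2_diff[OF f f]] L2_measurable[OF L2_diff[OF g f]] in auto)
  qed simp
  with g lim show ?thesis by blast
qed

text \<open>
  Orthogonal projection onto a closed subspace of square integrable functions. A minimising
  sequence is Cauchy by the parallelogram identity, and the minimiser is orthogonal because moving
  away from it along \<open>t Z\<close> cannot decrease the distance.
\<close>

lemma L2_projection:
  fixes K :: "('a \<Rightarrow> real) set"
  assumes K: "K \<subseteq> L2 M" and "K \<noteq> {}"
    and add: "\<And>f g. f \<in> K \<Longrightarrow> g \<in> K \<Longrightarrow> (\<lambda>x. f x + g x) \<in> K"
    and mult: "\<And>f c. f \<in> K \<Longrightarrow> (\<lambda>x. c * f x) \<in> K"
    and closed: "\<And>g. g \<in> L2 M \<Longrightarrow> (\<And>\<epsilon>. \<epsilon> > 0 \<Longrightarrow> \<exists>f\<in>K. (\<integral>x. (g x - f x)\<^sup>2 \<partial>M) < \<epsilon>) \<Longrightarrow> g \<in> K"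
    and F: "F \<in> L2 M"
  shows "\<exists>G\<in>K. \<forall>Z\<in>K. (\<integral>x. (F x - G x) * Z x \<partial>M) = 0"
proof -
  define D where "D G = (\<integral>x. (F x - G x)\<^sup>2 \<partial>M)" for G
  define d where "d = (INF G\<in>K. D G)"
  have D0: "D G \<ge> 0" for G unfolding D_def by simp
  have bdd: "bdd_below (D ` K)" using D0 by (intro bdd_belowI2[of _ 0]) auto
  have dle: "d \<le> D G" if "G \<in> K" for G
    unfolding d_def by (rule cINF_lower[OF bdd that])
  \<comment> \<open>With this tolerance the parallelogram identity makes the squared distances at most \<open>(1/4) ^ n\<close>.\<close>
  have "\<exists>G\<in>K. D G < d + (1/4) ^ n / 4" for n
  proof -
    have "d < d + (1/4) ^ n / 4" by simp
    then show ?thesis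
      unfolding d_def by (subst (asm) cINF_less_iff) (use bdd \<open>K \<noteq> {}\<close> in auto)
  qed
  then obtain G where G: "\<And>n. G n \<in> K" and GD: "\<And>n. D (G n) < d + (1/4) ^ n / 4"
    by metis
  have GL: "G n \<in> L2 M" for n using G K by auto
  have par: "(\<integral>x. (G m x - G n x)\<^sup>2 \<partial>M) \<le> 2 * D (G m) + 2 * D (G n) - 4 * d" for m n
  proof -
    have mid: "(\<lambda>x. (1/2) * (G m x + G n x)) \<in> K" by (intro mult add G)
    have L: "(\<lambda>x. F x - (1/2) * (G m x + G n x)) \<in> L2 M" using mid K by (intro L2_diff F) auto
    have eq: "(G m x - G n x)\<^sup>2 = 2 * (F x - G m x)\<^sup>2 + 2 * (F x - G n x)\<^sup>2
        - 4 * (F x - (1/2) * (G m x + G n x))\<^sup>2" for x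
      by (simp add: power2_eq_square algebra_simps)
    have "(\<integral>x. (G m x - G n x)\<^sup>2 \<partial>M) = 2 * D (G m) + 2 * D (G n)
        - 4 * D (\<lambda>x. (1/2) * (G m x + G n x))"
      unfolding eq D_def
      using L2_integrable_real[OF L] L2_integrable_real[OF L2_diff[OF F GL]]
      by (simp del: times_divide_eq_left mult_1)
    with dle[OF mid] show ?thesis by simp
  qed
  have "(\<integral>x. (norm (G m x - G n x))\<^sup>2 \<partial>M) \<le> (1/4) ^ n" if "n \<le> m" for m n
  proof -
    have "(1/4::real) ^ m \<le> (1/4) ^ n" using that by (intro power_decreasing) auto
    then have "(\<integral>x. (G m x - G n x)\<^sup>2 \<partial>M) \<le> (1/4) ^ n"
      using par[of m n] GD[of m] GD[of n] by linarith
    then show ?thesis by simp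
  qed
  from L2_fast_Cauchy_limit_rate[OF GL this] obtain g where g: "g \<in> L2 M"
    and lim: "AE x in M. (\<lambda>n. G n x) \<longlonglongrightarrow> g x"
    and rate: "\<And>n. (\<integral>x. (norm (g x - G n x))\<^sup>2 \<partial>M) \<le> (1/4) ^ n" by blast
  have pow0: "\<exists>n. (1/4::real) ^ n < \<epsilon>" if "\<epsilon> > 0" for \<epsilon>
    using that by (intro real_arch_pow_inv) auto
  have gK: "g \<in> K"
  proof (rule closed[OF g])
    fix \<epsilon> :: real assume "\<epsilon> > 0"
    from pow0[OF this] obtain n where "(1/4) ^ n < \<epsilon>" by blast
    with rate[of n] show "\<exists>f\<in>K. (\<integral>x. (g x - f x)\<^sup>2 \<partial>M) < \<epsilon>"
      using G by (intro bexI[of _ "G n"]) auto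
  qed
  have "D g \<le> d"
  proof (rule field_le_epsilon)
    fix \<epsilon> :: real assume "\<epsilon> > 0"
    from pow0[OF this] obtain n where n: "(1/4) ^ n < \<epsilon>" by blast
    have "(\<integral>x. (norm (F x - g x))\<^sup>2 \<partial>M) \<le> d + \<epsilon>"
    proof (rule integral_norm2_le_of_nn)
      show "(\<lambda>x. F x - g x) \<in> L2 M" by (intro L2_diff F g)
      show "(\<integral>\<^sup>+x. ennreal ((norm (F x - g x))\<^sup>2) \<partial>M) \<le> ennreal (d + \<epsilon>)"
      proof (rule nn_integral_norm_power_Fatou[where f = "\<lambda>m x. F x - G m x" and m = n])
        show "AE x in M. (\<lambda>m. F x - G m x) \<longlonglongrightarrow> F x - g x"
          using lim by eventually_elim (intro tendsto_intros)
        show "(\<integral>\<^sup>+x. ennreal ((norm (F x - G m x))\<^sup>2) \<partial>M) \<le> ennreal (d + \<epsilon>)" if "n \<le> m" for m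
        proof -
          have "(1/4::real) ^ m \<le> (1/4) ^ n" using that by (intro power_decreasing) auto
          then have "D (G m) \<le> d + \<epsilon>" using GD[of m] n \<open>\<epsilon> > 0\<close> by linarith
          then show ?thesis
            unfolding nn_integral_norm2[OF L2_diff[OF F GL]] by (simp add: D_def ennreal_leI)
        qed
      qed (use L2_measurable[OF L2_diff[OF F GL]] L2_measurable[OF L2_diff[OF F g]] in auto)
      have "0 \<le> d" using D0 \<open>K \<noteq> {}\<close> unfolding d_def by (intro cINF_greatest) auto
      then show "0 \<le> d + \<epsilon>" using \<open>\<epsilon> > 0\<close> by simp
    qed
    then show "D g \<le> d + \<epsilon>" by (simp add: D_def)
  qed
  have "(\<integral>x. (F x - g x) * Z x \<partial>M) = 0" if Z: "Z \<in> K" for Z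
  proof -
    define b c where "b = (\<integral>x. (F x - g x) * Z x \<partial>M)" and "c = (\<integral>x. (Z x)\<^sup>2 \<partial>M)"
    have ZL: "Z \<in> L2 M" using Z K by auto
    have "D g \<le> D g - 2 * t * b + t\<^sup>2 * c" for t
    proof -
      have "D g \<le> D (\<lambda>x. g x + t * Z x)"
        using \<open>D g \<le> d\<close> dle[OF add[OF gK mult[OF Z]]] by (rule order_trans)
      also have "(\<lambda>x. (F x - (g x + t * Z x))\<^sup>2)
          = (\<lambda>x. (F x - g x)\<^sup>2 - 2 * t * ((F x - g x) * Z x) + t\<^sup>2 * (Z x)\<^sup>2)"
        by (rule ext) (simp add: power2_eq_square algebra_simps)
      then have "D (\<lambda>x. g x + t * Z x) = D g - 2 * t * b + t\<^sup>2 * c"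
        unfolding D_def b_def c_def
        using L2_integrable_real[OF ZL] L2_integrable_real[OF L2_diff[OF F g]]
          integrable_mult_L2[OF L2_diff[OF F g] ZL]
        by simp
      finally show ?thesis .
    qed
    then have ineq: "2 * t * b \<le> t\<^sup>2 * c" for t by (smt (verit))
    have c0: "c \<ge> 0" unfolding c_def by simp
    \<comment> \<open>The step \<open>b / c\<close> would be optimal; adding 1 covers \<open>c = 0\<close>.\<close>
    have "2 * (b / (c + 1)) * b \<le> (b / (c + 1))\<^sup>2 * c" by (rule ineq)
    also have "\<dots> \<le> (b / (c + 1))\<^sup>2 * (c + 1)" by (intro mult_left_mono) auto
    also have "\<dots> = (b / (c + 1)) * b" using c0 by (simp add: power2_eq_square)
    finally have "b\<^sup>2 / (c + 1) \<le> 0" by (simp add: power2_eq_square)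
    then have "b\<^sup>2 \<le> 0" using c0 by (simp add: divide_le_0_iff)
    then show ?thesis unfolding b_def by simp
  qed
  with gK show ?thesis by blast
qed

section \<open>Fourier uniqueness in several variables\<close>

text \<open>
  The positive and the negative part of \<open>Z\<close>, normalised by their common mass, are densities of
  two probability measures under which \<open>Y\<close> has the same characteristic function.
\<close>

lemma weighted_Levy_uniqueness_real:
  fixes Z Y :: "'a \<Rightarrow> real"
  assumes Z: "integrable M Z" and Y[measurable]: "Y \<in> borel_measurable M"
    and zero: "\<And>t. (\<integral>\<omega>. complex_of_real (Z \<omega>) * iexp (t * Y \<omega>) \<partial>M) = 0"
    and B: "B \<in> sets borel"
  shows "(\<integral>\<omega>. Z \<omega> * indicator B (Y \<omega>) \<partial>M) = 0"
proof -
  have Zm[measurable]: "Z \<in> borel_measurable M" using Z by simp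
  define P where "P \<omega> = max 0 (Z \<omega>)" for \<omega>
  define N where "N \<omega> = max 0 (- Z \<omega>)" for \<omega>
  have [measurable]: "P \<in> borel_measurable M" "N \<in> borel_measurable M"
    unfolding P_def N_def by measurable
  have intP: "integrable M P" and intN: "integrable M N"
    unfolding P_def N_def using Z by auto
  have ZPN: "Z \<omega> = P \<omega> - N \<omega>" for \<omega> unfolding P_def N_def by auto
  have pos: "P \<omega> \<ge> 0" "N \<omega> \<ge> 0" for \<omega> unfolding P_def N_def by auto
  define c where "c = (\<integral>\<omega>. P \<omega> \<partial>M)"
  have "complex_of_real (\<integral>\<omega>. Z \<omega> \<partial>M) = 0" using zero[of 0] by simp
  then have cN: "c = (\<integral>\<omega>. N \<omega> \<partial>M)"
    unfolding c_def ZPN using intP intN by simp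
  have expi: "integrable M (\<lambda>\<omega>. complex_of_real (Q \<omega>) * iexp (t * Y \<omega>))"
    if "integrable M Q" for Q t
    using that by (intro Bochner_Integration.integrable_bound[OF that]) (auto simp: norm_mult)
  have eq: "(\<integral>\<omega>. complex_of_real (P \<omega>) * iexp (t * Y \<omega>) \<partial>M)
      = (\<integral>\<omega>. complex_of_real (N \<omega>) * iexp (t * Y \<omega>) \<partial>M)" for t
  proof -
    have "0 = (\<integral>\<omega>. complex_of_real (P \<omega>) * iexp (t * Y \<omega>) - complex_of_real (N \<omega>) * iexp (t * Y \<omega>) \<partial>M)"
      unfolding zero[of t, symmetric] by (intro Bochner_Integration.integral_cong) (auto simp: ZPN algebra_simps)
    also have "\<dots> = (\<integral>\<omega>. complex_of_real (P \<omega>) * iexp (t * Y \<omega>) \<partial>M)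
      - (\<integral>\<omega>. complex_of_real (N \<omega>) * iexp (t * Y \<omega>) \<partial>M)"
      by (intro Bochner_Integration.integral_diff expi intP intN)
    finally show ?thesis by simp
  qed
  have "c \<ge> 0" unfolding c_def using pos by simp
  then consider "c = 0" | "c > 0" by linarith
  then show ?thesis
  proof cases
    case 1
    have "AE \<omega> in M. P \<omega> = 0"
      using integral_nonneg_eq_0_iff_AE[OF intP] pos 1 unfolding c_def by simp
    moreover have "AE \<omega> in M. N \<omega> = 0"
      using integral_nonneg_eq_0_iff_AE[OF intN] pos 1 cN by simp
    ultimately have "AE \<omega> in M. Z \<omega> * indicator B (Y \<omega>) = 0"
      by eventually_elim (simp add: ZPN)
    then show ?thesis by (intro integral_eq_zero_AE)
  next
    case 2
    define \<mu> where "\<mu> Q = distr (density M (\<lambda>\<omega>. ennreal (Q \<omega> / c))) borel Y" for Q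
    have dist: "real_distribution (\<mu> Q)"
      if Q[measurable]: "integrable M Q" "\<And>\<omega>. Q \<omega> \<ge> 0" "(\<integral>\<omega>. Q \<omega> \<partial>M) = c" for Q
    proof -
      have [measurable]: "Q \<in> borel_measurable M" using Q by simp
      have "prob_space (density M (\<lambda>\<omega>. ennreal (Q \<omega> / c)))"
      proof (rule prob_spaceI)
        have "emeasure (density M (\<lambda>\<omega>. ennreal (Q \<omega> / c))) (space M) = (\<integral>\<^sup>+\<omega>. ennreal (Q \<omega> / c) \<partial>M)"
          by (subst emeasure_density) (auto intro!: nn_integral_cong)
        also have "\<dots> = ennreal (\<integral>\<omega>. Q \<omega> / c \<partial>M)"
          using Q 2 by (intro nn_integral_eq_integral) auto
        also have "\<dots> = 1" using Q 2 by simp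
        finally show "emeasure (density M (\<lambda>\<omega>. ennreal (Q \<omega> / c))) (space (density M (\<lambda>\<omega>. ennreal (Q \<omega> / c)))) = 1"
          by simp
      qed
      then show ?thesis unfolding \<mu>_def by (intro prob_space.real_distribution_distr) auto
    qed
    have int\<mu>: "(\<integral>y. f y \<partial>\<mu> Q) = (\<integral>\<omega>. (Q \<omega> / c) *\<^sub>R f (Y \<omega>) \<partial>M)"
      if Q: "integrable M Q" "\<And>\<omega>. Q \<omega> \<ge> 0" and f[measurable]: "f \<in> borel_measurable borel"
      for Q and f :: "real \<Rightarrow> 'b::{banach,second_countable_topology}"
    proof -
      have [measurable]: "Q \<in> borel_measurable M" using Q by simp
      have "(\<integral>y. f y \<partial>\<mu> Q) = (\<integral>\<omega>. f (Y \<omega>) \<partial>density M (\<lambda>\<omega>. ennreal (Q \<omega> / c)))"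
        unfolding \<mu>_def by (rule integral_distr) auto
      also have "\<dots> = (\<integral>\<omega>. (Q \<omega> / c) *\<^sub>R f (Y \<omega>) \<partial>M)"
        using Q 2 by (intro integral_density) auto
      finally show ?thesis .
    qed
    have ch: "char (\<mu> Q) t = (\<integral>\<omega>. complex_of_real (Q \<omega>) * iexp (t * Y \<omega>) \<partial>M) / c"
      if Q: "integrable M Q" "\<And>\<omega>. Q \<omega> \<ge> 0" for Q t
    proof -
      have "char (\<mu> Q) t = (\<integral>\<omega>. (Q \<omega> / c) *\<^sub>R iexp (t * Y \<omega>) \<partial>M)"
        unfolding char_def by (rule int\<mu>[OF Q]) measurable
      also have "\<dots> = (\<integral>\<omega>. (complex_of_real (Q \<omega>) * iexp (t * Y \<omega>)) / c \<partial>M)"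
        by (simp add: scaleR_conv_of_real)
      finally show ?thesis by simp
    qed
    have "\<mu> P = \<mu> N"
    proof (rule Levy_uniqueness)
      show "real_distribution (\<mu> P)" by (rule dist) (use intP pos c_def in auto)
      show "real_distribution (\<mu> N)" by (rule dist) (use intN pos cN in auto)
      show "char (\<mu> P) = char (\<mu> N)"
        using ch[OF intP pos(1)] ch[OF intN pos(2)] eq by (intro ext) simp
    qed
    moreover have "(\<integral>y. indicator B y \<partial>\<mu> Q) = (\<integral>\<omega>. Q \<omega> * indicator B (Y \<omega>) \<partial>M) / c"
      if Q: "integrable M Q" "\<And>\<omega>. Q \<omega> \<ge> 0" for Q
      using B by (subst int\<mu>[OF Q]) auto
    ultimately have "(\<integral>\<omega>. P \<omega> * indicator B (Y \<omega>) \<partial>M) = (\<integral>\<omega>. N \<omega> * indicator B (Y \<omega>) \<partial>M)"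
      using intP intN pos 2 by (metis div_by_0 divide_cancel_right less_irrefl)
    moreover have ind: "integrable M (\<lambda>\<omega>. Q \<omega> * indicator B (Y \<omega>))" if "integrable M Q" for Q :: "'a \<Rightarrow> real"
      using that B by (intro Bochner_Integration.integrable_bound[OF that]) (auto split: split_indicator)
    ultimately show ?thesis
      unfolding ZPN using ind[OF intP] ind[OF intN] by (simp add: left_diff_distrib)
  qed
qed

text \<open>
  Conjugation maps the assumption at \<open>t\<close> to that at \<open>- t\<close>, so it is inherited by the real and
  imaginary parts of \<open>Z\<close>.
\<close>

lemma weighted_Levy_uniqueness:
  fixes Z :: "'a \<Rightarrow> complex" and Y :: "'a \<Rightarrow> real"
  assumes Z: "integrable M Z" and Y[measurable]: "Y \<in> borel_measurable M"
    and zero: "\<And>t. (\<integral>\<omega>. Z \<omega> * iexp (t * Y \<omega>) \<partial>M) = 0"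
    and B: "B \<in> sets borel"
  shows "(\<integral>\<omega>. Z \<omega> * indicator B (Y \<omega>) \<partial>M) = 0"
proof -
  have Zm[measurable]: "Z \<in> borel_measurable M" using Z by simp
  have expi: "integrable M (\<lambda>\<omega>. Q \<omega> * iexp (t * Y \<omega>))"
    if "integrable M Q" for Q :: "'a \<Rightarrow> complex" and t
    using that by (intro Bochner_Integration.integrable_bound[OF that]) (auto simp: norm_mult)
  have cnjzero: "(\<integral>\<omega>. cnj (Z \<omega>) * iexp (t * Y \<omega>) \<partial>M) = 0" for t
  proof -
    have "(\<integral>\<omega>. cnj (Z \<omega>) * iexp (t * Y \<omega>) \<partial>M) = (\<integral>\<omega>. cnj (Z \<omega> * iexp (- t * Y \<omega>)) \<partial>M)"
      by (intro Bochner_Integration.integral_cong) (auto simp: exp_cnj)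
    also have "\<dots> = cnj (\<integral>\<omega>. Z \<omega> * iexp (- t * Y \<omega>) \<partial>M)" 
      using expi[OF Z, of "- t"] by (intro integral_bounded_linear bounded_linear_cnj) simp
    finally show ?thesis using zero[of "- t"] by simp
  qed
  have cZ: "integrable M (\<lambda>\<omega>. cnj (Z \<omega>))" using Z by simp
  have re_eq: "(\<integral>\<omega>. complex_of_real (Re (Z \<omega>)) * iexp (t * Y \<omega>) \<partial>M)
      = (\<integral>\<omega>. (Z \<omega> * iexp (t * Y \<omega>) + cnj (Z \<omega>) * iexp (t * Y \<omega>)) / 2 \<partial>M)" for t
    by (intro Bochner_Integration.integral_cong) (auto simp: complex_eq_iff algebra_simps)
  have re: "(\<integral>\<omega>. complex_of_real (Re (Z \<omega>)) * iexp (t * Y \<omega>) \<partial>M) = 0" for t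
    unfolding re_eq
    using zero[of t] cnjzero[of t] expi[OF Z, of t] expi[OF cZ, of t] by simp
  have im_eq: "(\<integral>\<omega>. complex_of_real (Im (Z \<omega>)) * iexp (t * Y \<omega>) \<partial>M)
      = (\<integral>\<omega>. (Z \<omega> * iexp (t * Y \<omega>) - cnj (Z \<omega>) * iexp (t * Y \<omega>)) * (- \<i> / 2) \<partial>M)" for t
    by (intro Bochner_Integration.integral_cong) (auto simp: complex_eq_iff field_simps)
  have im: "(\<integral>\<omega>. complex_of_real (Im (Z \<omega>)) * iexp (t * Y \<omega>) \<partial>M) = 0" for t
    unfolding im_eq
    using zero[of t] cnjzero[of t] expi[OF Z, of t] expi[OF cZ, of t] by simp
  have "(\<integral>\<omega>. Re (Z \<omega>) * indicator B (Y \<omega>) \<partial>M) = 0"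
    by (rule weighted_Levy_uniqueness_real[OF _ Y re B]) (use Z in simp)
  moreover have "(\<integral>\<omega>. Im (Z \<omega>) * indicator B (Y \<omega>) \<partial>M) = 0"
    by (rule weighted_Levy_uniqueness_real[OF _ Y im B]) (use Z in simp)
  moreover have "integrable M (\<lambda>\<omega>. Z \<omega> * indicator B (Y \<omega>))"
    using B by (intro Bochner_Integration.integrable_bound[OF Z]) (auto split: split_indicator)
  moreover have "Re (Z \<omega> * indicator B (Y \<omega>)) = Re (Z \<omega>) * indicator B (Y \<omega>)"
    "Im (Z \<omega> * indicator B (Y \<omega>)) = Im (Z \<omega>) * indicator B (Y \<omega>)" for \<omega>
    by (auto split: split_indicator)
  ultimately show ?thesis
    by (simp add: complex_eq_iff flip: integral_Re integral_Im)
qed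

text \<open>
  Several variables reduce to one: exponentials are traded for indicators one coordinate at a
  time, absorbing the other factors into the complex weight \<open>Z\<close>. This is why complex weights are
  needed although the final applications are real.
\<close>

lemma weighted_rectangle_zero:
  fixes Z :: "'a \<Rightarrow> complex" and Y :: "'i \<Rightarrow> 'a \<Rightarrow> real"
  assumes "finite S" and Z: "integrable M Z" and Y[measurable]: "\<And>i. Y i \<in> borel_measurable M"
    and zero: "\<And>t. (\<integral>\<omega>. Z \<omega> * iexp (\<Sum>i\<in>S. t i * Y i \<omega>) \<partial>M) = 0"
    and B: "\<And>i. i \<in> S \<Longrightarrow> B i \<in> sets borel"
  shows "(\<integral>\<omega>. Z \<omega> * (\<Prod>i\<in>S. indicator (B i) (Y i \<omega>)) \<partial>M) = 0"
  using assms(1) Z zero B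
proof (induction S arbitrary: Z rule: finite_induct)
  case empty
  then show ?case by simp
next
  case (insert j S)
  have "integrable M Z" by fact
  then have [measurable]: "Z \<in> borel_measurable M" by simp
  have Bj[measurable]: "B j \<in> sets borel" using insert by auto
  have split: "(\<integral>\<omega>. (Z \<omega> * iexp (\<Sum>i\<in>S. t i * Y i \<omega>)) * iexp (u * Y j \<omega>) \<partial>M) = 0" for t u
  proof -
    have "(\<integral>\<omega>. (Z \<omega> * iexp (\<Sum>i\<in>S. t i * Y i \<omega>)) * iexp (u * Y j \<omega>) \<partial>M)
        = (\<integral>\<omega>. Z \<omega> * iexp (\<Sum>i\<in>insert j S. (t(j := u)) i * Y i \<omega>) \<partial>M)"
    proof (intro Bochner_Integration.integral_cong refl)
      fix \<omega>
      have "(\<Sum>i\<in>insert j S. (t(j := u)) i * Y i \<omega>) = u * Y j \<omega> + (\<Sum>i\<in>S. t i * Y i \<omega>)"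
        using insert(1,2) by (simp cong: sum.cong) (intro sum.cong, auto)
      then show "(Z \<omega> * iexp (\<Sum>i\<in>S. t i * Y i \<omega>)) * iexp (u * Y j \<omega>)
          = Z \<omega> * iexp (\<Sum>i\<in>insert j S. (t(j := u)) i * Y i \<omega>)"
        by (simp add: ring_distribs exp_add)
    qed
    also have "\<dots> = 0" by fact
    finally show ?thesis .
  qed
  have "(\<integral>\<omega>. (Z \<omega> * indicator (B j) (Y j \<omega>)) * iexp (\<Sum>i\<in>S. t i * Y i \<omega>) \<partial>M) = 0" for t
  proof -
    have "(\<integral>\<omega>. (Z \<omega> * iexp (\<Sum>i\<in>S. t i * Y i \<omega>)) * indicator (B j) (Y j \<omega>) \<partial>M) = 0"
    proof (rule weighted_Levy_uniqueness)
      show "integrable M (\<lambda>\<omega>. Z \<omega> * iexp (\<Sum>i\<in>S. t i * Y i \<omega>))"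
        by (intro Bochner_Integration.integrable_bound[OF \<open>integrable M Z\<close>]) (auto simp: norm_mult)
    qed (use split in auto)
    then show ?thesis by (simp add: mult_ac)
  qed
  moreover have "integrable M (\<lambda>\<omega>. Z \<omega> * indicator (B j) (Y j \<omega>))"
    by (intro Bochner_Integration.integrable_bound[OF \<open>integrable M Z\<close>]) (auto split: split_indicator)
  ultimately have "(\<integral>\<omega>. (Z \<omega> * indicator (B j) (Y j \<omega>)) * (\<Prod>i\<in>S. indicator (B i) (Y i \<omega>)) \<partial>M) = 0"
    using insert by (intro insert.IH) auto
  then show ?case using insert(1,2) by (simp add: mult_ac)
qed

text \<open>
  The family of sets that \<open>Z\<close> does not see is a Dynkin system, and it contains the finite
  rectangles.
\<close>

lemma Fourier_determines_integrals:
  fixes Z :: "'a \<Rightarrow> complex" and Y :: "'i \<Rightarrow> 'a \<Rightarrow> real"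
  assumes Z: "integrable M Z" and Y[measurable]: "\<And>i. Y i \<in> borel_measurable M"
    and zero: "\<And>S t. finite S \<Longrightarrow> (\<integral>\<omega>. Z \<omega> * iexp (\<Sum>i\<in>S. t i * Y i \<omega>) \<partial>M) = 0"
    and A: "A \<in> sets (Pi\<^sub>M UNIV (\<lambda>_. borel))"
  shows "(\<integral>\<omega>. Z \<omega> * indicator A (\<lambda>i. Y i \<omega>) \<partial>M) = 0"
proof -
  have Zm[measurable]: "Z \<in> borel_measurable M" using Z by simp
  let ?P = "Pi\<^sub>M UNIV (\<lambda>_::'i. borel :: real measure)"
  have Ym[measurable]: "(\<lambda>\<omega> i. Y i \<omega>) \<in> measurable M ?P"
    by (rule measurable_PiM_single') auto
  have ind: "integrable M (\<lambda>\<omega>. Z \<omega> * indicator A (\<lambda>i. Y i \<omega>))" if [measurable]: "A \<in> sets ?P" for A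
    by (intro Bochner_Integration.integrable_bound[OF Z]) (auto split: split_indicator)
  have sp: "space ?P = UNIV" by (simp add: space_PiM)
  have gen: "sets ?P = sigma_sets UNIV (prod_algebra UNIV (\<lambda>_::'i. borel :: real measure))"
    by (simp add: sets_PiM)
  show ?thesis
    using Int_stable_prod_algebra _ A[unfolded gen]
  proof (rule sigma_sets_induct_disjoint)
    show "prod_algebra UNIV (\<lambda>_::'i. borel :: real measure) \<subseteq> Pow UNIV" by simp
  next
    fix A assume "A \<in> prod_algebra UNIV (\<lambda>_::'i. borel :: real measure)"
    then obtain J E where A: "A = prod_emb UNIV (\<lambda>_. borel) J (\<Pi>\<^sub>E j\<in>J. E j)"
      and J: "finite J" and E: "\<And>i. i \<in> J \<Longrightarrow> E i \<in> sets borel"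
      by (elim prod_algebraE) auto
    have "(indicator A (\<lambda>i. Y i \<omega>) :: complex) = (\<Prod>i\<in>J. indicator (E i) (Y i \<omega>))" for \<omega>
    proof (cases "\<forall>i\<in>J. Y i \<omega> \<in> E i")
      case True
      then show ?thesis by (auto simp: A prod_emb_iff PiE_iff indicator_def)
    next
      case False
      then have "(\<lambda>i. Y i \<omega>) \<notin> A" by (auto simp: A prod_emb_iff PiE_iff)
      moreover have "(\<Prod>i\<in>J. indicator (E i) (Y i \<omega>) :: complex) = 0"
        using False J by (auto simp: prod_zero_iff indicator_def)
      ultimately show ?thesis by simp
    qed
    then show "(\<integral>\<omega>. Z \<omega> * indicator A (\<lambda>i. Y i \<omega>) \<partial>M) = 0"
      using weighted_rectangle_zero[OF J Z Y zero[OF J] E] by simp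
  next
    show "(\<integral>\<omega>. Z \<omega> * indicator {} (\<lambda>i. Y i \<omega>) \<partial>M) = 0" by simp
  next
    fix A assume A: "A \<in> sigma_sets UNIV (prod_algebra UNIV (\<lambda>_::'i. borel :: real measure))"
      and 0: "(\<integral>\<omega>. Z \<omega> * indicator A (\<lambda>i. Y i \<omega>) \<partial>M) = 0"
    have "(\<integral>\<omega>. Z \<omega> * indicator (UNIV - A) (\<lambda>i. Y i \<omega>) \<partial>M)
        = (\<integral>\<omega>. Z \<omega> - Z \<omega> * indicator A (\<lambda>i. Y i \<omega>) \<partial>M)"
      by (intro Bochner_Integration.integral_cong) (auto split: split_indicator)
    also have "\<dots> = (\<integral>\<omega>. Z \<omega> \<partial>M) - (\<integral>\<omega>. Z \<omega> * indicator A (\<lambda>i. Y i \<omega>) \<partial>M)"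
      using A by (intro Bochner_Integration.integral_diff Z ind) (simp add: gen)
    also have "\<dots> = 0" using 0 zero[of "{}"] by simp
    finally show "(\<integral>\<omega>. Z \<omega> * indicator (UNIV - A) (\<lambda>i. Y i \<omega>) \<partial>M) = 0" .
  next
    fix A :: "nat \<Rightarrow> ('i \<Rightarrow> real) set"
    assume disj: "disjoint_family A"
      and A: "range A \<subseteq> sigma_sets UNIV (prod_algebra UNIV (\<lambda>_::'i. borel :: real measure))"
      and 0: "\<And>n. (\<integral>\<omega>. Z \<omega> * indicator (A n) (\<lambda>i. Y i \<omega>) \<partial>M) = 0"
    define C where "C n = {\<omega> \<in> space M. (\<lambda>i. Y i \<omega>) \<in> A n}" for n
    have An[measurable]: "A n \<in> sets ?P" for n using A by (auto simp: gen)
    have Cs: "C n \<in> sets M" for n unfolding C_def by measurable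
    have "(LINT \<omega>:(\<Union>n. C n)|M. Z \<omega>) = (\<Sum>n. LINT \<omega>:C n|M. Z \<omega>)"
    proof (rule lebesgue_integral_countable_add[OF Cs])
      show "C i \<inter> C j = {}" if "i \<noteq> j" for i j
        using disj that unfolding C_def disjoint_family_on_def by blast
      show "set_integrable M (\<Union>n. C n) Z"
        unfolding set_integrable_def using Cs Z by (intro integrable_mult_indicator) auto
    qed
    moreover have "(LINT \<omega>:C n|M. Z \<omega>) = (\<integral>\<omega>. Z \<omega> * indicator (A n) (\<lambda>i. Y i \<omega>) \<partial>M)" for n
      unfolding set_lebesgue_integral_def C_def
      by (intro Bochner_Integration.integral_cong) (auto split: split_indicator)
    moreover have "(LINT \<omega>:(\<Union>n. C n)|M. Z \<omega>) = (\<integral>\<omega>. Z \<omega> * indicator (\<Union>n. A n) (\<lambda>i. Y i \<omega>) \<partial>M)"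
      unfolding set_lebesgue_integral_def C_def
      by (intro Bochner_Integration.integral_cong) (auto split: split_indicator)
    ultimately show "(\<integral>\<omega>. Z \<omega> * indicator (\<Union>n. A n) (\<lambda>i. Y i \<omega>) \<partial>M) = 0"
      using 0 by simp
  qed
qed

section \<open>Stein's identity in one variable\<close>

text \<open>
  \<open>G y - G (- y)\<close> tends to the integral of the derivative as \<open>y\<close> grows; being an integrable
  function of \<open>y\<close>, it can only tend to 0.
\<close>

lemma integral_derivative_eq_0:
  fixes G G' :: "real \<Rightarrow> real"
  assumes G: "integrable lborel G" and G': "integrable lborel G'"
    and deriv: "\<And>x. (G has_real_derivative G' x) (at x)"
    and cont: "continuous_on UNIV G'"
  shows "(\<integral>x. G' x \<partial>lborel) = 0"
proof -
  define c where "c = (\<integral>x. G' x \<partial>lborel)"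
  have [measurable]: "G' \<in> borel_measurable borel" using G' by simp
  have "((\<lambda>y. \<integral>x. indicator {- y..y} x *\<^sub>R G' x \<partial>lborel) \<longlongrightarrow> c) at_top"
    unfolding c_def
  proof (rule integral_dominated_convergence_at_top)
    show "integrable lborel (\<lambda>x. \<bar>G' x\<bar>)" using G' by simp
    show "\<forall>\<^sub>F y in at_top. AE x in lborel. norm (indicator {- y..y} x *\<^sub>R G' x) \<le> \<bar>G' x\<bar>"
      by (auto split: split_indicator)
    have "((\<lambda>y. indicator {- y..y} x *\<^sub>R G' x) \<longlongrightarrow> G' x) at_top" for x
    proof (rule tendsto_eventually)
      show "\<forall>\<^sub>F y in at_top. indicator {- y..y} x *\<^sub>R G' x = G' x"
        using eventually_ge_at_top[of "\<bar>x\<bar>"] by eventually_elim (auto split: split_indicator)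
    qed
    then show "AE x in lborel. ((\<lambda>y. indicator {- y..y} x *\<^sub>R G' x) \<longlongrightarrow> G' x) at_top" by simp
  qed measurable
  moreover have "\<forall>\<^sub>F y in at_top. (\<integral>x. indicator {- y..y} x *\<^sub>R G' x \<partial>lborel) = G y - G (- y)"
    using eventually_ge_at_top[of 0]
  proof eventually_elim
    case (elim y)
    show ?case
    proof (rule integral_FTC_atLeastAtMost)
      show "(G has_vector_derivative G' x) (at x within {- y..y})" for x
        using deriv by (simp add: has_real_derivative_iff_has_vector_derivative has_vector_derivative_at_within)
    qed (use elim cont in \<open>auto intro: continuous_on_subset\<close>)
  qed
  ultimately have lim: "((\<lambda>y. G y - G (- y)) \<longlongrightarrow> c) at_top"
    by (simp cong: tendsto_cong)
  have int: "integrable lborel (\<lambda>y. G y - G (- y))"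
    using G lborel_integrable_real_affine[OF G, of "- 1" 0] by simp
  have "c = 0"
  proof (rule ccontr)
    assume "c \<noteq> 0"
    then have "\<forall>\<^sub>F y in at_top. \<bar>c\<bar> / 2 < \<bar>G y - G (- y)\<bar>"
      by (intro order_tendstoD(1)[OF tendsto_rabs[OF lim]]) auto
    then obtain y0 where y0: "\<And>y. y \<ge> y0 \<Longrightarrow> \<bar>c\<bar> / 2 < \<bar>G y - G (- y)\<bar>"
      by (auto simp: eventually_at_top_linorder)
    have "integrable lborel (\<lambda>y. indicator {y0..} y *\<^sub>R (\<bar>c\<bar> / 2))"
    proof (rule Bochner_Integration.integrable_bound[OF int])
      show "AE y in lborel. norm (indicator {y0..} y *\<^sub>R (\<bar>c\<bar> / 2)) \<le> norm (G y - G (- y))"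
        using y0 by (auto split: split_indicator intro!: less_imp_le)
    qed measurable
    then have "integrable lborel (\<lambda>y. (2 / \<bar>c\<bar>) * (indicator {y0..} y *\<^sub>R (\<bar>c\<bar> / 2)))"
      by (rule integrable_mult_right)
    then have "integrable lborel (indicator {y0..} :: real \<Rightarrow> real)"
      using \<open>c \<noteq> 0\<close> by simp
    then have "emeasure lborel {y0..} < \<infinity>" by (simp add: integrable_indicator_iff)
    moreover have "emeasure lborel {y0..} = \<infinity>"
    proof (rule ccontr)
      assume "emeasure lborel {y0..} \<noteq> \<infinity>"
      then obtain r where r: "emeasure lborel {y0..} = ennreal r" "r \<ge> 0"
        by (cases "emeasure lborel {y0..}") auto
      have "ennreal (r + 1) = emeasure lborel {y0..y0 + (r + 1)}" using r by simp
      also have "\<dots> \<le> emeasure lborel {y0..}" by (intro emeasure_mono) auto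
      finally show False using r by simp
    qed
    ultimately show False by simp
  qed
  then show ?thesis by (simp add: c_def)
qed

lemma std_normal_density_deriv:
  "(std_normal_density has_real_derivative - x * std_normal_density x) (at x)"
  unfolding std_normal_density_def by (auto intro!: derivative_eq_intros simp: field_simps)

lemma Stein_identity:
  fixes f f' :: "real \<Rightarrow> real"
  assumes deriv: "\<And>x. (f has_real_derivative f' x) (at x)" and cont: "continuous_on UNIV f'"
    and int: "integrable lborel (\<lambda>x. std_normal_density x * f x)"
      "integrable lborel (\<lambda>x. std_normal_density x * f' x)"
      "integrable lborel (\<lambda>x. std_normal_density x * (x * f x))"
  shows "(\<integral>x. std_normal_density x * (x * f x) \<partial>lborel) = (\<integral>x. std_normal_density x * f' x \<partial>lborel)"
proof -
  have cf: "continuous_on UNIV f"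
    using deriv by (meson DERIV_continuous continuous_at_imp_continuous_on)
  have cs: "continuous_on UNIV std_normal_density"
    using std_normal_density_deriv by (meson DERIV_continuous continuous_at_imp_continuous_on)
  have "(\<integral>x. std_normal_density x * f' x - std_normal_density x * (x * f x) \<partial>lborel) = 0"
  proof (rule integral_derivative_eq_0[OF int(1)])
    show "((\<lambda>x. std_normal_density x * f x) has_real_derivative
        std_normal_density x * f' x - std_normal_density x * (x * f x)) (at x)" for x
      using DERIV_mult[OF std_normal_density_deriv[of x] deriv[of x]] by (simp add: algebra_simps)
  qed (use int cf cs cont in \<open>auto intro!: continuous_intros\<close>)
  then show ?thesis using int by simp
qed

section \<open>Isonormal processes\<close>

lemma borel_measurable_poly [measurable (raw)]:
  fixes f :: "'a \<Rightarrow> real"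
  assumes f: "f \<in> borel_measurable M"
  shows "(\<lambda>x. poly p (f x)) \<in> borel_measurable M"
  using measurable_compose[OF f borel_measurable_continuous_onI[of "poly p"]]
  by (simp add: continuous_on_poly)

locale gaussian_space = prob_space M
  for M :: "'a measure" and X :: "'h::{real_inner,banach,second_countable_topology} \<Rightarrow> 'a \<Rightarrow> real" +
  assumes isonormal: "isonormal_gaussian_process M X"
begin

lemma X_measurable [measurable]: "X h \<in> borel_measurable M"
  using isonormal by (auto simp: isonormal_gaussian_process_def centered_gaussian_family_def)

lemma covariance: "expectation (\<lambda>\<omega>. X h \<omega> * X g \<omega>) = h \<bullet> g"
  using isonormal by (auto simp: isonormal_gaussian_process_def)

lemma variance_X: "expectation (\<lambda>\<omega>. (X h \<omega>)\<^sup>2) = (norm h)\<^sup>2"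
  using covariance[of h h] by (simp add: power2_eq_square power2_norm_eq_inner[symmetric])

lemma law_X_normal: "\<exists>v\<ge>0. distr M borel (X h) = normal_law 0 v"
proof -
  have "\<exists>v\<ge>0. distr M borel (\<lambda>\<omega>. \<Sum>i\<in>{h}. 1 * X i \<omega>) = normal_law 0 v"
    using isonormal unfolding isonormal_gaussian_process_def centered_gaussian_family_def
    by (elim conjE allE[of _ "{h}"] allE[of _ "\<lambda>_. 1"]) (auto dest: spec)
  then show ?thesis by simp
qed

lemma normal_law_second_moment:
  assumes "v \<ge> 0"
  shows "integrable (normal_law 0 v) (\<lambda>x. x\<^sup>2)" "(\<integral>x. x\<^sup>2 \<partial>normal_law 0 v) = v"
proof -
  have "integrable (normal_law 0 v) (\<lambda>x. x\<^sup>2) \<and> (\<integral>x. x\<^sup>2 \<partial>normal_law 0 v) = v"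
  proof (cases "v = 0")
    case True
    have "integrable (return borel (0::real)) (\<lambda>x. x\<^sup>2)"
      by (rule integrableI_bounded) (auto simp: nn_integral_return)
    then show ?thesis using True by (simp add: normal_law_def integral_return)
  next
    case False
    then have s: "0 < sqrt v" using assms by simp
    have "integrable lborel (\<lambda>x. normal_density 0 (sqrt v) x * x\<^sup>2)"
      using integrable_normal_moment[OF s, of 0 2] by simp
    moreover have "(\<integral>x. normal_density 0 (sqrt v) x * x\<^sup>2 \<partial>lborel) = v"
      using integral_normal_moment_even[OF s, of 0 1] assms by simp
    ultimately show ?thesis
      using False by (simp add: normal_law_def integrable_density integral_density)
  qed
  then show "integrable (normal_law 0 v) (\<lambda>x. x\<^sup>2)" "(\<integral>x. x\<^sup>2 \<partial>normal_law 0 v) = v" by auto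
qed

text \<open>
  The variance parameter of a centered Gaussian variable is its second moment.
\<close>

lemma law_X: "distr M borel (X h) = normal_law 0 ((norm h)\<^sup>2)"
proof -
  obtain v where v: "v \<ge> 0" "distr M borel (X h) = normal_law 0 v" using law_X_normal by blast
  have "v = (\<integral>x. x\<^sup>2 \<partial>distr M borel (X h))" using v normal_law_second_moment by simp
  also have "\<dots> = (norm h)\<^sup>2" by (subst integral_distr) (auto simp: variance_X)
  finally show ?thesis using v by simp
qed

lemma X_L2: "X h \<in> L2 M"
proof (rule L2_I)
  have "integrable (distr M borel (X h)) (\<lambda>x. x\<^sup>2)"
    unfolding law_X by (intro normal_law_second_moment) simp
  then show "integrable M (\<lambda>\<omega>. (norm (X h \<omega>))\<^sup>2)" by (subst (asm) integrable_distr_eq) auto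
qed measurable

text \<open>
  The second moment of the difference of both sides is computed from the covariances alone, and
  is 0.
\<close>

lemma X_linear: "AE \<omega> in M. X (a *\<^sub>R f + b *\<^sub>R g) \<omega> = a * X f \<omega> + b * X g \<omega>"
proof -
  let ?u = "a *\<^sub>R f + b *\<^sub>R g"
  let ?D = "\<lambda>\<omega>. X ?u \<omega> - (a * X f \<omega> + b * X g \<omega>)"
  have D: "?D \<in> L2 M" by (intro L2_diff L2_add L2_mult X_L2)
  note I = integrable_mult_L2[OF X_L2 X_L2]
  have "(\<integral>\<omega>. (?D \<omega>)\<^sup>2 \<partial>M) = (\<integral>\<omega>. X ?u \<omega> * X ?u \<omega> + a\<^sup>2 * (X f \<omega> * X f \<omega>) + b\<^sup>2 * (X g \<omega> * X g \<omega>)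
      - 2 * a * (X ?u \<omega> * X f \<omega>) - 2 * b * (X ?u \<omega> * X g \<omega>) + 2 * a * b * (X f \<omega> * X g \<omega>) \<partial>M)"
    by (intro Bochner_Integration.integral_cong) (auto simp: power2_eq_square algebra_simps)
  also have "\<dots> = ?u \<bullet> ?u + a\<^sup>2 * (f \<bullet> f) + b\<^sup>2 * (g \<bullet> g) - 2 * a * (?u \<bullet> f) - 2 * b * (?u \<bullet> g) + 2 * a * b * (f \<bullet> g)"
    using I by (simp add: covariance)
  also have "\<dots> = 0"
    by (simp add: inner_simps inner_commute power2_eq_square algebra_simps)
  finally have "AE \<omega> in M. (?D \<omega>)\<^sup>2 = 0"
    using L2_integrable_real[OF D] by (subst (asm) integral_nonneg_eq_0_iff_AE) auto
  then show ?thesis by eventually_elim simp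
qed

lemma X_sum:
  assumes "finite S"
  shows "AE \<omega> in M. X (\<Sum>i\<in>S. c i *\<^sub>R k i) \<omega> = (\<Sum>i\<in>S. c i * X (k i) \<omega>)"
  using assms
proof (induction S)
  case empty
  show ?case using X_linear[of 0 0 0 0] by simp
next
  case (insert j S)
  from insert.IH X_linear[of "c j" "k j" 1 "\<Sum>i\<in>S. c i *\<^sub>R k i"] show ?case
    by eventually_elim (use insert(1,2) in simp)
qed

lemma law_X_unit: "norm h = 1 \<Longrightarrow> distr M borel (X h) = density lborel std_normal_density"
  by (simp add: law_X normal_law_def)

lemma integrable_X_unit_iff:
  assumes "norm h = 1" and [measurable]: "f \<in> borel_measurable borel"
  shows "integrable M (\<lambda>\<omega>. f (X h \<omega>)) \<longleftrightarrow> integrable lborel (\<lambda>x. std_normal_density x * (f x :: real))"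
proof -
  have "integrable M (\<lambda>\<omega>. f (X h \<omega>)) \<longleftrightarrow> integrable (distr M borel (X h)) f"
    by (subst integrable_distr_eq) auto
  then show ?thesis unfolding law_X_unit[OF assms(1)] by (simp add: integrable_density)
qed

lemma integrable_exp_X:
  assumes "norm h = 1"
  shows "integrable M (\<lambda>\<omega>. exp (a * X h \<omega>))"
proof (subst integrable_X_unit_iff[OF assms])
  have "std_normal_density x * exp (a * x) = exp (a\<^sup>2 / 2) * normal_density a 1 x" for x
    by (simp add: normal_density_def power2_eq_square flip: exp_add) (simp add: field_simps)
  then show "integrable lborel (\<lambda>x. std_normal_density x * exp (a * x))" by simp
qed measurable

lemma integrable_exp_abs_X:
  assumes "norm h = 1"
  shows "integrable M (\<lambda>\<omega>. exp (a * \<bar>X h \<omega>\<bar>))"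
proof (rule Bochner_Integration.integrable_bound)
  show "integrable M (\<lambda>\<omega>. exp (a * X h \<omega>) + exp (- a * X h \<omega>))"
    using assms by (intro Bochner_Integration.integrable_add integrable_exp_X)
  have "exp (a * \<bar>x\<bar>) \<le> exp (a * x) + exp (- a * x)" for x :: real
    by (cases "x \<ge> 0") auto
  then show "AE \<omega> in M. norm (exp (a * \<bar>X h \<omega>\<bar>)) \<le> norm (exp (a * X h \<omega>) + exp (- a * X h \<omega>))"
    by (simp add: abs_of_pos add_pos_pos)
qed measurable

lemma integrable_X_power:
  assumes "norm h = 1"
  shows "integrable M (\<lambda>\<omega>. X h \<omega> ^ k)"
  by (subst integrable_X_unit_iff[OF assms, of "\<lambda>x. x ^ k"]) (auto intro: integrable_std_normal_moment)

lemma integrable_poly_X: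
  assumes "norm h = 1"
  shows "integrable M (\<lambda>\<omega>. poly p (X h \<omega>))"
  unfolding poly_altdef by (intro Bochner_Integration.integrable_sum integrable_mult_right integrable_X_power assms)

lemma integrable_abs_poly_X_power:
  assumes "norm h = 1"
  shows "integrable M (\<lambda>\<omega>. \<bar>poly p (X h \<omega>)\<bar> ^ m)"
proof (rule Bochner_Integration.integrable_bound)
  show "integrable M (\<lambda>\<omega>. 1 + poly (p ^ (2 * m)) (X h \<omega>))"
    by (intro Bochner_Integration.integrable_add integrable_poly_X assms) simp
  have "\<bar>y\<bar> ^ m \<le> 1 + y ^ (2 * m)" for y :: real
  proof -
    have "2 * \<bar>y\<bar> ^ m \<le> 1 + (\<bar>y\<bar> ^ m)\<^sup>2" using sum_squares_bound[of 1 "\<bar>y\<bar> ^ m"] by simp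
    moreover have "(\<bar>y\<bar> ^ m)\<^sup>2 = \<bar>y\<bar> ^ (2 * m)" by (metis power_mult mult.commute)
    then have "(\<bar>y\<bar> ^ m)\<^sup>2 = y ^ (2 * m)" by (simp add: power_even_abs)
    moreover have "0 \<le> \<bar>y\<bar> ^ m" by simp
    ultimately show ?thesis by linarith
  qed
  then have "\<bar>poly p (X h \<omega>)\<bar> ^ m \<le> \<bar>1 + poly (p ^ (2 * m)) (X h \<omega>)\<bar>" for \<omega>
    by (metis abs_ge_self order_trans poly_power)
  then show "AE \<omega> in M. norm (\<bar>poly p (X h \<omega>)\<bar> ^ m) \<le> norm (1 + poly (p ^ (2 * m)) (X h \<omega>))"
    by simp
qed measurable

lemma char_X: "(\<integral>\<omega>. iexp (X g \<omega>) \<partial>M) = exp (- (norm g)\<^sup>2 / 2)"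
proof (cases "g = 0")
  case True
  have "AE \<omega> in M. X g \<omega> = 0" using X_linear[of 0 0 0 0] True by simp
  then have "(\<integral>\<omega>. iexp (X g \<omega>) \<partial>M) = (\<integral>\<omega>. 1 \<partial>M)"
    by (intro integral_cong_AE) (auto elim: eventually_mono)
  then show ?thesis using True by (simp add: prob_space)
next
  case False
  define u where "u = (1 / norm g) *\<^sub>R g"
  have u: "norm u = 1" "g = norm g *\<^sub>R u" using False by (auto simp: u_def)
  have "AE \<omega> in M. X g \<omega> = norm g * X u \<omega>" using X_linear[of "norm g" u 0 0] u by simp
  then have "(\<integral>\<omega>. iexp (X g \<omega>) \<partial>M) = (\<integral>\<omega>. iexp (norm g * X u \<omega>) \<partial>M)"
    by (intro integral_cong_AE) (auto elim: eventually_mono)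
  also have "\<dots> = char (distr M borel (X u)) (norm g)"
    unfolding char_def by (subst integral_distr) auto
  also have "\<dots> = exp (- (norm g)\<^sup>2 / 2)"
    using u law_X_unit[of u] char_std_normal_distribution by simp
  finally show ?thesis .
qed

lemma char_X_scaled: "(\<integral>\<omega>. iexp (t * X g \<omega>) \<partial>M) = exp (- t\<^sup>2 * (norm g)\<^sup>2 / 2)"
proof -
  have "AE \<omega> in M. X (t *\<^sub>R g) \<omega> = t * X g \<omega>" using X_linear[of t g 0 0] by simp
  then have "(\<integral>\<omega>. iexp (t * X g \<omega>) \<partial>M) = (\<integral>\<omega>. iexp (X (t *\<^sub>R g) \<omega>) \<partial>M)"
    by (intro integral_cong_AE) (auto elim: eventually_mono)
  then show ?thesis using char_X[of "t *\<^sub>R g"] by (simp add: power_mult_distrib)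
qed

text \<open>
  The joint characteristic function of \<open>X h\<close> and of variables orthogonal to it factorises.
  Fourier uniqueness is applied twice, first in the orthogonal variables and then in \<open>X h\<close>.
\<close>

lemma X_orthogonal_independent:
  assumes k: "\<And>i. k i \<bullet> h = 0"
    and A: "A \<in> sets (Pi\<^sub>M UNIV (\<lambda>_. borel))" and B: "B \<in> sets borel"
  shows "(\<integral>\<omega>. indicator B (X h \<omega>) * indicator A (\<lambda>i. X (k i) \<omega>) \<partial>M)
    = (\<integral>\<omega>. indicator B (X h \<omega>) \<partial>M) * (\<integral>\<omega>. indicator A (\<lambda>i. X (k i) \<omega>) \<partial>M :: real)"
proof -
  have [measurable]: "(\<lambda>\<omega> i. X (k i) \<omega>) \<in> measurable M (Pi\<^sub>M UNIV (\<lambda>_. borel))"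
    by (rule measurable_PiM_single') auto
  note [measurable] = A B
  have bounded: "integrable M f" if "f \<in> borel_measurable M" "\<And>\<omega>. norm (f \<omega>) \<le> 2"
    for f :: "'a \<Rightarrow> 'c::{banach,second_countable_topology}"
    using that by (intro integrable_const_bound[of _ 2]) auto
  define c where "c s = (\<integral>\<omega>. iexp (s * X h \<omega>) \<partial>M)" for s
  have cle: "norm (c s) \<le> 1" for s
    unfolding c_def char_X_scaled by (simp add: mult_nonneg_nonneg)
  \<comment> \<open>The centered exponential of \<open>X h\<close> is invisible to all exponentials in the orthogonal variables.\<close>
  have Z: "(\<integral>\<omega>. (iexp (s * X h \<omega>) - c s) * iexp (\<Sum>i\<in>S. t i * X (k i) \<omega>) \<partial>M) = 0"
    if "finite S" for s S t
  proof -
    define w where "w = (\<Sum>i\<in>S. t i *\<^sub>R k i)"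
    have w: "w \<bullet> h = 0" unfolding w_def by (simp add: inner_sum_left k)
    have "AE \<omega> in M. (\<Sum>i\<in>S. t i * X (k i) \<omega>) = X w \<omega>"
      using X_sum[OF that, of t k] unfolding w_def by eventually_elim simp
    moreover have "AE \<omega> in M. s * X h \<omega> + X w \<omega> = X (s *\<^sub>R h + w) \<omega>"
      using X_linear[of s h 1 w] by eventually_elim simp
    ultimately have "AE \<omega> in M. (iexp (s * X h \<omega>) - c s) * iexp (\<Sum>i\<in>S. t i * X (k i) \<omega>)
        = iexp (X (s *\<^sub>R h + w) \<omega>) - c s * iexp (X w \<omega>)"
    proof eventually_elim
      case (elim \<omega>)
      have "iexp (s * X h \<omega>) * iexp (X w \<omega>) = iexp (s * X h \<omega> + X w \<omega>)"
        by (simp add: ring_distribs exp_add)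
      then show ?case unfolding elim(1) elim(2)[symmetric] left_diff_distrib by simp
    qed
    then have "(\<integral>\<omega>. (iexp (s * X h \<omega>) - c s) * iexp (\<Sum>i\<in>S. t i * X (k i) \<omega>) \<partial>M)
        = (\<integral>\<omega>. iexp (X (s *\<^sub>R h + w) \<omega>) - c s * iexp (X w \<omega>) \<partial>M)"
      by (intro integral_cong_AE) auto
    also have "\<dots> = (\<integral>\<omega>. iexp (X (s *\<^sub>R h + w) \<omega>) \<partial>M) - c s * (\<integral>\<omega>. iexp (X w \<omega>) \<partial>M)"
    proof -
      have "integrable M (\<lambda>\<omega>. iexp (X u \<omega>))" for u by (intro bounded) auto
      then show ?thesis by simp
    qed
    also have "\<dots> = 0"
    proof -
      have "(norm (s *\<^sub>R h + w))\<^sup>2 = s\<^sup>2 * (norm h)\<^sup>2 + (norm w)\<^sup>2"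
        unfolding power2_norm_eq_inner using w by (simp add: inner_simps inner_commute power2_eq_square)
      then show ?thesis
        unfolding c_def char_X char_X_scaled by (simp add: add_divide_distrib exp_add flip: exp_add of_real_mult)
    qed
    finally show ?thesis .
  qed
  define a where "a = (\<integral>\<omega>. indicator A (\<lambda>i. X (k i) \<omega>) \<partial>M :: real)"
  have ale: "\<bar>a\<bar> \<le> 1"
  proof -
    have "a \<le> (\<integral>\<omega>. 1 \<partial>M)" unfolding a_def by (intro integral_mono bounded) (auto split: split_indicator)
    moreover have "0 \<le> a" unfolding a_def by simp
    ultimately show ?thesis by (simp add: prob_space)
  qed
  have "(\<integral>\<omega>. (complex_of_real (indicator A (\<lambda>i. X (k i) \<omega>)) - a) * iexp (s * X h \<omega>) \<partial>M) = 0" for s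
  proof -
    have "(\<integral>\<omega>. (iexp (s * X h \<omega>) - c s) * indicator A (\<lambda>i. X (k i) \<omega>) \<partial>M) = 0"
    proof (rule Fourier_determines_integrals[OF _ _ Z A])
      show "integrable M (\<lambda>\<omega>. iexp (s * X h \<omega>) - c s)"
        using cle[of s] by (intro bounded order_trans[OF norm_triangle_ineq4]) auto
    qed auto
    moreover have "(\<integral>\<omega>. (iexp (s * X h \<omega>) - c s) * indicator A (\<lambda>i. X (k i) \<omega>) \<partial>M)
        = (\<integral>\<omega>. iexp (s * X h \<omega>) * indicator A (\<lambda>i. X (k i) \<omega>) \<partial>M)
          - c s * (\<integral>\<omega>. complex_of_real (indicator A (\<lambda>i. X (k i) \<omega>)) \<partial>M)"
    proof -
      have "integrable M (\<lambda>\<omega>. iexp (s * X h \<omega>) * indicator A (\<lambda>i. X (k i) \<omega>))"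
        "integrable M (\<lambda>\<omega>. complex_of_real (indicator A (\<lambda>i. X (k i) \<omega>)))"
        by (intro bounded; auto split: split_indicator)+
      moreover have "(\<lambda>\<omega>. (iexp (s * X h \<omega>) - c s) * indicator A (\<lambda>i. X (k i) \<omega>))
          = (\<lambda>\<omega>. iexp (s * X h \<omega>) * indicator A (\<lambda>i. X (k i) \<omega>)
              - c s * complex_of_real (indicator A (\<lambda>i. X (k i) \<omega>)))"
        by (auto split: split_indicator)
      ultimately show ?thesis by simp
    qed
    moreover have "(\<integral>\<omega>. (complex_of_real (indicator A (\<lambda>i. X (k i) \<omega>)) - a) * iexp (s * X h \<omega>) \<partial>M)
        = (\<integral>\<omega>. iexp (s * X h \<omega>) * indicator A (\<lambda>i. X (k i) \<omega>) \<partial>M) - a * c s"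
    proof -
      have "integrable M (\<lambda>\<omega>. iexp (s * X h \<omega>) * indicator A (\<lambda>i. X (k i) \<omega>))"
        "integrable M (\<lambda>\<omega>. iexp (s * X h \<omega>))"
        by (intro bounded; auto split: split_indicator)+
      moreover have "(\<lambda>\<omega>. (complex_of_real (indicator A (\<lambda>i. X (k i) \<omega>)) - a) * iexp (s * X h \<omega>))
          = (\<lambda>\<omega>. iexp (s * X h \<omega>) * indicator A (\<lambda>i. X (k i) \<omega>) - a * iexp (s * X h \<omega>))"
        by (auto split: split_indicator simp: algebra_simps)
      ultimately show ?thesis by (simp add: c_def)
    qed
    ultimately show ?thesis by (simp add: a_def)
  qed
  then have "(\<integral>\<omega>. complex_of_real (indicator A (\<lambda>i. X (k i) \<omega>) - a) * iexp (s * X h \<omega>) \<partial>M) = 0" for s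
    by simp
  then have "(\<integral>\<omega>. (indicator A (\<lambda>i. X (k i) \<omega>) - a) * indicator B (X h \<omega>) \<partial>M) = 0"
    using ale by (intro weighted_Levy_uniqueness_real[OF bounded X_measurable _ B])
      (auto split: split_indicator)
  moreover have "(\<integral>\<omega>. (indicator A (\<lambda>i. X (k i) \<omega>) - a) * indicator B (X h \<omega>) \<partial>M)
      = (\<integral>\<omega>. indicator B (X h \<omega>) * indicator A (\<lambda>i. X (k i) \<omega>) \<partial>M) - a * (\<integral>\<omega>. indicator B (X h \<omega>) \<partial>M)"
  proof -
    have "integrable M (\<lambda>\<omega>. indicator B (X h \<omega>) * indicator A (\<lambda>i. X (k i) \<omega>) :: real)"
      "integrable M (\<lambda>\<omega>. indicator B (X h \<omega>) :: real)"
      by (intro bounded; auto split: split_indicator)+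
    then show ?thesis by (simp add: right_diff_distrib mult.commute)
  qed
  ultimately show ?thesis by (simp add: a_def mult.commute)
qed

end

section \<open>Random variables with all moments\<close>

definition all_moments :: "'a measure \<Rightarrow> ('a \<Rightarrow> 'b::{banach,second_countable_topology}) \<Rightarrow> bool" where
  "all_moments M u \<longleftrightarrow> u \<in> borel_measurable M \<and> (\<forall>m. integrable M (\<lambda>\<omega>. norm (u \<omega>) ^ m))"

lemma all_moments_measurable: "all_moments M u \<Longrightarrow> u \<in> borel_measurable M"
  by (simp add: all_moments_def)

lemma all_moments_integrable_power: "all_moments M u \<Longrightarrow> integrable M (\<lambda>\<omega>. norm (u \<omega>) ^ m)"
  by (simp add: all_moments_def)

lemma all_moments_integrable:
  assumes "all_moments M u"
  shows "integrable M u"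
proof -
  have "integrable M (\<lambda>\<omega>. norm (u \<omega>))"
    using all_moments_integrable_power[OF assms, of 1] by simp
  then show ?thesis using all_moments_measurable[OF assms] by (simp add: integrable_norm_iff)
qed

lemma all_moments_L2: "all_moments M u \<Longrightarrow> u \<in> L2 M"
  by (simp add: all_moments_def L2_def)

lemma all_moments_norm: "all_moments M u \<Longrightarrow> all_moments M (\<lambda>\<omega>. norm (u \<omega>))"
  by (auto simp: all_moments_def intro!: borel_measurable_norm)

lemma all_moments_norm_bound:
  assumes "all_moments M w" "u \<in> borel_measurable M" "\<And>\<omega>. norm (u \<omega>) \<le> norm (w \<omega>)"
  shows "all_moments M u"
  unfolding all_moments_def
proof (intro conjI allI)
  fix m
  show "integrable M (\<lambda>\<omega>. norm (u \<omega>) ^ m)"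
    by (rule Bochner_Integration.integrable_bound[OF all_moments_integrable_power[OF assms(1), of m]])
      (use assms(2,3) in \<open>auto intro!: power_mono\<close>)
qed fact

lemma all_moments_add:
  assumes u: "all_moments M u" and w: "all_moments M w"
  shows "all_moments M (\<lambda>\<omega>. u \<omega> + w \<omega>)"
  unfolding all_moments_def
proof (intro conjI allI)
  note [measurable] = assms[THEN all_moments_measurable]
  show "(\<lambda>\<omega>. u \<omega> + w \<omega>) \<in> borel_measurable M" by measurable
  fix m
  show "integrable M (\<lambda>\<omega>. norm (u \<omega> + w \<omega>) ^ m)"
  proof (rule Bochner_Integration.integrable_bound)
    show "integrable M (\<lambda>\<omega>. 2 ^ m * (norm (u \<omega>) ^ m + norm (w \<omega>) ^ m))"
      using assms by (intro integrable_mult_right Bochner_Integration.integrable_add all_moments_integrable_power)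
    have "norm (u \<omega> + w \<omega>) ^ m \<le> 2 ^ m * (norm (u \<omega>) ^ m + norm (w \<omega>) ^ m)" for \<omega>
    proof -
      let ?a = "norm (u \<omega>)" and ?b = "norm (w \<omega>)"
      have "norm (u \<omega> + w \<omega>) \<le> ?a + ?b" by (rule norm_triangle_ineq)
      also have "\<dots> \<le> 2 * max ?a ?b" by simp
      finally have "norm (u \<omega> + w \<omega>) ^ m \<le> (2 * max ?a ?b) ^ m" by (intro power_mono) auto
      also have "\<dots> = 2 ^ m * (max ?a ?b) ^ m" by (rule power_mult_distrib)
      also have "(max ?a ?b) ^ m \<le> ?a ^ m + ?b ^ m" by (auto simp: max_def)
      finally show ?thesis by simp
    qed
    then show "AE \<omega> in M. norm (norm (u \<omega> + w \<omega>) ^ m) \<le> norm (2 ^ m * (norm (u \<omega>) ^ m + norm (w \<omega>) ^ m))"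
      by simp
  qed measurable
qed

lemma all_moments_scaleR:
  fixes u :: "'a \<Rightarrow> real"
  assumes u: "all_moments M u" and w: "all_moments M w"
  shows "all_moments M (\<lambda>\<omega>. u \<omega> *\<^sub>R w \<omega>)"
  unfolding all_moments_def
proof (intro conjI allI)
  note [measurable] = assms[THEN all_moments_measurable]
  show "(\<lambda>\<omega>. u \<omega> *\<^sub>R w \<omega>) \<in> borel_measurable M" by measurable
  fix m
  have "(\<lambda>\<omega>. norm (z \<omega>) ^ m) \<in> L2 M" if "all_moments M z" for z :: "'a \<Rightarrow> 'c::{banach,second_countable_topology}"
    using that all_moments_integrable_power[OF that, of "2 * m"]
    by (auto intro!: L2_I dest: all_moments_measurable simp: power_mult[symmetric] mult.commute)
  from integrable_mult_L2[OF this[OF u] this[OF w]]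
  show "integrable M (\<lambda>\<omega>. norm (u \<omega> *\<^sub>R w \<omega>) ^ m)"
    by (simp add: power_mult_distrib)
qed

lemma all_moments_mult:
  fixes u w :: "'a \<Rightarrow> real"
  assumes "all_moments M u" "all_moments M w"
  shows "all_moments M (\<lambda>\<omega>. u \<omega> * w \<omega>)"
  using all_moments_scaleR[OF assms] by simp

lemma all_moments_inner:
  fixes u w :: "'a \<Rightarrow> 'b::{real_inner,banach,second_countable_topology}"
  assumes "all_moments M u" "all_moments M w"
  shows "all_moments M (\<lambda>\<omega>. u \<omega> \<bullet> w \<omega>)"
proof (rule all_moments_norm_bound[OF all_moments_mult[OF assms[THEN all_moments_norm]]])
  note [measurable] = assms[THEN all_moments_measurable]
  show "(\<lambda>\<omega>. u \<omega> \<bullet> w \<omega>) \<in> borel_measurable M" by measurable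
qed (simp add: Cauchy_Schwarz_ineq2)

lemma all_moments_power:
  fixes u :: "'a \<Rightarrow> real"
  assumes "finite_measure M" "all_moments M u"
  shows "all_moments M (\<lambda>\<omega>. u \<omega> ^ k)"
proof -
  interpret finite_measure M by fact
  show ?thesis
  proof (induction k)
    case 0
    show ?case by (simp add: all_moments_def)
  next
    case (Suc k)
    then show ?case unfolding power_Suc by (intro all_moments_mult assms)
  qed
qed

lemma (in finite_measure) all_moments_bounded:
  assumes [measurable]: "u \<in> borel_measurable M" and b: "\<And>\<omega>. norm (u \<omega>) \<le> C"
  shows "all_moments M u"
  unfolding all_moments_def
proof (intro conjI allI)
  fix m
  show "integrable M (\<lambda>\<omega>. norm (u \<omega>) ^ m)"
    using b by (intro integrable_const_bound[of _ "C ^ m"]) (auto intro!: AE_I2 power_mono)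
qed measurable

lemma (in finite_measure) all_moments_sum:
  fixes u :: "'i \<Rightarrow> 'a \<Rightarrow> 'b::{banach,second_countable_topology}"
  assumes "\<And>i. i \<in> I \<Longrightarrow> all_moments M (u i)"
  shows "all_moments M (\<lambda>\<omega>. \<Sum>i\<in>I. u i \<omega>)"
  using assms
proof (induction I rule: infinite_finite_induct)
  case (insert i I)
  then show ?case using all_moments_add[of M "u i" "\<lambda>\<omega>. \<Sum>i\<in>I. u i \<omega>"] by simp
qed (auto intro: all_moments_bounded[of _ 0])

section \<open>Integration by parts on Gaussian space\<close>

context gaussian_space
begin

abbreviation path :: "'a \<Rightarrow> 'h \<Rightarrow> real" where
  "path \<omega> \<equiv> (\<lambda>g. X g \<omega>)"

abbreviation path_space :: "('h \<Rightarrow> real) measure" where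
  "path_space \<equiv> Pi\<^sub>M UNIV (\<lambda>_. borel)"

lemma path_measurable [measurable]: "path \<in> measurable M path_space"
  by (rule measurable_PiM_single') auto

text \<open>
  A functional of the process together with its gradient. Both are functions of the whole path
  \<open>x = (X g)\<^sub>g\<close>, indexed by the Hilbert space itself, so functionals that depend on different
  finite families of directions can be added and multiplied without renumbering. Moving \<open>X\<close> in
  direction \<open>h\<close> shifts the coordinate \<open>g\<close> by \<open>g \<bullet> h\<close>, and differentiability is only required along
  these lines.
\<close>

definition cylindrical :: "(('h \<Rightarrow> real) \<Rightarrow> real) \<Rightarrow> (('h \<Rightarrow> real) \<Rightarrow> 'h) \<Rightarrow> bool" where
  "cylindrical f v \<longleftrightarrow>
     f \<in> borel_measurable path_space \<and> v \<in> borel_measurable path_space \<and>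
     (\<exists>S. finite S \<and> (\<forall>x y. (\<forall>g\<in>S. x g = y g) \<longrightarrow> f x = f y \<and> v x = v y)) \<and>
     (\<forall>x h. ((\<lambda>t. f (\<lambda>g. x g + t * (g \<bullet> h))) has_real_derivative v x \<bullet> h) (at 0)) \<and>
     (\<forall>x h. continuous_on UNIV (\<lambda>t. v (\<lambda>g. x g + t * (g \<bullet> h)) \<bullet> h)) \<and>
     all_moments M (\<lambda>\<omega>. f (path \<omega>)) \<and> all_moments M (\<lambda>\<omega>. v (path \<omega>))"

lemma cylindricalD:
  assumes "cylindrical f v"
  shows "f \<in> borel_measurable path_space" "v \<in> borel_measurable path_space"
    "((\<lambda>t. f (\<lambda>g. x g + t * (g \<bullet> h))) has_real_derivative v x \<bullet> h) (at 0)"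
    "continuous_on UNIV (\<lambda>t. v (\<lambda>g. x g + t * (g \<bullet> h)) \<bullet> h)"
    "all_moments M (\<lambda>\<omega>. f (path \<omega>))" "all_moments M (\<lambda>\<omega>. v (path \<omega>))"
  using assms by (auto simp: cylindrical_def)

lemma cylindrical_finite:
  assumes "cylindrical f v"
  obtains S where "finite S" "\<And>x y. (\<And>g. g \<in> S \<Longrightarrow> x g = y g) \<Longrightarrow> f x = f y"
    "\<And>x y. (\<And>g. g \<in> S \<Longrightarrow> x g = y g) \<Longrightarrow> v x = v y"
  using assms by (auto simp: cylindrical_def)

lemma cylindrical_deriv:
  assumes "cylindrical f v"
  shows "((\<lambda>t. f (\<lambda>g. x g + t * (g \<bullet> h))) has_real_derivative v (\<lambda>g. x g + t * (g \<bullet> h)) \<bullet> h) (at t)"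
proof -
  have "((\<lambda>u. f (\<lambda>g. (x g + t * (g \<bullet> h)) + u * (g \<bullet> h))) has_real_derivative
      v (\<lambda>g. x g + t * (g \<bullet> h)) \<bullet> h) (at 0)"
    by (rule cylindricalD[OF assms])
  then have "((\<lambda>u. (\<lambda>s. f (\<lambda>g. x g + s * (g \<bullet> h))) (u + t)) has_real_derivative
      v (\<lambda>g. x g + t * (g \<bullet> h)) \<bullet> h) (at 0)"
    by (simp add: ring_distribs add_ac)
  then show ?thesis by (subst (asm) DERIV_shift[symmetric]) simp
qed

lemma cylindrical_continuous:
  assumes "cylindrical f v"
  shows "continuous_on UNIV (\<lambda>t. f (\<lambda>g. x g + t * (g \<bullet> h)))"
  using cylindrical_deriv[OF assms] by (meson DERIV_continuous continuous_at_imp_continuous_on)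

text \<open>
  Independence as a product law, in the form needed for Fubini's theorem.
\<close>

lemma distr_orthogonal_pair:
  assumes k: "\<And>i. k i \<bullet> h = 0"
  shows "distr M (path_space \<Otimes>\<^sub>M borel) (\<lambda>\<omega>. (\<lambda>i. X (k i) \<omega>, X h \<omega>))
    = distr M path_space (\<lambda>\<omega> i. X (k i) \<omega>) \<Otimes>\<^sub>M distr M borel (X h)"
proof -
  have Y[measurable]: "(\<lambda>\<omega> i. X (k i) \<omega>) \<in> measurable M path_space"
    by (rule measurable_PiM_single') auto
  interpret Y: prob_space "distr M path_space (\<lambda>\<omega> i. X (k i) \<omega>)" by (rule prob_space_distr[OF Y])
  interpret Xh: prob_space "distr M borel (X h)" by (rule prob_space_distr) measurable
  show ?thesis
  proof (rule pair_measure_eqI[symmetric])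
    fix A B assume "A \<in> sets (distr M path_space (\<lambda>\<omega> i. X (k i) \<omega>))" "B \<in> sets (distr M borel (X h))"
    then have A[measurable]: "A \<in> sets path_space" and B[measurable]: "B \<in> sets borel" by auto
    have ind: "(\<integral>\<omega>. indicator C (Z \<omega>) \<partial>M) = measure M (Z -` C \<inter> space M)"
      if "Z \<in> measurable M N" "C \<in> sets N" for Z :: "'a \<Rightarrow> 'd" and C N
    proof -
      have "(\<integral>\<omega>. indicator C (Z \<omega>) \<partial>M) = (\<integral>\<omega>. indicator (Z -` C \<inter> space M) \<omega> \<partial>M :: real)"
        by (intro Bochner_Integration.integral_cong) (auto split: split_indicator)
      then show ?thesis using measurable_sets[OF that] by simp
    qed
    have "(\<integral>\<omega>. indicator B (X h \<omega>) * indicator A (\<lambda>i. X (k i) \<omega>) \<partial>M)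
        = (\<integral>\<omega>. indicator (A \<times> B) (\<lambda>i. X (k i) \<omega>, X h \<omega>) \<partial>M :: real)"
      by (intro Bochner_Integration.integral_cong) (auto split: split_indicator)
    also have "\<dots> = measure M ((\<lambda>\<omega>. (\<lambda>i. X (k i) \<omega>, X h \<omega>)) -` (A \<times> B) \<inter> space M)"
      by (rule ind[of _ "path_space \<Otimes>\<^sub>M borel"]) measurable
    finally have "measure M ((\<lambda>\<omega>. (\<lambda>i. X (k i) \<omega>, X h \<omega>)) -` (A \<times> B) \<inter> space M)
        = measure M (X h -` B \<inter> space M) * measure M ((\<lambda>\<omega> i. X (k i) \<omega>) -` A \<inter> space M)"
      using X_orthogonal_independent[OF k A B] ind[OF X_measurable B] ind[OF Y A] by simp
    then show "emeasure (distr M path_space (\<lambda>\<omega> i. X (k i) \<omega>)) A * emeasure (distr M borel (X h)) B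
        = emeasure (distr M (path_space \<Otimes>\<^sub>M borel) (\<lambda>\<omega>. (\<lambda>i. X (k i) \<omega>, X h \<omega>))) (A \<times> B)"
      by (simp add: emeasure_distr emeasure_eq_measure ennreal_mult mult.commute)
  qed (auto intro: Y.sigma_finite_measure_axioms Xh.sigma_finite_measure_axioms intro!: sets_pair_measure_cong)
qed

text \<open>
  Write every coordinate as \<open>X g = X (g - (g \<bullet> h) h) + (g \<bullet> h) X h\<close>. Conditionally on the first
  summands, which are independent of \<open>X h\<close>, the claim is Stein's identity for a function of one
  standard normal variable.
\<close>

lemma integration_by_parts:
  assumes cyl: "cylindrical f v" and h: "norm h = 1"
  shows "expectation (\<lambda>\<omega>. X h \<omega> * f (path \<omega>)) = expectation (\<lambda>\<omega>. v (path \<omega>) \<bullet> h)"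
proof -
  define k where "k g = g - (g \<bullet> h) *\<^sub>R h" for g
  have hh: "h \<bullet> h = 1" using h by (simp add: norm_eq_1)
  have kh: "k g \<bullet> h = 0" for g by (simp add: k_def inner_diff_left hh)
  define Y where "Y \<omega> = (\<lambda>g. X (k g) \<omega>)" for \<omega>
  have Ym[measurable]: "Y \<in> measurable M path_space"
    unfolding Y_def by (rule measurable_PiM_single') auto
  define \<mu> where "\<mu> = distr M path_space Y"
  define N where "N = density lborel (\<lambda>x. ennreal (std_normal_density x))"
  have law: "distr M (path_space \<Otimes>\<^sub>M borel) (\<lambda>\<omega>. (Y \<omega>, X h \<omega>)) = \<mu> \<Otimes>\<^sub>M N"
    using distr_orthogonal_pair[OF kh] unfolding \<mu>_def N_def Y_def law_X_unit[OF h] .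
  interpret \<mu>: prob_space \<mu> unfolding \<mu>_def by (rule prob_space_distr) measurable
  interpret N: prob_space N unfolding N_def by (rule prob_space_normal_density) simp
  interpret pair_sigma_finite \<mu> N ..
  have sets_eq[measurable_cong]: "sets \<mu> = sets path_space" "sets N = sets borel" by (auto simp: \<mu>_def N_def)
  define L where "L y x = (\<lambda>g. y g + x * (g \<bullet> h))" for y :: "'h \<Rightarrow> real" and x :: real
  have Lm[measurable]: "(\<lambda>(y, x). L y x) \<in> measurable (path_space \<Otimes>\<^sub>M borel) path_space"
    unfolding L_def split_beta' by (rule measurable_PiM_single') auto
  note [measurable] = cylindricalD(1,2)[OF cyl]
  have pathL: "AE \<omega> in M. f (path \<omega>) = f (L (Y \<omega>) (X h \<omega>)) \<and> v (path \<omega>) = v (L (Y \<omega>) (X h \<omega>))"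
  proof -
    obtain S where S: "finite S" "\<And>x y. (\<And>g. g \<in> S \<Longrightarrow> x g = y g) \<Longrightarrow> f x = f y"
      "\<And>x y. (\<And>g. g \<in> S \<Longrightarrow> x g = y g) \<Longrightarrow> v x = v y"
      using cylindrical_finite[OF cyl] by blast
    have "AE \<omega> in M. X g \<omega> = L (Y \<omega>) (X h \<omega>) g" for g
      using X_linear[of 1 "k g" "g \<bullet> h" h]
      by (simp add: k_def Y_def L_def mult.commute)
    then have "AE \<omega> in M. \<forall>g\<in>S. X g \<omega> = L (Y \<omega>) (X h \<omega>) g"
      using S(1) by (simp add: AE_finite_all)
    then show ?thesis by eventually_elim (auto intro: S(2,3))
  qed
  have transfer: "integrable (\<mu> \<Otimes>\<^sub>M N) q \<and> expectation p = (\<integral>y. \<integral>x. q (y, x) \<partial>N \<partial>\<mu>)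
      \<and> (AE y in \<mu>. integrable N (\<lambda>x. q (y, x)))"
    if p: "integrable M p" and q[measurable]: "q \<in> borel_measurable (path_space \<Otimes>\<^sub>M borel)"
      and eq: "AE \<omega> in M. p \<omega> = q (Y \<omega>, X h \<omega>)" for p :: "'a \<Rightarrow> real" and q
  proof -
    have [measurable]: "p \<in> borel_measurable M" using p by simp
    have "integrable M (\<lambda>\<omega>. q (Y \<omega>, X h \<omega>))"
      using p by (rule integrable_cong_AE_imp) (use eq in auto)
    then have int: "integrable (\<mu> \<Otimes>\<^sub>M N) q"
      unfolding law[symmetric] by (subst integrable_distr_eq) auto
    have "expectation p = expectation (\<lambda>\<omega>. q (Y \<omega>, X h \<omega>))"
      using eq by (intro integral_cong_AE) auto
    also have "\<dots> = integral\<^sup>L (\<mu> \<Otimes>\<^sub>M N) q"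
      unfolding law[symmetric] by (subst integral_distr) auto
    also have "\<dots> = (\<integral>y. \<integral>x. q (y, x) \<partial>N \<partial>\<mu>)" by (rule integral_fst'[OF int, symmetric])
    finally show ?thesis using int AE_integrable_fst'[OF int] by auto
  qed
  have f2: "(\<lambda>\<omega>. f (path \<omega>)) \<in> L2 M" by (intro all_moments_L2 cylindricalD[OF cyl])
  have "AE \<omega> in M. X h \<omega> * f (path \<omega>) = X h \<omega> * f (L (Y \<omega>) (X h \<omega>))"
    using pathL by eventually_elim simp
  then have T1: "expectation (\<lambda>\<omega>. X h \<omega> * f (path \<omega>)) = (\<integral>y. \<integral>x. x * f (L y x) \<partial>N \<partial>\<mu>)
      \<and> (AE y in \<mu>. integrable N (\<lambda>x. x * f (L y x)))"
    using transfer[of "\<lambda>\<omega>. X h \<omega> * f (path \<omega>)", OF integrable_mult_L2[OF X_L2 f2], of "\<lambda>z. snd z * f (case z of (y, x) \<Rightarrow> L y x)"]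
    by auto
  have T2: "AE y in \<mu>. integrable N (\<lambda>x. f (L y x))"
    using transfer[OF all_moments_integrable[OF cylindricalD(5)[OF cyl]], of "\<lambda>z. f (case z of (y, x) \<Rightarrow> L y x)"] pathL
    by auto
  have vint: "integrable M (\<lambda>\<omega>. v (path \<omega>) \<bullet> h)"
    using all_moments_integrable[OF cylindricalD(6)[OF cyl]] by simp
  have "AE \<omega> in M. v (path \<omega>) \<bullet> h = v (L (Y \<omega>) (X h \<omega>)) \<bullet> h"
    using pathL by eventually_elim simp
  then have T3: "expectation (\<lambda>\<omega>. v (path \<omega>) \<bullet> h) = (\<integral>y. \<integral>x. v (L y x) \<bullet> h \<partial>N \<partial>\<mu>)
      \<and> (AE y in \<mu>. integrable N (\<lambda>x. v (L y x) \<bullet> h))"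
    using transfer[OF vint, of "\<lambda>z. v (case z of (y, x) \<Rightarrow> L y x) \<bullet> h"]
    by auto
  have "AE y in \<mu>. (\<integral>x. x * f (L y x) \<partial>N) = (\<integral>x. v (L y x) \<bullet> h \<partial>N)"
    using T1[THEN conjunct2] T2 T3[THEN conjunct2]
  proof eventually_elim
    case (elim y)
    have c1: "continuous_on UNIV (\<lambda>x. f (L y x))" unfolding L_def by (rule cylindrical_continuous[OF cyl])
    have c2: "continuous_on UNIV (\<lambda>x. v (L y x) \<bullet> h)" unfolding L_def by (rule cylindricalD[OF cyl])
    note [measurable] = borel_measurable_continuous_onI[OF c1] borel_measurable_continuous_onI[OF c2]
    have "(\<integral>x. std_normal_density x * (x * f (L y x)) \<partial>lborel)
        = (\<integral>x. std_normal_density x * (v (L y x) \<bullet> h) \<partial>lborel)"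
    proof (rule Stein_identity[OF _ c2])
      show "((\<lambda>x. f (L y x)) has_real_derivative v (L y x) \<bullet> h) (at x)" for x
        unfolding L_def by (rule cylindrical_deriv[OF cyl])
    qed (use elim in \<open>auto simp: N_def integrable_density\<close>)
    then show ?case by (simp add: N_def integral_density)
  qed
  then have "(\<integral>y. \<integral>x. x * f (L y x) \<partial>N \<partial>\<mu>) = (\<integral>y. \<integral>x. v (L y x) \<bullet> h \<partial>N \<partial>\<mu>)"
    by (intro integral_cong_AE) (auto simp: split_beta')
  with T1 T3 show ?thesis by simp
qed

lemma cylindrical_const: "cylindrical (\<lambda>x. c) (\<lambda>x. 0)"
  unfolding cylindrical_def
proof (intro conjI allI)
  show "\<exists>S. finite S \<and> (\<forall>x y. (\<forall>g\<in>S. x g = y g) \<longrightarrow> c = c \<and> (0::'h) = 0)"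
    by (intro exI[of _ "{}"]) simp
qed (auto intro: all_moments_bounded[OF _ order_refl])

lemma cylindrical_add:
  assumes f: "cylindrical f v" and g: "cylindrical g w"
  shows "cylindrical (\<lambda>x. f x + g x) (\<lambda>x. v x + w x)"
  unfolding cylindrical_def
proof (intro conjI allI)
  note [measurable] = cylindricalD(1,2)[OF f] cylindricalD(1,2)[OF g]
  show "(\<lambda>x. f x + g x) \<in> borel_measurable path_space" "(\<lambda>x. v x + w x) \<in> borel_measurable path_space" by measurable
  obtain S where S: "finite S" "\<And>x y. (\<And>g. g \<in> S \<Longrightarrow> x g = y g) \<Longrightarrow> f x = f y"
    "\<And>x y. (\<And>g. g \<in> S \<Longrightarrow> x g = y g) \<Longrightarrow> v x = v y" using cylindrical_finite[OF f] by blast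
  obtain T where T: "finite T" "\<And>x y. (\<And>h. h \<in> T \<Longrightarrow> x h = y h) \<Longrightarrow> g x = g y"
    "\<And>x y. (\<And>g. g \<in> T \<Longrightarrow> x g = y g) \<Longrightarrow> w x = w y" using cylindrical_finite[OF g] by blast
  have *: "f x = f y \<and> v x = v y \<and> g x = g y \<and> w x = w y" if "\<forall>g\<in>S \<union> T. x g = y g" for x y
    using that by (intro conjI S T) auto
  show "\<exists>S. finite S \<and> (\<forall>x y. (\<forall>g\<in>S. x g = y g) \<longrightarrow>
      f x + g x = f y + g y \<and> v x + w x = v y + w y)"
  proof (rule exI[of _ "S \<union> T"], rule conjI)
    show "\<forall>x y. (\<forall>g\<in>S \<union> T. x g = y g) \<longrightarrow> f x + g x = f y + g y \<and> v x + w x = v y + w y"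
    proof (rule allI, rule allI, rule impI)
      fix x y :: "'h \<Rightarrow> real" assume "\<forall>g\<in>S \<union> T. x g = y g"
      from *[OF this] show "f x + g x = f y + g y \<and> v x + w x = v y + w y" by simp
    qed
  qed (use S(1) T(1) in simp)
  fix x h
  show "((\<lambda>t. f (\<lambda>g. x g + t * (g \<bullet> h)) + g (\<lambda>g. x g + t * (g \<bullet> h))) has_real_derivative
      (v x + w x) \<bullet> h) (at 0)"
    unfolding inner_add_left by (intro DERIV_add cylindricalD f g)
  show "continuous_on UNIV (\<lambda>t. (v (\<lambda>g. x g + t * (g \<bullet> h)) + w (\<lambda>g. x g + t * (g \<bullet> h))) \<bullet> h)"
    unfolding inner_add_left by (rule continuous_on_add[OF cylindricalD(4)[OF f] cylindricalD(4)[OF g]])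
qed (intro all_moments_add cylindricalD(5)[OF f] cylindricalD(5)[OF g] cylindricalD(6)[OF f] cylindricalD(6)[OF g])+

lemma cylindrical_mult:
  assumes f: "cylindrical f v" and g: "cylindrical g w"
  shows "cylindrical (\<lambda>x. f x * g x) (\<lambda>x. f x *\<^sub>R w x + g x *\<^sub>R v x)"
  unfolding cylindrical_def
proof (intro conjI allI)
  note [measurable] = cylindricalD(1,2)[OF f] cylindricalD(1,2)[OF g]
  show "(\<lambda>x. f x * g x) \<in> borel_measurable path_space" "(\<lambda>x. f x *\<^sub>R w x + g x *\<^sub>R v x) \<in> borel_measurable path_space"
    by measurable
  obtain S where S: "finite S" "\<And>x y. (\<And>g. g \<in> S \<Longrightarrow> x g = y g) \<Longrightarrow> f x = f y"
    "\<And>x y. (\<And>g. g \<in> S \<Longrightarrow> x g = y g) \<Longrightarrow> v x = v y" using cylindrical_finite[OF f] by blast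
  obtain T where T: "finite T" "\<And>x y. (\<And>h. h \<in> T \<Longrightarrow> x h = y h) \<Longrightarrow> g x = g y"
    "\<And>x y. (\<And>g. g \<in> T \<Longrightarrow> x g = y g) \<Longrightarrow> w x = w y" using cylindrical_finite[OF g] by blast
  have *: "f x = f y \<and> v x = v y \<and> g x = g y \<and> w x = w y" if "\<forall>g\<in>S \<union> T. x g = y g" for x y
    using that by (intro conjI S T) auto
  show "\<exists>S. finite S \<and> (\<forall>x y. (\<forall>g\<in>S. x g = y g) \<longrightarrow>
      f x * g x = f y * g y \<and> f x *\<^sub>R w x + g x *\<^sub>R v x = f y *\<^sub>R w y + g y *\<^sub>R v y)"
  proof (rule exI[of _ "S \<union> T"], rule conjI)
    show "\<forall>x y. (\<forall>g\<in>S \<union> T. x g = y g) \<longrightarrow>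
        f x * g x = f y * g y \<and> f x *\<^sub>R w x + g x *\<^sub>R v x = f y *\<^sub>R w y + g y *\<^sub>R v y"
    proof (rule allI, rule allI, rule impI)
      fix x y :: "'h \<Rightarrow> real" assume "\<forall>g\<in>S \<union> T. x g = y g"
      from *[OF this]
      show "f x * g x = f y * g y \<and> f x *\<^sub>R w x + g x *\<^sub>R v x = f y *\<^sub>R w y + g y *\<^sub>R v y" by simp
    qed
  qed (use S(1) T(1) in simp)
  fix x h
  have "((\<lambda>t. f (\<lambda>g. x g + t * (g \<bullet> h)) * g (\<lambda>g. x g + t * (g \<bullet> h))) has_real_derivative
      (v x \<bullet> h) * g (\<lambda>g. x g + 0 * (g \<bullet> h)) + (w x \<bullet> h) * f (\<lambda>g. x g + 0 * (g \<bullet> h))) (at 0)"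
    by (intro DERIV_mult cylindricalD f g)
  then show "((\<lambda>t. f (\<lambda>g. x g + t * (g \<bullet> h)) * g (\<lambda>g. x g + t * (g \<bullet> h))) has_real_derivative
      (f x *\<^sub>R w x + g x *\<^sub>R v x) \<bullet> h) (at 0)"
    by (simp add: inner_add_left algebra_simps)
  show "continuous_on UNIV (\<lambda>t. (f (\<lambda>g. x g + t * (g \<bullet> h)) *\<^sub>R w (\<lambda>g. x g + t * (g \<bullet> h)) +
      g (\<lambda>g. x g + t * (g \<bullet> h)) *\<^sub>R v (\<lambda>g. x g + t * (g \<bullet> h))) \<bullet> h)"
    unfolding inner_add_left inner_scaleR_left
    by (intro continuous_on_add continuous_on_mult cylindrical_continuous[OF f]
      cylindrical_continuous[OF g] cylindricalD(4)[OF f] cylindricalD(4)[OF g])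
qed (intro all_moments_add all_moments_mult all_moments_scaleR cylindricalD(5,6)[OF f] cylindricalD(5,6)[OF g])+

lemma cylindrical_cmult:
  assumes f: "cylindrical f v"
  shows "cylindrical (\<lambda>x. c * f x) (\<lambda>x. c *\<^sub>R v x)"
  using cylindrical_mult[OF cylindrical_const[of c] f] by simp

lemma cylindrical_sum:
  assumes "\<And>i. i \<in> I \<Longrightarrow> cylindrical (f i) (v i)"
  shows "cylindrical (\<lambda>x. \<Sum>i\<in>I. f i x) (\<lambda>x. \<Sum>i\<in>I. v i x)"
  using assms
proof (induction I rule: infinite_finite_induct)
  case (insert i I)
  then show ?case using cylindrical_add[of "f i" "v i"] by simp
qed (auto intro: cylindrical_const)

lemma cylindrical_compose:
  fixes \<phi> \<phi>' :: "real \<Rightarrow> real"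
  assumes f: "cylindrical f v"
    and deriv: "\<And>y. (\<phi> has_real_derivative \<phi>' y) (at y)" and cont: "continuous_on UNIV \<phi>'"
    and b: "\<And>y. \<bar>\<phi> y\<bar> \<le> C" "\<And>y. \<bar>\<phi>' y\<bar> \<le> C"
  shows "cylindrical (\<lambda>x. \<phi> (f x)) (\<lambda>x. \<phi>' (f x) *\<^sub>R v x)"
  unfolding cylindrical_def
proof (intro conjI allI)
  have cp: "continuous_on UNIV \<phi>"
    using deriv by (meson DERIV_continuous continuous_at_imp_continuous_on)
  note [measurable] = cylindricalD(1,2)[OF f] borel_measurable_continuous_onI[OF cp]
    borel_measurable_continuous_onI[OF cont] all_moments_measurable[OF cylindricalD(5)[OF f]]
  show "(\<lambda>x. \<phi> (f x)) \<in> borel_measurable path_space" "(\<lambda>x. \<phi>' (f x) *\<^sub>R v x) \<in> borel_measurable path_space"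
    by measurable
  obtain S where S: "finite S" "\<And>x y. (\<And>g. g \<in> S \<Longrightarrow> x g = y g) \<Longrightarrow> f x = f y"
    "\<And>x y. (\<And>g. g \<in> S \<Longrightarrow> x g = y g) \<Longrightarrow> v x = v y" using cylindrical_finite[OF f] by blast
  have *: "f x = f y \<and> v x = v y" if "\<forall>g\<in>S. x g = y g" for x y
    using that by (intro conjI S) auto
  show "\<exists>S. finite S \<and> (\<forall>x y. (\<forall>g\<in>S. x g = y g) \<longrightarrow>
      \<phi> (f x) = \<phi> (f y) \<and> \<phi>' (f x) *\<^sub>R v x = \<phi>' (f y) *\<^sub>R v y)"
  proof (rule exI[of _ S], rule conjI[OF S(1)], rule allI, rule allI, rule impI)
    fix x y :: "'h \<Rightarrow> real" assume "\<forall>g\<in>S. x g = y g"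
    from *[OF this] show "\<phi> (f x) = \<phi> (f y) \<and> \<phi>' (f x) *\<^sub>R v x = \<phi>' (f y) *\<^sub>R v y" by simp
  qed
  fix x h
  have "((\<lambda>t. \<phi> (f (\<lambda>g. x g + t * (g \<bullet> h)))) has_real_derivative \<phi>' (f (\<lambda>g. x g + 0 * (g \<bullet> h))) * (v x \<bullet> h)) (at 0)"
    by (rule DERIV_chain2[OF deriv]) (rule cylindricalD[OF f])
  then show "((\<lambda>t. \<phi> (f (\<lambda>g. x g + t * (g \<bullet> h)))) has_real_derivative (\<phi>' (f x) *\<^sub>R v x) \<bullet> h) (at 0)"
    by simp
  show "continuous_on UNIV (\<lambda>t. (\<phi>' (f (\<lambda>g. x g + t * (g \<bullet> h))) *\<^sub>R v (\<lambda>g. x g + t * (g \<bullet> h))) \<bullet> h)"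
    unfolding inner_scaleR_left
    by (intro continuous_on_mult cylindricalD[OF f] continuous_on_compose2[OF cont]
      cylindrical_continuous[OF f]) auto
  show "all_moments M (\<lambda>\<omega>. \<phi> (f (path \<omega>)))"
    by (rule all_moments_bounded[of _ C]) (use b in auto)
  show "all_moments M (\<lambda>\<omega>. \<phi>' (f (path \<omega>)) *\<^sub>R v (path \<omega>))"
    by (rule all_moments_scaleR[OF all_moments_bounded[of _ C] cylindricalD(6)[OF f]]) (use b in auto)
qed

lemma cylindrical_coordinate:
  fixes \<phi> \<phi>' :: "real \<Rightarrow> real"
  assumes deriv: "\<And>y. (\<phi> has_real_derivative \<phi>' y) (at y)" and cont: "continuous_on UNIV \<phi>'"
    and am: "all_moments M (\<lambda>\<omega>. \<phi> (X k \<omega>))" "all_moments M (\<lambda>\<omega>. \<phi>' (X k \<omega>))"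
  shows "cylindrical (\<lambda>x. \<phi> (x k)) (\<lambda>x. \<phi>' (x k) *\<^sub>R k)"
  unfolding cylindrical_def
proof (intro conjI allI)
  have cp: "continuous_on UNIV \<phi>"
    using deriv by (meson DERIV_continuous continuous_at_imp_continuous_on)
  note [measurable] = borel_measurable_continuous_onI[OF cp] borel_measurable_continuous_onI[OF cont]
  show "(\<lambda>x. \<phi> (x k)) \<in> borel_measurable path_space" "(\<lambda>x. \<phi>' (x k) *\<^sub>R k) \<in> borel_measurable path_space"
    by measurable
  show "\<exists>S. finite S \<and> (\<forall>x y. (\<forall>g\<in>S. x g = y g) \<longrightarrow>
      \<phi> (x k) = \<phi> (y k) \<and> \<phi>' (x k) *\<^sub>R k = \<phi>' (y k) *\<^sub>R k)"
    by (intro exI[of _ "{k}"]) auto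
  fix x h
  show "((\<lambda>t. \<phi> (x k + t * (k \<bullet> h))) has_real_derivative (\<phi>' (x k) *\<^sub>R k) \<bullet> h) (at 0)"
    by (auto intro!: derivative_eq_intros DERIV_chain2[where f = \<phi>] deriv)
  show "continuous_on UNIV (\<lambda>t. (\<phi>' (x k + t * (k \<bullet> h)) *\<^sub>R k) \<bullet> h)"
    unfolding inner_scaleR_left
    by (intro continuous_intros continuous_on_compose2[OF cont]) auto
  show "all_moments M (\<lambda>\<omega>. \<phi>' (X k \<omega>) *\<^sub>R k)"
    by (intro all_moments_scaleR am all_moments_bounded[of _ "norm k"]) auto
qed (rule am)

end

section \<open>Hermite polynomials of Gaussian variables\<close>

lemma pderiv_hermite_Suc: "pderiv (hermite (Suc n)) = smult (real (Suc n)) (hermite n)"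
proof (induction n)
  case 0
  show ?case by (simp add: pderiv_pCons)
next
  case (Suc n)
  have "pderiv (hermite (Suc (Suc n)))
      = hermite (Suc n) + [:0, 1:] * pderiv (hermite (Suc n)) - pderiv (pderiv (hermite (Suc n)))"
    by (simp only: hermite.simps(2)[of "Suc n"] pderiv_diff pderiv_mult)
      (simp add: pderiv_pCons del: hermite.simps)
  also have "\<dots> = hermite (Suc n) + smult (real (Suc n)) ([:0, 1:] * hermite n - pderiv (hermite n))"
    unfolding Suc.IH by (simp add: pderiv_smult smult_diff_right del: hermite.simps)
  also have "[:0, 1:] * hermite n - pderiv (hermite n) = hermite (Suc n)" by simp
  also have "hermite (Suc n) + smult (real (Suc n)) (hermite (Suc n)) = smult (real (Suc (Suc n))) (hermite (Suc n))"
    by (simp only: of_nat_Suc[of "Suc n"] smult_add_left smult_1_left)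
  finally show ?case .
qed

text \<open>
  Gram-Schmidt. Only Parseval's identity on the span is kept.
\<close>

lemma exists_orthonormal_coordinates:
  fixes S :: "'h::real_inner set"
  assumes "finite S"
  shows "\<exists>B. finite B \<and> (\<forall>u\<in>span S. (norm u)\<^sup>2 = (\<Sum>e\<in>B. (u \<bullet> e)\<^sup>2))"
proof -
  have "\<exists>B. finite B \<and> (\<forall>a\<in>B. \<forall>b\<in>B. a \<bullet> b = (if a = b then 1 else 0)) \<and> S \<subseteq> span B"
    using assms
  proof (induction S)
    case empty
    show ?case by (rule exI[of _ "{}"]) simp
  next
    case (insert x S)
    then obtain B where B: "finite B" "\<And>a b. a \<in> B \<Longrightarrow> b \<in> B \<Longrightarrow> a \<bullet> b = (if a = b then 1 else 0)"
      "S \<subseteq> span B" by blast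
    define y where "y = x - (\<Sum>b\<in>B. (x \<bullet> b) *\<^sub>R b)"
    have orth: "y \<bullet> a = 0" if "a \<in> B" for a
    proof -
      have "(\<Sum>b\<in>B. (x \<bullet> b) *\<^sub>R b) \<bullet> a = (\<Sum>b\<in>B. (x \<bullet> b) * (if b = a then 1 else 0))"
        unfolding inner_sum_left using B(2) that by (intro sum.cong) auto
      also have "\<dots> = x \<bullet> a" using B(1) that by (simp add: if_distrib cong: if_cong)
      finally show ?thesis by (simp add: y_def inner_diff_left)
    qed
    have sumB: "(\<Sum>b\<in>B. (x \<bullet> b) *\<^sub>R b) \<in> span B" by (intro span_sum span_scale span_base)
    show ?case
    proof (cases "y = 0")
      case True
      then have "x \<in> span B" using sumB by (simp add: y_def)
      then show ?thesis using B by (intro exI[of _ B]) auto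
    next
      case False
      define z where "z = (1 / norm y) *\<^sub>R y"
      have z: "z \<bullet> z = 1" "y = norm y *\<^sub>R z" "\<And>a. a \<in> B \<Longrightarrow> z \<bullet> a = 0"
        using False orth by (auto simp: z_def power2_norm_eq_inner[symmetric] power2_eq_square dot_square_norm)
      have zB: "z \<notin> B" using z(1,3) by fastforce
      have "x = norm y *\<^sub>R z + (\<Sum>b\<in>B. (x \<bullet> b) *\<^sub>R b)" using z(2) by (simp add: y_def)
      moreover have "span B \<subseteq> span (insert z B)" by (intro span_mono) auto
      moreover have "norm y *\<^sub>R z \<in> span (insert z B)"
        by (intro span_scale span_base) simp
      then have "norm y *\<^sub>R z + (\<Sum>b\<in>B. (x \<bullet> b) *\<^sub>R b) \<in> span (insert z B)"
        using sumB calculation(2) by (intro span_add) auto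
      ultimately have "insert x S \<subseteq> span (insert z B)" using B(3) by auto
      moreover have "\<forall>a\<in>insert z B. \<forall>b\<in>insert z B. a \<bullet> b = (if a = b then 1 else 0)"
        using B(2) z zB by (auto simp: inner_commute)
      ultimately show ?thesis using B(1) by (intro exI[of _ "insert z B"]) auto
    qed
  qed
  then obtain B where B: "finite B" "\<And>a b. a \<in> B \<Longrightarrow> b \<in> B \<Longrightarrow> a \<bullet> b = (if a = b then 1 else 0)"
    "S \<subseteq> span B" by blast
  have expand: "u = (\<Sum>e\<in>B. (u \<bullet> e) *\<^sub>R e)" if "u \<in> span B" for u
    using that
  proof (induction rule: span_induct_alt)
    case base
    show ?case by simp
  next
    case (step c a u)
    have "(\<Sum>e\<in>B. (a \<bullet> e) *\<^sub>R e) = (\<Sum>e\<in>B. if a = e then e else 0)"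
      using B(2)[OF step(1)] by (intro sum.cong) auto
    also have "\<dots> = a" using B(1) step(1) by simp
    finally have "(\<Sum>e\<in>B. (a \<bullet> e) *\<^sub>R e) = a" .
    then have "c *\<^sub>R a + u = c *\<^sub>R (\<Sum>e\<in>B. (a \<bullet> e) *\<^sub>R e) + (\<Sum>e\<in>B. (u \<bullet> e) *\<^sub>R e)"
      using step(2) by simp
    also have "\<dots> = (\<Sum>e\<in>B. ((c *\<^sub>R a + u) \<bullet> e) *\<^sub>R e)"
      by (simp add: scaleR_sum_right inner_add_left scaleR_add_left sum.distrib)
    finally show ?case .
  qed
  have "(norm u)\<^sup>2 = (\<Sum>e\<in>B. (u \<bullet> e)\<^sup>2)" if "u \<in> span S" for u
  proof -
    have "u \<in> span B" using that span_mono[OF B(3)] by (auto simp: span_span)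
    then have "u \<bullet> u = u \<bullet> (\<Sum>e\<in>B. (u \<bullet> e) *\<^sub>R e)" using expand by metis
    then show ?thesis by (simp add: dot_square_norm inner_sum_right flip: power2_eq_square)
  qed
  with B(1) show ?thesis by blast
qed

context gaussian_space
begin

definition hermite_sum :: "'h set \<Rightarrow> ('h \<Rightarrow> real) \<Rightarrow> nat \<Rightarrow> ('h \<Rightarrow> real) \<Rightarrow> real" where
  "hermite_sum S c n x = (\<Sum>h\<in>S. c h * poly (hermite n) (x h))"

definition hermite_grad :: "'h set \<Rightarrow> ('h \<Rightarrow> real) \<Rightarrow> nat \<Rightarrow> ('h \<Rightarrow> real) \<Rightarrow> 'h" where
  "hermite_grad S c n x = (\<Sum>h\<in>S. (c h * poly (pderiv (hermite n)) (x h)) *\<^sub>R h)"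

text \<open>
  The dense part of the \<open>n\<close>th chaos, paired with its gradient. Keeping the pair avoids asking
  whether the gradient is determined by the random variable.
\<close>

definition chaos_poly :: "nat \<Rightarrow> (('h \<Rightarrow> real) \<Rightarrow> real) \<Rightarrow> (('h \<Rightarrow> real) \<Rightarrow> 'h) \<Rightarrow> bool" where
  "chaos_poly n f v \<longleftrightarrow> (\<exists>S c. finite S \<and> S \<subseteq> {h. norm h = 1} \<and> f = hermite_sum S c n \<and> v = hermite_grad S c n)"

lemma all_moments_poly_X: "norm h = 1 \<Longrightarrow> all_moments M (\<lambda>\<omega>. poly p (X h \<omega>))"
  using integrable_abs_poly_X_power[of h p] by (simp add: all_moments_def)

lemma cylindrical_poly_X:
  assumes "norm h = 1"
  shows "cylindrical (\<lambda>x. poly p (x h)) (\<lambda>x. poly (pderiv p) (x h) *\<^sub>R h)"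
  using assms by (intro cylindrical_coordinate poly_DERIV all_moments_poly_X continuous_on_poly continuous_on_id)

lemma chaos_poly_cylindrical:
  assumes "chaos_poly n f v"
  shows "cylindrical f v"
proof -
  obtain S c where S: "finite S" "S \<subseteq> {h. norm h = 1}" "f = hermite_sum S c n" "v = hermite_grad S c n"
    using assms by (auto simp: chaos_poly_def)
  have "cylindrical (\<lambda>x. \<Sum>h\<in>S. c h * poly (hermite n) (x h))
      (\<lambda>x. \<Sum>h\<in>S. c h *\<^sub>R (poly (pderiv (hermite n)) (x h) *\<^sub>R h))"
    using S(2) by (intro cylindrical_sum cylindrical_cmult cylindrical_poly_X) auto
  then show ?thesis using S(3,4) by (simp add: hermite_sum_def[abs_def] hermite_grad_def[abs_def])
qed

text \<open>
  The recursion \<open>H\<^sub>n\<^sub>+\<^sub>1 (x) = x H\<^sub>n (x) - H\<^sub>n' (x)\<close> says that multiplication by \<open>X h\<close>, integrated by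
  parts, loses exactly the derivative of \<open>H\<^sub>n\<close>.
\<close>

lemma hermite_integration_by_parts:
  assumes \<Phi>: "cylindrical \<Phi> w" and h: "norm h = 1"
  shows "expectation (\<lambda>\<omega>. poly (hermite (Suc n)) (X h \<omega>) * \<Phi> (path \<omega>))
    = expectation (\<lambda>\<omega>. poly (hermite n) (X h \<omega>) * (w (path \<omega>) \<bullet> h))"
proof -
  let ?H = "\<lambda>\<omega>. poly (hermite n) (X h \<omega>)" and ?H' = "\<lambda>\<omega>. poly (pderiv (hermite n)) (X h \<omega>)"
  have hh: "h \<bullet> h = 1" using h by (simp add: norm_eq_1)
  note am = all_moments_poly_X[OF h] cylindricalD(5,6)[OF \<Phi>]
  have wh: "all_moments M (\<lambda>\<omega>. w (path \<omega>) \<bullet> h)"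
    by (intro all_moments_inner am all_moments_bounded[OF _ order_refl]) simp
  have "integrable M (\<lambda>\<omega>. poly ([:0, 1:] * hermite n) (X h \<omega>) * \<Phi> (path \<omega>))"
    by (intro all_moments_integrable all_moments_mult am)
  then have i1: "integrable M (\<lambda>\<omega>. X h \<omega> * (?H \<omega> * \<Phi> (path \<omega>)))" by (simp add: mult.assoc)
  have i2: "integrable M (\<lambda>\<omega>. ?H' \<omega> * \<Phi> (path \<omega>))" "integrable M (\<lambda>\<omega>. ?H \<omega> * (w (path \<omega>) \<bullet> h))"
    by (intro all_moments_integrable all_moments_mult am wh)+
  have "expectation (\<lambda>\<omega>. poly (hermite (Suc n)) (X h \<omega>) * \<Phi> (path \<omega>))
      = expectation (\<lambda>\<omega>. X h \<omega> * (?H \<omega> * \<Phi> (path \<omega>)) - ?H' \<omega> * \<Phi> (path \<omega>))"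
    by (simp add: algebra_simps)
  also have "\<dots> = expectation (\<lambda>\<omega>. X h \<omega> * (?H \<omega> * \<Phi> (path \<omega>))) - expectation (\<lambda>\<omega>. ?H' \<omega> * \<Phi> (path \<omega>))"
    using i1 i2 by simp
  also have "expectation (\<lambda>\<omega>. X h \<omega> * (?H \<omega> * \<Phi> (path \<omega>)))
      = expectation (\<lambda>\<omega>. (?H \<omega> *\<^sub>R w (path \<omega>) + \<Phi> (path \<omega>) *\<^sub>R (?H' \<omega> *\<^sub>R h)) \<bullet> h)"
    by (rule integration_by_parts[OF cylindrical_mult[OF cylindrical_poly_X[OF h] \<Phi>] h])
  also have "\<dots> = expectation (\<lambda>\<omega>. ?H \<omega> * (w (path \<omega>) \<bullet> h) + ?H' \<omega> * \<Phi> (path \<omega>))"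
    by (simp add: inner_add_left hh mult.commute)
  also have "\<dots> = expectation (\<lambda>\<omega>. ?H \<omega> * (w (path \<omega>) \<bullet> h)) + expectation (\<lambda>\<omega>. ?H' \<omega> * \<Phi> (path \<omega>))"
    using i2 by simp
  finally show ?thesis by simp
qed

text \<open>
  Summation over the Hermite terms; by \<open>H\<^sub>n' = n H\<^sub>n\<^sub>-\<^sub>1\<close> the factor \<open>n\<close> turns
  \<open>H\<^sub>n\<^sub>-\<^sub>1 (X h) h\<close> into the gradient of \<open>H\<^sub>n (X h)\<close>.
\<close>

lemma chaos_integration_by_parts:
  assumes f: "chaos_poly n f v" and \<Phi>: "cylindrical \<Phi> w"
  shows "real n * expectation (\<lambda>\<omega>. f (path \<omega>) * \<Phi> (path \<omega>)) = expectation (\<lambda>\<omega>. v (path \<omega>) \<bullet> w (path \<omega>))"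
proof -
  obtain S c where S: "finite S" "\<And>h. h \<in> S \<Longrightarrow> norm h = 1" "f = hermite_sum S c n" "v = hermite_grad S c n"
    using f by (auto simp: chaos_poly_def)
  note am = all_moments_poly_X cylindricalD(5,6)[OF \<Phi>]
  have wh: "all_moments M (\<lambda>\<omega>. h \<bullet> w (path \<omega>))" for h
    by (intro all_moments_inner am all_moments_bounded[OF _ order_refl]) simp
  have "real n * expectation (\<lambda>\<omega>. f (path \<omega>) * \<Phi> (path \<omega>))
      = real n * expectation (\<lambda>\<omega>. \<Sum>h\<in>S. c h * (poly (hermite n) (X h \<omega>) * \<Phi> (path \<omega>)))"
    by (simp add: S(3) hermite_sum_def sum_distrib_right mult.assoc)
  also have "\<dots> = (\<Sum>h\<in>S. c h * (real n * expectation (\<lambda>\<omega>. poly (hermite n) (X h \<omega>) * \<Phi> (path \<omega>))))"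
    using S(2) by (subst Bochner_Integration.integral_sum)
      (auto intro!: integrable_mult_right all_moments_integrable all_moments_mult am simp: sum_distrib_left mult_ac)
  also have "\<dots> = (\<Sum>h\<in>S. c h * expectation (\<lambda>\<omega>. poly (pderiv (hermite n)) (X h \<omega>) * (h \<bullet> w (path \<omega>))))"
  proof (rule sum.cong[OF refl])
    fix h assume "h \<in> S"
    have "real n * expectation (\<lambda>\<omega>. poly (hermite n) (X h \<omega>) * \<Phi> (path \<omega>))
      = expectation (\<lambda>\<omega>. poly (pderiv (hermite n)) (X h \<omega>) * (h \<bullet> w (path \<omega>)))"
    proof (cases n)
      case 0
      then show ?thesis by simp
    next
      case (Suc m)
      then show ?thesis
        using hermite_integration_by_parts[OF \<Phi> S(2)[OF \<open>h \<in> S\<close>], of m]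
        by (simp add: pderiv_hermite_Suc inner_commute mult.assoc del: hermite.simps)
    qed
    then show "c h * (real n * expectation (\<lambda>\<omega>. poly (hermite n) (X h \<omega>) * \<Phi> (path \<omega>)))
      = c h * expectation (\<lambda>\<omega>. poly (pderiv (hermite n)) (X h \<omega>) * (h \<bullet> w (path \<omega>)))" by simp
  qed
  also have "\<dots> = expectation (\<lambda>\<omega>. \<Sum>h\<in>S. c h * (poly (pderiv (hermite n)) (X h \<omega>) * (h \<bullet> w (path \<omega>))))"
    using S(2) by (subst Bochner_Integration.integral_sum)
      (auto intro!: integrable_mult_right all_moments_integrable all_moments_mult am wh)
  also have "\<dots> = expectation (\<lambda>\<omega>. v (path \<omega>) \<bullet> w (path \<omega>))"
    by (simp add: S(4) hermite_grad_def inner_sum_left mult.assoc)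
  finally show ?thesis .
qed

text \<open>
  Since \<open>H\<^sub>n\<^sub>+\<^sub>1' = (n + 1) H\<^sub>n\<close>, differentiation lowers the order by one. Every induction on the
  order of the chaos below runs through this lemma.
\<close>

lemma chaos_poly_grad_component:
  assumes "chaos_poly (Suc n) f v"
  shows "\<exists>w. chaos_poly n (\<lambda>x. v x \<bullet> e) w"
proof -
  obtain S c where S: "finite S" "S \<subseteq> {h. norm h = 1}" "v = hermite_grad S c (Suc n)"
    using assms by (auto simp: chaos_poly_def)
  have "(\<lambda>x. v x \<bullet> e) = hermite_sum S (\<lambda>h. c h * real (Suc n) * (h \<bullet> e)) n"
    unfolding S(3) hermite_sum_def hermite_grad_def
    by (auto simp: inner_sum_left pderiv_hermite_Suc mult_ac simp del: hermite.simps of_nat_Suc intro!: ext sum.cong)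
  then show ?thesis using S(1,2) unfolding chaos_poly_def by blast
qed

lemma chaos_poly_grad_span:
  assumes "chaos_poly n f v"
  shows "\<exists>S. finite S \<and> (\<forall>x. v x \<in> span S)"
proof -
  obtain S c where S: "finite S" "v = hermite_grad S c n" using assms by (auto simp: chaos_poly_def)
  have "v x \<in> span S" for x
    unfolding S(2) hermite_grad_def by (intro span_sum span_scale span_base)
  then show ?thesis using S(1) by blast
qed

lemma chaos_poly_diff:
  assumes "chaos_poly n f v" "chaos_poly n g w"
  shows "chaos_poly n (\<lambda>x. f x - g x) (\<lambda>x. v x - w x)"
proof -
  obtain S c where S: "finite S" "S \<subseteq> {h. norm h = 1}" "f = hermite_sum S c n" "v = hermite_grad S c n"
    using assms(1) by (auto simp: chaos_poly_def)
  obtain T d where T: "finite T" "T \<subseteq> {h. norm h = 1}" "g = hermite_sum T d n" "w = hermite_grad T d n"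
    using assms(2) by (auto simp: chaos_poly_def)
  define e where "e h = (if h \<in> S then c h else 0) - (if h \<in> T then d h else 0)" for h
  have ext: "(\<Sum>h\<in>S. G h) = (\<Sum>h\<in>S \<union> T. if h \<in> S then G h else 0)"
    "(\<Sum>h\<in>T. G h) = (\<Sum>h\<in>S \<union> T. if h \<in> T then G h else 0)" for G :: "'h \<Rightarrow> 'k::comm_monoid_add"
    using S(1) T(1) by (simp_all add: sum.If_cases Int_absorb1 flip: Int_def)
  have "(\<lambda>x. f x - g x) = hermite_sum (S \<union> T) e n"
    unfolding S(3) T(3) hermite_sum_def ext sum_subtractf[symmetric]
    by (auto simp: e_def left_diff_distrib intro!: ext sum.cong)
  moreover have "(\<lambda>x. v x - w x) = hermite_grad (S \<union> T) e n"
    unfolding S(4) T(4) hermite_grad_def ext sum_subtractf[symmetric]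
    by (auto simp: e_def left_diff_distrib scaleR_diff_left intro!: ext sum.cong)
  ultimately show ?thesis
    unfolding chaos_poly_def using S(1,2) T(1,2) by (intro exI[of _ "S \<union> T"] exI[of _ e]) auto
qed

section \<open>Equivalence of moments on a fixed chaos\<close>

text \<open>
  A moment comparison for scalars extends to vectors with the same constant, by expanding the
  square and using the Cauchy-Schwarz inequality on the mixed terms.
\<close>

lemma fourth_moment_of_sum_of_squares:
  fixes u :: "'i \<Rightarrow> 'a \<Rightarrow> real"
  assumes "finite B" and am: "\<And>e. e \<in> B \<Longrightarrow> all_moments M (u e)" and "0 \<le> K"
    and bound: "\<And>e. e \<in> B \<Longrightarrow> expectation (\<lambda>\<omega>. u e \<omega> ^ 4) \<le> (K * expectation (\<lambda>\<omega>. (u e \<omega>)\<^sup>2))\<^sup>2"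
  shows "expectation (\<lambda>\<omega>. (\<Sum>e\<in>B. (u e \<omega>)\<^sup>2)\<^sup>2) \<le> (K * expectation (\<lambda>\<omega>. \<Sum>e\<in>B. (u e \<omega>)\<^sup>2))\<^sup>2"
proof -
  have am2: "all_moments M (\<lambda>\<omega>. (u e \<omega>)\<^sup>2)" if "e \<in> B" for e
    by (intro all_moments_power am that finite_measure_axioms)
  let ?m = "\<lambda>e. expectation (\<lambda>\<omega>. (u e \<omega>)\<^sup>2)"
  have m0: "0 \<le> K * ?m e" for e using \<open>0 \<le> K\<close> by simp
  have "expectation (\<lambda>\<omega>. (\<Sum>e\<in>B. (u e \<omega>)\<^sup>2)\<^sup>2) = expectation (\<lambda>\<omega>. \<Sum>e\<in>B. \<Sum>e'\<in>B. (u e \<omega>)\<^sup>2 * (u e' \<omega>)\<^sup>2)"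
    by (simp add: power2_eq_square sum_product)
  also have "\<dots> = (\<Sum>e\<in>B. \<Sum>e'\<in>B. expectation (\<lambda>\<omega>. (u e \<omega>)\<^sup>2 * (u e' \<omega>)\<^sup>2))"
    by (simp add: Bochner_Integration.integral_sum all_moments_integrable all_moments_mult am2
      Bochner_Integration.integrable_sum)
  also have "\<dots> \<le> (\<Sum>e\<in>B. \<Sum>e'\<in>B. (K * ?m e) * (K * ?m e'))"
  proof (intro sum_mono)
    fix e e' assume e: "e \<in> B" "e' \<in> B"
    have s: "sqrt (expectation (\<lambda>\<omega>. ((u e \<omega>)\<^sup>2)\<^sup>2)) \<le> K * ?m e" if "e \<in> B" for e
      using bound[OF that] m0[of e] by (intro real_le_lsqrt) (simp_all flip: power_mult)
    have "expectation (\<lambda>\<omega>. (u e \<omega>)\<^sup>2 * (u e' \<omega>)\<^sup>2)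
        \<le> sqrt (expectation (\<lambda>\<omega>. ((u e \<omega>)\<^sup>2)\<^sup>2)) * sqrt (expectation (\<lambda>\<omega>. ((u e' \<omega>)\<^sup>2)\<^sup>2))"
      using L2_cauchy_schwarz[OF all_moments_L2[OF am2[OF e(1)]] all_moments_L2[OF am2[OF e(2)]]] by simp
    also have "\<dots> \<le> (K * ?m e) * (K * ?m e')"
      by (intro mult_mono s e m0) simp
    finally show "expectation (\<lambda>\<omega>. (u e \<omega>)\<^sup>2 * (u e' \<omega>)\<^sup>2) \<le> (K * ?m e) * (K * ?m e')" .
  qed
  also have "\<dots> = (\<Sum>e\<in>B. K * ?m e)\<^sup>2"
    by (simp only: power2_eq_square sum_product)
  also have "(\<Sum>e\<in>B. K * ?m e) = K * (\<Sum>e\<in>B. ?m e)"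
    by (rule sum_distrib_left[symmetric])
  also have "(\<Sum>e\<in>B. ?m e) = expectation (\<lambda>\<omega>. \<Sum>e\<in>B. (u e \<omega>)\<^sup>2)"
    using am2 by (intro Bochner_Integration.integral_sum[symmetric] all_moments_integrable)
  finally show ?thesis .
qed

lemma chaos_poly_norm_grad:
  assumes "chaos_poly n f v"
  shows "expectation (\<lambda>\<omega>. (norm (v (path \<omega>)))\<^sup>2) = real n * expectation (\<lambda>\<omega>. (f (path \<omega>))\<^sup>2)"
  using chaos_integration_by_parts[OF assms chaos_poly_cylindrical[OF assms]]
  by (simp add: dot_square_norm flip: power2_eq_square)

text \<open>
  Integration by parts against \<open>F\<^sup>3\<close>.
\<close>

lemma fourth_moment_by_grad:
  assumes f: "chaos_poly n f v"
  shows "real n * expectation (\<lambda>\<omega>. f (path \<omega>) ^ 4)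
    = 3 * expectation (\<lambda>\<omega>. (f (path \<omega>))\<^sup>2 * (norm (v (path \<omega>)))\<^sup>2)"
proof -
  note c = chaos_poly_cylindrical[OF f]
  have "real n * expectation (\<lambda>\<omega>. f (path \<omega>) * (f (path \<omega>) * (f (path \<omega>) * f (path \<omega>))))
     = expectation (\<lambda>\<omega>. v (path \<omega>) \<bullet> (f (path \<omega>) *\<^sub>R (f (path \<omega>) *\<^sub>R v (path \<omega>) + f (path \<omega>) *\<^sub>R v (path \<omega>))
        + (f (path \<omega>) * f (path \<omega>)) *\<^sub>R v (path \<omega>)))"
    by (rule chaos_integration_by_parts[OF f cylindrical_mult[OF c cylindrical_mult[OF c c]]])
  also have "\<dots> = expectation (\<lambda>\<omega>. 3 * ((f (path \<omega>))\<^sup>2 * (norm (v (path \<omega>)))\<^sup>2))"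
    by (simp add: inner_add_right dot_square_norm power2_eq_square algebra_simps)
  finally show ?thesis by (simp add: power4_eq_xxxx mult.assoc)
qed

lemma grad_fourth_moment_of_components:
  assumes f: "chaos_poly (Suc n) f v" and K: "0 \<le> K"
    and IH: "\<And>g w. chaos_poly n g w \<Longrightarrow>
      expectation (\<lambda>\<omega>. g (path \<omega>) ^ 4) \<le> (K * expectation (\<lambda>\<omega>. (g (path \<omega>))\<^sup>2))\<^sup>2"
  shows "expectation (\<lambda>\<omega>. norm (v (path \<omega>)) ^ 4) \<le> (K * (real (Suc n) * expectation (\<lambda>\<omega>. (f (path \<omega>))\<^sup>2)))\<^sup>2"
proof -
  obtain S where S: "finite S" "\<And>x. v x \<in> span S" using chaos_poly_grad_span[OF f] by blast
  obtain B where B: "finite B" "\<And>x. (norm (v x))\<^sup>2 = (\<Sum>e\<in>B. (v x \<bullet> e)\<^sup>2)"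
    using exists_orthonormal_coordinates[OF S(1)] S(2) by blast
  have comp: "\<exists>w. chaos_poly n (\<lambda>x. v x \<bullet> e) w" for e by (rule chaos_poly_grad_component[OF f])
  have "expectation (\<lambda>\<omega>. (\<Sum>e\<in>B. (v (path \<omega>) \<bullet> e)\<^sup>2)\<^sup>2)
      \<le> (K * expectation (\<lambda>\<omega>. \<Sum>e\<in>B. (v (path \<omega>) \<bullet> e)\<^sup>2))\<^sup>2"
  proof (rule fourth_moment_of_sum_of_squares[OF B(1) _ K])
    fix e
    obtain w where w: "chaos_poly n (\<lambda>x. v x \<bullet> e) w" using comp by blast
    show "all_moments M (\<lambda>\<omega>. v (path \<omega>) \<bullet> e)"
      using cylindricalD(5)[OF chaos_poly_cylindrical[OF w]] .
    show "expectation (\<lambda>\<omega>. (v (path \<omega>) \<bullet> e) ^ 4) \<le> (K * expectation (\<lambda>\<omega>. (v (path \<omega>) \<bullet> e)\<^sup>2))\<^sup>2"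
      using IH[OF w] .
  qed
  then have "expectation (\<lambda>\<omega>. ((norm (v (path \<omega>)))\<^sup>2)\<^sup>2)
      \<le> (K * expectation (\<lambda>\<omega>. (norm (v (path \<omega>)))\<^sup>2))\<^sup>2"
    by (simp only: B(2))
  moreover have "((norm y)\<^sup>2)\<^sup>2 = norm y ^ 4" for y :: 'h by (simp flip: power_mult)
  ultimately show ?thesis by (simp only: chaos_poly_norm_grad[OF f])
qed

text \<open>
  Combining \<open>n E[F\<^sup>4] = 3 E[F\<^sup>2 \<parallel>DF\<parallel>\<^sup>2]\<close> with the Cauchy-Schwarz inequality gives
  \<open>n\<^sup>2 E[F\<^sup>4] \<le> 9 E[\<parallel>DF\<parallel>\<^sup>4]\<close>. The induction hypothesis for the components of the gradient bounds the
  right-hand side by second moments, and \<open>E[\<parallel>DF\<parallel>\<^sup>2] = n E[F\<^sup>2]\<close> cancels the factor \<open>n\<^sup>2\<close>.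
\<close>

theorem chaos_poly_hypercontractive:
  "chaos_poly n f v \<Longrightarrow> expectation (\<lambda>\<omega>. f (path \<omega>) ^ 4) \<le> (3 ^ n * expectation (\<lambda>\<omega>. (f (path \<omega>))\<^sup>2))\<^sup>2"
proof (induction n arbitrary: f v)
  case 0
  then obtain S c where f: "f = hermite_sum S c 0" by (auto simp: chaos_poly_def)
  then have "f x = (\<Sum>h\<in>S. c h)" for x by (simp add: hermite_sum_def)
  then show ?case by (simp add: prob_space flip: power_mult)
next
  case (Suc n)
  let ?a = "expectation (\<lambda>\<omega>. f (path \<omega>) ^ 4)" and ?b = "expectation (\<lambda>\<omega>. norm (v (path \<omega>)) ^ 4)"
  let ?N = "real (Suc n)"
  note am = cylindricalD(5,6)[OF chaos_poly_cylindrical[OF Suc.prems]]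
  have L: "(\<lambda>\<omega>. (f (path \<omega>))\<^sup>2) \<in> L2 M" "(\<lambda>\<omega>. (norm (v (path \<omega>)))\<^sup>2) \<in> L2 M"
    by (intro all_moments_L2 all_moments_power all_moments_norm am finite_measure_axioms)+
  have a0: "0 \<le> ?a" by simp
  have "?N * ?a = 3 * expectation (\<lambda>\<omega>. (f (path \<omega>))\<^sup>2 * (norm (v (path \<omega>)))\<^sup>2)"
    by (rule fourth_moment_by_grad[OF Suc.prems])
  also have "\<dots> \<le> 3 * (sqrt ?a * sqrt ?b)"
    using L2_cauchy_schwarz[OF L] by (simp flip: power_mult)
  finally have "(?N * ?a)\<^sup>2 \<le> (3 * (sqrt ?a * sqrt ?b))\<^sup>2"
    using a0 by (intro power_mono) auto
  then have "?a * (?N\<^sup>2 * ?a) \<le> ?a * (9 * ?b)"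
    using a0 by (simp add: power_mult_distrib power2_eq_square algebra_simps del: of_nat_Suc)
  then have "?N\<^sup>2 * ?a \<le> 9 * ?b"
    using a0 by (cases "?a = 0") (auto simp del: of_nat_Suc)
  also have "\<dots> \<le> 9 * (3 ^ n * (?N * expectation (\<lambda>\<omega>. (f (path \<omega>))\<^sup>2)))\<^sup>2"
    using grad_fourth_moment_of_components[OF Suc.prems _ Suc.IH] by simp
  also have "\<dots> = ?N\<^sup>2 * (3 ^ Suc n * expectation (\<lambda>\<omega>. (f (path \<omega>))\<^sup>2))\<^sup>2"
    by (simp add: power_mult_distrib del: of_nat_Suc)
  finally show ?case by (subst (asm) mult_le_cancel_left_pos) auto
qed

lemma chaos_poly_grad_hypercontractive:
  assumes f: "chaos_poly n f v"
  shows "expectation (\<lambda>\<omega>. norm (v (path \<omega>)) ^ 4) \<le> (3 ^ n * (real n * expectation (\<lambda>\<omega>. (f (path \<omega>))\<^sup>2)))\<^sup>2"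
proof (cases n)
  case 0
  with f have "v x = 0" for x by (auto simp: chaos_poly_def hermite_grad_def)
  then have "expectation (\<lambda>\<omega>. norm (v (path \<omega>)) ^ 4) = 0" by simp
  then show ?thesis by (simp only: zero_le_power2)
next
  case (Suc m)
  have "expectation (\<lambda>\<omega>. norm (v (path \<omega>)) ^ 4)
      \<le> (3 ^ m * (real (Suc m) * expectation (\<lambda>\<omega>. (f (path \<omega>))\<^sup>2)))\<^sup>2"
    using f unfolding Suc by (rule grad_fourth_moment_of_components) (use chaos_poly_hypercontractive in auto)
  also have "\<dots> \<le> (3 ^ n * (real n * expectation (\<lambda>\<omega>. (f (path \<omega>))\<^sup>2)))\<^sup>2"
    unfolding Suc by (intro power_mono mult_right_mono) (auto simp del: of_nat_Suc)
  finally show ?thesis .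
qed

end

section \<open>The chaos decomposition\<close>

context gaussian_space
begin

lemma hermite_X_L2: "norm h = 1 \<Longrightarrow> (\<lambda>\<omega>. poly p (X h \<omega>)) \<in> L2 M"
  by (intro all_moments_L2 all_moments_poly_X)

lemma const_L2: "(\<lambda>\<omega>. c) \<in> L2 M"
  by (intro all_moments_L2 all_moments_bounded[OF _ order_refl]) simp

lemma L2_imp_integrable: "(f :: 'a \<Rightarrow> real) \<in> L2 M \<Longrightarrow> integrable M f"
  using integrable_mult_L2[OF _ const_L2, of f 1] by simp

lemma chaos_polyE:
  assumes "chaos_poly n f v"
  obtains S c where "finite S" "\<And>h. h \<in> S \<Longrightarrow> norm h = 1" "\<And>x. f x = (\<Sum>h\<in>S. c h * poly (hermite n) (x h))"
proof -
  obtain S c where "finite S" "S \<subseteq> {h. norm h = 1}" "f = hermite_sum S c n"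
    using assms unfolding chaos_poly_def by blast
  then show ?thesis by (intro that[of S c]) (auto simp: hermite_sum_def)
qed

lemma hermite_mean_zero:
  assumes "norm h = 1" "n \<ge> 1"
  shows "expectation (\<lambda>\<omega>. poly (hermite n) (X h \<omega>)) = 0"
proof -
  obtain m where "n = Suc m" using assms(2) by (cases n) auto
  then show ?thesis
    using hermite_integration_by_parts[OF cylindrical_const[of 1] assms(1), of m] by simp
qed

text \<open>
  Each integration by parts lowers the order \<open>k\<close> of the Hermite factor by one and differentiates
  one of the other two factors, which together admit at most \<open>p + q\<close> derivatives.
\<close>

lemma chaos_product_degree:
  assumes "norm l = 1"
  shows "chaos_poly p f v \<Longrightarrow> chaos_poly q g w \<Longrightarrow> k > p + q \<Longrightarrow>
    expectation (\<lambda>\<omega>. poly (hermite k) (X l \<omega>) * (f (path \<omega>) * g (path \<omega>))) = 0"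
proof (induction k arbitrary: p q f v g w)
  case 0
  then show ?case by simp
next
  case (Suc k)
  let ?H = "\<lambda>\<omega>. poly (hermite k) (X l \<omega>)"
  have part: "expectation (\<lambda>\<omega>. ?H \<omega> * ((v (path \<omega>) \<bullet> l) * g (path \<omega>))) = 0
      \<and> integrable M (\<lambda>\<omega>. ?H \<omega> * ((v (path \<omega>) \<bullet> l) * g (path \<omega>)))"
    if f: "chaos_poly p f v" and g: "chaos_poly q g w" and k: "Suc k > p + q" for p q f v g w
  proof (cases p)
    case 0
    with f have "v x = 0" for x by (auto simp: chaos_poly_def hermite_grad_def)
    then show ?thesis by simp
  next
    case (Suc p')
    then obtain u where u: "chaos_poly p' (\<lambda>x. v x \<bullet> l) u"
      using chaos_poly_grad_component f by blast
    have "integrable M (\<lambda>\<omega>. ?H \<omega> * ((v (path \<omega>) \<bullet> l) * g (path \<omega>)))"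
      using assms cylindricalD(5)[OF chaos_poly_cylindrical[OF u]] cylindricalD(5)[OF chaos_poly_cylindrical[OF g]]
      by (intro all_moments_integrable all_moments_mult all_moments_poly_X)
    then show ?thesis using Suc.IH[OF u g] k Suc by simp
  qed
  have "expectation (\<lambda>\<omega>. poly (hermite (Suc k)) (X l \<omega>) * (f (path \<omega>) * g (path \<omega>)))
    = expectation (\<lambda>\<omega>. ?H \<omega> * ((f (path \<omega>) *\<^sub>R w (path \<omega>) + g (path \<omega>) *\<^sub>R v (path \<omega>)) \<bullet> l))"
    using Suc.prems by (intro hermite_integration_by_parts cylindrical_mult assms chaos_poly_cylindrical)
  also have "\<dots> = expectation (\<lambda>\<omega>. ?H \<omega> * ((w (path \<omega>) \<bullet> l) * f (path \<omega>)) + ?H \<omega> * ((v (path \<omega>) \<bullet> l) * g (path \<omega>)))"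
    by (simp add: inner_add_left algebra_simps)
  also have "\<dots> = 0"
    using part[OF Suc.prems(1,2)] part[OF Suc.prems(2,1)] Suc.prems(3) by (simp add: add.commute)
  finally show ?case .
qed

lemma hermite_X_chaos_poly:
  assumes "norm h = 1"
  shows "chaos_poly n (\<lambda>x. poly (hermite n) (x h)) (\<lambda>x. poly (pderiv (hermite n)) (x h) *\<^sub>R h)"
  unfolding chaos_poly_def using assms
  by (intro exI[of _ "{h}"] exI[of _ "\<lambda>_. 1"]) (auto simp: hermite_sum_def hermite_grad_def)

lemma hermite_orthogonal:
  assumes "norm h = 1" "norm g = 1" "n \<noteq> m"
  shows "expectation (\<lambda>\<omega>. poly (hermite n) (X h \<omega>) * poly (hermite m) (X g \<omega>)) = 0"
proof -
  have *: "expectation (\<lambda>\<omega>. poly (hermite n) (X h \<omega>) * poly (hermite m) (X g \<omega>)) = 0"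
    if "norm h = 1" "norm g = 1" "n > m" for h g n m
    using chaos_product_degree[OF that(1) hermite_X_chaos_poly[OF that(2), of m]
        hermite_X_chaos_poly[OF that(2), of 0], of n] that(3) by simp
  show ?thesis
  proof (cases "n > m")
    case True
    then show ?thesis using * assms by blast
  next
    case False
    then have "expectation (\<lambda>\<omega>. poly (hermite m) (X g \<omega>) * poly (hermite n) (X h \<omega>)) = 0"
      using assms by (intro *) auto
    then show ?thesis by (simp add: mult.commute)
  qed
qed

text \<open>
  Order 0 is separate because the constants are in the chaos even when there are no unit vectors
  at all.
\<close>

definition chaos_orthogonal :: "nat \<Rightarrow> ('a \<Rightarrow> real) \<Rightarrow> bool" where
  "chaos_orthogonal n R \<longleftrightarrow> (if n = 0 then expectation R = 0
     else (\<forall>h. norm h = 1 \<longrightarrow> expectation (\<lambda>\<omega>. R \<omega> * poly (hermite n) (X h \<omega>)) = 0))"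

lemma hermite_span_chaos_poly:
  assumes "G \<in> hermite_span X n"
  shows "\<exists>f v. chaos_poly n f v \<and> G = (\<lambda>\<omega>. f (path \<omega>))"
proof -
  obtain S c where S: "finite S" "S \<subseteq> {h. norm h = 1}" "G = (\<lambda>\<omega>. \<Sum>h\<in>S. c h * poly (hermite n) (X h \<omega>))"
    using assms unfolding hermite_span_def by blast
  then have "chaos_poly n (hermite_sum S c n) (hermite_grad S c n)" "G = (\<lambda>\<omega>. hermite_sum S c n (path \<omega>))"
    by (auto simp: chaos_poly_def hermite_sum_def)
  then show ?thesis by blast
qed

lemma chaos_poly_in_span:
  assumes "chaos_poly n f v"
  shows "(\<lambda>\<omega>. f (path \<omega>)) \<in> hermite_span X n"
  using assms unfolding chaos_poly_def hermite_span_def hermite_sum_def by blast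

lemma chaos_poly_L2: "chaos_poly n f v \<Longrightarrow> (\<lambda>\<omega>. f (path \<omega>)) \<in> L2 M"
  by (intro all_moments_L2 cylindricalD(5)[OF chaos_poly_cylindrical])

lemma chaos_orthogonal_poly:
  assumes "chaos_orthogonal n R" "R \<in> L2 M" "chaos_poly n f v" "n \<ge> 1"
  shows "expectation (\<lambda>\<omega>. R \<omega> * f (path \<omega>)) = 0"
proof -
  obtain S c where S: "finite S" "\<And>h. h \<in> S \<Longrightarrow> norm h = 1" "\<And>x. f x = (\<Sum>h\<in>S. c h * poly (hermite n) (x h))"
    by (rule chaos_polyE[OF assms(3)]) (rule that)
  have "expectation (\<lambda>\<omega>. R \<omega> * f (path \<omega>)) = expectation (\<lambda>\<omega>. \<Sum>h\<in>S. c h * (R \<omega> * poly (hermite n) (X h \<omega>)))"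
    by (simp add: S(3) sum_distrib_left mult_ac)
  also have "\<dots> = (\<Sum>h\<in>S. c h * expectation (\<lambda>\<omega>. R \<omega> * poly (hermite n) (X h \<omega>)))"
    by (subst Bochner_Integration.integral_sum)
      (auto intro!: integrable_mult_right integrable_mult_L2 assms hermite_X_L2 S(2))
  also have "\<dots> = 0"
    using assms(1,4) S(2) by (intro sum.neutral) (auto simp: chaos_orthogonal_def)
  finally show ?thesis .
qed

lemma L2_approx_orthogonal:
  fixes R G :: "'a \<Rightarrow> real"
  assumes "R \<in> L2 M" "G \<in> L2 M"
    and approx: "\<And>\<epsilon>. \<epsilon> > 0 \<Longrightarrow> \<exists>Z\<in>L2 M. expectation (\<lambda>\<omega>. R \<omega> * Z \<omega>) = 0 \<and> expectation (\<lambda>\<omega>. (G \<omega> - Z \<omega>)\<^sup>2) < \<epsilon>"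
  shows "expectation (\<lambda>\<omega>. R \<omega> * G \<omega>) = 0"
proof -
  let ?r = "sqrt (expectation (\<lambda>\<omega>. (R \<omega>)\<^sup>2))"
  have "\<bar>expectation (\<lambda>\<omega>. R \<omega> * G \<omega>)\<bar> \<le> 0 + \<epsilon>" if "\<epsilon> > 0" for \<epsilon>
  proof -
    have r: "0 \<le> ?r" by simp
    \<comment> \<open>Adding 1 covers \<open>R = 0\<close>.\<close>
    define \<delta> where "\<delta> = (\<epsilon> / (?r + 1))\<^sup>2"
    have "\<delta> > 0" unfolding \<delta>_def using that r by (intro zero_less_power divide_pos_pos) linarith+
    then obtain Z where Z: "Z \<in> L2 M" "expectation (\<lambda>\<omega>. R \<omega> * Z \<omega>) = 0" "expectation (\<lambda>\<omega>. (G \<omega> - Z \<omega>)\<^sup>2) < \<delta>"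
      using approx by blast
    have "expectation (\<lambda>\<omega>. R \<omega> * G \<omega>) = expectation (\<lambda>\<omega>. R \<omega> * (G \<omega> - Z \<omega>))"
      using integrable_mult_L2[OF assms(1,2)] integrable_mult_L2[OF assms(1) Z(1)] Z(2)
      by (simp add: right_diff_distrib)
    also have "\<bar>\<dots>\<bar> \<le> ?r * sqrt (expectation (\<lambda>\<omega>. (G \<omega> - Z \<omega>)\<^sup>2))"
      by (rule L2_cauchy_schwarz[OF assms(1) L2_diff[OF assms(2) Z(1)]])
    also have "\<dots> \<le> ?r * sqrt \<delta>" using Z(3) r by (intro mult_left_mono) auto
    also have "\<dots> = ?r * (\<epsilon> / (?r + 1))" unfolding \<delta>_def using that r by simp
    also have "\<dots> = \<epsilon> * (?r / (?r + 1))" by simp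
    also have "\<dots> \<le> \<epsilon> * 1" 
    proof (rule mult_left_mono)
      have "0 < ?r + 1" using r by linarith
      then show "?r / (?r + 1) \<le> 1" by (simp only: divide_le_eq_1_pos)
    qed (use that in simp)
    finally show ?thesis by simp
  qed
  then have "\<bar>expectation (\<lambda>\<omega>. R \<omega> * G \<omega>)\<bar> \<le> 0" by (rule field_le_epsilon)
  then show ?thesis by simp
qed

lemma wiener_chaos_L2: "G \<in> wiener_chaos M X n \<Longrightarrow> G \<in> L2 M"
  by (auto simp: wiener_chaos_def split: if_splits)

lemma wiener_chaos_approx:
  assumes "G \<in> wiener_chaos M X n" "n \<ge> 1" "\<epsilon> > 0"
  shows "\<exists>f v. chaos_poly n f v \<and> expectation (\<lambda>\<omega>. (G \<omega> - f (path \<omega>))\<^sup>2) < \<epsilon>"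
proof -
  obtain Z where "Z \<in> hermite_span X n" "expectation (\<lambda>\<omega>. (G \<omega> - Z \<omega>)\<^sup>2) < \<epsilon>"
    using assms by (auto simp: wiener_chaos_def)
  with hermite_span_chaos_poly show ?thesis by blast
qed

lemma chaos_orthogonal_chaos:
  assumes R: "chaos_orthogonal n R" "R \<in> L2 M" and G: "G \<in> wiener_chaos M X n"
  shows "expectation (\<lambda>\<omega>. R \<omega> * G \<omega>) = 0"
proof (cases "n = 0")
  case True
  then obtain c where c: "AE \<omega> in M. G \<omega> = c" using G by (auto simp: wiener_chaos_def)
  note [measurable] = L2_measurable[OF R(2)] L2_measurable[OF wiener_chaos_L2[OF G]]
  have "expectation (\<lambda>\<omega>. R \<omega> * G \<omega>) = expectation (\<lambda>\<omega>. R \<omega> * c)"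
    using c by (intro integral_cong_AE) (auto elim: eventually_mono)
  then show ?thesis using R(1) True by (simp add: chaos_orthogonal_def)
next
  case False
  show ?thesis
  proof (rule L2_approx_orthogonal[OF R(2) wiener_chaos_L2[OF G]])
    fix \<epsilon> :: real assume "\<epsilon> > 0"
    then obtain f v where "chaos_poly n f v" "expectation (\<lambda>\<omega>. (G \<omega> - f (path \<omega>))\<^sup>2) < \<epsilon>"
      using wiener_chaos_approx[OF G] False by (metis One_nat_def Suc_leI neq0_conv)
    then show "\<exists>Z\<in>L2 M. expectation (\<lambda>\<omega>. R \<omega> * Z \<omega>) = 0 \<and> expectation (\<lambda>\<omega>. (G \<omega> - Z \<omega>)\<^sup>2) < \<epsilon>"
      using chaos_orthogonal_poly[OF R] chaos_poly_L2 False
      by (intro bexI[of _ "\<lambda>\<omega>. f (path \<omega>)"]) auto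
  qed
qed

lemma hermite_X_in_chaos:
  assumes "norm h = 1"
  shows "(\<lambda>\<omega>. poly (hermite n) (X h \<omega>)) \<in> wiener_chaos M X n"
proof (cases "n = 0")
  case True
  then show ?thesis using const_L2[of 1] by (auto simp: wiener_chaos_def)
next
  case False
  have "(\<lambda>\<omega>. poly (hermite n) (X h \<omega>)) \<in> hermite_span X n"
    using chaos_poly_in_span[OF hermite_X_chaos_poly[OF assms]] .
  then show ?thesis using False hermite_X_L2[OF assms] by (force simp: wiener_chaos_def)
qed

lemma wiener_chaos_orthogonal_hermite:
  assumes G: "G \<in> wiener_chaos M X n" and "n \<noteq> m"
  shows "chaos_orthogonal m G"
proof -
  have herm: "chaos_orthogonal n (\<lambda>\<omega>. poly (hermite m) (X h \<omega>))" if "norm h = 1" "m \<ge> 1" for h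
    unfolding chaos_orthogonal_def
    using that hermite_mean_zero hermite_orthogonal[OF that(1) _ \<open>n \<noteq> m\<close>[symmetric]] by auto
  have one: "chaos_orthogonal n (\<lambda>\<omega>. 1)" if "n \<ge> 1"
    unfolding chaos_orthogonal_def using hermite_mean_zero that by auto
  show ?thesis
  proof (cases "m = 0")
    case True
    then show ?thesis
      using chaos_orthogonal_chaos[OF one const_L2 G] \<open>n \<noteq> m\<close> by (simp add: chaos_orthogonal_def)
  next
    case False
    then show ?thesis
      using chaos_orthogonal_chaos[OF herm hermite_X_L2 G] by (simp add: chaos_orthogonal_def mult.commute)
  qed
qed

lemma wiener_chaos_orthogonal:
  assumes "F \<in> wiener_chaos M X n" "G \<in> wiener_chaos M X m" "n \<noteq> m"
  shows "expectation (\<lambda>\<omega>. F \<omega> * G \<omega>) = 0"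
  by (rule chaos_orthogonal_chaos[OF wiener_chaos_orthogonal_hermite[OF assms(1,3)] wiener_chaos_L2[OF assms(1)] assms(2)])

lemma chaos_poly_cmult:
  assumes "chaos_poly n f v"
  shows "\<exists>u. chaos_poly n (\<lambda>x. c * f x) u"
proof -
  obtain S d where S: "finite S" "S \<subseteq> {h. norm h = 1}" "f = hermite_sum S d n"
    using assms unfolding chaos_poly_def by blast
  then have "(\<lambda>x. c * f x) = hermite_sum S (\<lambda>h. c * d h) n"
    by (auto simp: hermite_sum_def sum_distrib_left mult.assoc)
  then show ?thesis using S(1,2) unfolding chaos_poly_def by blast
qed

lemma chaos_poly_add:
  assumes "chaos_poly n f v" "chaos_poly n g w"
  shows "\<exists>u. chaos_poly n (\<lambda>x. f x + g x) u"
proof -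
  obtain u where "chaos_poly n (\<lambda>x. - 1 * g x) u" using chaos_poly_cmult[OF assms(2)] by blast
  from chaos_poly_diff[OF assms(1) this] show ?thesis by auto
qed

lemma chaos_poly_in_chaos:
  assumes "chaos_poly n f v"
  shows "(\<lambda>\<omega>. f (path \<omega>)) \<in> wiener_chaos M X n"
proof (cases "n = 0")
  case True
  obtain S c where "\<And>x. f x = (\<Sum>h\<in>S. c h * poly (hermite n) (x h))"
    by (rule chaos_polyE[OF assms]) (rule that)
  then have "f x = (\<Sum>h\<in>S. c h)" for x using True by simp
  then show ?thesis using True chaos_poly_L2[OF assms] by (auto simp: wiener_chaos_def)
next
  case False
  then show ?thesis using chaos_poly_in_span[OF assms] chaos_poly_L2[OF assms]
    by (force simp: wiener_chaos_def)
qed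

lemma L2_square_add_le:
  fixes f g :: "'a \<Rightarrow> real"
  assumes "f \<in> L2 M" "g \<in> L2 M"
  shows "expectation (\<lambda>\<omega>. (f \<omega> + g \<omega>)\<^sup>2) \<le> 2 * expectation (\<lambda>\<omega>. (f \<omega>)\<^sup>2) + 2 * expectation (\<lambda>\<omega>. (g \<omega>)\<^sup>2)"
proof -
  have "expectation (\<lambda>\<omega>. (f \<omega> + g \<omega>)\<^sup>2) \<le> expectation (\<lambda>\<omega>. 2 * (f \<omega>)\<^sup>2 + 2 * (g \<omega>)\<^sup>2)"
  proof (rule integral_mono)
    show "(f \<omega> + g \<omega>)\<^sup>2 \<le> 2 * (f \<omega>)\<^sup>2 + 2 * (g \<omega>)\<^sup>2" for \<omega>
      using sum_squares_bound[of "f \<omega>" "g \<omega>"] by (simp add: power2_sum)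
  qed (use assms L2_add[OF assms] in \<open>auto intro!: Bochner_Integration.integrable_add integrable_mult_right L2_integrable_real\<close>)
  also have "\<dots> = 2 * expectation (\<lambda>\<omega>. (f \<omega>)\<^sup>2) + 2 * expectation (\<lambda>\<omega>. (g \<omega>)\<^sup>2)"
    using assms by (simp add: L2_integrable_real)
  finally show ?thesis .
qed

lemma wiener_chaos_add:
  assumes F: "F \<in> wiener_chaos M X n" and G: "G \<in> wiener_chaos M X n"
  shows "(\<lambda>\<omega>. F \<omega> + G \<omega>) \<in> wiener_chaos M X n"
proof (cases "n = 0")
  case True
  then obtain a b where "AE \<omega> in M. F \<omega> = a" "AE \<omega> in M. G \<omega> = b"
    using F G by (auto simp: wiener_chaos_def)
  then have "AE \<omega> in M. F \<omega> + G \<omega> = a + b" by eventually_elim simp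
  then show ?thesis using True L2_add[OF wiener_chaos_L2[OF F] wiener_chaos_L2[OF G]]
    by (auto simp: wiener_chaos_def)
next
  case False
  have "\<exists>Z\<in>hermite_span X n. expectation (\<lambda>\<omega>. (F \<omega> + G \<omega> - Z \<omega>)\<^sup>2) < \<epsilon>" if "\<epsilon> > 0" for \<epsilon>
  proof -
    have n: "n \<ge> 1" "\<epsilon> / 4 > 0" using False that by auto
    obtain f v where f: "chaos_poly n f v" "expectation (\<lambda>\<omega>. (F \<omega> - f (path \<omega>))\<^sup>2) < \<epsilon> / 4"
      using wiener_chaos_approx[OF F n] by blast
    obtain g w where g: "chaos_poly n g w" "expectation (\<lambda>\<omega>. (G \<omega> - g (path \<omega>))\<^sup>2) < \<epsilon> / 4"
      using wiener_chaos_approx[OF G n] by blast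
    obtain u where u: "chaos_poly n (\<lambda>x. f x + g x) u" using chaos_poly_add[OF f(1) g(1)] by blast
    have "expectation (\<lambda>\<omega>. (F \<omega> + G \<omega> - (f (path \<omega>) + g (path \<omega>)))\<^sup>2)
        = expectation (\<lambda>\<omega>. ((F \<omega> - f (path \<omega>)) + (G \<omega> - g (path \<omega>)))\<^sup>2)"
      by (simp add: algebra_simps)
    also have "\<dots> \<le> 2 * expectation (\<lambda>\<omega>. (F \<omega> - f (path \<omega>))\<^sup>2) + 2 * expectation (\<lambda>\<omega>. (G \<omega> - g (path \<omega>))\<^sup>2)"
      by (intro L2_square_add_le L2_diff chaos_poly_L2[OF f(1)] chaos_poly_L2[OF g(1)]
        wiener_chaos_L2[OF F] wiener_chaos_L2[OF G])
    also have "\<dots> < \<epsilon>" using f(2) g(2) by linarith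
    finally show ?thesis using chaos_poly_in_span[OF u] by (rule bexI)
  qed
  then show ?thesis using False L2_add[OF wiener_chaos_L2[OF F] wiener_chaos_L2[OF G]]
    by (simp add: wiener_chaos_def)
qed

lemma wiener_chaos_cmult:
  assumes F: "F \<in> wiener_chaos M X n"
  shows "(\<lambda>\<omega>. c * F \<omega>) \<in> wiener_chaos M X n"
proof (cases "n = 0")
  case True
  then obtain a where "AE \<omega> in M. F \<omega> = a" using F by (auto simp: wiener_chaos_def)
  then have "AE \<omega> in M. c * F \<omega> = c * a" by eventually_elim simp
  then show ?thesis using True L2_mult[OF wiener_chaos_L2[OF F]] by (auto simp: wiener_chaos_def)
next
  case False
  have "\<exists>Z\<in>hermite_span X n. expectation (\<lambda>\<omega>. (c * F \<omega> - Z \<omega>)\<^sup>2) < \<epsilon>" if "\<epsilon> > 0" for \<epsilon>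
  proof -
    have n: "n \<ge> 1" "\<epsilon> / (c\<^sup>2 + 1) > 0" using False that by (auto intro!: divide_pos_pos add_nonneg_pos)
    obtain f v where f: "chaos_poly n f v" "expectation (\<lambda>\<omega>. (F \<omega> - f (path \<omega>))\<^sup>2) < \<epsilon> / (c\<^sup>2 + 1)"
      using wiener_chaos_approx[OF F n] by blast
    obtain u where u: "chaos_poly n (\<lambda>x. c * f x) u" using chaos_poly_cmult[OF f(1)] by blast
    have c1: "0 < c\<^sup>2 + 1" by (intro add_nonneg_pos) auto
    have "expectation (\<lambda>\<omega>. (c * F \<omega> - c * f (path \<omega>))\<^sup>2) = c\<^sup>2 * expectation (\<lambda>\<omega>. (F \<omega> - f (path \<omega>))\<^sup>2)"
      by (simp flip: right_diff_distrib add: power_mult_distrib)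
    also have "\<dots> \<le> (c\<^sup>2 + 1) * expectation (\<lambda>\<omega>. (F \<omega> - f (path \<omega>))\<^sup>2)"
      by (intro mult_right_mono) auto
    also have "\<dots> < \<epsilon>" using f(2) c1 by (simp add: field_simps)
    finally show ?thesis using chaos_poly_in_span[OF u] by (rule bexI)
  qed
  then show ?thesis using False L2_mult[OF wiener_chaos_L2[OF F]] by (simp add: wiener_chaos_def)
qed

text \<open>
  For order 0 the best constant is the mean: \<open>G - E[G]\<close> is orthogonal to constants and
  approximated by constants, hence orthogonal to itself.
\<close>

lemma wiener_chaos_closed:
  assumes G: "G \<in> L2 M"
    and approx: "\<And>\<epsilon>. \<epsilon> > 0 \<Longrightarrow> \<exists>F\<in>wiener_chaos M X n. expectation (\<lambda>\<omega>. (G \<omega> - F \<omega>)\<^sup>2) < \<epsilon>"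
  shows "G \<in> wiener_chaos M X n"
proof (cases "n = 0")
  case True
  define c where "c = expectation G"
  have Gi: "integrable M G" by (rule L2_imp_integrable[OF G])
  have "expectation (\<lambda>\<omega>. (G \<omega> - c) * (G \<omega> - c)) = 0"
  proof (rule L2_approx_orthogonal)
    show L: "(\<lambda>\<omega>. G \<omega> - c) \<in> L2 M" "(\<lambda>\<omega>. G \<omega> - c) \<in> L2 M" by (intro L2_diff G const_L2)+
    fix \<epsilon> :: real assume "\<epsilon> > 0"
    then obtain F where F: "F \<in> wiener_chaos M X n" "expectation (\<lambda>\<omega>. (G \<omega> - F \<omega>)\<^sup>2) < \<epsilon>"
      using approx by blast
    then obtain a where a: "AE \<omega> in M. F \<omega> = a" using True by (auto simp: wiener_chaos_def)
    note [measurable] = L2_measurable[OF G] L2_measurable[OF wiener_chaos_L2[OF F(1)]]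
    have "expectation (\<lambda>\<omega>. (G \<omega> - F \<omega>)\<^sup>2) = expectation (\<lambda>\<omega>. (G \<omega> - c - (a - c))\<^sup>2)"
      using a by (intro integral_cong_AE) (auto elim: eventually_mono)
    moreover have "expectation (\<lambda>\<omega>. (G \<omega> - c) * (a - c)) = 0"
      using Gi by (simp add: c_def prob_space)
    ultimately show "\<exists>Z\<in>L2 M. expectation (\<lambda>\<omega>. (G \<omega> - c) * Z \<omega>) = 0 \<and> expectation (\<lambda>\<omega>. (G \<omega> - c - Z \<omega>)\<^sup>2) < \<epsilon>"
      using F(2) const_L2[of "a - c"] by (intro bexI[of _ "\<lambda>_. a - c"]) auto
  qed
  then have "expectation (\<lambda>\<omega>. (G \<omega> - c)\<^sup>2) = 0" by (simp add: power2_eq_square)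
  then have "AE \<omega> in M. (G \<omega> - c)\<^sup>2 = 0"
    using L2_integrable_real[OF L2_diff[OF G const_L2]] by (subst (asm) integral_nonneg_eq_0_iff_AE) auto
  then have "AE \<omega> in M. G \<omega> = c" by eventually_elim simp
  then show ?thesis using True G by (auto simp: wiener_chaos_def)
next
  case False
  have "\<exists>Z\<in>hermite_span X n. expectation (\<lambda>\<omega>. (G \<omega> - Z \<omega>)\<^sup>2) < \<epsilon>" if "\<epsilon> > 0" for \<epsilon>
  proof -
    have n: "n \<ge> 1" "\<epsilon> / 4 > 0" using False that by auto
    obtain F where F: "F \<in> wiener_chaos M X n" "expectation (\<lambda>\<omega>. (G \<omega> - F \<omega>)\<^sup>2) < \<epsilon> / 4"
      using approx[OF n(2)] by blast
    obtain f v where f: "chaos_poly n f v" "expectation (\<lambda>\<omega>. (F \<omega> - f (path \<omega>))\<^sup>2) < \<epsilon> / 4"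
      using wiener_chaos_approx[OF F(1) n] by blast
    have "expectation (\<lambda>\<omega>. (G \<omega> - f (path \<omega>))\<^sup>2) = expectation (\<lambda>\<omega>. ((G \<omega> - F \<omega>) + (F \<omega> - f (path \<omega>)))\<^sup>2)"
      by simp
    also have "\<dots> \<le> 2 * expectation (\<lambda>\<omega>. (G \<omega> - F \<omega>)\<^sup>2) + 2 * expectation (\<lambda>\<omega>. (F \<omega> - f (path \<omega>))\<^sup>2)"
      by (intro L2_square_add_le L2_diff chaos_poly_L2[OF f(1)] wiener_chaos_L2[OF F(1)] G)
    also have "\<dots> < \<epsilon>" using F(2) f(2) by linarith
    finally show ?thesis using chaos_poly_in_span[OF f(1)] by (rule bexI)
  qed
  then show ?thesis using False G by (simp add: wiener_chaos_def)
qed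

lemma chaos_projection:
  assumes F: "F \<in> L2 M"
  shows "chaos_projection M X n F \<in> wiener_chaos M X n"
    and "Z \<in> wiener_chaos M X n \<Longrightarrow> expectation (\<lambda>\<omega>. (F \<omega> - chaos_projection M X n F \<omega>) * Z \<omega>) = 0"
proof -
  have "(\<lambda>\<omega>. 0) \<in> wiener_chaos M X n"
  proof (rule wiener_chaos_closed[OF L2_zero])
    fix \<epsilon> :: real assume "\<epsilon> > 0"
    have "chaos_poly n (hermite_sum {} (\<lambda>_. 0) n) (hermite_grad {} (\<lambda>_. 0) n)"
      by (auto simp: chaos_poly_def)
    from chaos_poly_in_chaos[OF this] show "\<exists>F\<in>wiener_chaos M X n. expectation (\<lambda>\<omega>. (0 - F \<omega>)\<^sup>2) < \<epsilon>"
      using \<open>\<epsilon> > 0\<close> by (intro bexI[of _ "\<lambda>\<omega>. hermite_sum {} (\<lambda>_. 0) n (path \<omega>)"]) (auto simp: hermite_sum_def)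
  qed
  then have ne: "wiener_chaos M X n \<noteq> {}" by blast
  have "\<exists>G\<in>wiener_chaos M X n. \<forall>Z\<in>wiener_chaos M X n. expectation (\<lambda>\<omega>. (F \<omega> - G \<omega>) * Z \<omega>) = 0"
  proof (rule L2_projection[OF _ ne _ _ _ F])
    show "wiener_chaos M X n \<subseteq> L2 M" using wiener_chaos_L2 by blast
    show "(\<lambda>x. f x + g x) \<in> wiener_chaos M X n"
      if "f \<in> wiener_chaos M X n" "g \<in> wiener_chaos M X n" for f g
      using that by (rule wiener_chaos_add)
    show "(\<lambda>x. c * f x) \<in> wiener_chaos M X n" if "f \<in> wiener_chaos M X n" for f c
      using that by (rule wiener_chaos_cmult)
    show "g \<in> wiener_chaos M X n" if "g \<in> L2 M"
      "\<And>\<epsilon>. 0 < \<epsilon> \<Longrightarrow> \<exists>f\<in>wiener_chaos M X n. expectation (\<lambda>x. (g x - f x)\<^sup>2) < \<epsilon>" for g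
      by (rule wiener_chaos_closed[OF that(1)]) (rule that(2))
  qed
  then have "\<exists>G. is_chaos_projection M X n F G" unfolding is_chaos_projection_def by blast
  then have "is_chaos_projection M X n F (chaos_projection M X n F)"
    unfolding chaos_projection_def by (rule someI_ex)
  then show "chaos_projection M X n F \<in> wiener_chaos M X n"
    "Z \<in> wiener_chaos M X n \<Longrightarrow> expectation (\<lambda>\<omega>. (F \<omega> - chaos_projection M X n F \<omega>) * Z \<omega>) = 0"
    by (auto simp: is_chaos_projection_def)
qed


lemma chaos_projection_L2: "F \<in> L2 M \<Longrightarrow> chaos_projection M X n F \<in> L2 M"
  by (rule wiener_chaos_L2[OF chaos_projection(1)])

lemma chaos_projection_orthogonal:
  assumes F: "F \<in> L2 M"
  shows "chaos_orthogonal n (\<lambda>\<omega>. F \<omega> - chaos_projection M X n F \<omega>)"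
proof (cases "n = 0")
  case True
  have "(\<lambda>\<omega>. 1) \<in> wiener_chaos M X n" using True const_L2 by (auto simp: wiener_chaos_def)
  from chaos_projection(2)[OF F this] show ?thesis using True by (simp add: chaos_orthogonal_def)
next
  case False
  then show ?thesis
    unfolding chaos_orthogonal_def using chaos_projection(2)[OF F hermite_X_in_chaos] by simp
qed

lemma chaos_orthogonal_add:
  assumes "chaos_orthogonal n R" "chaos_orthogonal n Q" "R \<in> L2 M" "Q \<in> L2 M"
  shows "chaos_orthogonal n (\<lambda>\<omega>. R \<omega> + Q \<omega>)"
  using assms integrable_mult_L2[OF assms(3) hermite_X_L2] integrable_mult_L2[OF assms(4) hermite_X_L2]
    L2_imp_integrable[OF assms(3)] L2_imp_integrable[OF assms(4)]
  by (auto simp: chaos_orthogonal_def distrib_right)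

lemma chaos_orthogonal_cmult:
  assumes "chaos_orthogonal n R"
  shows "chaos_orthogonal n (\<lambda>\<omega>. c * R \<omega>)"
  using assms by (auto simp: chaos_orthogonal_def mult.assoc)

lemma chaos_orthogonal_diff:
  assumes "chaos_orthogonal n R" "chaos_orthogonal n Q" "R \<in> L2 M" "Q \<in> L2 M"
  shows "chaos_orthogonal n (\<lambda>\<omega>. R \<omega> - Q \<omega>)"
  using chaos_orthogonal_add[OF assms(1) chaos_orthogonal_cmult[OF assms(2), of "- 1"] assms(3) L2_mult[OF assms(4)]]
  by simp

lemma chaos_orthogonal_sum:
  assumes "finite I" "\<And>i. i \<in> I \<Longrightarrow> chaos_orthogonal n (R i)" "\<And>i. i \<in> I \<Longrightarrow> R i \<in> L2 M"
  shows "chaos_orthogonal n (\<lambda>\<omega>. \<Sum>i\<in>I. R i \<omega>)"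
  using assms
proof (induction I)
  case empty
  show ?case by (simp add: chaos_orthogonal_def)
next
  case (insert i I)
  then show ?case
    using chaos_orthogonal_add[of n "R i" "\<lambda>\<omega>. \<Sum>i\<in>I. R i \<omega>"] by (simp add: L2_sum)
qed

lemma expectation_sum_chaos_square:
  assumes "finite I" "\<And>n. n \<in> I \<Longrightarrow> G n \<in> wiener_chaos M X n"
  shows "expectation (\<lambda>\<omega>. (\<Sum>n\<in>I. G n \<omega>)\<^sup>2) = (\<Sum>n\<in>I. expectation (\<lambda>\<omega>. (G n \<omega>)\<^sup>2))"
proof -
  have int: "integrable M (\<lambda>\<omega>. G n \<omega> * G m \<omega>)" if "n \<in> I" "m \<in> I" for n m
    using assms(2)[OF that(1)] assms(2)[OF that(2)] by (intro integrable_mult_L2 wiener_chaos_L2)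
  have "expectation (\<lambda>\<omega>. (\<Sum>n\<in>I. G n \<omega>)\<^sup>2) = expectation (\<lambda>\<omega>. \<Sum>n\<in>I. \<Sum>m\<in>I. G n \<omega> * G m \<omega>)"
    by (simp add: power2_eq_square sum_product)
  also have "\<dots> = (\<Sum>n\<in>I. \<Sum>m\<in>I. expectation (\<lambda>\<omega>. G n \<omega> * G m \<omega>))"
    by (simp add: int Bochner_Integration.integral_sum Bochner_Integration.integrable_sum)
  also have "\<dots> = (\<Sum>n\<in>I. \<Sum>m\<in>I. if n = m then expectation (\<lambda>\<omega>. (G n \<omega>)\<^sup>2) else 0)"
    using assms(2) by (intro sum.cong refl) (auto simp: power2_eq_square intro: wiener_chaos_orthogonal)
  also have "\<dots> = (\<Sum>n\<in>I. expectation (\<lambda>\<omega>. (G n \<omega>)\<^sup>2))" using assms(1) by simp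
  finally show ?thesis .
qed

lemma chaos_projection_inner:
  assumes "F \<in> L2 M"
  shows "expectation (\<lambda>\<omega>. F \<omega> * chaos_projection M X n F \<omega>) = expectation (\<lambda>\<omega>. (chaos_projection M X n F \<omega>)\<^sup>2)"
  using chaos_projection(2)[OF assms chaos_projection(1)[OF assms], of n]
    integrable_mult_L2[OF assms chaos_projection_L2[OF assms]]
    integrable_mult_L2[OF chaos_projection_L2[OF assms] chaos_projection_L2[OF assms]]
  by (simp add: left_diff_distrib power2_eq_square)

lemma chaos_Bessel:
  assumes F: "F \<in> L2 M" and I: "finite I"
  shows "(\<Sum>n\<in>I. expectation (\<lambda>\<omega>. (chaos_projection M X n F \<omega>)\<^sup>2)) \<le> expectation (\<lambda>\<omega>. (F \<omega>)\<^sup>2)"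
proof -
  let ?J = "\<lambda>n. chaos_projection M X n F"
  let ?S = "\<lambda>\<omega>. \<Sum>n\<in>I. ?J n \<omega>"
  note J = chaos_projection_L2[OF F] and S = L2_sum[of I ?J M, OF chaos_projection_L2[OF F]]
  have "expectation (\<lambda>\<omega>. F \<omega> * ?S \<omega>) = (\<Sum>n\<in>I. expectation (\<lambda>\<omega>. F \<omega> * ?J n \<omega>))"
    using integrable_mult_L2[OF F J] by (simp add: sum_distrib_left)
  also have "\<dots> = expectation (\<lambda>\<omega>. (?S \<omega>)\<^sup>2)"
    unfolding chaos_projection_inner[OF F] by (rule expectation_sum_chaos_square[symmetric, OF I chaos_projection(1)[OF F]])
  finally have FS: "expectation (\<lambda>\<omega>. F \<omega> * ?S \<omega>) = expectation (\<lambda>\<omega>. (?S \<omega>)\<^sup>2)" .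
  have "0 \<le> expectation (\<lambda>\<omega>. (F \<omega> - ?S \<omega>)\<^sup>2)" by simp
  also have "\<dots> = expectation (\<lambda>\<omega>. (F \<omega>)\<^sup>2 + (?S \<omega>)\<^sup>2 - 2 * (F \<omega> * ?S \<omega>))"
    by (simp add: power2_diff mult.assoc)
  also have "\<dots> = expectation (\<lambda>\<omega>. (F \<omega>)\<^sup>2) + expectation (\<lambda>\<omega>. (?S \<omega>)\<^sup>2) - 2 * expectation (\<lambda>\<omega>. F \<omega> * ?S \<omega>)"
    using L2_integrable_real[OF F] L2_integrable_real[OF S] integrable_mult_L2[OF F S] by simp
  finally show ?thesis
    unfolding FS expectation_sum_chaos_square[OF I chaos_projection(1)[OF F]] by simp
qed

end

section \<open>Totality of the chaoses\<close>

locale generated_gaussian_space = gaussian_space M X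
  for M :: "'a measure" and X :: "'h::{real_inner,banach,second_countable_topology} \<Rightarrow> 'a \<Rightarrow> real" +
  assumes generated: "generated_by M X"
begin

text \<open>
  As \<open>X\<close> generates the \<open>\<sigma>\<close>-algebra, every event is an event about the path.
\<close>

lemma sets_path:
  assumes "E \<in> sets M"
  shows "\<exists>A\<in>sets path_space. E = {\<omega> \<in> space M. path \<omega> \<in> A}"
proof -
  have "E \<in> sigma_sets (space M) {X i -` B \<inter> space M | i B. B \<in> sets borel}"
    using assms generated unfolding generated_by_def by (rule subst[rotated])
  then show ?thesis
  proof (induction rule: sigma_sets.induct)
    case (Basic a)
    then obtain i B where iB: "a = X i -` B \<inter> space M" "B \<in> sets borel" by blast
    have "(\<lambda>x. x i) -` B \<inter> space path_space \<in> sets path_space"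
      using iB(2) by (intro measurable_sets[of _ _ borel]) auto
    then show ?case
      by (intro bexI[of _ "(\<lambda>x. x i) -` B \<inter> space path_space"]) (auto simp: iB(1) space_PiM)
  next
    case Empty
    show ?case by (rule bexI[of _ "{}"]) auto
  next
    case (Compl a)
    then obtain A where "A \<in> sets path_space" "a = {\<omega> \<in> space M. path \<omega> \<in> A}" by blast
    then show ?case by (intro bexI[OF _ sets.compl_sets[of A path_space]]) (auto simp: space_PiM)
  next
    case (Union a)
    then have "\<forall>i. \<exists>A. A \<in> sets path_space \<and> a i = {\<omega> \<in> space M. path \<omega> \<in> A}" by blast
    then obtain A where "\<And>i. A i \<in> sets path_space" "\<And>i. a i = {\<omega> \<in> space M. path \<omega> \<in> A i}" by metis
    then show ?case by (intro bexI[of _ "\<Union>i. A i"]) auto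
  qed
qed

text \<open>
  A linear combination of the \<open>X g\<close> is almost surely a single \<open>X g\<close>, so the exponentials
  \<open>exp (i X g)\<close> already determine all integrals over events.
\<close>

lemma Fourier_total:
  fixes Z :: "'a \<Rightarrow> real"
  assumes Z: "integrable M Z"
    and zero: "\<And>g. (\<integral>\<omega>. complex_of_real (Z \<omega>) * iexp (X g \<omega>) \<partial>M) = 0"
  shows "AE \<omega> in M. Z \<omega> = 0"
proof -
  have [measurable]: "Z \<in> borel_measurable M" using Z by simp
  have zero': "(\<integral>\<omega>. complex_of_real (Z \<omega>) * iexp (\<Sum>i\<in>S. t i * X i \<omega>) \<partial>M) = 0" if "finite S" for S t
  proof -
    have "AE \<omega> in M. (\<Sum>i\<in>S. t i * X i \<omega>) = X (\<Sum>i\<in>S. t i *\<^sub>R i) \<omega>"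
      using X_sum[OF that, of t "\<lambda>i. i"] by eventually_elim simp
    then have "(\<integral>\<omega>. complex_of_real (Z \<omega>) * iexp (\<Sum>i\<in>S. t i * X i \<omega>) \<partial>M)
        = (\<integral>\<omega>. complex_of_real (Z \<omega>) * iexp (X (\<Sum>i\<in>S. t i *\<^sub>R i) \<omega>) \<partial>M)"
      by (intro integral_cong_AE) (auto elim!: eventually_mono simp del: of_real_sum)
    then show ?thesis using zero by simp
  qed
  have setz: "(\<integral>\<omega>. Z \<omega> * indicator E \<omega> \<partial>M) = 0" if E: "E \<in> sets M" for E
  proof -
    obtain A where A: "A \<in> sets path_space" "E = {\<omega> \<in> space M. path \<omega> \<in> A}" using sets_path[OF E] by blast
    have "complex_of_real (\<integral>\<omega>. Z \<omega> * indicator E \<omega> \<partial>M) = (\<integral>\<omega>. complex_of_real (Z \<omega> * indicator E \<omega>) \<partial>M)"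
      by (rule integral_complex_of_real[symmetric])
    also have "\<dots> = (\<integral>\<omega>. complex_of_real (Z \<omega>) * indicator A (path \<omega>) \<partial>M)"
      using A(2) by (intro Bochner_Integration.integral_cong) (auto split: split_indicator)
    also have "\<dots> = 0"
      using Z by (intro Fourier_determines_integrals[OF _ X_measurable zero' A(1)]) simp_all
    finally show ?thesis by simp
  qed
  have one: "AE \<omega> in M. max 0 (W \<omega>) = 0"
    if W: "integrable M W" "\<And>E. E \<in> sets M \<Longrightarrow> (\<integral>\<omega>. W \<omega> * indicator E \<omega> \<partial>M) = 0" for W :: "'a \<Rightarrow> real"
  proof -
    have [measurable]: "W \<in> borel_measurable M" using W by simp
    have "(\<integral>\<omega>. max 0 (W \<omega>) \<partial>M) = (\<integral>\<omega>. W \<omega> * indicator {\<omega> \<in> space M. 0 \<le> W \<omega>} \<omega> \<partial>M)"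
      by (intro Bochner_Integration.integral_cong) (auto split: split_indicator)
    also have "\<dots> = 0" by (rule W(2)) measurable
    finally have "(\<integral>\<omega>. max 0 (W \<omega>) \<partial>M) = 0" .
    moreover have "integrable M (\<lambda>\<omega>. max 0 (W \<omega>))" using W(1) by simp
    ultimately show ?thesis by (subst (asm) integral_nonneg_eq_0_iff_AE) auto
  qed
  have "AE \<omega> in M. max 0 (Z \<omega>) = 0" by (rule one[OF Z setz])
  moreover have "AE \<omega> in M. max 0 (- Z \<omega>) = 0" using Z setz by (intro one) auto
  ultimately show ?thesis by eventually_elim auto
qed

lemma exp_abs_X_L2:
  assumes "norm h = 1"
  shows "(\<lambda>\<omega>. exp (a * \<bar>X h \<omega>\<bar>)) \<in> L2 M"
  using integrable_exp_abs_X[OF assms, of "2 * a"]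
  by (intro L2_I) (auto simp: power2_eq_square mult.assoc simp flip: exp_add)

text \<open>
  Orthogonality to all \<open>H\<^sub>k (X h)\<close> spreads to all monomials in \<open>X h\<close> by the three-term recursion,
  and from there to \<open>exp (i t X h)\<close> by the exponential series, which is dominated by
  \<open>|R| exp (|t| |X h|)\<close>.
\<close>

theorem chaos_total:
  assumes R: "R \<in> L2 M" and orth: "\<And>n. chaos_orthogonal n R"
  shows "AE \<omega> in M. R \<omega> = 0"
proof (rule Fourier_total)
  show Ri: "integrable M R" by (rule L2_imp_integrable[OF R])
  note [measurable] = L2_measurable[OF R]
  have ER: "expectation R = 0" using orth[of 0] by (simp add: chaos_orthogonal_def)
  have moments: "expectation (\<lambda>\<omega>. R \<omega> * (X h \<omega> ^ n * poly (hermite k) (X h \<omega>))) = 0" if h: "norm h = 1" for h n k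
  proof (induction n arbitrary: k)
    case 0
    show ?case using orth[of k] h ER by (cases "k = 0") (auto simp: chaos_orthogonal_def)
  next
    case (Suc n)
    have L: "(\<lambda>\<omega>. X h \<omega> ^ n * poly p (X h \<omega>)) \<in> L2 M" for p
      using hermite_X_L2[OF h, of "monom 1 n * p"] by (simp add: poly_monom)
    define j where "j = k - 1"
    have pd: "poly (pderiv (hermite k)) x = real k * poly (hermite j) x" for x
      unfolding j_def by (cases k) (auto simp: pderiv_hermite_Suc simp del: hermite.simps(2))
    have "R \<omega> * (X h \<omega> ^ Suc n * poly (hermite k) (X h \<omega>))
        = R \<omega> * (X h \<omega> ^ n * poly (hermite (Suc k)) (X h \<omega>))
          + real k * (R \<omega> * (X h \<omega> ^ n * poly (hermite j) (X h \<omega>)))" for \<omega>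
      by (simp add: pd algebra_simps)
    then show ?case
      using Suc.IH integrable_mult_L2[OF R L] by (simp del: hermite.simps power_Suc)
  qed
  have unit: "(\<integral>\<omega>. complex_of_real (R \<omega>) * iexp (t * X h \<omega>) \<partial>M) = 0" if h: "norm h = 1" for h t
  proof -
    let ?s = "\<lambda>N \<omega>. complex_of_real (R \<omega>) * (\<Sum>k<N. (\<i> * (t * X h \<omega>)) ^ k /\<^sub>R fact k)"
    have "(\<lambda>N. \<integral>\<omega>. ?s N \<omega> \<partial>M) \<longlonglongrightarrow> (\<integral>\<omega>. complex_of_real (R \<omega>) * iexp (t * X h \<omega>) \<partial>M)"
    proof (rule integral_dominated_convergence)
      have "(\<lambda>\<omega>. \<bar>R \<omega>\<bar>) \<in> L2 M" using L2_norm[OF R] by simp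
      from integrable_mult_L2[OF this exp_abs_X_L2[OF h]]
      show "integrable M (\<lambda>\<omega>. \<bar>R \<omega>\<bar> * exp (\<bar>t\<bar> * \<bar>X h \<omega>\<bar>))" .
      have "(\<lambda>N. \<Sum>k<N. z ^ k /\<^sub>R fact k) \<longlonglongrightarrow> exp z" for z :: complex
        using exp_converges[of z] by (simp add: sums_def)
      then show "AE \<omega> in M. (\<lambda>N. ?s N \<omega>) \<longlonglongrightarrow> complex_of_real (R \<omega>) * iexp (t * X h \<omega>)"
        by (intro AE_I2 tendsto_mult_left) simp
      fix N
      have "norm (\<Sum>k<N. z ^ k /\<^sub>R fact k) \<le> exp (norm z)" for z :: complex
      proof -
        have "norm (\<Sum>k<N. z ^ k /\<^sub>R fact k) \<le> (\<Sum>k<N. norm z ^ k /\<^sub>R fact k)"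
          by (intro order_trans[OF norm_sum] sum_mono) (simp add: norm_power)
        also have "\<dots> \<le> exp (norm z)"
          unfolding exp_def by (intro sum_le_suminf summable_exp_generic) (auto simp: divide_inverse)
        finally show ?thesis .
      qed
      from this[of "\<i> * (t * X h _)"]
      show "AE \<omega> in M. norm (?s N \<omega>) \<le> \<bar>R \<omega>\<bar> * exp (\<bar>t\<bar> * \<bar>X h \<omega>\<bar>)"
        by (intro AE_I2) (auto simp: norm_mult abs_mult intro!: mult_left_mono)
    qed measurable
    moreover have "(\<integral>\<omega>. ?s N \<omega> \<partial>M) = 0" for N
    proof -
      have int: "integrable M (\<lambda>\<omega>. R \<omega> * X h \<omega> ^ k)" for k
        using integrable_mult_L2[OF R hermite_X_L2[OF h, of "monom 1 k"]] by (simp add: poly_monom)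
      have m0: "expectation (\<lambda>\<omega>. R \<omega> * X h \<omega> ^ k) = 0" for k
        using moments[OF h, of k 0] by simp
      have "?s N \<omega> = (\<Sum>k<N. ((\<i> * t) ^ k /\<^sub>R fact k) * complex_of_real (R \<omega> * X h \<omega> ^ k))" for \<omega>
        by (simp add: sum_distrib_left power_mult_distrib scaleR_conv_of_real mult_ac)
      then have "(\<integral>\<omega>. ?s N \<omega> \<partial>M) = (\<Sum>k<N. \<integral>\<omega>. ((\<i> * t) ^ k /\<^sub>R fact k) * complex_of_real (R \<omega> * X h \<omega> ^ k) \<partial>M)"
        using int by (simp only:) (intro Bochner_Integration.integral_sum integrable_mult_right integrable_of_real)
      also have "\<dots> = 0"
        using m0 by (intro sum.neutral ballI) (simp only: integral_mult_right_zero integral_complex_of_real of_real_0 mult_zero_right)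
      finally show ?thesis .
    qed
    ultimately show ?thesis by (simp add: LIMSEQ_const_iff)
  qed
  fix g
  show "(\<integral>\<omega>. complex_of_real (R \<omega>) * iexp (X g \<omega>) \<partial>M) = 0"
  proof (cases "g = 0")
    case True
    have "AE \<omega> in M. X g \<omega> = 0" using X_linear[of 0 0 0 0] True by simp
    then have "(\<integral>\<omega>. complex_of_real (R \<omega>) * iexp (X g \<omega>) \<partial>M) = (\<integral>\<omega>. complex_of_real (R \<omega>) \<partial>M)"
      by (intro integral_cong_AE) (auto elim: eventually_mono)
    then show ?thesis using ER by simp
  next
    case False
    define u where "u = (1 / norm g) *\<^sub>R g"
    have u: "norm u = 1" "g = norm g *\<^sub>R u" using False by (auto simp: u_def)
    have "AE \<omega> in M. X g \<omega> = norm g * X u \<omega>" using X_linear[of "norm g" u 0 0] u by simp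
    then have "(\<integral>\<omega>. complex_of_real (R \<omega>) * iexp (X g \<omega>) \<partial>M)
        = (\<integral>\<omega>. complex_of_real (R \<omega>) * iexp (norm g * X u \<omega>) \<partial>M)"
      by (intro integral_cong_AE) (auto elim: eventually_mono)
    then show ?thesis using unit[OF u(1)] by simp
  qed
qed

text \<open>
  The partial sums of the expansion converge in \<open>L\<^sup>2\<close> by Bessel's inequality. Their limit has the
  same projections as \<open>F\<close>, so it is \<open>F\<close> by totality, and the error after \<open>N\<close> terms is the limit of
  orthogonal sums over \<open>{N<..K}\<close>.
\<close>

theorem chaos_expansion_tail:
  assumes F: "F \<in> L2 M"
    and T: "\<And>K. (\<Sum>n\<in>{N<..K}. expectation (\<lambda>\<omega>. (chaos_projection M X n F \<omega>)\<^sup>2)) \<le> T"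
  shows "expectation (\<lambda>\<omega>. (F \<omega> - (\<Sum>n\<le>N. chaos_projection M X n F \<omega>))\<^sup>2) \<le> T"
proof -
  let ?J = "\<lambda>n. chaos_projection M X n F"
  define b where "b n = expectation (\<lambda>\<omega>. (?J n \<omega>)\<^sup>2)" for n
  define S where "S N \<omega> = (\<Sum>n\<le>N. ?J n \<omega>)" for N \<omega>
  note J = chaos_projection_L2[OF F]
  have SL: "S n \<in> L2 M" for n unfolding S_def by (intro L2_sum J)
  have diffS: "expectation (\<lambda>\<omega>. (S m \<omega> - S n \<omega>)\<^sup>2) = (\<Sum>k\<in>{n<..m}. b k)" if "n \<le> m" for n m
  proof -
    have "S m \<omega> - S n \<omega> = (\<Sum>k\<in>{n<..m}. ?J k \<omega>)" for \<omega>
    proof -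
      have "{..m} = {..n} \<union> {n<..m}" using that by auto
      then have "(\<Sum>k\<le>m. ?J k \<omega>) = (\<Sum>k\<le>n. ?J k \<omega>) + (\<Sum>k\<in>{n<..m}. ?J k \<omega>)"
        by (simp only:) (rule sum.union_disjoint, auto)
      then show ?thesis unfolding S_def by simp
    qed
    then show ?thesis unfolding b_def
      by (simp add: expectation_sum_chaos_square chaos_projection(1)[OF F])
  qed
  have "summable b"
  proof (rule bounded_imp_summable)
    show "b n \<ge> 0" for n by (simp add: b_def)
    show "(\<Sum>k\<le>n. b k) \<le> expectation (\<lambda>\<omega>. (F \<omega>)\<^sup>2)" for n
      unfolding b_def by (rule chaos_Bessel[OF F]) simp
  qed
  then have "\<exists>r. \<forall>n m. r \<le> n \<longrightarrow> n \<le> m \<longrightarrow> (\<Sum>k\<in>{n<..m}. b k) < (1/4) ^ j" for j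
  proof -
    have "\<exists>r. \<forall>m\<ge>r. \<forall>n. norm (sum b {m..<n}) < (1/4) ^ j"
      using \<open>summable b\<close> unfolding summable_Cauchy by simp
    then obtain r where r: "\<And>m n. r \<le> m \<Longrightarrow> norm (sum b {m..<n}) < (1/4) ^ j" by blast
    have "(\<Sum>k\<in>{n<..m}. b k) < (1/4) ^ j" if "r \<le> n" for n m
    proof -
      have "{n<..m} = {Suc n..<Suc m}" by auto
      then show ?thesis using r[of "Suc n" "Suc m"] that by simp
    qed
    then show ?thesis by blast
  qed
  then obtain r where r: "\<And>j n m. r j \<le> n \<Longrightarrow> n \<le> m \<Longrightarrow> (\<Sum>k\<in>{n<..m}. b k) < (1/4) ^ j" by metis
  \<comment> \<open>Indices beyond \<open>r j\<close> that also increase with \<open>j\<close> and dominate it.\<close>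
  define \<rho> where "\<rho> j = j + (\<Sum>i\<le>j. r i)" for j
  have \<rho>mono: "\<rho> i \<le> \<rho> j" if "i \<le> j" for i j
    unfolding \<rho>_def using that by (intro add_mono sum_mono2) auto
  have \<rho>r: "r j \<le> \<rho> j" "j \<le> \<rho> j" for j
    unfolding \<rho>_def by (auto intro!: trans_le_add2 member_le_sum)
  have "\<exists>g\<in>L2 M. (AE \<omega> in M. (\<lambda>j. S (\<rho> j) \<omega>) \<longlonglongrightarrow> g \<omega>)
     \<and> (\<forall>j. (\<integral>\<omega>. (norm (g \<omega> - S (\<rho> j) \<omega>))\<^sup>2 \<partial>M) \<le> (1/4) ^ j)"
  proof (rule L2_fast_Cauchy_limit_rate[OF SL])
    fix n m :: nat assume "n \<le> m"
    then show "(\<integral>\<omega>. (norm (S (\<rho> m) \<omega> - S (\<rho> n) \<omega>))\<^sup>2 \<partial>M) \<le> (1/4) ^ n"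
      using diffS[OF \<rho>mono] r[OF \<rho>r(1) \<rho>mono] by (simp add: less_imp_le)
  qed
  then obtain g where g: "g \<in> L2 M" and rate: "\<And>j. expectation (\<lambda>\<omega>. (g \<omega> - S (\<rho> j) \<omega>)\<^sup>2) \<le> (1/4) ^ j"
    by auto
  have quarter: "\<exists>j\<ge>n. (1/4::real) ^ j < \<epsilon>" if "\<epsilon> > 0" for n \<epsilon>
  proof -
    have "\<exists>j. (1/4::real) ^ j < \<epsilon>" using that by (intro real_arch_pow_inv) auto
    then obtain j where j: "(1/4::real) ^ j < \<epsilon>" by blast
    have "(1/4::real) ^ (max n j) \<le> (1/4) ^ j" by (intro power_decreasing) auto
    with j have "(1/4::real) ^ (max n j) < \<epsilon>" by linarith
    then show ?thesis by (intro exI[of _ "max n j"]) auto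
  qed
  have FS: "chaos_orthogonal n (\<lambda>\<omega>. F \<omega> - S m \<omega>)" if "n \<le> m" for n m
  proof -
    \<comment> \<open>The remainder of the \<open>n\<close>th projection is orthogonal to the \<open>n\<close>th chaos, and so are the other projections.\<close>
    have eq: "F \<omega> - S m \<omega> = (F \<omega> - ?J n \<omega>) - (\<Sum>k\<in>{..m} - {n}. ?J k \<omega>)" for \<omega>
      unfolding S_def using that by (subst sum.remove[of _ n]) auto
    show ?thesis unfolding eq
      by (intro chaos_orthogonal_diff chaos_projection_orthogonal F chaos_orthogonal_sum L2_diff L2_sum J
          wiener_chaos_orthogonal_hermite[OF chaos_projection(1)[OF F]]) auto
  qed
  have "AE \<omega> in M. F \<omega> - g \<omega> = 0"
  proof (rule chaos_total[OF L2_diff[OF F g]])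
    fix n
    have *: "expectation (\<lambda>\<omega>. \<Psi> \<omega> * (F \<omega> - g \<omega>)) = 0"
      if \<Psi>: "\<Psi> \<in> L2 M" and orth: "\<And>m. n \<le> m \<Longrightarrow> expectation (\<lambda>\<omega>. \<Psi> \<omega> * (F \<omega> - S m \<omega>)) = 0" for \<Psi>
    proof (rule L2_approx_orthogonal[OF \<Psi> L2_diff[OF F g]])
      fix \<epsilon> :: real assume "\<epsilon> > 0"
      then obtain j where j: "n \<le> j" "(1/4::real) ^ j < \<epsilon>" using quarter by blast
      have "expectation (\<lambda>\<omega>. (F \<omega> - g \<omega> - (F \<omega> - S (\<rho> j) \<omega>))\<^sup>2) = expectation (\<lambda>\<omega>. (g \<omega> - S (\<rho> j) \<omega>)\<^sup>2)"
        by (simp add: power2_commute)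
      then show "\<exists>Z\<in>L2 M. expectation (\<lambda>\<omega>. \<Psi> \<omega> * Z \<omega>) = 0 \<and> expectation (\<lambda>\<omega>. (F \<omega> - g \<omega> - Z \<omega>)\<^sup>2) < \<epsilon>"
        using orth[of "\<rho> j"] \<rho>r(2)[of j] j rate[of j]
        by (intro bexI[of _ "\<lambda>\<omega>. F \<omega> - S (\<rho> j) \<omega>"] conjI L2_diff F SL) auto
    qed
    show "chaos_orthogonal n (\<lambda>\<omega>. F \<omega> - g \<omega>)"
    proof (cases "n = 0")
      case True
      then show ?thesis using *[OF const_L2[of 1]] FS[of n] by (simp add: chaos_orthogonal_def)
    next
      case False
      then show ?thesis
        using *[OF hermite_X_L2, of _ "hermite n"] FS[of n] by (simp add: chaos_orthogonal_def mult.commute)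
    qed
  qed
  then have Fg: "AE \<omega> in M. F \<omega> = g \<omega>" by eventually_elim simp
  have lim: "sqrt (expectation (\<lambda>\<omega>. (F \<omega> - S N \<omega>)\<^sup>2)) \<le> sqrt T + sqrt \<epsilon>" if e0: "\<epsilon> > 0" for \<epsilon>
  proof -
    obtain j where j: "N \<le> j" "(1/4::real) ^ j < \<epsilon>" using quarter[OF e0, of N] by blast
    note [measurable] = L2_measurable[OF F] L2_measurable[OF g] L2_measurable[OF SL]
    have "expectation (\<lambda>\<omega>. (F \<omega> - S (\<rho> j) \<omega>)\<^sup>2) = expectation (\<lambda>\<omega>. (g \<omega> - S (\<rho> j) \<omega>)\<^sup>2)"
      using Fg by (intro integral_cong_AE) (auto elim: eventually_mono)
    then have 1: "expectation (\<lambda>\<omega>. (F \<omega> - S (\<rho> j) \<omega>)\<^sup>2) \<le> \<epsilon>" using rate[of j] j(2) by linarith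
    have 2: "expectation (\<lambda>\<omega>. (S (\<rho> j) \<omega> - S N \<omega>)\<^sup>2) \<le> T"
      using diffS[of N "\<rho> j"] T[of "\<rho> j"] j(1) \<rho>r(2)[of j] by (simp add: b_def)
    have "sqrt (expectation (\<lambda>\<omega>. (F \<omega> - S N \<omega>)\<^sup>2))
        = sqrt (expectation (\<lambda>\<omega>. ((F \<omega> - S (\<rho> j) \<omega>) + (S (\<rho> j) \<omega> - S N \<omega>))\<^sup>2))" by simp
    also have "\<dots> \<le> sqrt (expectation (\<lambda>\<omega>. (F \<omega> - S (\<rho> j) \<omega>)\<^sup>2)) + sqrt (expectation (\<lambda>\<omega>. (S (\<rho> j) \<omega> - S N \<omega>)\<^sup>2))"
      by (intro L2_triangle L2_diff F SL)
    also have "\<dots> \<le> sqrt T + sqrt \<epsilon>" using real_sqrt_le_mono[OF 1] real_sqrt_le_mono[OF 2] by linarith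
    finally show ?thesis .
  qed
  have "sqrt (expectation (\<lambda>\<omega>. (F \<omega> - S N \<omega>)\<^sup>2)) \<le> sqrt T"
  proof (rule field_le_epsilon)
    fix e :: real assume "e > 0"
    with lim[of "e\<^sup>2"] show "sqrt (expectation (\<lambda>\<omega>. (F \<omega> - S N \<omega>)\<^sup>2)) \<le> sqrt T + e" by simp
  qed
  then show ?thesis by (simp add: S_def)
qed

end

section \<open>Smooth functionals and closability\<close>

text \<open>
  The increment along the diagonal is a step in the first variable followed by one in the second;
  continuity of the second partial derivative controls the latter near the base point.
\<close>

lemma diagonal_DERIV:
  fixes g :: "real \<Rightarrow> real \<Rightarrow> real"
  assumes s: "((\<lambda>s. g s t) has_real_derivative A) (at t)"
    and u: "\<And>s u. ((\<lambda>u. g s u) has_real_derivative D s u) (at u)"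
    and cont: "continuous_on UNIV (\<lambda>(s, u). D s u)"
  shows "((\<lambda>t. g t t) has_real_derivative A + D t t) (at t)"
proof -
  have "((\<lambda>(s, u). g s u) has_derivative (\<lambda>(ts, tu). A * ts + blinfun_apply (blinfun_scaleR_left (D t t)) tu))
      (at (t, t) within UNIV \<times> UNIV)"
  proof (rule has_derivative_partialsI[where f = g and fx = "\<lambda>ts. A * ts"
        and fy = "\<lambda>s u. blinfun_scaleR_left (D s u)"])
    show "((\<lambda>s. g s t) has_derivative (\<lambda>ts. A * ts)) (at t within UNIV)"
      using s by (simp add: has_field_derivative_def)
    show "((\<lambda>u. g s u) has_derivative blinfun_apply (blinfun_scaleR_left (D s u))) (at u within UNIV)" for s u
    proof -
      have "(\<lambda>y. y * D s u) = (*) (D s u)" by (auto simp: mult.commute)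
      then show ?thesis using u[of s u] by (simp add: has_field_derivative_def blinfun_scaleR_left.rep_eq)
    qed
    have "continuous_on UNIV (\<lambda>z. blinfun_scaleR_left (case z of (s, u) \<Rightarrow> D s u) :: real \<Rightarrow>\<^sub>L real)"
      using cont by (intro bounded_linear.continuous_on[OF bounded_linear_blinfun_scaleR_left]) auto
    then show "continuous (at (t, t) within UNIV \<times> UNIV) (\<lambda>(s, u). blinfun_scaleR_left (D s u) :: real \<Rightarrow>\<^sub>L real)"
      by (simp add: continuous_on_eq_continuous_within split_beta')
  qed auto
  then have d: "((\<lambda>(s, u). g s u) has_derivative (\<lambda>(ts, tu). A * ts + tu * D t t)) (at (t, t))"
    by (simp add: blinfun_scaleR_left.rep_eq)
  have "((\<lambda>t. (t, t)) has_derivative (\<lambda>x. (x, x))) (at t)"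
    by (auto intro!: derivative_eq_intros)
  from has_derivative_compose[OF this d]
  have "((\<lambda>t. g t t) has_derivative (\<lambda>x. A * x + x * D t t)) (at t)" by simp
  moreover have "(\<lambda>x. A * x + x * D t t) = (*) (A + D t t)" by (auto simp: algebra_simps)
  ultimately show ?thesis by (simp add: has_field_derivative_def)
qed

lemma Cb_infinity_partials:
  assumes f: "f \<in> Cb_infinity p" and i: "i < p"
  shows "continuous_on UNIV (partial_deriv i f)" "bounded (range (partial_deriv i f))"
    "((\<lambda>t. f (x(i := t))) has_real_derivative partial_deriv i f (x(i := t))) (at t)"
    "(\<And>j. j < p \<Longrightarrow> x j = y j) \<Longrightarrow> partial_deriv i f x = partial_deriv i f y"
proof -
  have dep: "f x = f y" if "\<And>i. i < p \<Longrightarrow> x i = y i" for x y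
    using f that by (auto simp: Cb_infinity_def)
  have all: "let g = foldr partial_deriv js f in continuous_on UNIV g \<and> bounded (range g) \<and>
      (\<forall>i<p. \<forall>x. (\<lambda>t. g (x(i := t))) differentiable at (x i))" if "set js \<subseteq> {..<p}" for js
    using f that by (auto simp: Cb_infinity_def)
  show "continuous_on UNIV (partial_deriv i f)" "bounded (range (partial_deriv i f))"
    using all[of "[i]"] i by (auto simp: Let_def)
  have "\<forall>i<p. \<forall>x. (\<lambda>t. f (x(i := t))) differentiable at (x i)"
    using all[of "[]"] by (simp add: Let_def)
  from this[rule_format, OF i, of "x(i := t)"]
  have "((\<lambda>s. f (x(i := s))) has_real_derivative deriv (\<lambda>s. f (x(i := s))) t) (at t)"
    by (simp add: DERIV_deriv_iff_real_differentiable)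
  then show "((\<lambda>t. f (x(i := t))) has_real_derivative partial_deriv i f (x(i := t))) (at t)"
    by (simp add: partial_deriv_def)
  assume xy: "\<And>j. j < p \<Longrightarrow> x j = y j"
  have "(\<lambda>t. f (x(i := t))) = (\<lambda>t. f (y(i := t)))" by (intro ext dep) (auto simp: xy)
  then show "partial_deriv i f x = partial_deriv i f y" using xy[OF i] by (simp add: partial_deriv_def)
qed

lemma Cb_infinity_base:
  assumes f: "f \<in> Cb_infinity p"
  shows "continuous_on UNIV f" "bounded (range f)" "(\<And>j. j < p \<Longrightarrow> x j = y j) \<Longrightarrow> f x = f y"
proof -
  have "let g = foldr partial_deriv [] f in continuous_on UNIV g \<and> bounded (range g) \<and>
      (\<forall>i<p. \<forall>x. (\<lambda>t. g (x(i := t))) differentiable at (x i))"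
    using f unfolding Cb_infinity_def by (auto simp del: foldr.simps)
  then show "continuous_on UNIV f" "bounded (range f)" by (auto simp: Let_def)
  show "(\<And>j. j < p \<Longrightarrow> x j = y j) \<Longrightarrow> f x = f y" using f by (auto simp: Cb_infinity_def)
qed

text \<open>
  The coordinates are set in motion one after the other; each new one enters through the chain
  rule along the diagonal.
\<close>

lemma Cb_infinity_line_DERIV:
  assumes f: "f \<in> Cb_infinity p" and "k \<le> p"
  shows "((\<lambda>t. f (\<lambda>j. x j + (if j < k then t * a j else 0))) has_real_derivative
    (\<Sum>i<k. a i * partial_deriv i f (\<lambda>j. x j + (if j < k then t * a j else 0)))) (at t)"
  using \<open>k \<le> p\<close>
proof (induction k arbitrary: x t)
  case 0
  show ?case by simp
next
  case (Suc k)
  then have k: "k < p" "k \<le> p" by auto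
  define z where "z s u = (\<lambda>j. x j + (if j < k then s * a j else if j = k then u * a k else 0))" for s u
  have diag: "(\<lambda>j. x j + (if j < Suc k then t * a j else 0)) = z t t" for t
    by (auto simp: z_def less_Suc_eq)
  have "((\<lambda>t. f (z t t)) has_real_derivative
      (\<Sum>i<k. a i * partial_deriv i f (z t t)) + a k * partial_deriv k f (z t t)) (at t)"
  proof (rule diagonal_DERIV[where g = "\<lambda>s u. f (z s u)" and D = "\<lambda>s u. a k * partial_deriv k f (z s u)"])
    have eq: "(\<lambda>j. (x(k := x k + t * a k)) j + (if j < k then s * a j else 0)) = z s t" for s
      by (auto simp: z_def)
    show "((\<lambda>s. f (z s t)) has_real_derivative (\<Sum>i<k. a i * partial_deriv i f (z t t))) (at t)"
      using Suc.IH[OF k(2), of "x(k := x k + t * a k)" t] unfolding eq .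
    show "((\<lambda>u. f (z s u)) has_real_derivative a k * partial_deriv k f (z s u)) (at u)" for s u
    proof -
      have eq: "(z s 0)(k := x k + u * a k) = z s u" for u by (auto simp: z_def)
      have "((\<lambda>u. f ((z s 0)(k := x k + u * a k))) has_real_derivative
          partial_deriv k f ((z s 0)(k := x k + u * a k)) * a k) (at u)"
        by (rule DERIV_chain2[OF Cb_infinity_partials(3)[OF f k(1)]]) (auto intro!: derivative_eq_intros)
      then show ?thesis unfolding eq by (simp add: mult.commute)
    qed
    have "continuous_on UNIV (\<lambda>y. z (fst y) (snd y) j)" for j
      unfolding z_def by (cases "j < k"; cases "j = k") (auto intro!: continuous_intros)
    then have "continuous_on UNIV (\<lambda>y. z (fst y) (snd y))"
      by (rule continuous_on_coordinatewise_then_product)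
    then have "continuous_on UNIV (\<lambda>y. partial_deriv k f (z (fst y) (snd y)))"
      by (rule continuous_on_compose2[OF Cb_infinity_partials(1)[OF f k(1)]]) auto
    then show "continuous_on UNIV (\<lambda>(s, u). a k * partial_deriv k f (z s u))"
      unfolding split_beta' by (rule continuous_on_mult[OF continuous_on_const])
  qed
  then show ?case unfolding diag by (simp add: mult.commute)
qed

context gaussian_space
begin

lemma smooth_cylindrical:
  fixes h :: "nat \<Rightarrow> 'h"
  assumes f: "f \<in> Cb_infinity p"
  shows "cylindrical (\<lambda>x. f (\<lambda>j. x (h j))) (\<lambda>x. \<Sum>i<p. partial_deriv i f (\<lambda>j. x (h j)) *\<^sub>R h i)"
  unfolding cylindrical_def
proof (intro conjI allI)
  note base = Cb_infinity_base[OF f] and part = Cb_infinity_partials[OF f]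
  have seqm: "(\<lambda>x j. x (h j)) \<in> measurable path_space (borel :: (nat \<Rightarrow> real) measure)"
  proof -
    have "(\<lambda>x j. x (h j)) \<in> measurable path_space (Pi\<^sub>M UNIV (\<lambda>_::nat. borel :: real measure))"
      by (rule measurable_PiM_single') auto
    then show ?thesis by (simp cong: measurable_cong_sets add: sets_PiM_equal_borel)
  qed
  have meas: "(\<lambda>x. g (\<lambda>j. x (h j))) \<in> borel_measurable path_space" if "continuous_on UNIV g" for g :: "(nat \<Rightarrow> real) \<Rightarrow> real"
    using measurable_compose[OF seqm borel_measurable_continuous_onI[OF that]] .
  show fm[measurable]: "(\<lambda>x. f (\<lambda>j. x (h j))) \<in> borel_measurable path_space" by (rule meas[OF base(1)])
  have pm: "(\<lambda>x. partial_deriv i f (\<lambda>j. x (h j))) \<in> borel_measurable path_space" if "i < p" for i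
    by (rule meas[OF part(1)[OF that]])
  show vm[measurable]: "(\<lambda>x. \<Sum>i<p. partial_deriv i f (\<lambda>j. x (h j)) *\<^sub>R h i) \<in> borel_measurable path_space"
    using pm by (intro borel_measurable_sum borel_measurable_scaleR) auto
  show "\<exists>S. finite S \<and> (\<forall>x y. (\<forall>g\<in>S. x g = y g) \<longrightarrow> f (\<lambda>j. x (h j)) = f (\<lambda>j. y (h j)) \<and>
      (\<Sum>i<p. partial_deriv i f (\<lambda>j. x (h j)) *\<^sub>R h i) = (\<Sum>i<p. partial_deriv i f (\<lambda>j. y (h j)) *\<^sub>R h i))"
  proof (rule exI[of _ "h ` {..<p}"], intro conjI allI impI)
    fix x y :: "'h \<Rightarrow> real" assume xy: "\<forall>g\<in>h ` {..<p}. x g = y g"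
    show "f (\<lambda>j. x (h j)) = f (\<lambda>j. y (h j))" by (rule base(3)) (use xy in auto)
    show "(\<Sum>i<p. partial_deriv i f (\<lambda>j. x (h j)) *\<^sub>R h i) = (\<Sum>i<p. partial_deriv i f (\<lambda>j. y (h j)) *\<^sub>R h i)"
    proof (intro sum.cong refl)
      fix i assume "i \<in> {..<p}"
      then have "partial_deriv i f (\<lambda>j. x (h j)) = partial_deriv i f (\<lambda>j. y (h j))"
        by (intro part(4)) (use xy in auto)
      then show "partial_deriv i f (\<lambda>j. x (h j)) *\<^sub>R h i = partial_deriv i f (\<lambda>j. y (h j)) *\<^sub>R h i" by simp
    qed
  qed simp
  fix x k
  define L where "L t = (\<lambda>j. x (h j) + t * (h j \<bullet> k))" for t
  have fL: "f (L t) = f (\<lambda>j. x (h j) + (if j < p then t * (h j \<bullet> k) else 0))" for t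
    by (rule base(3)) (simp add: L_def)
  have pL: "partial_deriv i f (L t) = partial_deriv i f (\<lambda>j. x (h j) + (if j < p then t * (h j \<bullet> k) else 0))"
    if "i < p" for i t
    by (rule part(4)[OF that]) (simp add: L_def)
  have "((\<lambda>t. f (L t)) has_real_derivative (\<Sum>i<p. (h i \<bullet> k) * partial_deriv i f (L 0))) (at 0)"
    using Cb_infinity_line_DERIV[OF f order_refl, of "\<lambda>j. x (h j)" "\<lambda>j. h j \<bullet> k" 0]
    unfolding fL by (simp add: pL)
  then show "((\<lambda>t. f (\<lambda>j. x (h j) + t * (h j \<bullet> k))) has_real_derivative
      (\<Sum>i<p. partial_deriv i f (\<lambda>j. x (h j)) *\<^sub>R h i) \<bullet> k) (at 0)"
    by (simp add: L_def inner_sum_left mult.commute)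
  have "continuous_on UNIV L" unfolding L_def
    by (intro continuous_on_coordinatewise_then_product continuous_intros)
  then have "continuous_on UNIV (\<lambda>t. partial_deriv i f (L t))" if "i < p" for i
    using that by (intro continuous_on_compose2[OF part(1)]) auto
  then show "continuous_on UNIV (\<lambda>t. (\<Sum>i<p. partial_deriv i f (\<lambda>j. x (h j) + t * (h j \<bullet> k)) *\<^sub>R h i) \<bullet> k)"
    unfolding inner_sum_left inner_scaleR_left L_def by (intro continuous_intros) auto
next
  note base = Cb_infinity_base[OF f] and part = Cb_infinity_partials[OF f]
  have am: "all_moments M (\<lambda>\<omega>. g (\<lambda>j. X (h j) \<omega>))"
    if c: "continuous_on UNIV g" and b: "bounded (range g)" for g :: "(nat \<Rightarrow> real) \<Rightarrow> real"
  proof -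
    obtain C where C: "\<And>x. norm (g x) \<le> C" using b by (auto simp: bounded_iff)
    have "(\<lambda>\<omega> j. X (h j) \<omega>) \<in> measurable M (Pi\<^sub>M UNIV (\<lambda>_::nat. borel :: real measure))"
      by (rule measurable_PiM_single') auto
    then have "(\<lambda>\<omega> j. X (h j) \<omega>) \<in> measurable M (borel :: (nat \<Rightarrow> real) measure)"
      by (simp cong: measurable_cong_sets add: sets_PiM_equal_borel)
    from measurable_compose[OF this borel_measurable_continuous_onI[OF c]] C
    show ?thesis by (intro all_moments_bounded) auto
  qed
  show "all_moments M (\<lambda>\<omega>. f (\<lambda>j. X (h j) \<omega>))" by (rule am[OF base(1,2)])
  show "all_moments M (\<lambda>\<omega>. \<Sum>i<p. partial_deriv i f (\<lambda>j. X (h j) \<omega>) *\<^sub>R h i)"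
    by (intro all_moments_sum all_moments_scaleR am part all_moments_bounded[OF _ order_refl]) auto
qed

lemma smooth_graph_cylindrical:
  assumes "(G, V) \<in> smooth_malliavin_graph X"
  obtains f v where "cylindrical f v" "G = (\<lambda>\<omega>. f (path \<omega>))" "V = (\<lambda>\<omega>. v (path \<omega>))"
proof -
  obtain f p h where "f \<in> Cb_infinity p" "G = (\<lambda>\<omega>. f (\<lambda>j. X (h j) \<omega>))"
    "V = (\<lambda>\<omega>. \<Sum>i<p. partial_deriv i f (\<lambda>j. X (h j) \<omega>) *\<^sub>R h i)"
    using assms unfolding smooth_malliavin_graph_def by blast
  then show ?thesis by (intro that[OF smooth_cylindrical])
qed

lemma L2_inner:
  fixes U :: "'a \<Rightarrow> 'h"
  assumes "U \<in> L2 M"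
  shows "(\<lambda>\<omega>. U \<omega> \<bullet> h) \<in> L2 M"
proof (rule L2_I)
  note [measurable] = L2_measurable[OF assms]
  show "(\<lambda>\<omega>. U \<omega> \<bullet> h) \<in> borel_measurable M" by measurable
  have le: "(U \<omega> \<bullet> h)\<^sup>2 \<le> (norm (U \<omega>))\<^sup>2 * (norm h)\<^sup>2" for \<omega>
    using Cauchy_Schwarz_ineq[of "U \<omega>" h] by (simp add: power2_norm_eq_inner)
  show "integrable M (\<lambda>\<omega>. (norm (U \<omega> \<bullet> h))\<^sup>2)"
    by (rule Bochner_Integration.integrable_bound[OF integrable_mult_left[OF L2_integrable[OF assms], of "(norm h)\<^sup>2"]])
      (use le in auto)
qed

text \<open>
  The duality holds for smooth functionals by integration by parts for their product with
  \<open>\<phi> (X g)\<close>. Both sides are continuous for the graph norm, so it extends to the closure.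
\<close>

lemma malliavin_duality:
  fixes \<phi> \<phi>' :: "real \<Rightarrow> real"
  assumes FU: "has_malliavin_derivative M X F U" and h: "norm h = 1"
    and deriv: "\<And>y. (\<phi> has_real_derivative \<phi>' y) (at y)" and cont: "continuous_on UNIV \<phi>'"
    and b: "\<And>y. \<bar>\<phi> y\<bar> \<le> 1" "\<And>y. \<bar>\<phi>' y\<bar> \<le> 1"
  shows "expectation (\<lambda>\<omega>. (U \<omega> \<bullet> h) * \<phi> (X g \<omega>))
    = expectation (\<lambda>\<omega>. F \<omega> * (X h \<omega> * \<phi> (X g \<omega>) - (g \<bullet> h) * \<phi>' (X g \<omega>)))"
proof -
  have F: "F \<in> L2 M" and U: "U \<in> L2 M" using FU by (auto simp: has_malliavin_derivative_def)
  have cp: "continuous_on UNIV \<phi>"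
    using deriv by (meson DERIV_continuous continuous_at_imp_continuous_on)
  note [measurable] = borel_measurable_continuous_onI[OF cp] borel_measurable_continuous_onI[OF cont]
  define q where "q \<omega> = \<phi> (X g \<omega>)" for \<omega>
  define r where "r \<omega> = X h \<omega> * \<phi> (X g \<omega>) - (g \<bullet> h) * \<phi>' (X g \<omega>)" for \<omega>
  have amX: "all_moments M (X h)" using all_moments_poly_X[OF h, of "[:0, 1:]"] by simp
  have amq: "all_moments M (\<lambda>\<omega>. \<phi> (X g \<omega>))" "all_moments M (\<lambda>\<omega>. \<phi>' (X g \<omega>))"
    by (intro all_moments_bounded[of _ 1]; use b in simp)+
  have "all_moments M (\<lambda>\<omega>. X h \<omega> * \<phi> (X g \<omega>) + (- (g \<bullet> h)) * \<phi>' (X g \<omega>))"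
    by (intro all_moments_add all_moments_mult amX amq all_moments_bounded[OF _ order_refl]) simp
  then have rL: "r \<in> L2 M" unfolding r_def by (intro all_moments_L2) simp
  have qL: "q \<in> L2 M" unfolding q_def by (intro all_moments_L2 amq)
  have smooth: "expectation (\<lambda>\<omega>. (V \<omega> \<bullet> h) * q \<omega>) = expectation (\<lambda>\<omega>. G \<omega> * r \<omega>) \<and> G \<in> L2 M \<and> V \<in> L2 M"
    if GV: "(G, V) \<in> smooth_malliavin_graph X" for G V
  proof -
    obtain f v where fv: "cylindrical f v" "G = (\<lambda>\<omega>. f (path \<omega>))" "V = (\<lambda>\<omega>. v (path \<omega>))"
      using smooth_graph_cylindrical[OF GV] .
    have amG: "all_moments M G" "all_moments M V" using cylindricalD(5,6)[OF fv(1)] fv by auto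
    have amV: "all_moments M (\<lambda>\<omega>. V \<omega> \<bullet> h)"
      by (intro all_moments_inner amG all_moments_bounded[OF _ order_refl]) simp
    have "expectation (\<lambda>\<omega>. X h \<omega> * (f (path \<omega>) * \<phi> (path \<omega> g)))
      = expectation (\<lambda>\<omega>. (f (path \<omega>) *\<^sub>R (\<phi>' (path \<omega> g) *\<^sub>R g) + \<phi> (path \<omega> g) *\<^sub>R v (path \<omega>)) \<bullet> h)"
      by (intro integration_by_parts cylindrical_mult fv cylindrical_coordinate deriv cont h amq)
    then have "expectation (\<lambda>\<omega>. X h \<omega> * (G \<omega> * \<phi> (X g \<omega>)))
      = expectation (\<lambda>\<omega>. G \<omega> * \<phi>' (X g \<omega>) * (g \<bullet> h) + \<phi> (X g \<omega>) * (V \<omega> \<bullet> h))"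
      by (simp add: fv inner_add_left mult.assoc)
    also have "\<dots> = expectation (\<lambda>\<omega>. G \<omega> * \<phi>' (X g \<omega>) * (g \<bullet> h)) + expectation (\<lambda>\<omega>. \<phi> (X g \<omega>) * (V \<omega> \<bullet> h))"
      by (intro Bochner_Integration.integral_add integrable_mult_left all_moments_integrable all_moments_mult amG amq amV)
    finally have "expectation (\<lambda>\<omega>. (V \<omega> \<bullet> h) * q \<omega>)
        = expectation (\<lambda>\<omega>. X h \<omega> * (G \<omega> * \<phi> (X g \<omega>))) - expectation (\<lambda>\<omega>. G \<omega> * \<phi>' (X g \<omega>) * (g \<bullet> h))"
      by (simp add: q_def mult.commute)
    also have "\<dots> = expectation (\<lambda>\<omega>. X h \<omega> * (G \<omega> * \<phi> (X g \<omega>)) - G \<omega> * \<phi>' (X g \<omega>) * (g \<bullet> h))"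
      by (intro Bochner_Integration.integral_diff[symmetric] integrable_mult_left all_moments_integrable
        all_moments_mult amG amX amq)
    also have "\<dots> = expectation (\<lambda>\<omega>. G \<omega> * r \<omega>)" by (simp add: r_def algebra_simps)
    finally show ?thesis using amG by (auto intro: all_moments_L2)
  qed
  let ?l = "expectation (\<lambda>\<omega>. (U \<omega> \<bullet> h) * q \<omega>)" and ?rr = "expectation (\<lambda>\<omega>. F \<omega> * r \<omega>)"
  let ?q = "sqrt (expectation (\<lambda>\<omega>. (q \<omega>)\<^sup>2))" and ?r = "sqrt (expectation (\<lambda>\<omega>. (r \<omega>)\<^sup>2))"
  have "\<bar>?l - ?rr\<bar> \<le> 0 + e" if "e > 0" for e
  proof -
    define d where "d = e / (?q + ?r + 1)"
    have den: "0 < ?q + ?r + 1" by (intro add_nonneg_pos add_nonneg_nonneg) auto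
    have d: "d > 0" unfolding d_def using that den by simp
    have "d\<^sup>2 > 0" using d by simp
    then obtain G V where GV: "(G, V) \<in> smooth_malliavin_graph X"
      "expectation (\<lambda>\<omega>. (F \<omega> - G \<omega>)\<^sup>2) + expectation (\<lambda>\<omega>. (norm (U \<omega> - V \<omega>))\<^sup>2) < d\<^sup>2"
      using FU unfolding has_malliavin_derivative_def by blast
    note sm = smooth[OF GV(1)]
    have p0: "0 \<le> expectation (\<lambda>\<omega>. (F \<omega> - G \<omega>)\<^sup>2)" "0 \<le> expectation (\<lambda>\<omega>. (norm (U \<omega> - V \<omega>))\<^sup>2)" by auto
    have "expectation (\<lambda>\<omega>. (F \<omega> - G \<omega>)\<^sup>2) \<le> d\<^sup>2" using GV(2) p0 by linarith
    then have e1: "sqrt (expectation (\<lambda>\<omega>. (F \<omega> - G \<omega>)\<^sup>2)) \<le> d"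
      using d by (intro real_le_lsqrt) auto
    have UV: "(\<lambda>\<omega>. U \<omega> - V \<omega>) \<in> L2 M" using sm by (intro L2_diff U) auto
    have "expectation (\<lambda>\<omega>. ((U \<omega> - V \<omega>) \<bullet> h)\<^sup>2) \<le> expectation (\<lambda>\<omega>. (norm (U \<omega> - V \<omega>))\<^sup>2)"
    proof (rule integral_mono)
      show "((U \<omega> - V \<omega>) \<bullet> h)\<^sup>2 \<le> (norm (U \<omega> - V \<omega>))\<^sup>2" for \<omega>
        using Cauchy_Schwarz_ineq[of "U \<omega> - V \<omega>" h] h by (simp add: power2_norm_eq_inner norm_eq_1)
    qed (use L2_integrable[OF UV] L2_integrable_real[OF L2_inner[OF UV]] in auto)
    then have "expectation (\<lambda>\<omega>. ((U \<omega> - V \<omega>) \<bullet> h)\<^sup>2) \<le> d\<^sup>2" using GV(2) p0 by linarith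
    then have e2: "sqrt (expectation (\<lambda>\<omega>. ((U \<omega> - V \<omega>) \<bullet> h)\<^sup>2)) \<le> d"
      using d by (intro real_le_lsqrt) auto
    have FG: "(\<lambda>\<omega>. F \<omega> - G \<omega>) \<in> L2 M" using sm by (intro L2_diff F) auto
    have "?l - expectation (\<lambda>\<omega>. (V \<omega> \<bullet> h) * q \<omega>) = expectation (\<lambda>\<omega>. ((U \<omega> - V \<omega>) \<bullet> h) * q \<omega>)"
      using integrable_mult_L2[OF L2_inner[OF U] qL] integrable_mult_L2[OF L2_inner qL, of V] sm
      by (simp add: inner_diff_left left_diff_distrib)
    also have "\<bar>\<dots>\<bar> \<le> sqrt (expectation (\<lambda>\<omega>. ((U \<omega> - V \<omega>) \<bullet> h)\<^sup>2)) * ?q"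
      by (rule L2_cauchy_schwarz[OF L2_inner[OF UV] qL])
    also have "\<dots> \<le> d * ?q" using e2 by (intro mult_right_mono) auto
    finally have 1: "\<bar>?l - expectation (\<lambda>\<omega>. (V \<omega> \<bullet> h) * q \<omega>)\<bar> \<le> d * ?q" .
    have "?rr - expectation (\<lambda>\<omega>. G \<omega> * r \<omega>) = expectation (\<lambda>\<omega>. (F \<omega> - G \<omega>) * r \<omega>)"
      using integrable_mult_L2[OF F rL] integrable_mult_L2[OF _ rL, of G] sm
      by (simp add: left_diff_distrib)
    also have "\<bar>\<dots>\<bar> \<le> sqrt (expectation (\<lambda>\<omega>. (F \<omega> - G \<omega>)\<^sup>2)) * ?r"
      by (rule L2_cauchy_schwarz[OF FG rL])
    also have "\<dots> \<le> d * ?r" using e1 by (intro mult_right_mono) auto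
    finally have 2: "\<bar>?rr - expectation (\<lambda>\<omega>. G \<omega> * r \<omega>)\<bar> \<le> d * ?r" .
    have "\<bar>?l - ?rr\<bar> \<le> d * ?q + d * ?r" using 1 2 sm by linarith
    also have "\<dots> \<le> d * (?q + ?r + 1)" using d by (simp add: algebra_simps)
    also have "\<dots> = e" unfolding d_def using den by simp
    finally show ?thesis by simp
  qed
  then have "\<bar>?l - ?rr\<bar> \<le> 0" by (rule field_le_epsilon)
  then show ?thesis by (simp add: q_def r_def)
qed

end

context generated_gaussian_space
begin

text \<open>
  By duality, the integrals of \<open>\<langle>DF, h\<rangle>\<close> against \<open>cos (X g)\<close> and \<open>sin (X g)\<close> depend on \<open>F\<close> only, and
  these functions are total. Separability of \<open>H\<close> makes the exceptional null set independent of the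
  direction \<open>h\<close>.
\<close>

theorem malliavin_derivative_unique:
  assumes FU: "has_malliavin_derivative M X F U" and FW: "has_malliavin_derivative M X F W"
  shows "AE \<omega> in M. U \<omega> = W \<omega>"
proof -
  have U: "U \<in> L2 M" and W: "W \<in> L2 M" using FU FW by (auto simp: has_malliavin_derivative_def)
  have D: "(\<lambda>\<omega>. U \<omega> - W \<omega>) \<in> L2 M" by (intro L2_diff U W)
  have unit: "AE \<omega> in M. (U \<omega> - W \<omega>) \<bullet> h = 0" if h: "norm h = 1" for h
  proof (rule Fourier_total)
    show int: "integrable M (\<lambda>\<omega>. (U \<omega> - W \<omega>) \<bullet> h)" by (intro L2_imp_integrable L2_inner D)
    fix g
    have zero: "expectation (\<lambda>\<omega>. ((U \<omega> - W \<omega>) \<bullet> h) * \<phi> (X g \<omega>)) = 0 \<and>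
        integrable M (\<lambda>\<omega>. ((U \<omega> - W \<omega>) \<bullet> h) * \<phi> (X g \<omega>))"
      if \<phi>: "\<And>y. (\<phi> has_real_derivative \<phi>' y) (at y)" "continuous_on UNIV \<phi>'"
        "\<And>y. \<bar>\<phi> y\<bar> \<le> 1" "\<And>y. \<bar>\<phi>' y\<bar> \<le> 1" for \<phi> \<phi>'
    proof -
      have cp: "continuous_on UNIV \<phi>"
        using \<phi>(1) by (meson DERIV_continuous continuous_at_imp_continuous_on)
      note [measurable] = borel_measurable_continuous_onI[OF cp]
      have "(\<lambda>\<omega>. \<phi> (X g \<omega>)) \<in> L2 M"
        by (intro all_moments_L2 all_moments_bounded[of _ 1]) (use \<phi>(3) in auto)
      note i = integrable_mult_L2[OF L2_inner this]
      have "expectation (\<lambda>\<omega>. (U \<omega> \<bullet> h) * \<phi> (X g \<omega>)) = expectation (\<lambda>\<omega>. (W \<omega> \<bullet> h) * \<phi> (X g \<omega>))"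
        using malliavin_duality[OF FU h \<phi>] malliavin_duality[OF FW h \<phi>] by simp
      then show ?thesis using i[OF U] i[OF W] i[OF D] by (simp add: inner_diff_left left_diff_distrib)
    qed
    have c: "expectation (\<lambda>\<omega>. ((U \<omega> - W \<omega>) \<bullet> h) * cos (X g \<omega>)) = 0 \<and>
        integrable M (\<lambda>\<omega>. ((U \<omega> - W \<omega>) \<bullet> h) * cos (X g \<omega>))"
      by (rule zero[of cos "\<lambda>y. - sin y"]) (auto intro!: derivative_eq_intros continuous_intros)
    have s: "expectation (\<lambda>\<omega>. ((U \<omega> - W \<omega>) \<bullet> h) * sin (X g \<omega>)) = 0 \<and>
        integrable M (\<lambda>\<omega>. ((U \<omega> - W \<omega>) \<bullet> h) * sin (X g \<omega>))"
      by (rule zero[of sin cos]) (auto intro!: derivative_eq_intros continuous_intros)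
    have "(\<integral>\<omega>. complex_of_real ((U \<omega> - W \<omega>) \<bullet> h) * iexp (X g \<omega>) \<partial>M)
        = (\<integral>\<omega>. complex_of_real (((U \<omega> - W \<omega>) \<bullet> h) * cos (X g \<omega>))
            + \<i> * complex_of_real (((U \<omega> - W \<omega>) \<bullet> h) * sin (X g \<omega>)) \<partial>M)"
      by (intro Bochner_Integration.integral_cong refl)
        (simp only: cis_conv_exp[symmetric] complex_eq_iff, simp)
    also have "\<dots> = (\<integral>\<omega>. complex_of_real (((U \<omega> - W \<omega>) \<bullet> h) * cos (X g \<omega>)) \<partial>M)
        + (\<integral>\<omega>. \<i> * complex_of_real (((U \<omega> - W \<omega>) \<bullet> h) * sin (X g \<omega>)) \<partial>M)"
      using c s by (intro Bochner_Integration.integral_add integrable_mult_right integrable_of_real) auto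
    also have "\<dots> = 0" using c s
      by (simp only: integral_mult_right_zero integral_complex_of_real) simp
    finally show "(\<integral>\<omega>. complex_of_real ((U \<omega> - W \<omega>) \<bullet> h) * iexp (X g \<omega>) \<partial>M) = 0" .
  qed
  have all: "AE \<omega> in M. (U \<omega> - W \<omega>) \<bullet> d = 0" for d
  proof (cases "d = 0")
    case False
    then have "AE \<omega> in M. (U \<omega> - W \<omega>) \<bullet> ((1 / norm d) *\<^sub>R d) = 0" by (intro unit) simp
    then show ?thesis by eventually_elim (use False in simp)
  qed simp
  obtain B :: "'h set" where B: "countable B" "\<And>S. open S \<Longrightarrow> S \<noteq> {} \<Longrightarrow> \<exists>d\<in>B. d \<in> S"
    using countable_dense_setE by (metis (full_types))
  have "AE \<omega> in M. \<forall>d\<in>B. (U \<omega> - W \<omega>) \<bullet> d = 0" using B(1) all by (simp add: AE_ball_countable)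
  then show ?thesis
  proof eventually_elim
    case (elim \<omega>)
    show ?case
    proof (rule ccontr)
      assume ne: "U \<omega> \<noteq> W \<omega>"
      have "open {d. 0 < (U \<omega> - W \<omega>) \<bullet> d}" by (intro open_Collect_less continuous_intros)
      moreover have "U \<omega> - W \<omega> \<in> {d. 0 < (U \<omega> - W \<omega>) \<bullet> d}" using ne by simp
      ultimately obtain d where "d \<in> B" "0 < (U \<omega> - W \<omega>) \<bullet> d" using B(2) by blast
      with elim show False by simp
    qed
  qed
qed

end

section \<open>Malliavin derivatives on a fixed chaos\<close>

lemma poly_exp_bound: "\<exists>C k. 0 \<le> C \<and> 0 \<le> k \<and> (\<forall>x::real. \<bar>poly p x\<bar> \<le> C * exp (k * \<bar>x\<bar>))"
proof (induction p)
  case 0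
  show ?case by (intro exI[of _ 0]) simp
next
  case (pCons a p)
  then obtain C k where Ck: "0 \<le> C" "0 \<le> k" "\<And>x. \<bar>poly p x\<bar> \<le> C * exp (k * \<bar>x\<bar>)" by blast
  have "\<bar>poly (pCons a p) x\<bar> \<le> (\<bar>a\<bar> + C) * exp ((k + 1) * \<bar>x\<bar>)" for x
  proof -
    have "\<bar>poly (pCons a p) x\<bar> \<le> \<bar>a\<bar> + \<bar>x\<bar> * \<bar>poly p x\<bar>"
      by (simp add: abs_mult[symmetric] abs_triangle_ineq)
    also have "\<dots> \<le> \<bar>a\<bar> * exp ((k + 1) * \<bar>x\<bar>) + exp \<bar>x\<bar> * (C * exp (k * \<bar>x\<bar>))"
    proof (intro add_mono mult_mono Ck)
      show "\<bar>a\<bar> \<le> \<bar>a\<bar> * exp ((k + 1) * \<bar>x\<bar>)"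
      proof -
        have "1 \<le> exp ((k + 1) * \<bar>x\<bar>)" using Ck(2) by simp
        then have "\<bar>a\<bar> * 1 \<le> \<bar>a\<bar> * exp ((k + 1) * \<bar>x\<bar>)" by (intro mult_left_mono) auto
        then show ?thesis by simp
      qed
      show "\<bar>x\<bar> \<le> exp \<bar>x\<bar>" using exp_ge_add_one_self[of "\<bar>x\<bar>"] by linarith
    qed (use Ck in auto)
    also have "exp \<bar>x\<bar> * (C * exp (k * \<bar>x\<bar>)) = C * exp ((k + 1) * \<bar>x\<bar>)"
      by (simp add: algebra_simps exp_add)
    finally show ?thesis by (simp add: algebra_simps)
  qed
  then show ?case using Ck(1,2) by (intro exI[of _ "\<bar>a\<bar> + C"] exI[of _ "k + 1"]) auto
qed

lemma damped_poly_bounded: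
  assumes "\<epsilon> > 0"
  shows "\<exists>C. \<forall>x::real. \<bar>poly p x * exp (- \<epsilon> * x\<^sup>2)\<bar> \<le> C"
proof -
  obtain C k where Ck: "0 \<le> C" "0 \<le> k" "\<And>x. \<bar>poly p x\<bar> \<le> C * exp (k * \<bar>x\<bar>)"
    using poly_exp_bound[of p] by blast
  have "\<bar>poly p x * exp (- \<epsilon> * x\<^sup>2)\<bar> \<le> C * exp (k\<^sup>2 / (4 * \<epsilon>))" for x
  proof -
    have "0 \<le> (k - 2 * \<epsilon> * \<bar>x\<bar>)\<^sup>2" by simp
    then have "4 * \<epsilon> * (k * \<bar>x\<bar> - \<epsilon> * x\<^sup>2) \<le> k\<^sup>2" by (simp add: power2_eq_square algebra_simps)
    then have "k * \<bar>x\<bar> - \<epsilon> * x\<^sup>2 \<le> k\<^sup>2 / (4 * \<epsilon>)" using assms by (simp add: pos_le_divide_eq mult.commute)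
    then have "exp (k * \<bar>x\<bar>) * exp (- \<epsilon> * x\<^sup>2) \<le> exp (k\<^sup>2 / (4 * \<epsilon>))" by (simp flip: exp_add)
    then have "C * (exp (k * \<bar>x\<bar>) * exp (- \<epsilon> * x\<^sup>2)) \<le> C * exp (k\<^sup>2 / (4 * \<epsilon>))"
      using Ck(1) by (intro mult_left_mono) auto
    moreover have "\<bar>poly p x * exp (- \<epsilon> * x\<^sup>2)\<bar> \<le> (C * exp (k * \<bar>x\<bar>)) * exp (- \<epsilon> * x\<^sup>2)"
      unfolding abs_mult by (simp add: Ck(3))
    ultimately show ?thesis by (simp add: mult.assoc)
  qed
  then show ?thesis by blast
qed

text \<open>
  Sums of polynomials in one coordinate each, with a Gaussian cutoff. The family is closed under
  partial derivatives and consists of bounded functions, so its members have bounded derivatives of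
  all orders; as \<open>\<epsilon>\<close> tends to 0 the cutoff disappears.
\<close>

definition damped :: "real \<Rightarrow> nat \<Rightarrow> (nat \<Rightarrow> real poly) \<Rightarrow> (nat \<Rightarrow> real) \<Rightarrow> real" where
  "damped \<epsilon> p q x = (\<Sum>i<p. poly (q i) (x i) * exp (- \<epsilon> * (x i)\<^sup>2))"

definition damped_deriv :: "real \<Rightarrow> real poly \<Rightarrow> real poly" where
  "damped_deriv \<epsilon> q = pderiv q - [:0, 2 * \<epsilon>:] * q"

lemma damped_partial:
  assumes "i < p"
  shows "((\<lambda>t. damped \<epsilon> p q (x(i := t))) has_real_derivative
    damped \<epsilon> p (\<lambda>j. if j = i then damped_deriv \<epsilon> (q i) else 0) (x(i := t))) (at t)"
  unfolding damped_def
proof (rule DERIV_sum)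
  fix j
  show "((\<lambda>t. poly (q j) ((x(i := t)) j) * exp (- \<epsilon> * ((x(i := t)) j)\<^sup>2)) has_real_derivative
      poly (if j = i then damped_deriv \<epsilon> (q i) else 0) ((x(i := t)) j) * exp (- \<epsilon> * ((x(i := t)) j)\<^sup>2)) (at t)"
  proof (cases "j = i")
    case True
    have "((\<lambda>t. poly (q i) t * exp (- \<epsilon> * t\<^sup>2)) has_real_derivative
        poly (damped_deriv \<epsilon> (q i)) t * exp (- \<epsilon> * t\<^sup>2)) (at t)"
      by (auto intro!: derivative_eq_intros poly_DERIV simp: damped_deriv_def algebra_simps)
    then show ?thesis using True by simp
  qed simp
qed

lemma damped_partial_deriv:
  assumes "i < p"
  shows "partial_deriv i (damped \<epsilon> p q) = damped \<epsilon> p (\<lambda>j. if j = i then damped_deriv \<epsilon> (q i) else 0)"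
proof
  fix x
  show "partial_deriv i (damped \<epsilon> p q) x = damped \<epsilon> p (\<lambda>j. if j = i then damped_deriv \<epsilon> (q i) else 0) x"
    using DERIV_imp_deriv[OF damped_partial[OF assms, of \<epsilon> q x "x i"]] by (simp add: partial_deriv_def)
qed

lemma damped_Cb_infinity:
  assumes "\<epsilon> > 0"
  shows "damped \<epsilon> p q \<in> Cb_infinity p"
proof -
  have iter: "\<exists>r. foldr partial_deriv js (damped \<epsilon> p q) = damped \<epsilon> p r" if "set js \<subseteq> {..<p}" for js
    using that
  proof (induction js)
    case (Cons i js)
    then obtain r where "foldr partial_deriv js (damped \<epsilon> p q) = damped \<epsilon> p r" by auto
    then show ?case using damped_partial_deriv[of i p \<epsilon> r] Cons.prems by auto
  qed auto
  have good: "continuous_on UNIV (damped \<epsilon> p r) \<and> bounded (range (damped \<epsilon> p r)) \<and>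
      (\<forall>i<p. \<forall>x. (\<lambda>t. damped \<epsilon> p r (x(i := t))) differentiable at (x i))" for r
  proof (intro conjI allI impI)
    show "continuous_on UNIV (damped \<epsilon> p r)"
      unfolding damped_def[abs_def]
      by (intro continuous_intros continuous_on_poly continuous_on_product_coordinates)
    have "\<forall>i. \<exists>C. \<forall>x::real. \<bar>poly (r i) x * exp (- \<epsilon> * x\<^sup>2)\<bar> \<le> C"
      using damped_poly_bounded[OF assms] by blast
    then obtain C where C: "\<And>i x. \<bar>poly (r i) x * exp (- \<epsilon> * x\<^sup>2)\<bar> \<le> C i" by metis
    have "norm (damped \<epsilon> p r x) \<le> (\<Sum>i<p. C i)" for x
      unfolding damped_def real_norm_def by (intro order_trans[OF sum_abs] sum_mono C)
    then show "bounded (range (damped \<epsilon> p r))" by (auto simp: bounded_iff)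
    fix i x assume "i < p"
    then show "(\<lambda>t. damped \<epsilon> p r (x(i := t))) differentiable at (x i)"
      using damped_partial real_differentiable_def by blast
  qed
  show ?thesis
    unfolding Cb_infinity_def
  proof (intro CollectI conjI allI impI)
    fix x y :: "nat \<Rightarrow> real" assume "\<forall>i<p. x i = y i"
    then show "damped \<epsilon> p q x = damped \<epsilon> p q y" unfolding damped_def by (intro sum.cong) auto
  next
    fix js assume "set js \<subseteq> {..<p}"
    then obtain r where "foldr partial_deriv js (damped \<epsilon> p q) = damped \<epsilon> p r" using iter by blast
    then show "let g = foldr partial_deriv js (damped \<epsilon> p q) in continuous_on UNIV g \<and> bounded (range g) \<and>
        (\<forall>i<p. \<forall>x. (\<lambda>t. g (x(i := t))) differentiable at (x i))"
      using good[of r] by (simp add: Let_def)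
  qed
qed

lemma damped_single:
  assumes "i < p"
  shows "damped \<epsilon> p (\<lambda>j. if j = i then r else 0) x = poly r (x i) * exp (- \<epsilon> * (x i)\<^sup>2)"
proof -
  have "damped \<epsilon> p (\<lambda>j. if j = i then r else 0) x = (\<Sum>j<p. if j = i then poly r (x i) * exp (- \<epsilon> * (x i)\<^sup>2) else 0)"
    unfolding damped_def by (intro sum.cong) auto
  then show ?thesis using assms by simp
qed

context gaussian_space
begin

lemma L2_dominated_to_zero:
  fixes u :: "nat \<Rightarrow> 'a \<Rightarrow> 'b::{banach,second_countable_topology}"
  assumes [measurable]: "\<And>m. u m \<in> borel_measurable M" and w: "w \<in> L2 M"
    and bound: "\<And>m \<omega>. norm (u m \<omega>) \<le> w \<omega>" and lim: "\<And>\<omega>. (\<lambda>m. u m \<omega>) \<longlonglongrightarrow> 0"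
  shows "(\<lambda>m. expectation (\<lambda>\<omega>. (norm (u m \<omega>))\<^sup>2)) \<longlonglongrightarrow> 0"
proof -
  have "(\<lambda>m. expectation (\<lambda>\<omega>. (norm (u m \<omega>))\<^sup>2)) \<longlonglongrightarrow> expectation (\<lambda>\<omega>. 0)"
  proof (rule integral_dominated_convergence)
    show "integrable M (\<lambda>\<omega>. (w \<omega>)\<^sup>2)" using L2_integrable_real[OF w] .
    have "(\<lambda>m. (norm (u m \<omega>))\<^sup>2) \<longlonglongrightarrow> (norm (0::'b))\<^sup>2" for \<omega>
      by (intro tendsto_intros lim)
    then show "AE \<omega> in M. (\<lambda>m. (norm (u m \<omega>))\<^sup>2) \<longlonglongrightarrow> 0" by simp
    show "AE \<omega> in M. norm ((norm (u m \<omega>))\<^sup>2) \<le> (w \<omega>)\<^sup>2" for m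
      using bound by (auto intro!: power_mono)
  qed measurable
  then show ?thesis by simp
qed

text \<open>
  The cutoff converges to 1 pointwise, and both differences are dominated by polynomials in
  finitely many of the variables.
\<close>

lemma chaos_poly_smooth_approx:
  assumes f: "chaos_poly n f v" and "\<epsilon> > 0"
  shows "\<exists>(G, V)\<in>smooth_malliavin_graph X.
    expectation (\<lambda>\<omega>. (f (path \<omega>) - G \<omega>)\<^sup>2) + expectation (\<lambda>\<omega>. (norm (v (path \<omega>) - V \<omega>))\<^sup>2) < \<epsilon>"
proof -
  obtain S c where S: "finite S" "S \<subseteq> {h. norm h = 1}" "f = hermite_sum S c n" "v = hermite_grad S c n"
    using f unfolding chaos_poly_def by blast
  obtain h where "bij_betw h {0..<card S} S" using ex_bij_betw_nat_finite[OF S(1)] by blast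
  define p where "p = card S"
  have h: "bij_betw h {..<p} S" using \<open>bij_betw h {0..<card S} S\<close> by (simp add: p_def atLeast0LessThan)
  have unit: "norm (h i) = 1" if "i < p" for i
    using bij_betw_apply[OF h] that S(2) by auto
  let ?H = "hermite n" and ?H' = "pderiv (hermite n)"
  have fh: "f x = (\<Sum>i<p. c (h i) * poly ?H (x (h i)))" for x
    unfolding S(3) hermite_sum_def
    by (rule sum.reindex_bij_betw[OF h, of "\<lambda>g. c g * poly ?H (x g)", symmetric])
  have vh: "v x = (\<Sum>i<p. (c (h i) * poly ?H' (x (h i))) *\<^sub>R h i)" for x
    unfolding S(4) hermite_grad_def
    by (rule sum.reindex_bij_betw[OF h, of "\<lambda>g. (c g * poly ?H' (x g)) *\<^sub>R g", symmetric])
  define e where "e m = inverse (real (Suc m))" for m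
  have e: "0 < e m" "e m \<le> 1" for m by (auto simp: e_def inverse_le_1_iff)
  have e0: "e \<longlonglongrightarrow> 0" unfolding e_def by (rule LIMSEQ_inverse_real_of_nat)
  define q where "q i = smult (c (h i)) ?H" for i
  define G where "G m \<omega> = damped (e m) p q (\<lambda>j. X (h j) \<omega>)" for m \<omega>
  define V where "V m \<omega> = (\<Sum>i<p. partial_deriv i (damped (e m) p q) (\<lambda>j. X (h j) \<omega>) *\<^sub>R h i)" for m \<omega>
  have GV: "(G m, V m) \<in> smooth_malliavin_graph X" for m
    unfolding smooth_malliavin_graph_def G_def V_def
    using damped_Cb_infinity[OF e(1), of m p q] by blast
  have [measurable]: "G m \<in> borel_measurable M" "V m \<in> borel_measurable M" for m
    using smooth_graph_cylindrical[OF GV[of m]] cylindricalD(5,6)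
    by (metis all_moments_measurable)+
  have Veq: "V m \<omega> = (\<Sum>i<p. (c (h i) * (poly ?H' (X (h i) \<omega>) - 2 * e m * X (h i) \<omega> * poly ?H (X (h i) \<omega>))
      * exp (- e m * (X (h i) \<omega>)\<^sup>2)) *\<^sub>R h i)" for m \<omega>
    unfolding V_def
    by (intro sum.cong refl) (simp add: damped_partial_deriv damped_single damped_deriv_def q_def pderiv_smult algebra_simps)
  have Geq: "G m \<omega> = (\<Sum>i<p. c (h i) * poly ?H (X (h i) \<omega>) * exp (- e m * (X (h i) \<omega>)\<^sup>2))" for m \<omega>
    unfolding G_def damped_def q_def by simp
  have ex1: "\<bar>1 - exp (- e m * y\<^sup>2)\<bar> \<le> 1" "exp (- e m * y\<^sup>2) \<le> 1" for m and y :: real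
    using e(1)[of m] by (auto simp: abs_le_iff)
  have elim: "(\<lambda>m. exp (- e m * y\<^sup>2)) \<longlonglongrightarrow> 1" for y :: real
  proof -
    have "(\<lambda>m. exp (- e m * y\<^sup>2)) \<longlonglongrightarrow> exp (- 0 * y\<^sup>2)" by (intro tendsto_intros e0)
    then show ?thesis by simp
  qed
  note amp = all_moments_poly_X[OF unit]
  have "(\<lambda>m. expectation (\<lambda>\<omega>. (norm (f (path \<omega>) - G m \<omega>))\<^sup>2)) \<longlonglongrightarrow> 0"
  proof (rule L2_dominated_to_zero)
    show "(\<lambda>\<omega>. f (path \<omega>) - G m \<omega>) \<in> borel_measurable M" for m
      using L2_measurable[OF chaos_poly_L2[OF f]] by measurable
    show "(\<lambda>\<omega>. \<Sum>i<p. \<bar>c (h i)\<bar> * norm (poly ?H (X (h i) \<omega>))) \<in> L2 M"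
      by (intro all_moments_L2 all_moments_sum all_moments_mult all_moments_bounded[OF _ order_refl] all_moments_norm amp) auto
    have eq: "f (path \<omega>) - G m \<omega> = (\<Sum>i<p. c (h i) * poly ?H (X (h i) \<omega>) * (1 - exp (- e m * (X (h i) \<omega>)\<^sup>2)))" for m \<omega>
      unfolding fh Geq sum_subtractf[symmetric] by (intro sum.cong) (auto simp: algebra_simps)
    show "norm (f (path \<omega>) - G m \<omega>) \<le> (\<Sum>i<p. \<bar>c (h i)\<bar> * norm (poly ?H (X (h i) \<omega>)))" for m \<omega>
    proof -
      have "\<bar>c (h i) * poly ?H (X (h i) \<omega>)\<bar> * \<bar>1 - exp (- e m * (X (h i) \<omega>)\<^sup>2)\<bar>
          \<le> \<bar>c (h i) * poly ?H (X (h i) \<omega>)\<bar> * 1" for i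
        by (intro mult_left_mono ex1) auto
      then show ?thesis unfolding eq real_norm_def
        by (intro order_trans[OF sum_abs] sum_mono) (simp add: abs_mult)
    qed
    show "(\<lambda>m. f (path \<omega>) - G m \<omega>) \<longlonglongrightarrow> 0" for \<omega>
    proof -
      have "(\<lambda>m. f (path \<omega>) - G m \<omega>) \<longlonglongrightarrow> (\<Sum>i<p. c (h i) * poly ?H (X (h i) \<omega>) * (1 - 1))"
        unfolding eq by (intro tendsto_intros elim)
      then show ?thesis by simp
    qed
  qed
  then have l1: "(\<lambda>m. expectation (\<lambda>\<omega>. (f (path \<omega>) - G m \<omega>)\<^sup>2)) \<longlonglongrightarrow> 0" by simp
  have l2: "(\<lambda>m. expectation (\<lambda>\<omega>. (norm (v (path \<omega>) - V m \<omega>))\<^sup>2)) \<longlonglongrightarrow> 0"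
  proof (rule L2_dominated_to_zero)
    show "(\<lambda>\<omega>. v (path \<omega>) - V m \<omega>) \<in> borel_measurable M" for m
      using all_moments_measurable[OF cylindricalD(6)[OF chaos_poly_cylindrical[OF f]]] by measurable
    let ?w = "\<lambda>i \<omega>. norm (poly ?H' (X (h i) \<omega>)) + 2 * norm (poly ([:0, 1:] * ?H) (X (h i) \<omega>))"
    show "(\<lambda>\<omega>. \<Sum>i<p. \<bar>c (h i)\<bar> * ?w i \<omega>) \<in> L2 M"
      by (intro all_moments_L2 all_moments_sum all_moments_mult all_moments_add
          all_moments_bounded[OF _ order_refl] all_moments_norm amp) auto
    have eq: "v (path \<omega>) - V m \<omega> = (\<Sum>i<p. (c (h i) * (poly ?H' (X (h i) \<omega>) * (1 - exp (- e m * (X (h i) \<omega>)\<^sup>2))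
        + 2 * e m * (X (h i) \<omega> * poly ?H (X (h i) \<omega>)) * exp (- e m * (X (h i) \<omega>)\<^sup>2))) *\<^sub>R h i)" for m \<omega>
      unfolding vh Veq sum_subtractf[symmetric] scaleR_diff_left[symmetric]
      by (intro sum.cong) (auto simp: algebra_simps)
    show "norm (v (path \<omega>) - V m \<omega>) \<le> (\<Sum>i<p. \<bar>c (h i)\<bar> * ?w i \<omega>)" for m \<omega>
      unfolding eq
    proof (intro order_trans[OF norm_sum] sum_mono)
      fix i assume "i \<in> {..<p}"
      let ?y = "X (h i) \<omega>" and ?E = "exp (- e m * (X (h i) \<omega>)\<^sup>2)"
      have "\<bar>poly ?H' ?y * (1 - ?E)\<bar> \<le> \<bar>poly ?H' ?y\<bar> * 1"
        unfolding abs_mult by (intro mult_left_mono ex1) auto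
      moreover have "\<bar>2 * e m * (?y * poly ?H ?y) * ?E\<bar> \<le> 2 * 1 * \<bar>?y * poly ?H ?y\<bar> * 1"
        unfolding abs_mult using e[of m] ex1(2)[of m ?y]
        by (intro mult_mono) (auto simp: abs_mult)
      ultimately have "\<bar>poly ?H' ?y * (1 - ?E) + 2 * e m * (?y * poly ?H ?y) * ?E\<bar> \<le> ?w i \<omega>"
        by (simp only: poly_mult poly_pCons poly_0 real_norm_def mult_1_right mult_zero_right add_0_left add_0_right)
      then show "norm ((c (h i) * (poly ?H' ?y * (1 - ?E) + 2 * e m * (?y * poly ?H ?y) * ?E)) *\<^sub>R h i) \<le> \<bar>c (h i)\<bar> * ?w i \<omega>"
        using unit \<open>i \<in> {..<p}\<close> by (simp only: norm_scaleR real_norm_def abs_mult[of "c (h i)"] lessThan_iff)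
          (simp add: mult_left_mono)
    qed
    show "(\<lambda>m. v (path \<omega>) - V m \<omega>) \<longlonglongrightarrow> 0" for \<omega>
    proof -
      have "(\<lambda>m. v (path \<omega>) - V m \<omega>) \<longlonglongrightarrow> (\<Sum>i<p. (c (h i) * (poly ?H' (X (h i) \<omega>) * (1 - 1)
        + 2 * 0 * (X (h i) \<omega> * poly ?H (X (h i) \<omega>)) * 1)) *\<^sub>R h i)"
        unfolding eq by (intro tendsto_intros elim e0)
      then show ?thesis by simp
    qed
  qed
  have "(\<lambda>m. expectation (\<lambda>\<omega>. (f (path \<omega>) - G m \<omega>)\<^sup>2) + expectation (\<lambda>\<omega>. (norm (v (path \<omega>) - V m \<omega>))\<^sup>2)) \<longlonglongrightarrow> 0"
    using tendsto_add[OF l1 l2] by simp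
  from order_tendstoD(2)[OF this \<open>\<epsilon> > 0\<close>]
  obtain m where "expectation (\<lambda>\<omega>. (f (path \<omega>) - G m \<omega>)\<^sup>2) + expectation (\<lambda>\<omega>. (norm (v (path \<omega>) - V m \<omega>))\<^sup>2) < \<epsilon>"
    by (auto simp: eventually_sequentially)
  then show ?thesis using GV[of m] by blast
qed

lemma L2_norm_square_add_le:
  assumes "f \<in> L2 M" "g \<in> L2 M"
  shows "expectation (\<lambda>\<omega>. (norm (f \<omega> + g \<omega>))\<^sup>2)
    \<le> 2 * expectation (\<lambda>\<omega>. (norm (f \<omega>))\<^sup>2) + 2 * expectation (\<lambda>\<omega>. (norm (g \<omega>))\<^sup>2)"
proof -
  have "expectation (\<lambda>\<omega>. (norm (f \<omega> + g \<omega>))\<^sup>2) \<le> expectation (\<lambda>\<omega>. (norm (f \<omega>) + norm (g \<omega>))\<^sup>2)"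
  proof (rule integral_mono)
    show "integrable M (\<lambda>\<omega>. (norm (f \<omega> + g \<omega>))\<^sup>2)" by (intro L2_integrable L2_add assms)
    show "integrable M (\<lambda>\<omega>. (norm (f \<omega>) + norm (g \<omega>))\<^sup>2)"
      by (intro L2_integrable_real L2_add L2_norm assms)
    show "(norm (f \<omega> + g \<omega>))\<^sup>2 \<le> (norm (f \<omega>) + norm (g \<omega>))\<^sup>2" for \<omega>
      by (intro power_mono norm_triangle_ineq) auto
  qed
  also have "\<dots> \<le> 2 * expectation (\<lambda>\<omega>. (norm (f \<omega>))\<^sup>2) + 2 * expectation (\<lambda>\<omega>. (norm (g \<omega>))\<^sup>2)"
    by (intro L2_square_add_le L2_norm assms)
  finally show ?thesis .
qed

lemma chaos_poly_grad_L2: "chaos_poly n f v \<Longrightarrow> (\<lambda>\<omega>. v (path \<omega>)) \<in> L2 M"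
  by (intro all_moments_L2 cylindricalD(6)[OF chaos_poly_cylindrical])

lemma has_malliavin_derivative_chosen:
  "has_malliavin_derivative M X F U \<Longrightarrow> has_malliavin_derivative M X F (malliavin_derivative M X F)"
  unfolding malliavin_derivative_def by (rule someI[of "has_malliavin_derivative M X F"])

text \<open>
  On the \<open>n\<close>th chaos the gradient is bounded, \<open>E[\<parallel>DF\<parallel>\<^sup>2] = n E[F\<^sup>2]\<close>, so gradients of fast
  approximations converge. By hypercontractivity they also converge in fourth mean, with an explicit
  rate that the limit inherits.
\<close>

theorem wiener_chaos_malliavin:
  assumes F: "F \<in> wiener_chaos M X n" and n: "n \<ge> 1"
  shows "\<exists>f v U. (\<forall>j. chaos_poly n (f j) (v j)) \<and> has_malliavin_derivative M X F U
    \<and> (\<forall>j. expectation (\<lambda>\<omega>. (F \<omega> - f j (path \<omega>))\<^sup>2) \<le> (1/4) ^ j)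
    \<and> (\<forall>j. (\<integral>\<^sup>+\<omega>. ennreal (norm (U \<omega> - v j (path \<omega>)) ^ 4) \<partial>M) \<le> ennreal ((3 ^ n * (1/4) ^ j)\<^sup>2))"
proof -
  note FL = wiener_chaos_L2[OF F]
  \<comment> \<open>The factor \<open>n\<close> is lost again in \<open>E[\<parallel>DF\<parallel>\<^sup>2] = n E[F\<^sup>2]\<close>, the factor 4 in the triangle inequality.\<close>
  define \<delta> where "\<delta> j = (1/4) ^ j / (4 * real n)" for j :: nat
  have n0: "1 \<le> real n" using n by simp
  have \<delta>0: "0 < \<delta> j" for j unfolding \<delta>_def using n0 by simp
  have \<delta>le: "\<delta> j \<le> (1/4) ^ j" for j
  proof -
    have "(1/4) ^ j / (4 * real n) \<le> (1/4) ^ j / 1" using n0 by (intro divide_left_mono) auto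
    then show ?thesis by (simp add: \<delta>_def)
  qed
  have \<delta>mono: "\<delta> m \<le> \<delta> j" if "j \<le> m" for j m
    unfolding \<delta>_def using that n0 by (intro divide_right_mono power_decreasing) auto
  have "\<forall>j. \<exists>f v. chaos_poly n f v \<and> expectation (\<lambda>\<omega>. (F \<omega> - f (path \<omega>))\<^sup>2) < \<delta> j"
    using wiener_chaos_approx[OF F n \<delta>0] by blast
  then obtain f v where fv: "\<And>j. chaos_poly n (f j) (v j)"
    and fF: "\<And>j. expectation (\<lambda>\<omega>. (F \<omega> - f j (path \<omega>))\<^sup>2) < \<delta> j" by metis
  have ff: "real n * expectation (\<lambda>\<omega>. (f m (path \<omega>) - f j (path \<omega>))\<^sup>2) \<le> (1/4) ^ j" if "j \<le> m" for j m
  proof -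
    have "expectation (\<lambda>\<omega>. (f m (path \<omega>) - f j (path \<omega>))\<^sup>2)
        = expectation (\<lambda>\<omega>. ((F \<omega> - f j (path \<omega>)) + (- 1) * (F \<omega> - f m (path \<omega>)))\<^sup>2)" by simp
    also have "\<dots> \<le> 2 * expectation (\<lambda>\<omega>. (F \<omega> - f j (path \<omega>))\<^sup>2) + 2 * expectation (\<lambda>\<omega>. ((- 1) * (F \<omega> - f m (path \<omega>)))\<^sup>2)"
      by (intro L2_square_add_le L2_diff FL chaos_poly_L2[OF fv] L2_mult)
    also have "\<dots> = 2 * expectation (\<lambda>\<omega>. (F \<omega> - f j (path \<omega>))\<^sup>2) + 2 * expectation (\<lambda>\<omega>. (F \<omega> - f m (path \<omega>))\<^sup>2)"
      by (simp add: power_mult_distrib power2_commute)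
    also have "\<dots> \<le> 4 * \<delta> j" using fF[of j] fF[of m] \<delta>mono[OF that] by linarith
    finally have "real n * expectation (\<lambda>\<omega>. (f m (path \<omega>) - f j (path \<omega>))\<^sup>2) \<le> real n * (4 * \<delta> j)"
      by (intro mult_left_mono) auto
    then show ?thesis using n0 by (simp add: \<delta>_def)
  qed
  have diff: "chaos_poly n (\<lambda>x. f m x - f j x) (\<lambda>x. v m x - v j x)" for m j
    by (rule chaos_poly_diff[OF fv fv])
  have vL: "(\<lambda>\<omega>. v j (path \<omega>)) \<in> L2 M" for j by (rule chaos_poly_grad_L2[OF fv])
  have "\<exists>U\<in>L2 M. (AE \<omega> in M. (\<lambda>j. v j (path \<omega>)) \<longlonglongrightarrow> U \<omega>)
     \<and> (\<forall>j. (\<integral>\<omega>. (norm (U \<omega> - v j (path \<omega>)))\<^sup>2 \<partial>M) \<le> (1/4) ^ j)"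
  proof (rule L2_fast_Cauchy_limit_rate[OF vL])
    fix j m :: nat assume "j \<le> m"
    then show "(\<integral>\<omega>. (norm (v m (path \<omega>) - v j (path \<omega>)))\<^sup>2 \<partial>M) \<le> (1/4) ^ j"
      using chaos_poly_norm_grad[OF diff[of m j]] ff[of j m] by simp
  qed
  then obtain U where U: "U \<in> L2 M" and lim: "AE \<omega> in M. (\<lambda>j. v j (path \<omega>)) \<longlonglongrightarrow> U \<omega>"
    and rate: "\<And>j. expectation (\<lambda>\<omega>. (norm (U \<omega> - v j (path \<omega>)))\<^sup>2) \<le> (1/4) ^ j" by blast
  have fourth: "(\<integral>\<^sup>+\<omega>. ennreal (norm (U \<omega> - v j (path \<omega>)) ^ 4) \<partial>M) \<le> ennreal ((3 ^ n * (1/4) ^ j)\<^sup>2)" for j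
  proof (rule nn_integral_norm_power_Fatou[where f = "\<lambda>m \<omega>. v m (path \<omega>) - v j (path \<omega>)" and m = j])
    show "AE \<omega> in M. (\<lambda>m. v m (path \<omega>) - v j (path \<omega>)) \<longlonglongrightarrow> U \<omega> - v j (path \<omega>)"
      using lim by eventually_elim (intro tendsto_intros)
    fix m assume "j \<le> m"
    have am: "all_moments M (\<lambda>\<omega>. v m (path \<omega>) - v j (path \<omega>))"
      by (rule cylindricalD(6)[OF chaos_poly_cylindrical[OF diff]])
    have "(\<integral>\<^sup>+\<omega>. ennreal (norm (v m (path \<omega>) - v j (path \<omega>)) ^ 4) \<partial>M)
        = ennreal (expectation (\<lambda>\<omega>. norm (v m (path \<omega>) - v j (path \<omega>)) ^ 4))"
      using all_moments_integrable_power[OF am] by (intro nn_integral_eq_integral) auto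
    also have "\<dots> \<le> ennreal ((3 ^ n * (1/4) ^ j)\<^sup>2)"
    proof (rule ennreal_leI)
      have "expectation (\<lambda>\<omega>. norm (v m (path \<omega>) - v j (path \<omega>)) ^ 4)
          \<le> (3 ^ n * (real n * expectation (\<lambda>\<omega>. (f m (path \<omega>) - f j (path \<omega>))\<^sup>2)))\<^sup>2"
        by (rule chaos_poly_grad_hypercontractive[OF diff])
      also have "\<dots> \<le> (3 ^ n * (1/4) ^ j)\<^sup>2"
        using ff[OF \<open>j \<le> m\<close>] by (intro power_mono mult_left_mono) auto
      finally show "expectation (\<lambda>\<omega>. norm (v m (path \<omega>) - v j (path \<omega>)) ^ 4) \<le> (3 ^ n * (1/4) ^ j)\<^sup>2" .
    qed
    finally show "(\<integral>\<^sup>+\<omega>. ennreal (norm (v m (path \<omega>) - v j (path \<omega>)) ^ 4) \<partial>M) \<le> ennreal ((3 ^ n * (1/4) ^ j)\<^sup>2)" .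
  qed (use L2_measurable[OF L2_diff[OF vL vL]] L2_measurable[OF L2_diff[OF U vL]] in auto)
  have "has_malliavin_derivative M X F U"
    unfolding has_malliavin_derivative_def
  proof (intro conjI allI impI FL U)
    fix \<epsilon> :: real assume "\<epsilon> > 0"
    then have "\<exists>j. (1/4::real) ^ j < \<epsilon> / 8" by (intro real_arch_pow_inv) auto
    then obtain j where j: "(1/4::real) ^ j < \<epsilon> / 8" by blast
    obtain G V where GV: "(G, V) \<in> smooth_malliavin_graph X"
      "expectation (\<lambda>\<omega>. (f j (path \<omega>) - G \<omega>)\<^sup>2) + expectation (\<lambda>\<omega>. (norm (v j (path \<omega>) - V \<omega>))\<^sup>2) < \<epsilon> / 8"
      using chaos_poly_smooth_approx[OF fv, of "\<epsilon> / 8" j] \<open>\<epsilon> > 0\<close> by auto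
    obtain g w where gw: "cylindrical g w" "G = (\<lambda>\<omega>. g (path \<omega>))" "V = (\<lambda>\<omega>. w (path \<omega>))"
      using smooth_graph_cylindrical[OF GV(1)] .
    have GL: "G \<in> L2 M" "V \<in> L2 M" using cylindricalD(5,6)[OF gw(1)] gw by (auto intro: all_moments_L2)
    have "expectation (\<lambda>\<omega>. (F \<omega> - G \<omega>)\<^sup>2) = expectation (\<lambda>\<omega>. ((F \<omega> - f j (path \<omega>)) + (f j (path \<omega>) - G \<omega>))\<^sup>2)" by simp
    also have "\<dots> \<le> 2 * expectation (\<lambda>\<omega>. (F \<omega> - f j (path \<omega>))\<^sup>2) + 2 * expectation (\<lambda>\<omega>. (f j (path \<omega>) - G \<omega>)\<^sup>2)"
      by (intro L2_square_add_le L2_diff FL chaos_poly_L2[OF fv] GL)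
    finally have 1: "expectation (\<lambda>\<omega>. (F \<omega> - G \<omega>)\<^sup>2)
      \<le> 2 * expectation (\<lambda>\<omega>. (F \<omega> - f j (path \<omega>))\<^sup>2) + 2 * expectation (\<lambda>\<omega>. (f j (path \<omega>) - G \<omega>)\<^sup>2)" .
    have "expectation (\<lambda>\<omega>. (norm (U \<omega> - V \<omega>))\<^sup>2)
        = expectation (\<lambda>\<omega>. (norm ((U \<omega> - v j (path \<omega>)) + (v j (path \<omega>) - V \<omega>)))\<^sup>2)" by simp
    also have "\<dots> \<le> 2 * expectation (\<lambda>\<omega>. (norm (U \<omega> - v j (path \<omega>)))\<^sup>2) + 2 * expectation (\<lambda>\<omega>. (norm (v j (path \<omega>) - V \<omega>))\<^sup>2)"
      by (intro L2_norm_square_add_le L2_diff U vL GL)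
    finally have 2: "expectation (\<lambda>\<omega>. (norm (U \<omega> - V \<omega>))\<^sup>2)
      \<le> 2 * expectation (\<lambda>\<omega>. (norm (U \<omega> - v j (path \<omega>)))\<^sup>2) + 2 * expectation (\<lambda>\<omega>. (norm (v j (path \<omega>) - V \<omega>))\<^sup>2)" .
    have "expectation (\<lambda>\<omega>. (F \<omega> - G \<omega>)\<^sup>2) + expectation (\<lambda>\<omega>. (norm (U \<omega> - V \<omega>))\<^sup>2) < \<epsilon>"
      using 1 2 GV(2) fF[of j] \<delta>le[of j] rate[of j] j \<open>\<epsilon> > 0\<close> by linarith
    then show "\<exists>(G, V)\<in>smooth_malliavin_graph X.
        expectation (\<lambda>\<omega>. (F \<omega> - G \<omega>)\<^sup>2) + expectation (\<lambda>\<omega>. (norm (U \<omega> - V \<omega>))\<^sup>2) < \<epsilon>"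
      using GV(1) by blast
  qed
  moreover have "expectation (\<lambda>\<omega>. (F \<omega> - f j (path \<omega>))\<^sup>2) \<le> (1/4) ^ j" for j
    using fF[of j] \<delta>le[of j] by linarith
  ultimately show ?thesis using fv fourth by blast
qed

end

context generated_gaussian_space
begin

text \<open>
  \<open>\<parallel>U\<parallel>\<^sup>2 - \<parallel>v\<parallel>\<^sup>2\<close> is at most \<open>\<parallel>U - v\<parallel> (2 \<parallel>v\<parallel> + \<parallel>U - v\<parallel>)\<close>, whose second moment is controlled by
  the fourth moments of \<open>U - v\<close> and \<open>v\<close>. By uniqueness the limit \<open>U\<close> of the gradients may stand for
  the derivative.
\<close>

theorem wiener_chaos_poly_approx:
  assumes F: "F \<in> wiener_chaos M X n" and n: "n \<ge> 1" and "\<delta> > 0"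
  shows "\<exists>f v. chaos_poly n f v \<and> expectation (\<lambda>\<omega>. (F \<omega> - f (path \<omega>))\<^sup>2) < \<delta> \<and>
    (\<integral>\<^sup>+\<omega>. ennreal (((norm (malliavin_derivative M X F \<omega>))\<^sup>2 - (norm (v (path \<omega>)))\<^sup>2)\<^sup>2) \<partial>M) < ennreal \<delta>"
proof -
  note FL = wiener_chaos_L2[OF F]
  obtain f v U where fv: "\<And>j. chaos_poly n (f j) (v j)" and U: "has_malliavin_derivative M X F U"
    and fF: "\<And>j. expectation (\<lambda>\<omega>. (F \<omega> - f j (path \<omega>))\<^sup>2) \<le> (1/4) ^ j"
    and four: "\<And>j. (\<integral>\<^sup>+\<omega>. ennreal (norm (U \<omega> - v j (path \<omega>)) ^ 4) \<partial>M) \<le> ennreal ((3 ^ n * (1/4) ^ j)\<^sup>2)"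
    using wiener_chaos_malliavin[OF F n] by blast
  from malliavin_derivative_unique[OF has_malliavin_derivative_chosen[OF U] U]
  have eqU: "AE \<omega> in M. malliavin_derivative M X F \<omega> = U \<omega>" .
  have UL: "U \<in> L2 M" using U by (simp add: has_malliavin_derivative_def)
  define B where "B = 3 ^ n * (real n * (2 * expectation (\<lambda>\<omega>. (F \<omega>)\<^sup>2) + 2))"
  have B0: "0 \<le> B" unfolding B_def by simp
  define K where "K j = 3 ^ n * (1/4::real) ^ j" for j :: nat
  have K0: "0 \<le> K j" for j unfolding K_def by simp
  have main: "(\<integral>\<^sup>+\<omega>. ennreal (((norm (U \<omega>))\<^sup>2 - (norm (v j (path \<omega>)))\<^sup>2)\<^sup>2) \<partial>M)
      \<le> ennreal (8 * (K j * B) + 2 * (K j)\<^sup>2)" for j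
  proof -
    define a where "a \<omega> = norm (U \<omega> - v j (path \<omega>))" for \<omega>
    define b where "b \<omega> = norm (v j (path \<omega>))" for \<omega>
    have amv: "all_moments M (\<lambda>\<omega>. v j (path \<omega>))" by (rule cylindricalD(6)[OF chaos_poly_cylindrical[OF fv]])
    note [measurable] = L2_measurable[OF UL] all_moments_measurable[OF amv]
    have am[measurable]: "a \<in> borel_measurable M" "b \<in> borel_measurable M"
      unfolding a_def b_def by measurable
    have n4: "(y ^ 2)\<^sup>2 = y ^ 4" for y :: real by (simp flip: power_mult)
    have aL: "(\<lambda>\<omega>. (a \<omega>)\<^sup>2) \<in> L2 M"
      by (rule L2_nn_I[of _ _ "(K j)\<^sup>2"]) (use four[of j] in \<open>auto simp: n4 a_def K_def\<close>)
    have bL: "(\<lambda>\<omega>. (b \<omega>)\<^sup>2) \<in> L2 M"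
      using all_moments_integrable_power[OF amv, of 4] by (intro L2_I) (auto simp: n4 b_def)
    have a4: "expectation (\<lambda>\<omega>. ((a \<omega>)\<^sup>2)\<^sup>2) \<le> (K j)\<^sup>2"
      using integral_norm2_le_of_nn[OF aL, of "(K j)\<^sup>2"] four[of j] by (simp add: n4 a_def K_def)
    have f2: "expectation (\<lambda>\<omega>. (f j (path \<omega>))\<^sup>2) \<le> 2 * expectation (\<lambda>\<omega>. (F \<omega>)\<^sup>2) + 2"
    proof -
      have "expectation (\<lambda>\<omega>. (f j (path \<omega>))\<^sup>2) = expectation (\<lambda>\<omega>. (F \<omega> + (- 1) * (F \<omega> - f j (path \<omega>)))\<^sup>2)" by simp
      also have "\<dots> \<le> 2 * expectation (\<lambda>\<omega>. (F \<omega>)\<^sup>2) + 2 * expectation (\<lambda>\<omega>. ((- 1) * (F \<omega> - f j (path \<omega>)))\<^sup>2)"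
        by (intro L2_square_add_le L2_mult L2_diff FL chaos_poly_L2[OF fv])
      also have "expectation (\<lambda>\<omega>. ((- 1) * (F \<omega> - f j (path \<omega>)))\<^sup>2) = expectation (\<lambda>\<omega>. (F \<omega> - f j (path \<omega>))\<^sup>2)"
        by (simp add: power2_commute)
      also have "\<dots> \<le> 1" using fF[of j] power_le_one[of "1/4::real" j] by simp
      finally show ?thesis by simp
    qed
    have b4: "expectation (\<lambda>\<omega>. ((b \<omega>)\<^sup>2)\<^sup>2) \<le> B\<^sup>2"
    proof -
      have "expectation (\<lambda>\<omega>. ((b \<omega>)\<^sup>2)\<^sup>2) \<le> (3 ^ n * (real n * expectation (\<lambda>\<omega>. (f j (path \<omega>))\<^sup>2)))\<^sup>2"
        unfolding n4 b_def by (rule chaos_poly_grad_hypercontractive[OF fv])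
      also have "\<dots> \<le> B\<^sup>2" unfolding B_def using f2 by (intro power_mono mult_left_mono) auto
      finally show ?thesis .
    qed
    have "(\<integral>\<^sup>+\<omega>. ennreal (((norm (U \<omega>))\<^sup>2 - (norm (v j (path \<omega>)))\<^sup>2)\<^sup>2) \<partial>M)
        \<le> (\<integral>\<^sup>+\<omega>. ennreal (8 * ((a \<omega>)\<^sup>2 * (b \<omega>)\<^sup>2) + 2 * ((a \<omega>)\<^sup>2)\<^sup>2) \<partial>M)"
    proof (intro nn_integral_mono ennreal_leI)
      fix \<omega>
      let ?u = "norm (U \<omega>)"
      have u: "\<bar>?u - b \<omega>\<bar> \<le> a \<omega>" unfolding a_def b_def by (rule norm_triangle_ineq3)
      have b0: "0 \<le> b \<omega>" "0 \<le> a \<omega>" "0 \<le> ?u" by (auto simp: a_def b_def)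
      have "?u\<^sup>2 - (b \<omega>)\<^sup>2 = (?u - b \<omega>) * (?u + b \<omega>)" by (simp add: power2_eq_square algebra_simps)
      also have "\<bar>\<dots>\<bar> \<le> a \<omega> * (2 * b \<omega> + a \<omega>)"
        unfolding abs_mult using u b0 by (intro mult_mono) auto
      finally have "\<bar>?u\<^sup>2 - (b \<omega>)\<^sup>2\<bar>\<^sup>2 \<le> (a \<omega> * (2 * b \<omega> + a \<omega>))\<^sup>2" by (intro power_mono) auto
      also have "\<dots> = (a \<omega>)\<^sup>2 * (2 * b \<omega> + a \<omega>)\<^sup>2" by (rule power_mult_distrib)
      also have "\<dots> \<le> (a \<omega>)\<^sup>2 * (8 * (b \<omega>)\<^sup>2 + 2 * (a \<omega>)\<^sup>2)"
        using sum_squares_bound[of "2 * b \<omega>" "a \<omega>"] by (intro mult_left_mono) (auto simp: power2_sum power_mult_distrib)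
      finally show "(?u\<^sup>2 - (norm (v j (path \<omega>)))\<^sup>2)\<^sup>2 \<le> 8 * ((a \<omega>)\<^sup>2 * (b \<omega>)\<^sup>2) + 2 * ((a \<omega>)\<^sup>2)\<^sup>2"
        by (simp add: b_def algebra_simps power2_eq_square)
    qed
    also have "\<dots> = ennreal (expectation (\<lambda>\<omega>. 8 * ((a \<omega>)\<^sup>2 * (b \<omega>)\<^sup>2) + 2 * ((a \<omega>)\<^sup>2)\<^sup>2))"
      using integrable_mult_L2[OF aL bL] L2_integrable_real[OF aL]
      by (intro nn_integral_eq_integral) auto
    also have "\<dots> \<le> ennreal (8 * (K j * B) + 2 * (K j)\<^sup>2)"
    proof (rule ennreal_leI)
      have "expectation (\<lambda>\<omega>. 8 * ((a \<omega>)\<^sup>2 * (b \<omega>)\<^sup>2) + 2 * ((a \<omega>)\<^sup>2)\<^sup>2)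
          = 8 * expectation (\<lambda>\<omega>. (a \<omega>)\<^sup>2 * (b \<omega>)\<^sup>2) + 2 * expectation (\<lambda>\<omega>. ((a \<omega>)\<^sup>2)\<^sup>2)"
        using integrable_mult_L2[OF aL bL] L2_integrable_real[OF aL] by simp
      moreover have "expectation (\<lambda>\<omega>. (a \<omega>)\<^sup>2 * (b \<omega>)\<^sup>2) \<le> K j * B"
      proof -
        have "expectation (\<lambda>\<omega>. (a \<omega>)\<^sup>2 * (b \<omega>)\<^sup>2)
            \<le> sqrt (expectation (\<lambda>\<omega>. ((a \<omega>)\<^sup>2)\<^sup>2)) * sqrt (expectation (\<lambda>\<omega>. ((b \<omega>)\<^sup>2)\<^sup>2))"
          using L2_cauchy_schwarz[OF aL bL] by simp
        also have "\<dots> \<le> K j * B"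
          using a4 b4 K0 B0 by (intro mult_mono real_le_lsqrt) auto
        finally show ?thesis .
      qed
      ultimately show "expectation (\<lambda>\<omega>. 8 * ((a \<omega>)\<^sup>2 * (b \<omega>)\<^sup>2) + 2 * ((a \<omega>)\<^sup>2)\<^sup>2) \<le> 8 * (K j * B) + 2 * (K j)\<^sup>2"
        using a4 by linarith
    qed
    finally show ?thesis .
  qed
  have p0: "(\<lambda>j. (1/4::real) ^ j) \<longlonglongrightarrow> 0" by (intro LIMSEQ_realpow_zero) auto
  have Klim: "K \<longlonglongrightarrow> 0" unfolding K_def using tendsto_mult_left[OF p0, of "3 ^ n"] by simp
  have "(\<lambda>j. 8 * (K j * B) + 2 * (K j)\<^sup>2) \<longlonglongrightarrow> 8 * (0 * B) + 2 * 0\<^sup>2"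
    by (intro tendsto_intros Klim)
  then have "\<forall>\<^sub>F j in sequentially. 8 * (K j * B) + 2 * (K j)\<^sup>2 < \<delta>"
    using \<open>\<delta> > 0\<close> by (intro order_tendstoD(2)) auto
  moreover have "\<forall>\<^sub>F j in sequentially. (1/4::real) ^ j < \<delta>"
    using p0 \<open>\<delta> > 0\<close> by (rule order_tendstoD(2))
  ultimately have "\<forall>\<^sub>F j in sequentially. 8 * (K j * B) + 2 * (K j)\<^sup>2 < \<delta> \<and> (1/4::real) ^ j < \<delta>"
    by eventually_elim simp
  then obtain j where j: "8 * (K j * B) + 2 * (K j)\<^sup>2 < \<delta>" "(1/4::real) ^ j < \<delta>"
    by (auto simp: eventually_sequentially)
  have "(\<integral>\<^sup>+\<omega>. ennreal (((norm (malliavin_derivative M X F \<omega>))\<^sup>2 - (norm (v j (path \<omega>)))\<^sup>2)\<^sup>2) \<partial>M)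
      = (\<integral>\<^sup>+\<omega>. ennreal (((norm (U \<omega>))\<^sup>2 - (norm (v j (path \<omega>)))\<^sup>2)\<^sup>2) \<partial>M)"
    using eqU by (intro nn_integral_cong_AE) (auto elim: eventually_mono)
  also have "\<dots> \<le> ennreal (8 * (K j * B) + 2 * (K j)\<^sup>2)" by (rule main)
  also have "\<dots> < ennreal \<delta>" using j(1) \<open>\<delta> > 0\<close> by (intro ennreal_lessI) auto
  finally show ?thesis using fv[of j] fF[of j] j(2) by (intro exI[of _ "f j"] exI[of _ "v j"]) auto
qed

end

section \<open>Inner products of gradients from two chaoses\<close>

context gaussian_space
begin

text \<open>
  The relation \<open>\<langle>DF, DG\<rangle> = (L + p + q) (F G) / 2\<close> tested against the \<open>k\<close>th chaos. It is the sum of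
  the integrations by parts based on \<open>F\<close> and on \<open>G\<close>, minus the one based on \<open>\<psi>\<close>.
\<close>

lemma chaos_product_test:
  assumes f: "chaos_poly p f v" and g: "chaos_poly q g w" and psi: "chaos_poly k \<psi> u"
  shows "expectation (\<lambda>\<omega>. (v (path \<omega>) \<bullet> w (path \<omega>)) * \<psi> (path \<omega>))
    = (real p + real q - real k) / 2 * expectation (\<lambda>\<omega>. (f (path \<omega>) * g (path \<omega>)) * \<psi> (path \<omega>))"
proof -
  note c = chaos_poly_cylindrical[OF f] chaos_poly_cylindrical[OF g] chaos_poly_cylindrical[OF psi]
  note am = cylindricalD(5,6)[OF c(1)] cylindricalD(5,6)[OF c(2)] cylindricalD(5,6)[OF c(3)]
  let ?a = "\<lambda>\<omega>. \<psi> (path \<omega>) * (v (path \<omega>) \<bullet> w (path \<omega>))"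
  let ?b = "\<lambda>\<omega>. g (path \<omega>) * (v (path \<omega>) \<bullet> u (path \<omega>))"
  let ?c = "\<lambda>\<omega>. f (path \<omega>) * (w (path \<omega>) \<bullet> u (path \<omega>))"
  let ?e = "expectation (\<lambda>\<omega>. f (path \<omega>) * g (path \<omega>) * \<psi> (path \<omega>))"
  have i: "integrable M ?a" "integrable M ?b" "integrable M ?c"
    by (intro all_moments_integrable all_moments_mult all_moments_inner am)+
  have "real p * expectation (\<lambda>\<omega>. f (path \<omega>) * (g (path \<omega>) * \<psi> (path \<omega>)))
      = expectation (\<lambda>\<omega>. v (path \<omega>) \<bullet> (g (path \<omega>) *\<^sub>R u (path \<omega>) + \<psi> (path \<omega>) *\<^sub>R w (path \<omega>)))"
    by (rule chaos_integration_by_parts[OF f cylindrical_mult[OF c(2,3)]])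
  also have "\<dots> = expectation (\<lambda>\<omega>. ?b \<omega> + ?a \<omega>)" by (simp add: inner_add_right)
  finally have 1: "real p * ?e = expectation ?b + expectation ?a" using i by (simp add: mult.assoc)
  have "real q * expectation (\<lambda>\<omega>. g (path \<omega>) * (f (path \<omega>) * \<psi> (path \<omega>)))
      = expectation (\<lambda>\<omega>. w (path \<omega>) \<bullet> (f (path \<omega>) *\<^sub>R u (path \<omega>) + \<psi> (path \<omega>) *\<^sub>R v (path \<omega>)))"
    by (rule chaos_integration_by_parts[OF g cylindrical_mult[OF c(1,3)]])
  also have "\<dots> = expectation (\<lambda>\<omega>. ?c \<omega> + ?a \<omega>)" by (simp add: inner_add_right inner_commute)
  finally have 2: "real q * ?e = expectation ?c + expectation ?a" using i by (simp add: mult_ac)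
  have "real k * expectation (\<lambda>\<omega>. \<psi> (path \<omega>) * (f (path \<omega>) * g (path \<omega>)))
      = expectation (\<lambda>\<omega>. u (path \<omega>) \<bullet> (f (path \<omega>) *\<^sub>R w (path \<omega>) + g (path \<omega>) *\<^sub>R v (path \<omega>)))"
    by (rule chaos_integration_by_parts[OF psi cylindrical_mult[OF c(1,2)]])
  also have "\<dots> = expectation (\<lambda>\<omega>. ?c \<omega> + ?b \<omega>)" by (simp add: inner_add_right inner_commute)
  finally have 3: "real k * ?e = expectation ?c + expectation ?b" using i by (simp add: mult_ac)
  have "(real p + real q - real k) / 2 * ?e = expectation ?a"
    using 1 2 3 by (simp add: algebra_simps)
  then show ?thesis by (simp add: mult.commute)
qed

lemma chaos_product_mean:
  assumes f: "chaos_poly p f v" and g: "chaos_poly q g w"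
  shows "expectation (\<lambda>\<omega>. v (path \<omega>) \<bullet> w (path \<omega>))
    = (real p + real q) / 2 * expectation (\<lambda>\<omega>. f (path \<omega>) * g (path \<omega>))"
proof -
  have "real p * expectation (\<lambda>\<omega>. f (path \<omega>) * g (path \<omega>)) = expectation (\<lambda>\<omega>. v (path \<omega>) \<bullet> w (path \<omega>))"
    by (rule chaos_integration_by_parts[OF f chaos_poly_cylindrical[OF g]])
  moreover have "real q * expectation (\<lambda>\<omega>. f (path \<omega>) * g (path \<omega>)) = expectation (\<lambda>\<omega>. v (path \<omega>) \<bullet> w (path \<omega>))"
    using chaos_integration_by_parts[OF g chaos_poly_cylindrical[OF f]] by (simp add: mult.commute inner_commute)
  ultimately show ?thesis by (simp add: field_simps)
qed

text \<open>
  Integration by parts based on \<open>F\<close>, against \<open>F G\<^sup>2\<close>. Exchanging \<open>F\<close> and \<open>G\<close> changes the factor \<open>p\<close>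
  and the first term on the right, but not the second.
\<close>

lemma fourth_moment_exchange:
  assumes f: "chaos_poly p f v" and g: "chaos_poly q g w"
  shows "real p * expectation (\<lambda>\<omega>. (f (path \<omega>))\<^sup>2 * (g (path \<omega>))\<^sup>2)
    = expectation (\<lambda>\<omega>. (g (path \<omega>))\<^sup>2 * (norm (v (path \<omega>)))\<^sup>2)
      + 2 * expectation (\<lambda>\<omega>. f (path \<omega>) * g (path \<omega>) * (v (path \<omega>) \<bullet> w (path \<omega>)))"
proof -
  note c = chaos_poly_cylindrical[OF f] chaos_poly_cylindrical[OF g]
  note am = cylindricalD(5,6)[OF c(1)] cylindricalD(5,6)[OF c(2)]
  have i: "integrable M (\<lambda>\<omega>. (g (path \<omega>))\<^sup>2 * (norm (v (path \<omega>)))\<^sup>2)"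
    "integrable M (\<lambda>\<omega>. f (path \<omega>) * g (path \<omega>) * (v (path \<omega>) \<bullet> w (path \<omega>)))"
    by (intro all_moments_integrable all_moments_mult all_moments_inner all_moments_power all_moments_norm
      am finite_measure_axioms)+
  have "real p * expectation (\<lambda>\<omega>. f (path \<omega>) * (f (path \<omega>) * (g (path \<omega>) * g (path \<omega>))))
     = expectation (\<lambda>\<omega>. v (path \<omega>) \<bullet> (f (path \<omega>) *\<^sub>R (g (path \<omega>) *\<^sub>R w (path \<omega>) + g (path \<omega>) *\<^sub>R w (path \<omega>))
        + (g (path \<omega>) * g (path \<omega>)) *\<^sub>R v (path \<omega>)))"
    by (rule chaos_integration_by_parts[OF f cylindrical_mult[OF c(1) cylindrical_mult[OF c(2) c(2)]]])
  also have "\<dots> = expectation (\<lambda>\<omega>. (g (path \<omega>))\<^sup>2 * (norm (v (path \<omega>)))\<^sup>2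
      + 2 * (f (path \<omega>) * g (path \<omega>) * (v (path \<omega>) \<bullet> w (path \<omega>))))"
    by (simp add: inner_add_right dot_square_norm power2_eq_square algebra_simps)
  also have "\<dots> = expectation (\<lambda>\<omega>. (g (path \<omega>))\<^sup>2 * (norm (v (path \<omega>)))\<^sup>2)
      + 2 * expectation (\<lambda>\<omega>. f (path \<omega>) * g (path \<omega>) * (v (path \<omega>) \<bullet> w (path \<omega>)))"
    using i by simp
  finally show ?thesis by (simp add: power2_eq_square mult.assoc)
qed

end

context generated_gaussian_space
begin

text \<open>
  In terms of the components \<open>J\<^sub>k\<close> of \<open>F G\<close>, the inner product of the gradients is
  \<open>\<Sum>\<^sub>k a\<^sub>k J\<^sub>k\<close> with \<open>a\<^sub>k = (p + q - k) / 2\<close>. Only \<open>k \<le> p + q\<close> occur, so \<open>0 \<le> a\<^sub>k \<le> (p + q) / 2\<close> and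
  \<open>\<Sum>\<^sub>k a\<^sub>k\<^sup>2 E[J\<^sub>k\<^sup>2] \<le> (p + q) / 2 * \<Sum>\<^sub>k a\<^sub>k E[J\<^sub>k\<^sup>2]\<close>.
\<close>

theorem gradient_inner_product_bound:
  assumes f: "chaos_poly p f v" and g: "chaos_poly q g w"
  shows "expectation (\<lambda>\<omega>. (v (path \<omega>) \<bullet> w (path \<omega>))\<^sup>2)
    \<le> (real p + real q) / 2 * expectation (\<lambda>\<omega>. f (path \<omega>) * g (path \<omega>) * (v (path \<omega>) \<bullet> w (path \<omega>)))"
proof -
  note c = chaos_poly_cylindrical[OF f] chaos_poly_cylindrical[OF g]
  note am = cylindricalD(5,6)[OF c(1)] cylindricalD(5,6)[OF c(2)]
  define R where "R \<omega> = v (path \<omega>) \<bullet> w (path \<omega>)" for \<omega>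
  define Q where "Q \<omega> = f (path \<omega>) * g (path \<omega>)" for \<omega>
  have RL: "R \<in> L2 M" and QL: "Q \<in> L2 M" unfolding R_def Q_def
    by (intro all_moments_L2 all_moments_mult all_moments_inner am)+
  define J where "J k = chaos_projection M X k Q" for k
  \<comment> \<open>The eigenvalue of \<open>(L + p + q) / 2\<close> on the \<open>k\<close>th chaos.\<close>
  define a where "a k = (real p + real q - real k) / 2" for k
  have J: "J k \<in> wiener_chaos M X k" "J k \<in> L2 M" for k
    unfolding J_def by (intro chaos_projection(1) QL chaos_projection_L2)+
  define R' where "R' \<omega> = (\<Sum>k\<le>p + q. a k * J k \<omega>)" for \<omega>
  have aJ: "(\<lambda>\<omega>. a k * J k \<omega>) \<in> wiener_chaos M X k" "(\<lambda>\<omega>. a k * J k \<omega>) \<in> L2 M" for k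
    by (intro wiener_chaos_cmult L2_mult J)+
  have R'L: "R' \<in> L2 M" unfolding R'_def by (intro L2_sum aJ)
  have test: "chaos_orthogonal k (\<lambda>\<omega>. R \<omega> - a k * Q \<omega>)" for k
  proof (cases "k = 0")
    case True
    have "expectation (\<lambda>\<omega>. R \<omega> - a k * Q \<omega>) = expectation R - a k * expectation Q"
      using L2_imp_integrable[OF RL] L2_imp_integrable[OF QL] by simp
    also have "\<dots> = 0"
      using chaos_product_mean[OF f g] True by (simp add: R_def[abs_def] Q_def[abs_def] a_def)
    finally show ?thesis using True by (simp add: chaos_orthogonal_def)
  next
    case False
    have "expectation (\<lambda>\<omega>. (R \<omega> - a k * Q \<omega>) * poly (hermite k) (X h \<omega>)) = 0" if h: "norm h = 1" for h
    proof -
      let ?H = "\<lambda>\<omega>. poly (hermite k) (X h \<omega>)"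
      have "expectation (\<lambda>\<omega>. (R \<omega> - a k * Q \<omega>) * ?H \<omega>)
          = expectation (\<lambda>\<omega>. R \<omega> * ?H \<omega> - a k * (Q \<omega> * ?H \<omega>))"
        by (simp add: left_diff_distrib mult.assoc)
      also have "\<dots> = expectation (\<lambda>\<omega>. R \<omega> * ?H \<omega>) - a k * expectation (\<lambda>\<omega>. Q \<omega> * ?H \<omega>)"
        using integrable_mult_L2[OF RL hermite_X_L2[OF h]] integrable_mult_L2[OF QL hermite_X_L2[OF h]] by simp
      also have "\<dots> = 0"
        using chaos_product_test[OF f g hermite_X_chaos_poly[OF h, of k]] by (simp add: R_def Q_def a_def)
      finally show ?thesis .
    qed
    then show ?thesis using False by (simp add: chaos_orthogonal_def)
  qed
  have "AE \<omega> in M. R \<omega> - R' \<omega> = 0"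
  proof (rule chaos_total[OF L2_diff[OF RL R'L]])
    fix n
    show "chaos_orthogonal n (\<lambda>\<omega>. R \<omega> - R' \<omega>)"
    proof (cases "n \<le> p + q")
      case True
      have eq: "R \<omega> - R' \<omega> = (R \<omega> - a n * Q \<omega>) + a n * (Q \<omega> - J n \<omega>) - (\<Sum>k\<in>{..p + q} - {n}. a k * J k \<omega>)" for \<omega>
        unfolding R'_def using True by (subst sum.remove[of _ n]) (auto simp: algebra_simps)
      have 1: "chaos_orthogonal n (\<lambda>\<omega>. a n * (Q \<omega> - J n \<omega>))"
        unfolding J_def by (intro chaos_orthogonal_cmult chaos_projection_orthogonal QL)
      have 2: "chaos_orthogonal n (\<lambda>\<omega>. \<Sum>k\<in>{..p + q} - {n}. a k * J k \<omega>)"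
        by (rule chaos_orthogonal_sum) (auto intro: aJ(2) wiener_chaos_orthogonal_hermite[OF aJ(1)])
      have L: "(\<lambda>\<omega>. R \<omega> - a n * Q \<omega>) \<in> L2 M" "(\<lambda>\<omega>. a n * (Q \<omega> - J n \<omega>)) \<in> L2 M"
        "(\<lambda>\<omega>. \<Sum>k\<in>{..p + q} - {n}. a k * J k \<omega>) \<in> L2 M"
        by (intro L2_sum L2_diff L2_mult RL QL J)+
      show ?thesis unfolding eq
        by (rule chaos_orthogonal_diff[OF chaos_orthogonal_add[OF test 1 L(1,2)] 2 L2_add[OF L(1,2)] L(3)])
    next
      case False
      have "chaos_orthogonal n Q"
      proof -
        have "expectation (\<lambda>\<omega>. Q \<omega> * poly (hermite n) (X h \<omega>)) = 0" if "norm h = 1" for h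
          using chaos_product_degree[OF that f g, of n] False by (simp add: Q_def mult.commute)
        then show ?thesis using False by (simp add: chaos_orthogonal_def)
      qed
      then have Q: "chaos_orthogonal n (\<lambda>\<omega>. a n * Q \<omega>)" by (rule chaos_orthogonal_cmult)
      have eq: "R \<omega> - R' \<omega> = (R \<omega> - a n * Q \<omega>) + a n * Q \<omega> - R' \<omega>" for \<omega> by simp
      have R': "chaos_orthogonal n R'" unfolding R'_def
        using False by (intro chaos_orthogonal_sum wiener_chaos_orthogonal_hermite[OF aJ(1)] aJ) auto
      have L: "(\<lambda>\<omega>. R \<omega> - a n * Q \<omega>) \<in> L2 M" "(\<lambda>\<omega>. a n * Q \<omega>) \<in> L2 M"
        by (intro L2_diff L2_mult RL QL)+
      show ?thesis unfolding eq
        by (rule chaos_orthogonal_diff[OF chaos_orthogonal_add[OF test Q L] R' L2_add[OF L] R'L])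
    qed
  qed
  then have RR': "AE \<omega> in M. R \<omega> = R' \<omega>" by eventually_elim simp
  note [measurable] = L2_measurable[OF RL] L2_measurable[OF QL] L2_measurable[OF R'L]
  have "expectation (\<lambda>\<omega>. (R \<omega>)\<^sup>2) = expectation (\<lambda>\<omega>. (R' \<omega>)\<^sup>2)"
    using RR' by (intro integral_cong_AE) (auto elim: eventually_mono)
  also have "\<dots> = (\<Sum>k\<le>p + q. expectation (\<lambda>\<omega>. (a k * J k \<omega>)\<^sup>2))"
    unfolding R'_def by (rule expectation_sum_chaos_square) (auto intro: aJ)
  also have "\<dots> = (\<Sum>k\<le>p + q. a k * (a k * expectation (\<lambda>\<omega>. (J k \<omega>)\<^sup>2)))"
  proof (intro sum.cong refl)
    fix k
    have "(a k * J k \<omega>)\<^sup>2 = a k * (a k * (J k \<omega>)\<^sup>2)" for \<omega> by (simp add: power2_eq_square)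
    then show "expectation (\<lambda>\<omega>. (a k * J k \<omega>)\<^sup>2) = a k * (a k * expectation (\<lambda>\<omega>. (J k \<omega>)\<^sup>2))"
      by (simp only: integral_mult_right_zero)
  qed
  also have "\<dots> \<le> (\<Sum>k\<le>p + q. (real p + real q) / 2 * (a k * expectation (\<lambda>\<omega>. (J k \<omega>)\<^sup>2)))"
  proof (intro sum_mono mult_right_mono)
    fix k assume "k \<in> {..p + q}"
    then have "0 \<le> a k" unfolding a_def by (simp flip: of_nat_add)
    then show "0 \<le> a k * expectation (\<lambda>\<omega>. (J k \<omega>)\<^sup>2)" by simp
    show "a k \<le> (real p + real q) / 2" by (simp add: a_def)
  qed
  also have "\<dots> = (real p + real q) / 2 * (\<Sum>k\<le>p + q. a k * expectation (\<lambda>\<omega>. (J k \<omega>)\<^sup>2))"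
    by (simp only: sum_distrib_left)
  also have "(\<Sum>k\<le>p + q. a k * expectation (\<lambda>\<omega>. (J k \<omega>)\<^sup>2)) = (\<Sum>k\<le>p + q. expectation (\<lambda>\<omega>. Q \<omega> * (a k * J k \<omega>)))"
  proof (intro sum.cong refl)
    fix k
    have "Q \<omega> * (a k * J k \<omega>) = a k * (Q \<omega> * J k \<omega>)" for \<omega> by simp
    then show "a k * expectation (\<lambda>\<omega>. (J k \<omega>)\<^sup>2) = expectation (\<lambda>\<omega>. Q \<omega> * (a k * J k \<omega>))"
      using chaos_projection_inner[OF QL, of k] by (simp only: integral_mult_right_zero J_def)
  qed
  also have "\<dots> = expectation (\<lambda>\<omega>. Q \<omega> * R' \<omega>)"
    unfolding R'_def sum_distrib_left
    by (rule Bochner_Integration.integral_sum[symmetric]) (intro integrable_mult_L2 QL aJ)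
  also have "\<dots> = expectation (\<lambda>\<omega>. Q \<omega> * R \<omega>)"
    using RR' by (intro integral_cong_AE) (auto elim: eventually_mono)
  finally show ?thesis by (simp add: R_def Q_def)
qed

text \<open>
  The two exchange identities form a linear system for \<open>A = E[F\<^sup>2 G\<^sup>2]\<close> and \<open>B = E[F G \<langle>DF, DG\<rangle>]\<close>
  that is regular exactly because \<open>p \<noteq> q\<close>. Its right-hand sides converge, as the fourth moments are
  bounded by hypercontractivity.
\<close>

theorem gradients_asymptotically_orthogonal:
  assumes f: "\<And>k. chaos_poly p (f k) (v k)" and g: "\<And>k. chaos_poly q (g k) (w k)"
    and "p \<noteq> q"
    and f2: "(\<lambda>k. expectation (\<lambda>\<omega>. (f k (path \<omega>))\<^sup>2)) \<longlonglongrightarrow> \<alpha>"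
    and g2: "(\<lambda>k. expectation (\<lambda>\<omega>. (g k (path \<omega>))\<^sup>2)) \<longlonglongrightarrow> \<beta>"
    and v: "(\<lambda>k. expectation (\<lambda>\<omega>. ((norm (v k (path \<omega>)))\<^sup>2 - real p * \<alpha>)\<^sup>2)) \<longlonglongrightarrow> 0"
    and w: "(\<lambda>k. expectation (\<lambda>\<omega>. ((norm (w k (path \<omega>)))\<^sup>2 - real q * \<beta>)\<^sup>2)) \<longlonglongrightarrow> 0"
  shows "(\<lambda>k. expectation (\<lambda>\<omega>. (v k (path \<omega>) \<bullet> w k (path \<omega>))\<^sup>2)) \<longlonglongrightarrow> 0"
proof -
  have cross: "(\<lambda>k. expectation (\<lambda>\<omega>. (g k (path \<omega>))\<^sup>2 * (norm (v k (path \<omega>)))\<^sup>2)) \<longlonglongrightarrow> real p * \<alpha> * \<beta>"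
    if f: "\<And>k. chaos_poly p (f k) (v k)" and g: "\<And>k. chaos_poly q (g k) (w k)"
      and g2: "(\<lambda>k. expectation (\<lambda>\<omega>. (g k (path \<omega>))\<^sup>2)) \<longlonglongrightarrow> \<beta>"
      and v: "(\<lambda>k. expectation (\<lambda>\<omega>. ((norm (v k (path \<omega>)))\<^sup>2 - real p * \<alpha>)\<^sup>2)) \<longlonglongrightarrow> 0"
    for p q \<alpha> \<beta> f v g w
  proof -
    have amg: "all_moments M (\<lambda>\<omega>. g k (path \<omega>))" and amv: "all_moments M (\<lambda>\<omega>. v k (path \<omega>))" for k
      using cylindricalD(5)[OF chaos_poly_cylindrical[OF g]] cylindricalD(6)[OF chaos_poly_cylindrical[OF f]] by auto
    have gL: "(\<lambda>\<omega>. (g k (path \<omega>))\<^sup>2) \<in> L2 M" for k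
      by (intro all_moments_L2 all_moments_power amg finite_measure_axioms)
    have dL: "(\<lambda>\<omega>. (norm (v k (path \<omega>)))\<^sup>2 - real p * \<alpha>) \<in> L2 M" for k
      by (intro L2_diff const_L2 all_moments_L2 all_moments_power all_moments_norm amv finite_measure_axioms)
    let ?d = "\<lambda>k. sqrt (expectation (\<lambda>\<omega>. ((norm (v k (path \<omega>)))\<^sup>2 - real p * \<alpha>)\<^sup>2))"
    let ?e = "\<lambda>k. expectation (\<lambda>\<omega>. (g k (path \<omega>))\<^sup>2 * ((norm (v k (path \<omega>)))\<^sup>2 - real p * \<alpha>))"
    have bound: "norm (?e k) \<le> 3 ^ q * expectation (\<lambda>\<omega>. (g k (path \<omega>))\<^sup>2) * ?d k" for k
    proof -
      have "norm (?e k) \<le> sqrt (expectation (\<lambda>\<omega>. ((g k (path \<omega>))\<^sup>2)\<^sup>2)) * ?d k"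
        using L2_cauchy_schwarz[OF gL dL] by simp
      also have "sqrt (expectation (\<lambda>\<omega>. ((g k (path \<omega>))\<^sup>2)\<^sup>2)) \<le> 3 ^ q * expectation (\<lambda>\<omega>. (g k (path \<omega>))\<^sup>2)"
        using chaos_poly_hypercontractive[OF g, of k] by (intro real_le_lsqrt) (simp_all flip: power_mult)
      finally show ?thesis by (simp add: mult_right_mono)
    qed
    have "(\<lambda>k. 3 ^ q * expectation (\<lambda>\<omega>. (g k (path \<omega>))\<^sup>2) * ?d k) \<longlonglongrightarrow> 3 ^ q * \<beta> * sqrt 0"
      by (intro tendsto_intros g2 v)
    then have e0: "?e \<longlonglongrightarrow> 0" by (intro Lim_null_comparison[OF always_eventually[OF allI, OF bound]]) simp
    have eq: "expectation (\<lambda>\<omega>. (g k (path \<omega>))\<^sup>2 * (norm (v k (path \<omega>)))\<^sup>2)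
        = ?e k + real p * \<alpha> * expectation (\<lambda>\<omega>. (g k (path \<omega>))\<^sup>2)" for k
    proof -
      have "(g k (path \<omega>))\<^sup>2 * (norm (v k (path \<omega>)))\<^sup>2
          = (g k (path \<omega>))\<^sup>2 * ((norm (v k (path \<omega>)))\<^sup>2 - real p * \<alpha>) + (real p * \<alpha>) * (g k (path \<omega>))\<^sup>2" for \<omega>
        by (simp add: algebra_simps)
      then show ?thesis
        using integrable_mult_L2[OF gL dL, of k k] L2_imp_integrable[OF gL, of k] by simp
    qed
    have "(\<lambda>k. ?e k + real p * \<alpha> * expectation (\<lambda>\<omega>. (g k (path \<omega>))\<^sup>2)) \<longlonglongrightarrow> 0 + real p * \<alpha> * \<beta>"
      by (intro tendsto_intros e0 g2)
    then show ?thesis unfolding eq by simp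
  qed
  define A where "A k = expectation (\<lambda>\<omega>. (f k (path \<omega>))\<^sup>2 * (g k (path \<omega>))\<^sup>2)" for k
  define B where "B k = expectation (\<lambda>\<omega>. f k (path \<omega>) * g k (path \<omega>) * (v k (path \<omega>) \<bullet> w k (path \<omega>)))" for k
  define C where "C k = expectation (\<lambda>\<omega>. (g k (path \<omega>))\<^sup>2 * (norm (v k (path \<omega>)))\<^sup>2)" for k
  define D where "D k = expectation (\<lambda>\<omega>. (f k (path \<omega>))\<^sup>2 * (norm (w k (path \<omega>)))\<^sup>2)" for k
  have C: "C \<longlonglongrightarrow> real p * \<alpha> * \<beta>" unfolding C_def[abs_def] by (rule cross[OF f g g2 v])
  have D: "D \<longlonglongrightarrow> real q * \<beta> * \<alpha>" unfolding D_def[abs_def] by (rule cross[OF g f f2 w])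
  have 1: "real p * A k = C k + 2 * B k" for k
    unfolding A_def B_def C_def by (rule fourth_moment_exchange[OF f g])
  have 2: "real q * A k = D k + 2 * B k" for k
    using fourth_moment_exchange[OF g f, of k] unfolding A_def B_def D_def by (simp add: mult_ac inner_commute)
  have pq: "real q - real p \<noteq> 0" using \<open>p \<noteq> q\<close> by simp
  \<comment> \<open>Subtracting the two identities eliminates \<open>B\<close>; this is where \<open>p \<noteq> q\<close> enters.\<close>
  have A: "A k = (D k - C k) / (real q - real p)" for k
    using 1[of k] 2[of k] pq by (simp add: field_simps)
  have "(\<lambda>k. (real p * ((D k - C k) / (real q - real p)) - C k) / 2)
      \<longlonglongrightarrow> (real p * ((real q * \<beta> * \<alpha> - real p * \<alpha> * \<beta>) / (real q - real p)) - real p * \<alpha> * \<beta>) / 2"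
    by (intro tendsto_intros C D pq) simp
  also have "(real p * ((real q * \<beta> * \<alpha> - real p * \<alpha> * \<beta>) / (real q - real p)) - real p * \<alpha> * \<beta>) / 2 = 0"
  proof -
    have "real q * \<beta> * \<alpha> - real p * \<alpha> * \<beta> = (real q - real p) * (\<alpha> * \<beta>)" by (simp add: algebra_simps)
    then have "(real q * \<beta> * \<alpha> - real p * \<alpha> * \<beta>) / (real q - real p) = \<alpha> * \<beta>" using pq by simp
    then show ?thesis by simp
  qed
  finally have "(\<lambda>k. (real p * A k - C k) / 2) \<longlonglongrightarrow> 0" by (simp only: A)
  then have B: "B \<longlonglongrightarrow> 0" unfolding 1 by simp
  have "(\<lambda>k. (real p + real q) / 2 * B k) \<longlonglongrightarrow> (real p + real q) / 2 * 0"
    by (intro tendsto_intros B)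
  then have up: "(\<lambda>k. (real p + real q) / 2 * B k) \<longlonglongrightarrow> 0" by simp
  show ?thesis
  proof (rule tendsto_sandwich[OF _ _ tendsto_const up])
    show "\<forall>\<^sub>F k in sequentially. 0 \<le> expectation (\<lambda>\<omega>. (v k (path \<omega>) \<bullet> w k (path \<omega>))\<^sup>2)" by simp
    show "\<forall>\<^sub>F k in sequentially. expectation (\<lambda>\<omega>. (v k (path \<omega>) \<bullet> w k (path \<omega>))\<^sup>2) \<le> (real p + real q) / 2 * B k"
      unfolding B_def using gradient_inner_product_bound[OF f g] by simp
  qed
qed

end

section \<open>The central limit theorem\<close>

context gaussian_space
begin

text \<open>
  Differentiation under the expectation; the difference quotients are dominated by \<open>|T|\<close>.
\<close>

lemma DERIV_expectation:
  fixes \<phi> \<phi>' :: "real \<Rightarrow> real"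
  assumes T: "integrable M T"
    and deriv: "\<And>y. (\<phi> has_real_derivative \<phi>' y) (at y)" and cont: "continuous_on UNIV \<phi>'"
    and b: "\<And>y. \<bar>\<phi> y\<bar> \<le> 1" "\<And>y. \<bar>\<phi>' y\<bar> \<le> 1"
  shows "((\<lambda>t. expectation (\<lambda>\<omega>. \<phi> (t * T \<omega>))) has_real_derivative expectation (\<lambda>\<omega>. T \<omega> * \<phi>' (t * T \<omega>))) (at t)"
proof -
  have cp: "continuous_on UNIV \<phi>"
    using deriv by (meson DERIV_continuous continuous_at_imp_continuous_on)
  note [measurable] = borel_measurable_continuous_onI[OF cp] borel_measurable_continuous_onI[OF cont]
    borel_measurable_integrable[OF T]
  have int: "integrable M (\<lambda>\<omega>. \<phi> (s * T \<omega>))" for s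
    using b by (intro integrable_const_bound[of _ 1]) auto
  have lip: "\<bar>\<phi> x - \<phi> y\<bar> \<le> \<bar>x - y\<bar>" for x y
  proof -
    have "norm (\<phi> x - \<phi> y) \<le> 1 * norm (x - y)"
      using deriv b(2) by (intro field_differentiable_bound[of UNIV \<phi> \<phi>']) auto
    then show ?thesis by simp
  qed
  let ?q = "\<lambda>u. (expectation (\<lambda>\<omega>. \<phi> ((t + u) * T \<omega>)) - expectation (\<lambda>\<omega>. \<phi> (t * T \<omega>))) / u"
  have "(?q \<longlongrightarrow> expectation (\<lambda>\<omega>. T \<omega> * \<phi>' (t * T \<omega>))) (at 0)"
    unfolding tendsto_at_iff_sequentially
  proof (intro allI impI)
    fix u :: "nat \<Rightarrow> real" assume u: "\<forall>i. u i \<in> UNIV - {0}" "u \<longlonglongrightarrow> 0"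
    have lim: "(\<lambda>i. expectation (\<lambda>\<omega>. (\<phi> ((t + u i) * T \<omega>) - \<phi> (t * T \<omega>)) / u i))
        \<longlonglongrightarrow> expectation (\<lambda>\<omega>. T \<omega> * \<phi>' (t * T \<omega>))"
    proof (rule integral_dominated_convergence)
      show "integrable M (\<lambda>\<omega>. \<bar>T \<omega>\<bar>)" using T by simp
      show "AE \<omega> in M. (\<lambda>i. (\<phi> ((t + u i) * T \<omega>) - \<phi> (t * T \<omega>)) / u i) \<longlonglongrightarrow> T \<omega> * \<phi>' (t * T \<omega>)"
      proof (rule AE_I2)
        fix \<omega>
        have "((\<lambda>s. \<phi> (s * T \<omega>)) has_real_derivative \<phi>' (t * T \<omega>) * T \<omega>) (at t)"
          by (rule DERIV_chain2[OF deriv]) (auto intro!: derivative_eq_intros)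
        then have "((\<lambda>s. (\<phi> ((t + s) * T \<omega>) - \<phi> (t * T \<omega>)) / s) \<longlongrightarrow> \<phi>' (t * T \<omega>) * T \<omega>) (at 0)"
          by (simp add: DERIV_def)
        then show "(\<lambda>i. (\<phi> ((t + u i) * T \<omega>) - \<phi> (t * T \<omega>)) / u i) \<longlonglongrightarrow> T \<omega> * \<phi>' (t * T \<omega>)"
          using u unfolding tendsto_at_iff_sequentially by (auto simp: o_def mult.commute)
      qed
      show "AE \<omega> in M. norm ((\<phi> ((t + u i) * T \<omega>) - \<phi> (t * T \<omega>)) / u i) \<le> \<bar>T \<omega>\<bar>" for i
      proof (rule AE_I2)
        fix \<omega>
        have "\<bar>\<phi> ((t + u i) * T \<omega>) - \<phi> (t * T \<omega>)\<bar> \<le> \<bar>u i\<bar> * \<bar>T \<omega>\<bar>"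
          using lip[of "(t + u i) * T \<omega>" "t * T \<omega>"] by (simp add: algebra_simps abs_mult)
        then show "norm ((\<phi> ((t + u i) * T \<omega>) - \<phi> (t * T \<omega>)) / u i) \<le> \<bar>T \<omega>\<bar>"
          using u(1) by (simp add: divide_le_eq mult.commute)
      qed
    qed measurable
    have eq: "expectation (\<lambda>\<omega>. (\<phi> ((t + u i) * T \<omega>) - \<phi> (t * T \<omega>)) / u i) = ?q (u i)" for i
      using int by simp
    show "(?q \<circ> u) \<longlonglongrightarrow> expectation (\<lambda>\<omega>. T \<omega> * \<phi>' (t * T \<omega>))"
      using lim unfolding eq o_def .
  qed
  then show ?thesis by (simp add: DERIV_def)
qed

text \<open>
  Stated for a function with \<open>\<phi>'' = - \<phi>\<close>, to cover the real and the imaginary part of the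
  characteristic function at once. With \<open>C t = E[\<phi> (t T)]\<close>, integration by parts gives
  \<open>C' t = - t E[Y \<phi> (t T)]\<close>; hence \<open>exp (V t\<^sup>2 / 2) C t\<close> has a derivative of size at most
  \<open>|t| exp (V t\<^sup>2 / 2) E|Y - V|\<close>.
\<close>

lemma chaos_sum_characteristic_bound:
  fixes \<phi> \<phi>' :: "real \<Rightarrow> real"
  assumes I: "finite I" "\<And>n. n \<in> I \<Longrightarrow> n \<ge> 1"
    and f: "\<And>n. n \<in> I \<Longrightarrow> chaos_poly n (f n) (v n)"
    and deriv: "\<And>y. (\<phi> has_real_derivative \<phi>' y) (at y)" "\<And>y. (\<phi>' has_real_derivative - \<phi> y) (at y)"
    and b: "\<And>y. \<bar>\<phi> y\<bar> \<le> 1" "\<And>y. \<bar>\<phi>' y\<bar> \<le> 1"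
    and V: "0 \<le> V"
  defines "T \<equiv> \<lambda>x. \<Sum>n\<in>I. f n x" and "W \<equiv> \<lambda>x. \<Sum>n\<in>I. v n x"
    and "Y \<equiv> \<lambda>x. \<Sum>n\<in>I. (v n x \<bullet> (\<Sum>n\<in>I. v n x)) / real n"
  shows "\<bar>expectation (\<lambda>\<omega>. \<phi> (t * T (path \<omega>))) - \<phi> 0 * exp (- V * t\<^sup>2 / 2)\<bar>
    \<le> t\<^sup>2 * expectation (\<lambda>\<omega>. \<bar>Y (path \<omega>) - V\<bar>)"
proof -
  have cT: "cylindrical T W" unfolding T_def W_def
    by (rule cylindrical_sum) (rule chaos_poly_cylindrical[OF f])
  note amT = cylindricalD(5,6)[OF cT]
  have amv: "all_moments M (\<lambda>\<omega>. v n (path \<omega>))" "all_moments M (\<lambda>\<omega>. f n (path \<omega>))" if "n \<in> I" for n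
    using cylindricalD(5,6)[OF chaos_poly_cylindrical[OF f[OF that]]] by auto
  have amvW: "all_moments M (\<lambda>\<omega>. (v n (path \<omega>) \<bullet> W (path \<omega>)) / real n)" if "n \<in> I" for n
  proof -
    have "all_moments M (\<lambda>\<omega>. (v n (path \<omega>) \<bullet> W (path \<omega>)) * (1 / real n))"
      by (intro all_moments_mult all_moments_inner amv amT that all_moments_bounded[OF _ order_refl]) simp
    then show ?thesis by simp
  qed
  have Yeq: "Y x = (\<Sum>n\<in>I. (v n x \<bullet> W x) / real n)" for x unfolding Y_def W_def ..
  have amY: "all_moments M (\<lambda>\<omega>. Y (path \<omega>))" unfolding Yeq by (rule all_moments_sum) (rule amvW)
  have cphi: "continuous_on UNIV \<phi>" "continuous_on UNIV \<phi>'"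
    using deriv by (meson DERIV_continuous continuous_at_imp_continuous_on)+
  note [measurable] = borel_measurable_continuous_onI[OF cphi(1)] borel_measurable_continuous_onI[OF cphi(2)]
    all_moments_measurable[OF amT(1)] all_moments_measurable[OF amY]
  define C where "C t = expectation (\<lambda>\<omega>. \<phi> (t * T (path \<omega>)))" for t
  define E where "E = expectation (\<lambda>\<omega>. \<bar>Y (path \<omega>) - V\<bar>)"
  have E0: "0 \<le> E" unfolding E_def by simp
  have am\<phi>: "all_moments M (\<lambda>\<omega>. \<phi> (s * T (path \<omega>)))" "all_moments M (\<lambda>\<omega>. \<phi>' (s * T (path \<omega>)))" for s
    by (intro all_moments_bounded[of _ 1]; use b in simp)+
  have step: "expectation (\<lambda>\<omega>. T (path \<omega>) * \<phi>' (s * T (path \<omega>))) = - s * expectation (\<lambda>\<omega>. Y (path \<omega>) * \<phi> (s * T (path \<omega>)))" for s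
  proof -
    have cyl: "cylindrical (\<lambda>x. \<phi>' (s * T x)) (\<lambda>x. - \<phi> (s * T x) *\<^sub>R (s *\<^sub>R W x))"
      using b cphi by (intro cylindrical_compose[where C = 1] cylindrical_cmult cT deriv continuous_on_minus) auto
    have one: "expectation (\<lambda>\<omega>. f n (path \<omega>) * \<phi>' (s * T (path \<omega>)))
        = - s * expectation (\<lambda>\<omega>. (v n (path \<omega>) \<bullet> W (path \<omega>)) / real n * \<phi> (s * T (path \<omega>)))" if n: "n \<in> I" for n
    proof -
      have n0: "real n \<noteq> 0" using I(2)[OF n] by simp
      have "real n * expectation (\<lambda>\<omega>. f n (path \<omega>) * \<phi>' (s * T (path \<omega>)))
          = expectation (\<lambda>\<omega>. v n (path \<omega>) \<bullet> (- \<phi> (s * T (path \<omega>)) *\<^sub>R (s *\<^sub>R W (path \<omega>))))"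
        by (rule chaos_integration_by_parts[OF f[OF n] cyl])
      also have "\<dots> = expectation (\<lambda>\<omega>. (- s * real n) * ((v n (path \<omega>) \<bullet> W (path \<omega>)) / real n * \<phi> (s * T (path \<omega>))))"
        using n0 by (intro Bochner_Integration.integral_cong) (auto simp: field_simps)
      also have "\<dots> = (- s * real n) * expectation (\<lambda>\<omega>. (v n (path \<omega>) \<bullet> W (path \<omega>)) / real n * \<phi> (s * T (path \<omega>)))"
        by (rule integral_mult_right_zero)
      also have "\<dots> = real n * (- s * expectation (\<lambda>\<omega>. (v n (path \<omega>) \<bullet> W (path \<omega>)) / real n * \<phi> (s * T (path \<omega>))))"
        by (simp only: mult_ac)
      finally show ?thesis by (rule iffD1[OF mult_left_cancel[OF n0]])
    qed
    have "expectation (\<lambda>\<omega>. T (path \<omega>) * \<phi>' (s * T (path \<omega>)))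
        = expectation (\<lambda>\<omega>. \<Sum>n\<in>I. f n (path \<omega>) * \<phi>' (s * T (path \<omega>)))"
      by (simp add: T_def sum_distrib_right)
    also have "\<dots> = (\<Sum>n\<in>I. expectation (\<lambda>\<omega>. f n (path \<omega>) * \<phi>' (s * T (path \<omega>))))"
      by (intro Bochner_Integration.integral_sum all_moments_integrable all_moments_mult amv am\<phi>)
    also have "\<dots> = - s * (\<Sum>n\<in>I. expectation (\<lambda>\<omega>. (v n (path \<omega>) \<bullet> W (path \<omega>)) / real n * \<phi> (s * T (path \<omega>))))"
      unfolding sum_distrib_left by (intro sum.cong refl one)
    also have "(\<Sum>n\<in>I. expectation (\<lambda>\<omega>. (v n (path \<omega>) \<bullet> W (path \<omega>)) / real n * \<phi> (s * T (path \<omega>))))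
        = expectation (\<lambda>\<omega>. \<Sum>n\<in>I. (v n (path \<omega>) \<bullet> W (path \<omega>)) / real n * \<phi> (s * T (path \<omega>)))"
      by (intro Bochner_Integration.integral_sum[symmetric] all_moments_integrable all_moments_mult amvW am\<phi>)
    also have "\<dots> = expectation (\<lambda>\<omega>. Y (path \<omega>) * \<phi> (s * T (path \<omega>)))"
      unfolding Yeq sum_distrib_right ..
    finally show ?thesis .
  qed
  have Cd: "(C has_real_derivative - s * expectation (\<lambda>\<omega>. Y (path \<omega>) * \<phi> (s * T (path \<omega>)))) (at s)" for s
    using DERIV_expectation[OF all_moments_integrable[OF amT(1)] deriv(1) cphi(2) b, of s]
    unfolding step C_def[abs_def] .
  \<comment> \<open>The integrating factor removes the main part \<open>- V s C s\<close> of the derivative of \<open>C\<close>.\<close>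
  define H where "H s = exp (V * s\<^sup>2 / 2) * C s" for s
  define H' where "H' s = - s * exp (V * s\<^sup>2 / 2) * expectation (\<lambda>\<omega>. (Y (path \<omega>) - V) * \<phi> (s * T (path \<omega>)))" for s
  have H: "(H has_real_derivative H' s) (at s)" for s
  proof -
    have "expectation (\<lambda>\<omega>. (Y (path \<omega>) - V) * \<phi> (s * T (path \<omega>)))
        = expectation (\<lambda>\<omega>. Y (path \<omega>) * \<phi> (s * T (path \<omega>))) - V * C s"
      using all_moments_integrable[OF all_moments_mult[OF amY am\<phi>(1)], of s] all_moments_integrable[OF am\<phi>(1), of s]
      by (simp add: left_diff_distrib C_def)
    then have H'eq: "H' s = exp (V * s\<^sup>2 / 2) * (V * s) * C s
        + - s * expectation (\<lambda>\<omega>. Y (path \<omega>) * \<phi> (s * T (path \<omega>))) * exp (V * s\<^sup>2 / 2)"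
      unfolding H'_def by (simp only:) (simp add: algebra_simps)
    have "((\<lambda>s. exp (V * s\<^sup>2 / 2)) has_real_derivative exp (V * s\<^sup>2 / 2) * (V * s)) (at s)"
      by (auto intro!: derivative_eq_intros)
    from DERIV_mult[OF this Cd[of s]] show ?thesis unfolding H'eq H_def[abs_def] .
  qed
  have H'le: "norm (H' s) \<le> \<bar>t\<bar> * exp (V * t\<^sup>2 / 2) * E" if s: "s \<in> {- \<bar>t\<bar>..\<bar>t\<bar>}" for s
  proof -
    have st: "\<bar>s\<bar> \<le> \<bar>t\<bar>" using s by auto
    then have "s\<^sup>2 \<le> t\<^sup>2" by (rule abs_le_square_iff[THEN iffD1])
    then have ex: "exp (V * s\<^sup>2 / 2) \<le> exp (V * t\<^sup>2 / 2)" using V by (simp add: mult_left_mono)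
    have "\<bar>expectation (\<lambda>\<omega>. (Y (path \<omega>) - V) * \<phi> (s * T (path \<omega>)))\<bar>
        \<le> expectation (\<lambda>\<omega>. \<bar>(Y (path \<omega>) - V) * \<phi> (s * T (path \<omega>))\<bar>)"
      by (rule integral_abs_bound)
    also have "\<dots> \<le> E"
      unfolding E_def
    proof (rule integral_mono)
      have amYV: "all_moments M (\<lambda>\<omega>. Y (path \<omega>) + (- V))"
        by (intro all_moments_add amY all_moments_bounded[OF _ order_refl]) simp
      show "integrable M (\<lambda>\<omega>. \<bar>(Y (path \<omega>) - V) * \<phi> (s * T (path \<omega>))\<bar>)"
        using all_moments_integrable[OF all_moments_mult[OF amYV am\<phi>(1)], of s] by simp
      show "integrable M (\<lambda>\<omega>. \<bar>Y (path \<omega>) - V\<bar>)"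
        using all_moments_integrable[OF amYV] by simp
      show "\<bar>(Y (path \<omega>) - V) * \<phi> (s * T (path \<omega>))\<bar> \<le> \<bar>Y (path \<omega>) - V\<bar>" for \<omega>
        using mult_left_mono[OF b(1), of "\<bar>Y (path \<omega>) - V\<bar>"] by (simp add: abs_mult)
    qed
    finally have "\<bar>expectation (\<lambda>\<omega>. (Y (path \<omega>) - V) * \<phi> (s * T (path \<omega>)))\<bar> \<le> E" .
    then show ?thesis unfolding H'_def real_norm_def abs_mult
      using st ex by (intro mult_mono) auto
  qed
  have "norm (H t - H 0) \<le> (\<bar>t\<bar> * exp (V * t\<^sup>2 / 2) * E) * norm (t - 0)"
    by (rule field_differentiable_bound[of "{- \<bar>t\<bar>..\<bar>t\<bar>}" H H'])
      (use H H'le in \<open>auto intro: has_field_derivative_at_within\<close>)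
  also have "\<dots> = exp (V * t\<^sup>2 / 2) * (t\<^sup>2 * E)"
    by (simp add: power2_eq_square abs_mult[symmetric])
  finally have HH: "\<bar>H t - H 0\<bar> \<le> exp (V * t\<^sup>2 / 2) * (t\<^sup>2 * E)" by simp
  have H0: "H 0 = \<phi> 0" by (simp add: H_def C_def prob_space)
  have inv: "exp (- V * t\<^sup>2 / 2) * exp (V * t\<^sup>2 / 2) = 1" by (simp flip: exp_add)
  have Ct: "exp (- V * t\<^sup>2 / 2) * H t = C t"
    unfolding H_def using inv by (simp only: mult.assoc[symmetric] mult_1_left)
  have "C t - \<phi> 0 * exp (- V * t\<^sup>2 / 2) = exp (- V * t\<^sup>2 / 2) * (H t - H 0)"
    unfolding right_diff_distrib Ct H0 by (simp only: mult.commute)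
  also have "\<bar>\<dots>\<bar> = exp (- V * t\<^sup>2 / 2) * \<bar>H t - H 0\<bar>" by (simp add: abs_mult)
  also have "\<dots> \<le> exp (- V * t\<^sup>2 / 2) * (exp (V * t\<^sup>2 / 2) * (t\<^sup>2 * E))"
    by (intro mult_left_mono HH) simp
  also have "\<dots> = t\<^sup>2 * E" using inv by (simp only: mult.assoc[symmetric] mult_1_left)
  finally show ?thesis by (simp add: C_def E_def)
qed

end

context generated_gaussian_space
begin

text \<open>
  \<open>Y - V\<close> is the sum over \<open>n\<close> and \<open>m\<close> of the centered inner products \<open>Z\<^sub>n\<^sub>m / n\<close>: for \<open>n = m\<close> they vanish
  in \<open>L\<^sup>2\<close> by assumption, for \<open>n \<noteq> m\<close> by the asymptotic orthogonality of gradients.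
\<close>

theorem chaos_poly_sum_CLT:
  fixes s :: "nat \<Rightarrow> real"
  assumes I: "finite I" "\<And>n. n \<in> I \<Longrightarrow> n \<ge> 1"
    and f: "\<And>n k. n \<in> I \<Longrightarrow> chaos_poly n (f n k) (v n k)"
    and f2: "\<And>n. n \<in> I \<Longrightarrow> (\<lambda>k. expectation (\<lambda>\<omega>. (f n k (path \<omega>))\<^sup>2)) \<longlonglongrightarrow> (s n)\<^sup>2"
    and v2: "\<And>n. n \<in> I \<Longrightarrow> (\<lambda>k. expectation (\<lambda>\<omega>. ((norm (v n k (path \<omega>)))\<^sup>2 - real n * (s n)\<^sup>2)\<^sup>2)) \<longlonglongrightarrow> 0"
  shows "(\<lambda>k. \<integral>\<omega>. iexp (t * (\<Sum>n\<in>I. f n k (path \<omega>))) \<partial>M) \<longlonglongrightarrow> complex_of_real (exp (- (\<Sum>n\<in>I. (s n)\<^sup>2) * t\<^sup>2 / 2))"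
proof -
  define V where "V = (\<Sum>n\<in>I. (s n)\<^sup>2)"
  have V0: "0 \<le> V" unfolding V_def by (intro sum_nonneg) simp
  define Z where "Z n m k x = v n k x \<bullet> v m k x - (if n = m then real n * (s n)\<^sup>2 else 0)" for n m k and x :: "'h \<Rightarrow> real"
  have amv: "all_moments M (\<lambda>\<omega>. v n k (path \<omega>))" "all_moments M (\<lambda>\<omega>. f n k (path \<omega>))" if "n \<in> I" for n k
    using cylindricalD(5,6)[OF chaos_poly_cylindrical[OF f[OF that]]] by auto
  have ZL: "(\<lambda>\<omega>. Z n m k (path \<omega>)) \<in> L2 M" if "n \<in> I" "m \<in> I" for n m k
    unfolding Z_def by (intro L2_diff const_L2 all_moments_L2 all_moments_inner amv that)
  have Zlim: "(\<lambda>k. expectation (\<lambda>\<omega>. (Z n m k (path \<omega>))\<^sup>2)) \<longlonglongrightarrow> 0" if nm: "n \<in> I" "m \<in> I" for n m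
  proof (cases "n = m")
    case True
    then show ?thesis using v2[OF nm(1)] by (simp add: Z_def power2_norm_eq_inner)
  next
    case False
    have "(\<lambda>k. expectation (\<lambda>\<omega>. (v n k (path \<omega>) \<bullet> v m k (path \<omega>))\<^sup>2)) \<longlonglongrightarrow> 0"
      by (rule gradients_asymptotically_orthogonal[OF f[OF nm(1)] f[OF nm(2)] False f2[OF nm(1)] f2[OF nm(2)]
        v2[OF nm(1)] v2[OF nm(2)]])
    then show ?thesis using False by (simp add: Z_def)
  qed
  define Y where "Y k x = (\<Sum>n\<in>I. (v n k x \<bullet> (\<Sum>n\<in>I. v n k x)) / real n)" for k and x :: "'h \<Rightarrow> real"
  have YV: "Y k x - V = (\<Sum>n\<in>I. \<Sum>m\<in>I. Z n m k x / real n)" for k x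
  proof -
    have "(\<Sum>m\<in>I. Z n m k x / real n) = (v n k x \<bullet> (\<Sum>n\<in>I. v n k x)) / real n - (s n)\<^sup>2" if n: "n \<in> I" for n
    proof -
      have "(\<Sum>m\<in>I. Z n m k x) = v n k x \<bullet> (\<Sum>n\<in>I. v n k x) - real n * (s n)\<^sup>2"
        unfolding Z_def sum_subtractf inner_sum_right using I(1) n by simp
      then show ?thesis using I(2)[OF n] by (simp add: sum_divide_distrib[symmetric] diff_divide_distrib)
    qed
    then show ?thesis by (simp add: Y_def V_def sum_subtractf)
  qed
  define e where "e k = (\<Sum>n\<in>I. \<Sum>m\<in>I. sqrt (expectation (\<lambda>\<omega>. (Z n m k (path \<omega>))\<^sup>2)) / real n)" for k
  have "e \<longlonglongrightarrow> (\<Sum>n\<in>I. \<Sum>m\<in>I. sqrt 0 / real n)"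
    unfolding e_def[abs_def] using I(2)
    by (intro tendsto_sum tendsto_divide tendsto_real_sqrt Zlim tendsto_const) force+
  then have e0: "e \<longlonglongrightarrow> 0" by simp
  have Ee: "expectation (\<lambda>\<omega>. \<bar>Y k (path \<omega>) - V\<bar>) \<le> e k" for k
  proof -
    have int: "integrable M (\<lambda>\<omega>. \<bar>Z n m k (path \<omega>)\<bar> / real n)" if "n \<in> I" "m \<in> I" for n m
      using L2_imp_integrable[OF ZL[OF that]] by simp
    have "expectation (\<lambda>\<omega>. \<bar>Y k (path \<omega>) - V\<bar>) \<le> expectation (\<lambda>\<omega>. \<Sum>n\<in>I. \<Sum>m\<in>I. \<bar>Z n m k (path \<omega>)\<bar> / real n)"
    proof (rule integral_mono)
      have "integrable M (\<lambda>\<omega>. \<Sum>n\<in>I. \<Sum>m\<in>I. Z n m k (path \<omega>) / real n)"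
        using L2_imp_integrable[OF ZL] by (intro Bochner_Integration.integrable_sum) auto
      then show "integrable M (\<lambda>\<omega>. \<bar>Y k (path \<omega>) - V\<bar>)" unfolding YV by simp
      show "integrable M (\<lambda>\<omega>. \<Sum>n\<in>I. \<Sum>m\<in>I. \<bar>Z n m k (path \<omega>)\<bar> / real n)"
        by (intro Bochner_Integration.integrable_sum int)
      show "\<bar>Y k (path \<omega>) - V\<bar> \<le> (\<Sum>n\<in>I. \<Sum>m\<in>I. \<bar>Z n m k (path \<omega>)\<bar> / real n)" for \<omega>
        unfolding YV by (intro order_trans[OF sum_abs] sum_mono) simp
    qed
    also have "\<dots> = (\<Sum>n\<in>I. \<Sum>m\<in>I. expectation (\<lambda>\<omega>. \<bar>Z n m k (path \<omega>)\<bar> / real n))"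
      using int by (simp add: Bochner_Integration.integral_sum Bochner_Integration.integrable_sum)
    also have "\<dots> \<le> e k"
      unfolding e_def
    proof (intro sum_mono)
      fix n m assume nm: "n \<in> I" "m \<in> I"
      have "expectation (\<lambda>\<omega>. \<bar>Z n m k (path \<omega>)\<bar>) \<le> sqrt (expectation (\<lambda>\<omega>. (Z n m k (path \<omega>))\<^sup>2))"
        using L2_cauchy_schwarz_abs_sqrt[OF ZL[OF nm] const_L2[of 1], of k] by (simp add: prob_space)
      then show "expectation (\<lambda>\<omega>. \<bar>Z n m k (path \<omega>)\<bar> / real n) \<le> sqrt (expectation (\<lambda>\<omega>. (Z n m k (path \<omega>))\<^sup>2)) / real n"
        by (simp add: divide_right_mono)
    qed
    finally show ?thesis .
  qed
  have lim: "(\<lambda>k. expectation (\<lambda>\<omega>. \<phi> (t * (\<Sum>n\<in>I. f n k (path \<omega>))))) \<longlonglongrightarrow> \<phi> 0 * exp (- V * t\<^sup>2 / 2)"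
    if \<phi>: "\<And>y. (\<phi> has_real_derivative \<phi>' y) (at y)" "\<And>y. (\<phi>' has_real_derivative - \<phi> y) (at y)"
      "\<And>y. \<bar>\<phi> y\<bar> \<le> 1" "\<And>y. \<bar>\<phi>' y\<bar> \<le> 1" for \<phi> \<phi>' :: "real \<Rightarrow> real"
  proof -
    have bd: "norm (expectation (\<lambda>\<omega>. \<phi> (t * (\<Sum>n\<in>I. f n k (path \<omega>)))) - \<phi> 0 * exp (- V * t\<^sup>2 / 2)) \<le> t\<^sup>2 * e k" for k
    proof -
      have "\<bar>expectation (\<lambda>\<omega>. \<phi> (t * (\<Sum>n\<in>I. f n k (path \<omega>)))) - \<phi> 0 * exp (- V * t\<^sup>2 / 2)\<bar>
          \<le> t\<^sup>2 * expectation (\<lambda>\<omega>. \<bar>Y k (path \<omega>) - V\<bar>)"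
        unfolding Y_def by (rule chaos_sum_characteristic_bound[OF I f \<phi> V0])
      also have "\<dots> \<le> t\<^sup>2 * e k" by (intro mult_left_mono Ee) simp
      finally show ?thesis by simp
    qed
    have "(\<lambda>k. t\<^sup>2 * e k) \<longlonglongrightarrow> 0" using tendsto_mult_left[OF e0, of "t\<^sup>2"] by simp
    then have "(\<lambda>k. expectation (\<lambda>\<omega>. \<phi> (t * (\<Sum>n\<in>I. f n k (path \<omega>)))) - \<phi> 0 * exp (- V * t\<^sup>2 / 2)) \<longlonglongrightarrow> 0"
      by (rule Lim_null_comparison[OF always_eventually[OF allI, OF bd]])
    then show ?thesis by (simp add: LIM_zero_iff)
  qed
  have c: "(\<lambda>k. expectation (\<lambda>\<omega>. cos (t * (\<Sum>n\<in>I. f n k (path \<omega>))))) \<longlonglongrightarrow> cos 0 * exp (- V * t\<^sup>2 / 2)"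
    by (rule lim[of cos "\<lambda>y. - sin y"]) (auto intro!: derivative_eq_intros)
  have s: "(\<lambda>k. expectation (\<lambda>\<omega>. sin (t * (\<Sum>n\<in>I. f n k (path \<omega>))))) \<longlonglongrightarrow> sin 0 * exp (- V * t\<^sup>2 / 2)"
    by (rule lim[of sin cos]) (auto intro!: derivative_eq_intros)
  have eq: "(\<integral>\<omega>. iexp (t * (\<Sum>n\<in>I. f n k (path \<omega>))) \<partial>M)
      = complex_of_real (expectation (\<lambda>\<omega>. cos (t * (\<Sum>n\<in>I. f n k (path \<omega>)))))
        + \<i> * complex_of_real (expectation (\<lambda>\<omega>. sin (t * (\<Sum>n\<in>I. f n k (path \<omega>)))))" for k
  proof -
    have Tm: "(\<lambda>\<omega>. \<Sum>n\<in>I. f n k (path \<omega>)) \<in> borel_measurable M"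
      by (intro borel_measurable_sum all_moments_measurable amv)
    have i: "integrable M (\<lambda>\<omega>. cos (t * (\<Sum>n\<in>I. f n k (path \<omega>))))" "integrable M (\<lambda>\<omega>. sin (t * (\<Sum>n\<in>I. f n k (path \<omega>))))"
      using Tm by (intro integrable_const_bound[of _ 1]; simp)+
    have "(\<integral>\<omega>. iexp (t * (\<Sum>n\<in>I. f n k (path \<omega>))) \<partial>M)
        = (\<integral>\<omega>. complex_of_real (cos (t * (\<Sum>n\<in>I. f n k (path \<omega>))))
          + \<i> * complex_of_real (sin (t * (\<Sum>n\<in>I. f n k (path \<omega>)))) \<partial>M)"
      by (intro Bochner_Integration.integral_cong refl)
        (simp only: cis_conv_exp[symmetric] complex_eq_iff, simp)
    also have "\<dots> = (\<integral>\<omega>. complex_of_real (cos (t * (\<Sum>n\<in>I. f n k (path \<omega>)))) \<partial>M)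
          + (\<integral>\<omega>. \<i> * complex_of_real (sin (t * (\<Sum>n\<in>I. f n k (path \<omega>)))) \<partial>M)"
      using i by (intro Bochner_Integration.integral_add integrable_mult_right integrable_of_real) auto
    finally show ?thesis by (simp only: integral_mult_right_zero integral_complex_of_real)
  qed
  have "(\<lambda>k. complex_of_real (expectation (\<lambda>\<omega>. cos (t * (\<Sum>n\<in>I. f n k (path \<omega>)))))
        + \<i> * complex_of_real (expectation (\<lambda>\<omega>. sin (t * (\<Sum>n\<in>I. f n k (path \<omega>))))))
     \<longlonglongrightarrow> complex_of_real (cos 0 * exp (- V * t\<^sup>2 / 2)) + \<i> * complex_of_real (sin 0 * exp (- V * t\<^sup>2 / 2))"
    by (intro tendsto_intros c s)
  then show ?thesis unfolding eq V_def by simp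
qed

end

section \<open>From the truncated expansions to the full sums\<close>

context generated_gaussian_space
begin

text \<open>
  The tail bound for the expansion counts from order 0, whereas the expansion of a centered
  variable starts at order 1.
\<close>

lemma chaos_projection_0_centered:
  assumes F: "F \<in> L2 M" and "expectation F = 0"
  shows "AE \<omega> in M. chaos_projection M X 0 F \<omega> = 0"
proof -
  have "chaos_projection M X 0 F \<in> wiener_chaos M X 0" by (rule chaos_projection(1)[OF F])
  then obtain c where c: "AE \<omega> in M. chaos_projection M X 0 F \<omega> = c" by (auto simp: wiener_chaos_def)
  note JL = chaos_projection_L2[OF F, of 0]
  note [measurable] = L2_measurable[OF JL]
  have "expectation (\<lambda>\<omega>. F \<omega> - chaos_projection M X 0 F \<omega>) = 0"
    using chaos_projection_orthogonal[OF F, of 0] by (simp add: chaos_orthogonal_def)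
  then have "expectation (chaos_projection M X 0 F) = 0"
    using L2_imp_integrable[OF F] L2_imp_integrable[OF JL] assms(2) by simp
  moreover have "expectation (chaos_projection M X 0 F) = expectation (\<lambda>\<omega>. c)"
    using c by (intro integral_cong_AE) auto
  ultimately have "c = 0" by (simp add: prob_space)
  with c show ?thesis by simp
qed

lemma chaos_truncation_error:
  assumes F: "F \<in> L2 M" and EF: "expectation F = 0" and "0 \<le> T"
    and tail: "(\<Sum>n. ennreal (expectation (\<lambda>\<omega>. (chaos_projection M X (N + 1 + n) F \<omega>)\<^sup>2))) \<le> ennreal T"
  shows "expectation (\<lambda>\<omega>. (F \<omega> - (\<Sum>n\<in>{1..N}. chaos_projection M X n F \<omega>))\<^sup>2) \<le> T"
proof -
  let ?b = "\<lambda>n. expectation (\<lambda>\<omega>. (chaos_projection M X n F \<omega>)\<^sup>2)"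
  have part: "(\<Sum>n\<in>{N<..K}. ?b n) \<le> T" for K
  proof -
    have "(\<Sum>n\<in>{N<..K}. ?b n) = (\<Sum>n<K - N. ?b (N + 1 + n))"
      by (rule sum.reindex_bij_witness[of _ "\<lambda>n. N + 1 + n" "\<lambda>n. n - N - 1"]) auto
    then have "ennreal (\<Sum>n\<in>{N<..K}. ?b n) = (\<Sum>n<K - N. ennreal (?b (N + 1 + n)))"
      by (simp add: sum_ennreal)
    also have "\<dots> \<le> (\<Sum>n. ennreal (?b (N + 1 + n)))"
      by (rule sum_le_suminf) auto
    also note tail
    finally show ?thesis using \<open>0 \<le> T\<close> by simp
  qed
  have J: "chaos_projection M X n F \<in> L2 M" for n by (rule chaos_projection_L2[OF F])
  note [measurable] = L2_measurable[OF F] L2_measurable[OF J]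
  have "AE \<omega> in M. (\<Sum>n\<le>N. chaos_projection M X n F \<omega>) = (\<Sum>n\<in>{1..N}. chaos_projection M X n F \<omega>)"
    using chaos_projection_0_centered[OF F EF]
  proof eventually_elim
    case (elim \<omega>)
    have "{..N} = insert 0 {1..N}" by auto
    then show ?case using elim by simp
  qed
  then have "expectation (\<lambda>\<omega>. (F \<omega> - (\<Sum>n\<in>{1..N}. chaos_projection M X n F \<omega>))\<^sup>2)
      = expectation (\<lambda>\<omega>. (F \<omega> - (\<Sum>n\<le>N. chaos_projection M X n F \<omega>))\<^sup>2)"
    by (intro integral_cong_AE) (auto elim: eventually_mono)
  also have "\<dots> \<le> T" by (rule chaos_expansion_tail[OF F part])
  finally show ?thesis .
qed

lemma char_distance_L2:
  assumes F: "F \<in> L2 M" and G: "G \<in> L2 M"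
  shows "norm ((\<integral>\<omega>. iexp (t * F \<omega>) \<partial>M) - (\<integral>\<omega>. iexp (t * G \<omega>) \<partial>M))
    \<le> \<bar>t\<bar> * sqrt (expectation (\<lambda>\<omega>. (F \<omega> - G \<omega>)\<^sup>2))"
proof -
  note [measurable] = L2_measurable[OF F] L2_measurable[OF G]
  have D: "(\<lambda>\<omega>. F \<omega> - G \<omega>) \<in> L2 M" by (intro L2_diff F G)
  have int: "integrable M (\<lambda>\<omega>. iexp (t * H \<omega>))" if [measurable]: "H \<in> borel_measurable M" for H
    by (intro integrable_const_bound[of _ 1]) auto
  have lip: "norm (iexp x - iexp y) \<le> \<bar>x - y\<bar>" for x y :: real
  proof -
    have "iexp x - iexp y = iexp y * (iexp (x - y) - 1)"
      by (simp add: right_diff_distrib flip: exp_add)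
    then have "norm (iexp x - iexp y) = norm (iexp (x - y) - 1)" by (simp add: norm_mult)
    also have "\<dots> \<le> \<bar>x - y\<bar>" using iexp_approx1[of "x - y" 0] by simp
    finally show ?thesis .
  qed
  have "norm ((\<integral>\<omega>. iexp (t * F \<omega>) \<partial>M) - (\<integral>\<omega>. iexp (t * G \<omega>) \<partial>M))
      = norm (\<integral>\<omega>. iexp (t * F \<omega>) - iexp (t * G \<omega>) \<partial>M)"
    by (subst Bochner_Integration.integral_diff[OF int int]) auto
  also have "\<dots> \<le> (\<integral>\<omega>. norm (iexp (t * F \<omega>) - iexp (t * G \<omega>)) \<partial>M)"
    by (rule integral_norm_bound)
  also have "\<dots> \<le> (\<integral>\<omega>. \<bar>t\<bar> * \<bar>F \<omega> - G \<omega>\<bar> \<partial>M)"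
  proof (rule integral_mono)
    show "integrable M (\<lambda>\<omega>. norm (iexp (t * F \<omega>) - iexp (t * G \<omega>)))"
      by (intro integrable_norm Bochner_Integration.integrable_diff int) auto
    show "integrable M (\<lambda>\<omega>. \<bar>t\<bar> * \<bar>F \<omega> - G \<omega>\<bar>)" using L2_imp_integrable[OF D] by simp
    show "norm (iexp (t * F \<omega>) - iexp (t * G \<omega>)) \<le> \<bar>t\<bar> * \<bar>F \<omega> - G \<omega>\<bar>" for \<omega>
      using lip[of "t * F \<omega>" "t * G \<omega>"] by (simp add: right_diff_distrib[symmetric] abs_mult)
  qed
  also have "\<dots> = \<bar>t\<bar> * expectation (\<lambda>\<omega>. \<bar>F \<omega> - G \<omega>\<bar>)" by simp
  also have "\<dots> \<le> \<bar>t\<bar> * sqrt (expectation (\<lambda>\<omega>. (F \<omega> - G \<omega>)\<^sup>2))"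
    using L2_cauchy_schwarz_abs_sqrt[OF D const_L2[of 1]] by (intro mult_left_mono) (simp_all add: prob_space)
  finally show ?thesis .
qed

lemma L2_sum_triangle:
  assumes "finite I" "\<And>i. i \<in> I \<Longrightarrow> (F i :: 'a \<Rightarrow> real) \<in> L2 M"
  shows "sqrt (expectation (\<lambda>\<omega>. (\<Sum>i\<in>I. F i \<omega>)\<^sup>2)) \<le> (\<Sum>i\<in>I. sqrt (expectation (\<lambda>\<omega>. (F i \<omega>)\<^sup>2)))"
  using assms
proof (induction I)
  case (insert i I)
  have "sqrt (expectation (\<lambda>\<omega>. (F i \<omega> + (\<Sum>i\<in>I. F i \<omega>))\<^sup>2))
      \<le> sqrt (expectation (\<lambda>\<omega>. (F i \<omega>)\<^sup>2)) + sqrt (expectation (\<lambda>\<omega>. (\<Sum>i\<in>I. F i \<omega>)\<^sup>2))"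
    using insert.prems by (intro L2_triangle L2_sum) auto
  also have "\<dots> \<le> sqrt (expectation (\<lambda>\<omega>. (F i \<omega>)\<^sup>2)) + (\<Sum>i\<in>I. sqrt (expectation (\<lambda>\<omega>. (F i \<omega>)\<^sup>2)))"
    using insert.IH insert.prems by simp
  finally show ?case using insert.hyps by simp
qed simp

text \<open>
  Each projection is replaced by a finite sum of Hermite polynomials up to an error
  of \<open>1 / (k + 1)\<close> in mean square, both for the variable and for the squared norm of its gradient. The assumptions and the conclusion are stable
  under this replacement.
\<close>

lemma char_truncated_limit:
  fixes s :: "nat \<Rightarrow> real" and F :: "nat \<Rightarrow> 'a \<Rightarrow> real"
  assumes F: "\<And>k. F k \<in> L2 M"
    and ii: "\<And>n. n \<ge> 1 \<Longrightarrow> (\<lambda>k. expectation (\<lambda>\<omega>. (chaos_projection M X n (F k) \<omega>)\<^sup>2)) \<longlonglongrightarrow> (s n)\<^sup>2"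
    and iv: "\<And>n. n \<ge> 1 \<Longrightarrow>
      (\<lambda>k. \<integral>\<^sup>+\<omega>. ennreal (((norm (malliavin_derivative M X (chaos_projection M X n (F k)) \<omega>))\<^sup>2
          - real n * (s n)\<^sup>2)\<^sup>2) \<partial>M) \<longlonglongrightarrow> 0"
  shows "(\<lambda>k. \<integral>\<omega>. iexp (t * (\<Sum>n\<in>{1..N}. chaos_projection M X n (F k) \<omega>)) \<partial>M)
    \<longlonglongrightarrow> complex_of_real (exp (- (\<Sum>n\<in>{1..N}. (s n)\<^sup>2) * t\<^sup>2 / 2))"
proof -
  define J where "J n k = chaos_projection M X n (F k)" for n k
  have JW: "J n k \<in> wiener_chaos M X n" for n k unfolding J_def by (rule chaos_projection(1)[OF F])
  have JL: "J n k \<in> L2 M" for n k by (rule wiener_chaos_L2[OF JW])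
  define \<delta> where "\<delta> k = inverse (real (Suc k))" for k
  have \<delta>: "0 < \<delta> k" for k by (simp add: \<delta>_def)
  have \<delta>0: "\<delta> \<longlonglongrightarrow> 0" unfolding \<delta>_def by (rule LIMSEQ_inverse_real_of_nat)
  define P where "P n k fv \<longleftrightarrow> chaos_poly n (fst fv) (snd fv) \<and>
      expectation (\<lambda>\<omega>. (J n k \<omega> - fst fv (path \<omega>))\<^sup>2) < \<delta> k \<and>
      (\<integral>\<^sup>+\<omega>. ennreal (((norm (malliavin_derivative M X (J n k) \<omega>))\<^sup>2 - (norm (snd fv (path \<omega>)))\<^sup>2)\<^sup>2) \<partial>M)
        < ennreal (\<delta> k)" for n k fv
  define fv where "fv n k = (SOME q. P n k q)" for n k
  define f where "f n k = fst (fv n k)" for n k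
  define v where "v n k = snd (fv n k)" for n k
  have "P n k (fv n k)" if "n \<ge> 1" for n k
  proof -
    have "\<exists>q. P n k q" using wiener_chaos_poly_approx[OF JW that \<delta>, of k k] unfolding P_def by auto
    then show ?thesis unfolding fv_def by (rule someI_ex)
  qed
  then have f: "\<And>n k. n \<ge> 1 \<Longrightarrow> chaos_poly n (f n k) (v n k)"
    and Jf: "\<And>n k. n \<ge> 1 \<Longrightarrow> expectation (\<lambda>\<omega>. (J n k \<omega> - f n k (path \<omega>))\<^sup>2) < \<delta> k"
    and Dv: "\<And>n k. n \<ge> 1 \<Longrightarrow> (\<integral>\<^sup>+\<omega>. ennreal (((norm (malliavin_derivative M X (J n k) \<omega>))\<^sup>2
        - (norm (v n k (path \<omega>)))\<^sup>2)\<^sup>2) \<partial>M) < ennreal (\<delta> k)"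
    unfolding P_def f_def v_def by auto
  have fL: "(\<lambda>\<omega>. f n k (path \<omega>)) \<in> L2 M" if "n \<ge> 1" for n k by (rule chaos_poly_L2[OF f[OF that]])
  have sq: "sqrt (expectation (\<lambda>\<omega>. (J n k \<omega> - f n k (path \<omega>))\<^sup>2)) \<le> sqrt (\<delta> k)" if "n \<ge> 1" for n k
    using Jf[OF that, of k] by simp
  have \<delta>s: "(\<lambda>k. sqrt (\<delta> k)) \<longlonglongrightarrow> 0" using tendsto_real_sqrt[OF \<delta>0] by simp
  have f2: "(\<lambda>k. expectation (\<lambda>\<omega>. (f n k (path \<omega>))\<^sup>2)) \<longlonglongrightarrow> (s n)\<^sup>2" if n: "n \<ge> 1" for n
  proof -
    let ?a = "\<lambda>k. sqrt (expectation (\<lambda>\<omega>. (J n k \<omega>)\<^sup>2))" and ?b = "\<lambda>k. sqrt (expectation (\<lambda>\<omega>. (f n k (path \<omega>))\<^sup>2))"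
    have bd: "norm (?b k - ?a k) \<le> sqrt (\<delta> k)" for k
    proof -
      have "?a k = sqrt (expectation (\<lambda>\<omega>. (f n k (path \<omega>) + (J n k \<omega> - f n k (path \<omega>)))\<^sup>2))" by simp
      also have "\<dots> \<le> ?b k + sqrt (expectation (\<lambda>\<omega>. (J n k \<omega> - f n k (path \<omega>))\<^sup>2))"
        by (intro L2_triangle L2_diff JL fL n)
      finally have 1: "?a k \<le> ?b k + sqrt (\<delta> k)" using sq[OF n, of k] by linarith
      have "?b k = sqrt (expectation (\<lambda>\<omega>. (J n k \<omega> + (f n k (path \<omega>) - J n k \<omega>))\<^sup>2))" by simp
      also have "\<dots> \<le> ?a k + sqrt (expectation (\<lambda>\<omega>. (f n k (path \<omega>) - J n k \<omega>)\<^sup>2))"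
        by (intro L2_triangle L2_diff JL fL n)
      also have "expectation (\<lambda>\<omega>. (f n k (path \<omega>) - J n k \<omega>)\<^sup>2) = expectation (\<lambda>\<omega>. (J n k \<omega> - f n k (path \<omega>))\<^sup>2)"
        by (simp add: power2_commute)
      finally have 2: "?b k \<le> ?a k + sqrt (\<delta> k)" using sq[OF n, of k] by linarith
      show ?thesis using 1 2 by (simp add: abs_le_iff)
    qed
    have "(\<lambda>k. ?b k - ?a k) \<longlonglongrightarrow> 0"
      by (rule Lim_null_comparison[OF always_eventually[OF allI, OF bd] \<delta>s])
    moreover have "?a \<longlonglongrightarrow> sqrt ((s n)\<^sup>2)" using tendsto_real_sqrt[OF ii[OF n]] by (simp add: J_def)
    ultimately have "(\<lambda>k. (?b k - ?a k) + ?a k) \<longlonglongrightarrow> 0 + sqrt ((s n)\<^sup>2)" by (rule tendsto_add)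
    then have "?b \<longlonglongrightarrow> sqrt ((s n)\<^sup>2)" by simp
    from tendsto_power[OF this, of 2] show ?thesis by simp
  qed
  have v2: "(\<lambda>k. expectation (\<lambda>\<omega>. ((norm (v n k (path \<omega>)))\<^sup>2 - real n * (s n)\<^sup>2)\<^sup>2)) \<longlonglongrightarrow> 0" if n: "n \<ge> 1" for n
  proof -
    let ?c = "real n * (s n)\<^sup>2"
    let ?d = "\<lambda>k. \<integral>\<^sup>+\<omega>. ennreal (((norm (malliavin_derivative M X (J n k) \<omega>))\<^sup>2 - ?c)\<^sup>2) \<partial>M"
    let ?g = "\<lambda>k. \<integral>\<^sup>+\<omega>. ennreal (((norm (malliavin_derivative M X (J n k) \<omega>))\<^sup>2 - (norm (v n k (path \<omega>)))\<^sup>2)\<^sup>2) \<partial>M"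
    have amv: "all_moments M (\<lambda>\<omega>. v n k (path \<omega>))" for k
      by (rule cylindricalD(6)[OF chaos_poly_cylindrical[OF f[OF n]]])
    have vL: "(\<lambda>\<omega>. (norm (v n k (path \<omega>)))\<^sup>2 - ?c) \<in> L2 M" for k
      by (intro L2_diff const_L2 all_moments_L2 all_moments_power all_moments_norm amv finite_measure_axioms)
    have bd: "ennreal (expectation (\<lambda>\<omega>. ((norm (v n k (path \<omega>)))\<^sup>2 - ?c)\<^sup>2)) \<le> 2 * ?d k + 2 * ennreal (\<delta> k)" for k
    proof -
      have "\<exists>U. has_malliavin_derivative M X (J n k) U"
        using wiener_chaos_malliavin[OF JW n, of k] by blast
      then have "malliavin_derivative M X (J n k) \<in> L2 M"
        using has_malliavin_derivative_chosen by (auto simp: has_malliavin_derivative_def)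
      note [measurable] = L2_measurable[OF this] all_moments_measurable[OF amv]
      have "ennreal (expectation (\<lambda>\<omega>. ((norm (v n k (path \<omega>)))\<^sup>2 - ?c)\<^sup>2))
          = (\<integral>\<^sup>+\<omega>. ennreal (((norm (v n k (path \<omega>)))\<^sup>2 - ?c)\<^sup>2) \<partial>M)"
        using L2_integrable_real[OF vL] by (intro nn_integral_eq_integral[symmetric]) auto
      also have "\<dots> \<le> (\<integral>\<^sup>+\<omega>. 2 * ennreal (((norm (malliavin_derivative M X (J n k) \<omega>))\<^sup>2 - ?c)\<^sup>2)
          + 2 * ennreal (((norm (malliavin_derivative M X (J n k) \<omega>))\<^sup>2 - (norm (v n k (path \<omega>)))\<^sup>2)\<^sup>2) \<partial>M)"
      proof (rule nn_integral_mono)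
        fix \<omega>
        have "(b - c)\<^sup>2 \<le> 2 * (a - c)\<^sup>2 + 2 * (a - b)\<^sup>2" for a b c :: real
          using zero_le_power2[of "(a - c) + (a - b)"] by (simp add: power2_eq_square algebra_simps)
        then show "ennreal (((norm (v n k (path \<omega>)))\<^sup>2 - ?c)\<^sup>2)
          \<le> 2 * ennreal (((norm (malliavin_derivative M X (J n k) \<omega>))\<^sup>2 - ?c)\<^sup>2)
            + 2 * ennreal (((norm (malliavin_derivative M X (J n k) \<omega>))\<^sup>2 - (norm (v n k (path \<omega>)))\<^sup>2)\<^sup>2)"
          by (simp flip: ennreal_numeral ennreal_mult ennreal_plus)
      qed
      also have "\<dots> = 2 * ?d k + 2 * ?g k"
        by (simp add: nn_integral_add nn_integral_cmult)
      also have "\<dots> \<le> 2 * ?d k + 2 * ennreal (\<delta> k)"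
        using Dv[OF n, of k] by (intro add_mono mult_left_mono) (auto intro: less_imp_le)
      finally show ?thesis .
    qed
    have "(\<lambda>k. ennreal (\<delta> k)) \<longlonglongrightarrow> ennreal 0" by (intro tendsto_ennrealI \<delta>0)
    then have "(\<lambda>k. 2 * ennreal (\<delta> k)) \<longlonglongrightarrow> 2 * 0" by (intro ennreal_tendsto_cmult) auto
    moreover have "(\<lambda>k. 2 * ?d k) \<longlonglongrightarrow> 2 * 0"
      using iv[OF n] unfolding J_def by (intro ennreal_tendsto_cmult) auto
    ultimately have "(\<lambda>k. 2 * ?d k + 2 * ennreal (\<delta> k)) \<longlonglongrightarrow> 2 * 0 + 2 * 0" by (intro tendsto_add)
    then have up: "(\<lambda>k. 2 * ?d k + 2 * ennreal (\<delta> k)) \<longlonglongrightarrow> 0" by simp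
    have "(\<lambda>k. ennreal (expectation (\<lambda>\<omega>. ((norm (v n k (path \<omega>)))\<^sup>2 - ?c)\<^sup>2))) \<longlonglongrightarrow> ennreal 0"
      unfolding ennreal_0 by (rule tendsto_sandwich[OF _ _ tendsto_const up]) (use bd in auto)
    then show ?thesis by (rule tendsto_ennrealD) auto
  qed
  have T: "(\<lambda>k. \<integral>\<omega>. iexp (t * (\<Sum>n\<in>{1..N}. f n k (path \<omega>))) \<partial>M)
      \<longlonglongrightarrow> complex_of_real (exp (- (\<Sum>n\<in>{1..N}. (s n)\<^sup>2) * t\<^sup>2 / 2))"
    by (rule chaos_poly_sum_CLT[where v = v]) (use f f2 v2 in auto)
  have bd: "norm ((\<integral>\<omega>. iexp (t * (\<Sum>n\<in>{1..N}. J n k \<omega>)) \<partial>M) - (\<integral>\<omega>. iexp (t * (\<Sum>n\<in>{1..N}. f n k (path \<omega>))) \<partial>M))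
      \<le> \<bar>t\<bar> * (real N * sqrt (\<delta> k))" for k
  proof -
    have "norm ((\<integral>\<omega>. iexp (t * (\<Sum>n\<in>{1..N}. J n k \<omega>)) \<partial>M) - (\<integral>\<omega>. iexp (t * (\<Sum>n\<in>{1..N}. f n k (path \<omega>))) \<partial>M))
        \<le> \<bar>t\<bar> * sqrt (expectation (\<lambda>\<omega>. ((\<Sum>n\<in>{1..N}. J n k \<omega>) - (\<Sum>n\<in>{1..N}. f n k (path \<omega>)))\<^sup>2))"
      by (intro char_distance_L2 L2_sum JL fL) auto
    also have "sqrt (expectation (\<lambda>\<omega>. ((\<Sum>n\<in>{1..N}. J n k \<omega>) - (\<Sum>n\<in>{1..N}. f n k (path \<omega>)))\<^sup>2)) \<le> real N * sqrt (\<delta> k)"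
    proof -
      have "sqrt (expectation (\<lambda>\<omega>. (\<Sum>n\<in>{1..N}. J n k \<omega> - f n k (path \<omega>))\<^sup>2))
          \<le> (\<Sum>n\<in>{1..N}. sqrt (expectation (\<lambda>\<omega>. (J n k \<omega> - f n k (path \<omega>))\<^sup>2)))"
        by (intro L2_sum_triangle L2_diff JL fL) auto
      also have "\<dots> \<le> (\<Sum>n\<in>{1..N}. sqrt (\<delta> k))" by (intro sum_mono sq) auto
      finally show ?thesis by (simp add: sum_subtractf)
    qed
    finally show ?thesis by (simp add: mult_left_mono)
  qed
  have "(\<lambda>k. \<bar>t\<bar> * (real N * sqrt (\<delta> k))) \<longlonglongrightarrow> \<bar>t\<bar> * (real N * 0)" by (intro tendsto_intros \<delta>s)
  then have "(\<lambda>k. \<bar>t\<bar> * (real N * sqrt (\<delta> k))) \<longlonglongrightarrow> 0" by simp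
  from Lim_null_comparison[OF always_eventually[OF allI, OF bd] this]
  have "(\<lambda>k. ((\<integral>\<omega>. iexp (t * (\<Sum>n\<in>{1..N}. J n k \<omega>)) \<partial>M) - (\<integral>\<omega>. iexp (t * (\<Sum>n\<in>{1..N}. f n k (path \<omega>))) \<partial>M))
      + (\<integral>\<omega>. iexp (t * (\<Sum>n\<in>{1..N}. f n k (path \<omega>))) \<partial>M))
      \<longlonglongrightarrow> 0 + complex_of_real (exp (- (\<Sum>n\<in>{1..N}. (s n)\<^sup>2) * t\<^sup>2 / 2))"
    by (intro tendsto_add T)
  then show ?thesis by (simp add: J_def)
qed

text \<open>
  First \<open>N\<close> is fixed such that the discarded chaoses are negligible uniformly in large \<open>k\<close> and the
  variance of the first \<open>N\<close> is close to \<open>\<sigma>\<^sup>2\<close>; then \<open>k\<close> tends to infinity.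
\<close>

theorem char_chaos_limit:
  fixes s :: "nat \<Rightarrow> real" and F :: "nat \<Rightarrow> 'a \<Rightarrow> real" and \<sigma> :: real
  assumes F: "\<And>k. F k \<in> L2 M" and EF: "\<And>k. expectation (F k) = 0"
    and i: "(\<lambda>N. limsup (\<lambda>k. \<Sum>n. ennreal (expectation (\<lambda>\<omega>. (chaos_projection M X (N + 1 + n) (F k) \<omega>)\<^sup>2)))) \<longlonglongrightarrow> 0"
    and ii: "\<And>n. n \<ge> 1 \<Longrightarrow> (\<lambda>k. expectation (\<lambda>\<omega>. (chaos_projection M X n (F k) \<omega>)\<^sup>2)) \<longlonglongrightarrow> (s n)\<^sup>2"
    and iii: "(\<lambda>n. (s (n + 1))\<^sup>2) sums \<sigma>\<^sup>2"
    and iv: "\<And>n. n \<ge> 1 \<Longrightarrow>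
      (\<lambda>k. \<integral>\<^sup>+\<omega>. ennreal (((norm (malliavin_derivative M X (chaos_projection M X n (F k)) \<omega>))\<^sup>2
          - real n * (s n)\<^sup>2)\<^sup>2) \<partial>M) \<longlonglongrightarrow> 0"
  shows "(\<lambda>k. \<integral>\<omega>. iexp (t * F k \<omega>) \<partial>M) \<longlonglongrightarrow> complex_of_real (exp (- \<sigma>\<^sup>2 * t\<^sup>2 / 2))"
proof (rule metric_LIMSEQ_I)
  fix \<epsilon> :: real assume \<epsilon>: "\<epsilon> > 0"
  \<comment> \<open>Adding 1 covers \<open>t = 0\<close>.\<close>
  define \<eta> where "\<eta> = \<epsilon> / 3 / (\<bar>t\<bar> + 1)"
  have \<eta>: "\<eta> > 0" unfolding \<eta>_def using \<epsilon> by (intro divide_pos_pos) auto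
  have t\<eta>: "\<bar>t\<bar> * \<eta> \<le> \<epsilon> / 3"
  proof -
    have "\<bar>t\<bar> * \<eta> \<le> (\<bar>t\<bar> + 1) * \<eta>" using \<eta> by (intro mult_right_mono) auto
    also have "\<dots> = \<epsilon> / 3"
    proof -
      have "\<bar>t\<bar> + 1 \<noteq> 0" using abs_ge_zero[of t] by linarith
      moreover have "c * (r / c) = r" if "c \<noteq> 0" for c r :: real using that by simp
      ultimately show ?thesis unfolding \<eta>_def by blast
    qed
    finally show ?thesis .
  qed
  let ?tail = "\<lambda>N k. \<Sum>n. ennreal (expectation (\<lambda>\<omega>. (chaos_projection M X (N + 1 + n) (F k) \<omega>)\<^sup>2))"
  let ?V = "\<lambda>N. \<Sum>n\<in>{1..N}. (s n)\<^sup>2"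
  have Vs: "?V \<longlonglongrightarrow> \<sigma>\<^sup>2"
  proof -
    have "(\<Sum>n<N. (s (n + 1))\<^sup>2) = ?V N" for N
      by (rule sum.reindex_bij_witness[of _ "\<lambda>n. n - 1" "\<lambda>n. n + 1"]) auto
    then show ?thesis using iii by (simp add: sums_def)
  qed
  have "(\<lambda>N. complex_of_real (exp (- ?V N * t\<^sup>2 / 2))) \<longlonglongrightarrow> complex_of_real (exp (- \<sigma>\<^sup>2 * t\<^sup>2 / 2))"
    by (intro tendsto_intros Vs) simp
  then have "\<forall>\<^sub>F N in sequentially. dist (complex_of_real (exp (- ?V N * t\<^sup>2 / 2))) (complex_of_real (exp (- \<sigma>\<^sup>2 * t\<^sup>2 / 2))) < \<epsilon> / 3"
    using \<epsilon> by (intro tendstoD) auto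
  moreover have "\<forall>\<^sub>F N in sequentially. limsup (?tail N) < ennreal (\<eta>\<^sup>2)"
    using i \<eta> by (intro order_tendstoD(2)) auto
  ultimately have "\<forall>\<^sub>F N in sequentially. limsup (?tail N) < ennreal (\<eta>\<^sup>2) \<and>
      dist (complex_of_real (exp (- ?V N * t\<^sup>2 / 2))) (complex_of_real (exp (- \<sigma>\<^sup>2 * t\<^sup>2 / 2))) < \<epsilon> / 3"
    by eventually_elim simp
  then obtain N where N1: "limsup (?tail N) < ennreal (\<eta>\<^sup>2)"
    and N2: "dist (complex_of_real (exp (- ?V N * t\<^sup>2 / 2))) (complex_of_real (exp (- \<sigma>\<^sup>2 * t\<^sup>2 / 2))) < \<epsilon> / 3"
    by (auto simp: eventually_sequentially)
  let ?G = "\<lambda>k \<omega>. \<Sum>n\<in>{1..N}. chaos_projection M X n (F k) \<omega>"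
  have "\<forall>\<^sub>F k in sequentially. ?tail N k < ennreal (\<eta>\<^sup>2)"
    using N1 by (rule Limsup_lessD)
  moreover have "\<forall>\<^sub>F k in sequentially. dist (\<integral>\<omega>. iexp (t * ?G k \<omega>) \<partial>M) (complex_of_real (exp (- ?V N * t\<^sup>2 / 2))) < \<epsilon> / 3"
    using \<epsilon> by (intro tendstoD[OF char_truncated_limit[OF F ii iv]]) auto
  ultimately have "\<forall>\<^sub>F k in sequentially. dist (\<integral>\<omega>. iexp (t * F k \<omega>) \<partial>M) (complex_of_real (exp (- \<sigma>\<^sup>2 * t\<^sup>2 / 2))) < \<epsilon>"
  proof eventually_elim
    case (elim k)
    have "expectation (\<lambda>\<omega>. (F k \<omega> - ?G k \<omega>)\<^sup>2) \<le> \<eta>\<^sup>2"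
      using elim(1) by (intro chaos_truncation_error F EF) (auto intro: less_imp_le)
    then have "sqrt (expectation (\<lambda>\<omega>. (F k \<omega> - ?G k \<omega>)\<^sup>2)) \<le> \<eta>"
      using \<eta> by (intro real_le_lsqrt) auto
    then have "\<bar>t\<bar> * sqrt (expectation (\<lambda>\<omega>. (F k \<omega> - ?G k \<omega>)\<^sup>2)) \<le> \<bar>t\<bar> * \<eta>"
      by (intro mult_left_mono) auto
    moreover have "dist (\<integral>\<omega>. iexp (t * F k \<omega>) \<partial>M) (\<integral>\<omega>. iexp (t * ?G k \<omega>) \<partial>M)
        \<le> \<bar>t\<bar> * sqrt (expectation (\<lambda>\<omega>. (F k \<omega> - ?G k \<omega>)\<^sup>2))"
      unfolding dist_norm by (intro char_distance_L2 F L2_sum chaos_projection_L2)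
    ultimately have 1: "dist (\<integral>\<omega>. iexp (t * F k \<omega>) \<partial>M) (\<integral>\<omega>. iexp (t * ?G k \<omega>) \<partial>M) \<le> \<epsilon> / 3"
      using t\<eta> by linarith
    show ?case
      using 1 elim(2) N2
        dist_triangle[of "\<integral>\<omega>. iexp (t * F k \<omega>) \<partial>M" "complex_of_real (exp (- \<sigma>\<^sup>2 * t\<^sup>2 / 2))" "\<integral>\<omega>. iexp (t * ?G k \<omega>) \<partial>M"]
        dist_triangle[of "\<integral>\<omega>. iexp (t * ?G k \<omega>) \<partial>M" "complex_of_real (exp (- \<sigma>\<^sup>2 * t\<^sup>2 / 2))" "complex_of_real (exp (- ?V N * t\<^sup>2 / 2))"]
      by linarith
  qed
  then show "\<exists>no. \<forall>k\<ge>no. dist (\<integral>\<omega>. iexp (t * F k \<omega>) \<partial>M) (complex_of_real (exp (- \<sigma>\<^sup>2 * t\<^sup>2 / 2))) < \<epsilon>"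
    by (simp only: eventually_sequentially)
qed

end

section \<open>Convergence in law\<close>

lemma real_distribution_normal_law:
  assumes "0 \<le> v"
  shows "real_distribution (normal_law 0 v)"
proof (cases "v = 0")
  case True
  interpret prob_space "return borel (0::real)" by (rule prob_space_return) simp
  show ?thesis using True prob_space_axioms
    by (simp add: normal_law_def real_distribution_def real_distribution_axioms_def)
next
  case False
  then have "prob_space (density lborel (\<lambda>x. ennreal (normal_density 0 (sqrt v) x)))"
    using assms by (intro prob_space_normal_density) simp
  then show ?thesis using False by (simp add: normal_law_def real_distribution_def real_distribution_axioms_def)
qed

lemma char_normal_law:
  assumes "0 \<le> v"
  shows "char (normal_law 0 v) t = complex_of_real (exp (- v * t\<^sup>2 / 2))"
proof (cases "v = 0")
  case True
  then show ?thesis by (simp add: char_def normal_law_def integral_return)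
next
  case False
  define d where "d = sqrt v"
  have d: "d > 0" "d\<^sup>2 = v" using False assms by (auto simp: d_def)
  have dens: "normal_density 0 d (d * x) = std_normal_density x / d" for x
    using d(1) by (simp add: normal_density_def power_mult_distrib real_sqrt_mult)
  have "char (normal_law 0 v) t = (\<integral>x. normal_density 0 d x *\<^sub>R iexp (t * x) \<partial>lborel)"
    unfolding char_def using False by (simp add: normal_law_def d_def integral_density)
  also have "\<dots> = \<bar>d\<bar> *\<^sub>R (\<integral>x. normal_density 0 d (0 + d * x) *\<^sub>R iexp (t * (0 + d * x)) \<partial>lborel)"
    using d(1) by (intro lborel_integral_real_affine) simp
  also have "\<dots> = (\<integral>x. \<bar>d\<bar> *\<^sub>R (normal_density 0 d (0 + d * x) *\<^sub>R iexp (t * (0 + d * x))) \<partial>lborel)"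
    by (rule integral_scaleR_right[symmetric])
  also have "\<dots> = (\<integral>x. std_normal_density x *\<^sub>R iexp ((t * d) * x) \<partial>lborel)"
    using d(1) by (intro Bochner_Integration.integral_cong refl) (simp add: dens mult.assoc)
  also have "\<dots> = char std_normal_distribution (t * d)"
    unfolding char_def by (simp add: integral_density)
  also have "\<dots> = complex_of_real (exp (- v * t\<^sup>2 / 2))"
    unfolding char_std_normal_distribution using d(2) by (simp add: power_mult_distrib mult.commute)
  finally show ?thesis .
qed

theorem theorem8:
  fixes M :: "'a measure"
    and X :: "'h::{real_inner,banach,second_countable_topology} \<Rightarrow> 'a \<Rightarrow> real"
    and F :: "nat \<Rightarrow> 'a \<Rightarrow> real"
    and s :: "nat \<Rightarrow> real" and \<sigma> :: real
  assumes "isonormal_gaussian_process M X"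
    and "generated_by M X"
    and "\<And>k. F k \<in> L2 M"
    and "\<And>k. (\<integral>\<omega>. F k \<omega> \<partial>M) = 0"
    and i: "(\<lambda>N. limsup (\<lambda>k. \<Sum>n. ennreal (\<integral>\<omega>. (chaos_projection M X (N + 1 + n) (F k) \<omega>)\<^sup>2 \<partial>M)))
              \<longlonglongrightarrow> 0"
    and ii: "\<And>n. n \<ge> 1 \<Longrightarrow>
              (\<lambda>k. \<integral>\<omega>. (chaos_projection M X n (F k) \<omega>)\<^sup>2 \<partial>M) \<longlonglongrightarrow> (s n)\<^sup>2"
    and iii: "(\<lambda>n. (s (n + 1))\<^sup>2) sums \<sigma>\<^sup>2"
    and iv: "\<And>n. n \<ge> 1 \<Longrightarrow>
              (\<lambda>k. \<integral>\<^sup>+\<omega>. ennreal (((norm (malliavin_derivative M X (chaos_projection M X n (F k)) \<omega>))\<^sup>2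
                                   - real n * (s n)\<^sup>2)\<^sup>2) \<partial>M) \<longlonglongrightarrow> 0"
  shows "weak_conv_m (\<lambda>k. distr M borel (F k)) (normal_law 0 (\<sigma>\<^sup>2))"
proof -
  interpret prob_space M using assms(1) by (simp add: isonormal_gaussian_process_def)
  interpret generated_gaussian_space M X
    by unfold_locales (use assms(1,2) in auto)
  have Fm[measurable]: "F k \<in> borel_measurable M" for k using assms(3) by (rule L2_measurable)
  show ?thesis
  proof (rule levy_continuity)
    show "real_distribution (distr M borel (F k))" for k by simp
    show "real_distribution (normal_law 0 (\<sigma>\<^sup>2))" by (rule real_distribution_normal_law) simp
    fix t
    have "char (distr M borel (F k)) t = (\<integral>\<omega>. iexp (t * F k \<omega>) \<partial>M)" for k
      unfolding char_def by (rule integral_distr) auto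
    then show "(\<lambda>k. char (distr M borel (F k)) t) \<longlonglongrightarrow> char (normal_law 0 (\<sigma>\<^sup>2)) t"
      using char_chaos_limit[OF assms(3,4) i ii iii iv, of t] by (simp add: char_normal_law)
  qed
qed

end
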